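(* Let $n\ge 2$ and let $A=\mathbb R[x_0,\ldots,x_n]/(x_0^2+\cdots+x_n^2+1)$. Then the Euler class group $E(A)$ and the Chow group of zero-cycles $CH_0(A)$ both vanish: $E(A)=0$ and $CH_0(A)=0$.
   Context: $CH_0(A)$ is the group of zero-cycles of $\mathrm{Spec}(A)$ (the free abelian group on the maximal ideals of $A$) modulo rational equivalence. Euler class group $E(A)$ (with respect to $A$), for a Noetherian ring $A\supseteq\mathbb Q$ of dimension $n\ge2$: for an ideal $J\subset A$ of height $n$ such that $J/J^2$ is generated by $n$ elements, two surjections $\alpha,\beta:(A/J)^n\to J/J^2$ are called related if $\beta=\alpha\sigma$ for some $\sigma\in SL_n(A/J)$; an equivalence class $\omega_J$ of surjections is called a local orientation of $J$. It is called a global orientation if some (equivalently every) surjection in the class lifts to a surjection $A^n\to J$. Let $G$ be the free abelian group on pairs $(N,\omega_N)$, where $N$ is an ideal of height $n$ that is primary for a maximal ideal of height $n$, $N/N^2$ is generated by $n$ elements, and $\omega_N$ is a local orientation of $N$. If $J=\bigcap_i N_i$ is the (irredundant) primary decomposition of an ideal $J$ of height $n$ with $J/J^2$ generated by $n$ elements, a local orientation $\omega_J$ induces local orientations $\omega_{N_i}$ of the $N_i$, and one puts $(J,\omega_J)=\sum_i(N_i,\omega_{N_i})\in G$. Let $H\subseteq G$ be the subgroup generated by all $(J,\omega_J)$ with $\omega_J$ a global orientation of $J$. Then $E(A)=G/H$. *)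

theory Defs
  imports
    "HOL-Algebra.Algebra"
    "HOL-Algebra.Free_Abelian_Groups"
    "HOL-Algebra.Algebraic_Closure_Type"
    "HOL-Algebra.Module"
    "HOL-Algebra.Ideal_Product"
    "HOL-Combinatorics.Permutations"
    "HOL-Library.Extended_Nat"
    "HOL-Library.FuncSet"
begin

section \<open>Krull dimension, height, length\<close>

text \<open>Supremum of the lengths \<open>k\<close> of strict chains \<open>c 0 \<subset> \<dots> \<subset> c k\<close> of members of \<open>F\<close>.\<close>

definition chain_sup :: "('a set \<Rightarrow> bool) \<Rightarrow> enat" where
  "chain_sup F =
     (SUP k \<in> {k. \<exists>c. (\<forall>i\<le>k. F (c i)) \<and> (\<forall>i<k. c i \<subset> c (Suc i))}. enat k)"

definition krull_dim :: "('a, 'b) ring_scheme \<Rightarrow> enat" where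
  "krull_dim R = chain_sup (\<lambda>P. primeideal P R)"

definition prime_height :: "('a, 'b) ring_scheme \<Rightarrow> 'a set \<Rightarrow> enat" where
  "prime_height R P = chain_sup (\<lambda>Q. primeideal Q R \<and> Q \<subseteq> P)"

text \<open>The unit ideal has height \<open>\<infinity>\<close>.\<close>

definition ideal_height :: "('a, 'b) ring_scheme \<Rightarrow> 'a set \<Rightarrow> enat" where
  "ideal_height R J = (INF P \<in> {P. primeideal P R \<and> J \<subseteq> P}. prime_height R P)"

text \<open>The length of \<open>R\<close> as a module over itself, whose submodules are the ideals.\<close>

definition ring_length :: "('a, 'b) ring_scheme \<Rightarrow> enat" where
  "ring_length R = chain_sup (\<lambda>I. ideal I R)"


section \<open>Localization\<close>

text \<open>\<open>fraction R S a s\<close> is the class of \<open>a / s\<close> in \<open>S\<inverse>R\<close>.\<close>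

definition fraction :: "('a, 'b) ring_scheme \<Rightarrow> 'a set \<Rightarrow> 'a \<Rightarrow> 'a \<Rightarrow> ('a \<times> 'a) set" where
  "fraction R S a s =
     {(b, t). b \<in> carrier R \<and> t \<in> S \<and>
        (\<exists>u\<in>S. u \<otimes>\<^bsub>R\<^esub> (a \<otimes>\<^bsub>R\<^esub> t) = u \<otimes>\<^bsub>R\<^esub> (b \<otimes>\<^bsub>R\<^esub> s))}"

definition localization :: "('a, 'b) ring_scheme \<Rightarrow> 'a set \<Rightarrow> ('a \<times> 'a) set ring" where
  "localization R S =
     \<lparr>carrier = {fraction R S a s | a s. a \<in> carrier R \<and> s \<in> S},
      monoid.mult = (\<lambda>x y. \<Union>{fraction R S (a \<otimes>\<^bsub>R\<^esub> b) (s \<otimes>\<^bsub>R\<^esub> t) | a s b t.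
                         (a, s) \<in> x \<and> (b, t) \<in> y}),
      monoid.one = fraction R S \<one>\<^bsub>R\<^esub> \<one>\<^bsub>R\<^esub>,
      ring.zero = fraction R S \<zero>\<^bsub>R\<^esub> \<one>\<^bsub>R\<^esub>,
      ring.add = (\<lambda>x y. \<Union>{fraction R S (a \<otimes>\<^bsub>R\<^esub> t \<oplus>\<^bsub>R\<^esub> b \<otimes>\<^bsub>R\<^esub> s) (s \<otimes>\<^bsub>R\<^esub> t) | a s b t.
                        (a, s) \<in> x \<and> (b, t) \<in> y})\<rparr>"


section \<open>Zero-cycles modulo rational equivalence\<close>

text \<open>Order of vanishing of a nonzero element \<open>a\<close> of a one-dimensional domain \<open>B\<close> at a maximal
  ideal \<open>m\<close>: the length of \<open>B\<^sub>m / a B\<^sub>m\<close>.\<close>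

definition vanishing_order :: "('a, 'b) ring_scheme \<Rightarrow> 'a set \<Rightarrow> 'a \<Rightarrow> nat" where
  "vanishing_order B m a =
     (let S = carrier B - m; L = localization B S
      in the_enat (ring_length (L Quot (PIdl\<^bsub>L\<^esub> (fraction B S a \<one>\<^bsub>B\<^esub>)))))"

definition zero_cycles :: "('a, 'b) ring_scheme \<Rightarrow> ('a set \<Rightarrow>\<^sub>0 int) monoid" where
  "zero_cycles R = free_Abelian_group {m. maximalideal m R}"

text \<open>The divisor on the curve \<open>Spec (R/p)\<close> of the class of \<open>a \<notin> p\<close>, as a zero-cycle on
  \<open>Spec R\<close>. Points \<open>m\<close> with \<open>a \<notin> m\<close> have order \<open>0\<close>; leaving them out makes the sum finite for
  Noetherian \<open>R\<close>.\<close>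

definition curve_div :: "('a, 'b) ring_scheme \<Rightarrow> 'a set \<Rightarrow> 'a \<Rightarrow> ('a set \<Rightarrow>\<^sub>0 int)" where
  "curve_div R p a =
     (\<Sum>m\<in>{m. maximalideal m R \<and> p \<subseteq> m \<and> a \<in> m}.
        frag_cmul (int (vanishing_order (R Quot p) ((+>\<^bsub>R\<^esub>) p ` m) (p +>\<^bsub>R\<^esub> a))) (frag_of m))"

text \<open>Cycles rationally equivalent to zero: every nonzero rational function on \<open>Spec (R/p)\<close> is
  \<open>a / b\<close> with \<open>a, b \<notin> p\<close>, and its divisor is the difference of those of \<open>a\<close> and \<open>b\<close>.\<close>

definition rationally_trivial :: "('a, 'b) ring_scheme \<Rightarrow> ('a set \<Rightarrow>\<^sub>0 int) set" where
  "rationally_trivial R =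
     generate (zero_cycles R)
       {curve_div R p a - curve_div R p b | p a b.
          primeideal p R \<and> krull_dim (R Quot p) = 1 \<and>
          a \<in> carrier R - p \<and> b \<in> carrier R - p}"

definition CH0 :: "('a, 'b) ring_scheme \<Rightarrow> ('a set \<Rightarrow>\<^sub>0 int) set monoid" where
  "CH0 R = zero_cycles R Mod rationally_trivial R"


section \<open>Modules and matrices\<close>

text \<open>The ring fields \<open>mult\<close> and \<open>one\<close> of a module record carry no meaning here.\<close>

definition free_module :: "('a, 'b) ring_scheme \<Rightarrow> nat \<Rightarrow> ('a, nat \<Rightarrow> 'a) module" where
  "free_module R n =
     \<lparr>carrier = {..<n} \<rightarrow>\<^sub>E carrier R, monoid.mult = undefined, monoid.one = undefined,
      ring.zero = (\<lambda>i\<in>{..<n}. \<zero>\<^bsub>R\<^esub>), ring.add = (\<lambda>v w. \<lambda>i\<in>{..<n}. v i \<oplus>\<^bsub>R\<^esub> w i),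
      module.smult = (\<lambda>a v. \<lambda>i\<in>{..<n}. a \<otimes>\<^bsub>R\<^esub> v i)\<rparr>"

definition ideal_module :: "('a, 'b) ring_scheme \<Rightarrow> 'a set \<Rightarrow> ('a, 'a) module" where
  "ideal_module R J =
     \<lparr>carrier = J, monoid.mult = undefined, monoid.one = undefined,
      ring.zero = \<zero>\<^bsub>R\<^esub>, ring.add = ring.add R, module.smult = monoid.mult R\<rparr>"

text \<open>\<open>J/J\<^sup>2\<close> as a module over \<open>R/J\<close>: the scalar \<open>J + a\<close> times \<open>J\<^sup>2 + x\<close> is \<open>J\<^sup>2 + a x\<close>.\<close>

definition conormal_module :: "('a, 'b) ring_scheme \<Rightarrow> 'a set \<Rightarrow> ('a set, 'a set) module" where
  "conormal_module R J =
     \<lparr>carrier = (+>\<^bsub>R\<^esub>) (J \<cdot>\<^bsub>R\<^esub> J) ` J, monoid.mult = undefined, monoid.one = undefined,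
      ring.zero = J \<cdot>\<^bsub>R\<^esub> J, ring.add = set_add R, module.smult = rcoset_mult R (J \<cdot>\<^bsub>R\<^esub> J)\<rparr>"

definition module_surj ::
  "('a, 'b) ring_scheme \<Rightarrow> ('a, 'm, 'c) module_scheme \<Rightarrow> ('a, 'n, 'd) module_scheme \<Rightarrow> ('m \<Rightarrow> 'n) set"
  where
  "module_surj R M N =
     {f \<in> carrier M \<rightarrow>\<^sub>E carrier N.
        (\<forall>x\<in>carrier M. \<forall>y\<in>carrier M. f (x \<oplus>\<^bsub>M\<^esub> y) = f x \<oplus>\<^bsub>N\<^esub> f y) \<and>
        (\<forall>a\<in>carrier R. \<forall>x\<in>carrier M. f (a \<odot>\<^bsub>M\<^esub> x) = a \<odot>\<^bsub>N\<^esub> f x) \<and>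
        f ` carrier M = carrier N}"

definition mat_det :: "('a, 'b) ring_scheme \<Rightarrow> nat \<Rightarrow> (nat \<Rightarrow> nat \<Rightarrow> 'a) \<Rightarrow> 'a" where
  "mat_det R n A =
     (\<Oplus>\<^bsub>R\<^esub>\<pi>\<in>{\<pi>. \<pi> permutes {..<n}}.
        add_pow R (sign \<pi>) (\<Otimes>\<^bsub>R\<^esub>i\<in>{..<n}. A i (\<pi> i)))"

definition special_linear :: "('a, 'b) ring_scheme \<Rightarrow> nat \<Rightarrow> (nat \<Rightarrow> nat \<Rightarrow> 'a) set" where
  "special_linear R n =
     {A. (\<forall>i<n. \<forall>j<n. A i j \<in> carrier R) \<and> mat_det R n A = \<one>\<^bsub>R\<^esub>}"

definition mat_vec ::
  "('a, 'b) ring_scheme \<Rightarrow> nat \<Rightarrow> (nat \<Rightarrow> nat \<Rightarrow> 'a) \<Rightarrow> (nat \<Rightarrow> 'a) \<Rightarrow> (nat \<Rightarrow> 'a)" where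
  "mat_vec R n A v = (\<lambda>i\<in>{..<n}. \<Oplus>\<^bsub>R\<^esub>j\<in>{..<n}. A i j \<otimes>\<^bsub>R\<^esub> v j)"


section \<open>Local and global orientations\<close>

definition orient_surj ::
  "('a, 'b) ring_scheme \<Rightarrow> nat \<Rightarrow> 'a set \<Rightarrow> ((nat \<Rightarrow> 'a set) \<Rightarrow> 'a set) set" where
  "orient_surj R n J =
     module_surj (R Quot J) (free_module (R Quot J) n) (conormal_module R J)"

definition orient_rel ::
  "('a, 'b) ring_scheme \<Rightarrow> nat \<Rightarrow> 'a set \<Rightarrow> ((nat \<Rightarrow> 'a set) \<Rightarrow> 'a set) rel" where
  "orient_rel R n J =
     {(\<alpha>, \<beta>). \<alpha> \<in> orient_surj R n J \<and> \<beta> \<in> orient_surj R n J \<and>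
        (\<exists>\<sigma>\<in>special_linear (R Quot J) n.
           \<beta> = compose (carrier (free_module (R Quot J) n)) \<alpha> (mat_vec (R Quot J) n \<sigma>))}"

text \<open>There is a local orientation of \<open>J\<close> only if \<open>J/J\<^sup>2\<close> is generated by \<open>n\<close> elements.\<close>

definition local_orientations ::
  "('a, 'b) ring_scheme \<Rightarrow> nat \<Rightarrow> 'a set \<Rightarrow> ((nat \<Rightarrow> 'a set) \<Rightarrow> 'a set) set set" where
  "local_orientations R n J = orient_surj R n J // orient_rel R n J"

definition reduce_vec ::
  "('a, 'b) ring_scheme \<Rightarrow> nat \<Rightarrow> 'a set \<Rightarrow> (nat \<Rightarrow> 'a) \<Rightarrow> (nat \<Rightarrow> 'a set)" where
  "reduce_vec R n J v = (\<lambda>i\<in>{..<n}. J +>\<^bsub>R\<^esub> v i)"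

definition global_orientation ::
  "('a, 'b) ring_scheme \<Rightarrow> nat \<Rightarrow> 'a set \<Rightarrow> ((nat \<Rightarrow> 'a set) \<Rightarrow> 'a set) set \<Rightarrow> bool" where
  "global_orientation R n J \<omega> \<longleftrightarrow>
     \<omega> \<in> local_orientations R n J \<and>
     (\<exists>\<alpha>\<in>\<omega>. \<exists>\<phi>\<in>module_surj R (free_module R n) (ideal_module R J).
        \<forall>v\<in>carrier (free_module R n).
          \<alpha> (reduce_vec R n J v) = (J \<cdot>\<^bsub>R\<^esub> J) +>\<^bsub>R\<^esub> \<phi> v)"

text \<open>\<open>\<beta> : (R/N)\<^sup>n \<rightarrow> N/N\<^sup>2\<close> is induced by \<open>\<alpha> : (R/J)\<^sup>n \<rightarrow> J/J\<^sup>2\<close> (for \<open>J \<subseteq> N\<close>) if the two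
  commute with the reduction \<open>(R/J)\<^sup>n \<rightarrow> (R/N)\<^sup>n\<close> and the map \<open>J/J\<^sup>2 \<rightarrow> N/N\<^sup>2\<close> that comes from the
  inclusion. When \<open>N\<close> is a primary component of \<open>J\<close> and \<open>R/J\<close> is Artinian, \<open>J/J\<^sup>2 \<rightarrow> N/N\<^sup>2\<close> is onto,
  so each \<open>\<alpha>\<close> induces exactly one \<open>\<beta>\<close>.\<close>

definition induces ::
  "('a, 'b) ring_scheme \<Rightarrow> nat \<Rightarrow> 'a set \<Rightarrow> 'a set \<Rightarrow> ((nat \<Rightarrow> 'a set) \<Rightarrow> 'a set) \<Rightarrow>
   ((nat \<Rightarrow> 'a set) \<Rightarrow> 'a set) \<Rightarrow> bool" where
  "induces R n J N \<alpha> \<beta> \<longleftrightarrow>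
     \<beta> \<in> orient_surj R n N \<and>
     (\<forall>v\<in>carrier (free_module R n). \<forall>x\<in>J.
        \<alpha> (reduce_vec R n J v) = (J \<cdot>\<^bsub>R\<^esub> J) +>\<^bsub>R\<^esub> x \<longrightarrow>
        \<beta> (reduce_vec R n N v) = (N \<cdot>\<^bsub>R\<^esub> N) +>\<^bsub>R\<^esub> x)"

definition induced_orientation ::
  "('a, 'b) ring_scheme \<Rightarrow> nat \<Rightarrow> 'a set \<Rightarrow> 'a set \<Rightarrow> ((nat \<Rightarrow> 'a set) \<Rightarrow> 'a set) set \<Rightarrow>
   ((nat \<Rightarrow> 'a set) \<Rightarrow> 'a set) set" where
  "induced_orientation R n J N \<omega> = orient_rel R n N `` {\<beta>. \<exists>\<alpha>\<in>\<omega>. induces R n J N \<alpha> \<beta>}"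


section \<open>Primary decomposition\<close>

definition ideal_radical :: "('a, 'b) ring_scheme \<Rightarrow> 'a set \<Rightarrow> 'a set" where
  "ideal_radical R I = {a \<in> carrier R. \<exists>k::nat. a [^]\<^bsub>R\<^esub> k \<in> I}"

definition primary_ideal :: "'a set \<Rightarrow> ('a, 'b) ring_scheme \<Rightarrow> bool" where
  "primary_ideal N R \<longleftrightarrow>
     ideal N R \<and> N \<noteq> carrier R \<and>
     (\<forall>a\<in>carrier R. \<forall>b\<in>carrier R. a \<otimes>\<^bsub>R\<^esub> b \<in> N \<longrightarrow> a \<in> N \<or> b \<in> ideal_radical R N)"

definition irredundant_primary_decomposition ::
  "('a, 'b) ring_scheme \<Rightarrow> 'a set \<Rightarrow> 'a set set \<Rightarrow> bool" where
  "irredundant_primary_decomposition R J \<N> \<longleftrightarrow>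
     finite \<N> \<and> (\<forall>N\<in>\<N>. primary_ideal N R) \<and> inj_on (ideal_radical R) \<N> \<and>
     carrier R \<inter> \<Inter>\<N> = J \<and> (\<forall>N\<in>\<N>. carrier R \<inter> \<Inter>(\<N> - {N}) \<noteq> J)"


section \<open>The Euler class group\<close>

definition euler_gens ::
  "('a, 'b) ring_scheme \<Rightarrow> nat \<Rightarrow> ('a set \<times> ((nat \<Rightarrow> 'a set) \<Rightarrow> 'a set) set) set" where
  "euler_gens R n =
     {(N, \<omega>). primary_ideal N R \<and> ideal_height R N = enat n \<and>
        maximalideal (ideal_radical R N) R \<and> ideal_height R (ideal_radical R N) = enat n \<and>
        \<omega> \<in> local_orientations R n N}"

text \<open>The elements \<open>(J, \<omega>\<^sub>J)\<close> with \<open>\<omega>\<^sub>J\<close> a global orientation of \<open>J\<close>. For \<open>n = dim R\<close> the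
  components of \<open>J\<close> are all isolated, so the decomposition \<open>\<N>\<close> is unique.\<close>

definition euler_rels ::
  "('a, 'b) ring_scheme \<Rightarrow> nat \<Rightarrow> (('a set \<times> ((nat \<Rightarrow> 'a set) \<Rightarrow> 'a set) set) \<Rightarrow>\<^sub>0 int) set" where
  "euler_rels R n =
     {\<Sum>N\<in>\<N>. frag_of (N, induced_orientation R n J N \<omega>) | J \<omega> \<N>.
        ideal J R \<and> ideal_height R J = enat n \<and> global_orientation R n J \<omega> \<and>
        irredundant_primary_decomposition R J \<N>}"

definition euler_class_group ::
  "('a, 'b) ring_scheme \<Rightarrow>
   (('a set \<times> ((nat \<Rightarrow> 'a set) \<Rightarrow> 'a set) set) \<Rightarrow>\<^sub>0 int) set monoid" where
  "euler_class_group R =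
     (let n = the_enat (krull_dim R); G = free_Abelian_group (euler_gens R n)
      in G Mod generate G (euler_rels R n))"


section \<open>The coordinate ring of the anisotropic real quadric\<close>

text \<open>\<open>\<real>[x\<^sub>0, \<dots>, x\<^sub>n]\<close>: finitely supported coefficient functions on monomials, a monomial being
  a finitely supported exponent function.\<close>

definition real_mpoly_ring :: "nat \<Rightarrow> ((nat \<Rightarrow>\<^sub>0 nat) \<Rightarrow>\<^sub>0 real) ring" where
  "real_mpoly_ring n =
     ring_of_type_algebra\<lparr>carrier := {f. \<forall>m\<in>Poly_Mapping.keys f. Poly_Mapping.keys m \<subseteq> {..n}}\<rparr>"

definition mpoly_var :: "nat \<Rightarrow> ((nat \<Rightarrow>\<^sub>0 nat) \<Rightarrow>\<^sub>0 real)" where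
  "mpoly_var i = Poly_Mapping.single (Poly_Mapping.single i 1) 1"

definition quadric_ring :: "nat \<Rightarrow> ((nat \<Rightarrow>\<^sub>0 nat) \<Rightarrow>\<^sub>0 real) set ring" where
  "quadric_ring n =
     real_mpoly_ring n Quot (Idl\<^bsub>real_mpoly_ring n\<^esub> {(\<Sum>i\<le>n. mpoly_var i ^ 2) + 1})"

end

theory Submission
 imports
  Defs
  "Jordan_Normal_Form.Determinant"
  "HOL-Analysis.Complex_Transcendental"
  "HOL-Analysis.Continuum_Not_Denumerable"
  "HOL-Computational_Algebra.Fundamental_Theorem_Algebra"
begin

text \<open>
  Let \<open>A\<close> be the coordinate ring of the quadric \<open>x\<^sub>0\<^sup>2 + \<dots> + x\<^sub>n\<^sup>2 + 1 = 0\<close>. Both groups vanish because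
  the quadric has no real point. The residue field of every maximal ideal \<open>m\<close> is then \<open>\<complex>\<close>
 (\<open>nullstellensatz\<close>), so \<open>m\<close> is the ideal of a point \<open>z\<close> and of its conjugate. The line through these
 two points is real, and the \<open>n\<close> real equations of this line generate \<open>m\<close>. Taking them as coordinates
 \<open>y\<^sub>0, \<dots>, y\<^sub>n\<^sub>-\<^sub>1\<close> and completing the square in the remaining coordinate \<open>t\<close> presents \<open>A\<close> as the ring of a
 double cover \<open>t\<^sup>2 + c(y) = 0\<close> of affine space, with \<open>c > 0\<close> at the real points and \<open>m = (y)\<close>
 (\<open>recentre\<close>). The locale \<open>chart\<close> describes such presentations; what is proved there at the origin
 \<open>y = 0\<close> holds at every maximal ideal.

 Chow group: on the integral curve \<open>y\<^sub>0 = \<dots> = y\<^sub>n\<^sub>-\<^sub>2 = 0\<close> the divisor of \<open>y\<^sub>n\<^sub>-\<^sub>1\<close> is exactly \<open>m\<close>, so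
 the cycle of \<open>m\<close> is rationally trivial (\<open>origin_rationally_trivial\<close>).

 Euler class group: two systems of \<open>n\<close> generators of \<open>m/m\<^sup>2\<close> differ by a matrix over \<open>\<complex>\<close>. Its determinant
 is a square there, and a change of generators by a square can be realized by generators of \<open>m\<close> itself
 (\<open>square_twist\<close>); hence every orientation of \<open>m\<close> is global. Let \<open>N\<close> be an \<open>m\<close>-primary ideal with an
 orientation given by \<open>f\<^sub>0, \<dots>, f\<^sub>n\<^sub>-\<^sub>1\<close>. A Bertini argument (\<open>bertini_origin\<close>) changes the \<open>f\<^sub>i\<close> modulo
 \<open>N\<^sup>2\<close> into elements \<open>g\<^sub>i\<close> that generate the intersection of \<open>N\<close> with finitely many maximal ideals. The
 relation that belongs to the \<open>g\<^sub>i\<close> expresses the class of \<open>N\<close> by classes of maximal ideals, which are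
 zero (\<open>gen_in_span\<close>).

 The \<open>g\<^sub>i\<close> are \<open>f\<^sub>i + \<mu> y\<^sub>i\<^sup>K - s\<^sub>i h\<close>, where \<open>h\<close> is a combination of the \<open>y\<^sub>j\<^sup>K\<^sup>-\<^sup>1\<close>. Because of the leading
 terms the functions on their zero set are spanned by finitely many monomials, so the zero set is finite.
 Let \<open>J\<close> be the Jacobian of the quotients \<open>(f\<^sub>i + \<mu> y\<^sub>i\<^sup>K) / h\<close>. Counting monomials gives a relation
 \<open>\<Sum> Q\<^sub>j J\<^sup>j = 0\<close> whose coefficients \<open>Q\<^sub>j\<close> are polynomials in these quotients. Its lowest coefficient may be
 taken to be nonzero; if \<open>s\<close> is not a root of that coefficient, \<open>J\<close> has no zero on the common zero set of
 the \<open>g\<^sub>i\<close> off the origin (\<open>generic_values\<close>), and the Jacobian criterion shows that these zeros are simple.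
 The same count of monomials bounds the Krull dimension.
\<close>

section \<open>Ideals and chains of primes\<close>

lemma chain_sup_ge:
 assumes "\<And>i. i \<le> k ==> F (c i)" "\<And>i. i < k ==> c i \<subset> c (Suc i)"
 shows "enat k \<le> chain_sup F" unfolding chain_sup_def using assms by (intro SUP_upper) auto

lemma chain_sup_le:
 assumes "\<And>k c. (\<And>i. i \<le> k ==> F (c i)) ==> (\<And>i. i < k ==> c i \<subset> c (Suc i)) ==> k \<le> N"
 shows "chain_sup F \<le> enat N" unfolding chain_sup_def using assms by (intro SUP_least) auto

lemma chain_sup_le_Suc:
 assumes "\<And>c. (\<And>i. i \<le> Suc N ==> F (c i)) ==> (\<And>i. i < Suc N ==> c i \<subset> c (Suc i)) ==> False"
 shows "chain_sup F \<le> enat N"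
proof (rule chain_sup_le)
 fix k c assume c: "\<And>i. i \<le> k ==> F (c i)" "\<And>i. i < k ==> c i \<subset> c (Suc i)"
 show "k \<le> N"
 proof (rule ccontr)
  assume "\<not> k \<le> N"
  hence "Suc N \<le> k" by simp
  thus False using c by (intro assms[of c]) auto
 qed
qed

lemma chain_sup_mono:
 assumes "\<And>I. F I ==> F' I"
 shows "chain_sup F \<le> chain_sup F'" unfolding chain_sup_def using assms by (intro SUP_subset_mono) auto

context cring
begin

lemma ideal_subsetD: "ideal I R ==> x \<in> I ==> x \<in> carrier R" using additive_subgroup.a_subset ideal.axioms(1) by blast

lemma ideal_absorb: "ideal I R ==> x \<in> I ==> a \<in> carrier R ==> a \<otimes> x \<in> I" by (rule ideal.I_l_closed)

lemma ideal_add: "ideal I R ==> x \<in> I ==> y \<in> I ==> x \<oplus> y \<in> I"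
 by (simp add: additive_subgroup.a_closed ideal.axioms(1))

lemma ideal_minus: "ideal I R ==> x \<in> I ==> y \<in> I ==> x \<ominus> y \<in> I"
 using additive_subgroup.a_closed additive_subgroup.a_inv_closed ideal.axioms(1) minus_eq by metis

lemma ideal_zero: "ideal I R ==> \<zero> \<in> I" by (simp add: additive_subgroup.zero_closed ideal.axioms(1))

lemma ideal_one: "ideal I R ==> \<one> \<in> I ==> I = carrier R" by (rule ideal.one_imp_carrier)

lemma ideal_finsum:
 assumes "ideal I R" "finite A" "\<And>i. i \<in> A ==> f i \<in> I"
 shows "finsum R f A \<in> I" using assms(2,1,3)
proof (induction A rule: finite_induct)
 case empty thus ?case by (simp add: ideal_zero)
next
 case (insert x A)
 have "f \<in> A \<rightarrow> carrier R" "f x \<in> carrier R" using insert ideal_subsetD by auto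
 thus ?case using insert by (simp add: ideal_add)
qed

lemma sum_ideal_is_ideal:
 assumes "ideal I R" "ideal J R"
 shows "ideal (I <+>\<^bsub>R\<^esub> J) R" using add_ideals assms by blast

lemma exists_maximal_above:
 assumes I: "ideal I R" and ne: "I \<noteq> carrier R"
 obtains M where "maximalideal M R" "I \<subseteq> M"
proof -
 define A where "A = {J. ideal J R \<and> I \<subseteq> J \<and> \<one> \<notin> J}"
 have "\<exists>B\<in>A. \<forall>Y\<in>C. Y \<subseteq> B" if C: "C \<in> chains A" for C
 proof (cases "C = {}")
  case True
  have "I \<in> A" using I ne ideal_one by (auto simp: A_def)
  thus ?thesis using True by auto
 next
  case False
  have CA: "\<And>J. J \<in> C ==> ideal J R \<and> I \<subseteq> J \<and> \<one> \<notin> J"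
   using C by (auto simp: A_def chains_def chain_subset_def)
  have tot: "\<And>J K. J \<in> C ==> K \<in> C ==> J \<subseteq> K \<or> K \<subseteq> J"
   using C by (auto simp: chains_def chain_subset_def)
  have "ideal (\<Union>C) R"
  proof (rule idealI)
   show "ring R" by (rule ring_axioms)
   show "subgroup (\<Union>C) (add_monoid R)"
   proof (rule group.subgroupI)
    show "group (add_monoid R)" by (rule add.is_group)
    show "\<Union>C \<subseteq> carrier (add_monoid R)" using CA ideal_subsetD by auto
    show "\<Union>C \<noteq> {}" using False CA ideal_zero by fastforce
    fix a assume "a \<in> \<Union>C"
    then obtain J where "J \<in> C" "a \<in> J" by auto
    thus "inv\<^bsub>add_monoid R\<^esub> a \<in> \<Union>C"
     using CA[of J] additive_subgroup.a_inv_closed[of J R a] unfolding a_inv_def by (metis UnionI ideal.axioms(1))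
   next
    fix a b assume "a \<in> \<Union>C" "b \<in> \<Union>C"
    then obtain J K where JK: "J \<in> C" "a \<in> J" "K \<in> C" "b \<in> K" by auto
    from tot[OF JK(1,3)] show "a \<otimes>\<^bsub>add_monoid R\<^esub> b \<in> \<Union>C"
     using JK CA[of J] CA[of K] ideal_add[of J a b] ideal_add[of K a b] by (metis UnionI monoid.simps(1) subsetD)
   qed
  next
   fix a x assume a: "a \<in> \<Union>C" "x \<in> carrier R"
   then obtain J where J: "J \<in> C" "a \<in> J" by auto
   show "x \<otimes> a \<in> \<Union>C" using J CA[of J] a ideal.I_l_closed[of J R a x] by blast
   show "a \<otimes> x \<in> \<Union>C" using J CA[of J] a ideal.I_r_closed[of J R a x] by blast
  qed
  moreover have "I \<subseteq> \<Union>C" using False CA by auto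
  moreover have "\<one> \<notin> \<Union>C" using CA by auto
  ultimately have "\<Union>C \<in> A" by (auto simp: A_def)
  thus ?thesis by auto
 qed
 then obtain M where M: "M \<in> A" "\<And>Y. Y \<in> A ==> M \<subseteq> Y ==> Y = M" using Zorn_Lemma2[of A] by meson
 have "maximalideal M R"
 proof (rule maximalidealI)
  show "ideal M R" "carrier R \<noteq> M" using M(1) by (auto simp: A_def)
  fix J assume J: "ideal J R" "M \<subseteq> J" "J \<subseteq> carrier R"
  show "J = M \<or> J = carrier R"
  proof (cases "\<one> \<in> J")
   case True thus ?thesis using ideal_one[OF J(1)] by simp
  next
   case False
   hence "J \<in> A" using J(1,2) M(1) by (auto simp: A_def)
   thus ?thesis using M(2)[OF _ J(2)] by simp
  qed
 qed
 thus ?thesis using that M(1) by (auto simp: A_def)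
qed

lemma maximal_comax:
 assumes M: "maximalideal M R" and u: "u \<in> carrier R" "u \<notin> M"
 obtains w y where "w \<in> carrier R" "y \<in> M" "\<one> = u \<otimes> w \<oplus> y"
proof -
 interpret M: maximalideal M R by fact
 have id: "ideal (PIdl u <+>\<^bsub>R\<^esub> M) R" using M.is_ideal u cgenideal_ideal sum_ideal_is_ideal by blast
 have "u = u \<oplus> \<zero>" using u(1) by simp
 hence u_in: "u \<in> PIdl u <+>\<^bsub>R\<^esub> M"
  using cgenideal_self[OF u(1)] ideal_zero[OF M.is_ideal] unfolding set_add_def' by blast
 have M_in: "M \<subseteq> PIdl u <+>\<^bsub>R\<^esub> M"
 proof
  fix x assume "x \<in> M"
  moreover from this have "x = \<zero> \<oplus> x" using M.Icarr by simp
  ultimately show "x \<in> PIdl u <+>\<^bsub>R\<^esub> M"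
   using ideal_zero[OF cgenideal_ideal[OF u(1)]] unfolding set_add_def' by blast
 qed
 hence "PIdl u <+>\<^bsub>R\<^esub> M = carrier R" using M.I_maximal[OF id M_in] u(2) u_in ideal_subsetD[OF id] by blast
 hence "\<one> \<in> PIdl u <+>\<^bsub>R\<^esub> M" by simp
 then obtain w y where "w \<in> carrier R" "y \<in> M" "\<one> = w \<otimes> u \<oplus> y"
  unfolding set_add_def' cgenideal_def by blast
 thus ?thesis using that u by (simp add: m_comm)
qed

lemma maximal_unique:
 assumes "maximalideal M R" "maximalideal M' R" "M \<subseteq> M'"
 shows "M = M'"
proof -
 interpret M: maximalideal M R by fact
 interpret M': maximalideal M' R by fact
 show ?thesis using M.I_maximal[OF M'.is_ideal assms(3)] M'.I_notcarr M'.Icarr by blast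
qed

end

section \<open>Localization\<close>

definition mult_closed :: "('a, 'b) ring_scheme => 'a set => bool" where
 "mult_closed R S \<longleftrightarrow> S \<subseteq> carrier R \<and> \<one>\<^bsub>R\<^esub> \<in> S \<and> (\<forall>s\<in>S. \<forall>t\<in>S. s \<otimes>\<^bsub>R\<^esub> t \<in> S)"

locale localized = cring R for R (structure) +
 fixes S
 assumes S: "mult_closed R S"
begin

abbreviation frac where "frac \<equiv> fraction R S"
abbreviation "L \<equiv> localization R S"

lemma S_carrier: "s \<in> S ==> s \<in> carrier R"
 and one_S: "\<one> \<in> S" and mult_S: "s \<in> S ==> t \<in> S ==> s \<otimes> t \<in> S"
 using S by (auto simp: mult_closed_def)

lemma frac_self: "a \<in> carrier R ==> s \<in> S ==> (a, s) \<in> frac a s" using one_S by (auto simp: fraction_def)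

lemma frac_subset:
 assumes "a \<in> carrier R" "b \<in> carrier R" "s \<in> S" "t \<in> S" "u \<in> S"
  "u \<otimes> (a \<otimes> t) = u \<otimes> (b \<otimes> s)"
 shows "frac a s \<subseteq> frac b t"
proof (clarsimp simp: fraction_def)
 fix c r w assume c: "c \<in> carrier R" "r \<in> S" "w \<in> S" "w \<otimes> (a \<otimes> r) = w \<otimes> (c \<otimes> s)"
 note [simp] = assms(1,2) c(1) S_carrier[OF assms(3)] S_carrier[OF assms(4)] S_carrier[OF assms(5)]
  S_carrier[OF c(2)] S_carrier[OF c(3)]
 have "(u \<otimes> w \<otimes> s) \<otimes> (b \<otimes> r) = (w \<otimes> r) \<otimes> (u \<otimes> (b \<otimes> s))" by (simp add: m_ac)
 also have "\<dots> = (w \<otimes> r) \<otimes> (u \<otimes> (a \<otimes> t))" by (simp add: assms(6))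
 also have "\<dots> = (u \<otimes> t) \<otimes> (w \<otimes> (a \<otimes> r))" by (simp add: m_ac)
 also have "\<dots> = (u \<otimes> t) \<otimes> (w \<otimes> (c \<otimes> s))" by (simp add: c(4))
 also have "\<dots> = (u \<otimes> w \<otimes> s) \<otimes> (c \<otimes> t)" by (simp add: m_ac)
 finally show "\<exists>u\<in>S. u \<otimes> (b \<otimes> r) = u \<otimes> (c \<otimes> t)" using assms c mult_S by blast
qed

lemma frac_eq_iff:
 assumes "a \<in> carrier R" "b \<in> carrier R" "s \<in> S" "t \<in> S"
 shows "frac a s = frac b t \<longleftrightarrow> (\<exists>u\<in>S. u \<otimes> (a \<otimes> t) = u \<otimes> (b \<otimes> s))"
proof
 assume "frac a s = frac b t"
 hence "(b, t) \<in> frac a s" using frac_self assms by simp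
 thus "\<exists>u\<in>S. u \<otimes> (a \<otimes> t) = u \<otimes> (b \<otimes> s)" by (auto simp: fraction_def)
next
 assume "\<exists>u\<in>S. u \<otimes> (a \<otimes> t) = u \<otimes> (b \<otimes> s)"
 then obtain u where u: "u \<in> S" "u \<otimes> (a \<otimes> t) = u \<otimes> (b \<otimes> s)" by auto
 show "frac a s = frac b t" using frac_subset[OF assms u] frac_subset[OF assms(2,1,4,3) u(1) u(2)[symmetric]] by auto
qed

lemma frac_eqI':
 assumes "a \<in> carrier R" "b \<in> carrier R" "s \<in> S" "t \<in> S" "u \<in> S" "u \<otimes> (a \<otimes> t) = u \<otimes> (b \<otimes> s)"
 shows "frac a s = frac b t" using assms frac_eq_iff by blast

lemma frac_eqI:
 assumes "a \<in> carrier R" "b \<in> carrier R" "s \<in> S" "t \<in> S" "a \<otimes> t = b \<otimes> s"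
 shows "frac a s = frac b t" using assms one_S by (subst frac_eq_iff) auto

lemma in_frac:
 assumes "(b, t) \<in> frac a s" "a \<in> carrier R" "s \<in> S"
 shows "b \<in> carrier R" "t \<in> S" "frac b t = frac a s" using assms frac_eq_iff[of a b s t] by (auto simp: fraction_def)

lemma loc_mult:
 assumes "a \<in> carrier R" "b \<in> carrier R" "s \<in> S" "t \<in> S"
 shows "frac a s \<otimes>\<^bsub>L\<^esub> frac b t = frac (a \<otimes> b) (s \<otimes> t)"
proof -
 have "frac (a' \<otimes> b') (s' \<otimes> t') = frac (a \<otimes> b) (s \<otimes> t)"
  if h: "(a', s') \<in> frac a s" "(b', t') \<in> frac b t" for a' s' b' t'
 proof -
  note i = in_frac[OF h(1) assms(1,3)] and j = in_frac[OF h(2) assms(2,4)]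
  obtain u where u: "u \<in> S" "u \<otimes> (a' \<otimes> s) = u \<otimes> (a \<otimes> s')"
   using frac_eq_iff[of a' a s' s] i assms by auto
  obtain v where v: "v \<in> S" "v \<otimes> (b' \<otimes> t) = v \<otimes> (b \<otimes> t')"
   using frac_eq_iff[of b' b t' t] j assms by auto
  note [simp] = assms(1,2) i(1) j(1) S_carrier[OF assms(3)] S_carrier[OF assms(4)] S_carrier[OF i(2)]
   S_carrier[OF j(2)] S_carrier[OF u(1)] S_carrier[OF v(1)]
  have "(u \<otimes> v) \<otimes> ((a' \<otimes> b') \<otimes> (s \<otimes> t)) = (u \<otimes> (a' \<otimes> s)) \<otimes> (v \<otimes> (b' \<otimes> t))" by (simp add: m_ac)
  also have "\<dots> = (u \<otimes> v) \<otimes> ((a \<otimes> b) \<otimes> (s' \<otimes> t'))" by (simp add: u v) (simp add: m_ac)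
  finally show ?thesis by (intro frac_eqI'[of _ _ _ _ "u \<otimes> v"] mult_S assms i(2) j(2) u(1) v(1)) simp_all
 qed
 hence "{frac (a' \<otimes> b') (s' \<otimes> t') | a' s' b' t'. (a', s') \<in> frac a s \<and> (b', t') \<in> frac b t}
   = {frac (a \<otimes> b) (s \<otimes> t)}" using frac_self[OF assms(1,3)] frac_self[OF assms(2,4)] by blast
 thus ?thesis by (simp add: localization_def)
qed

lemma loc_add:
 assumes "a \<in> carrier R" "b \<in> carrier R" "s \<in> S" "t \<in> S"
 shows "frac a s \<oplus>\<^bsub>L\<^esub> frac b t = frac (a \<otimes> t \<oplus> b \<otimes> s) (s \<otimes> t)"
proof -
 have "frac (a' \<otimes> t' \<oplus> b' \<otimes> s') (s' \<otimes> t') = frac (a \<otimes> t \<oplus> b \<otimes> s) (s \<otimes> t)"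
  if h: "(a', s') \<in> frac a s" "(b', t') \<in> frac b t" for a' s' b' t'
 proof -
  note i = in_frac[OF h(1) assms(1,3)] and j = in_frac[OF h(2) assms(2,4)]
  obtain u where u: "u \<in> S" "u \<otimes> (a' \<otimes> s) = u \<otimes> (a \<otimes> s')"
   using frac_eq_iff[of a' a s' s] i assms by auto
  obtain v where v: "v \<in> S" "v \<otimes> (b' \<otimes> t) = v \<otimes> (b \<otimes> t')"
   using frac_eq_iff[of b' b t' t] j assms by auto
  note [simp] = assms(1,2) i(1) j(1) S_carrier[OF assms(3)] S_carrier[OF assms(4)] S_carrier[OF i(2)]
   S_carrier[OF j(2)] S_carrier[OF u(1)] S_carrier[OF v(1)]
  have "(u \<otimes> v) \<otimes> ((a' \<otimes> t' \<oplus> b' \<otimes> s') \<otimes> (s \<otimes> t))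
    = (v \<otimes> t \<otimes> t') \<otimes> (u \<otimes> (a' \<otimes> s)) \<oplus> (u \<otimes> s \<otimes> s') \<otimes> (v \<otimes> (b' \<otimes> t))"
   by (simp add: l_distr r_distr m_ac)
  also have "\<dots> = (v \<otimes> t \<otimes> t') \<otimes> (u \<otimes> (a \<otimes> s')) \<oplus> (u \<otimes> s \<otimes> s') \<otimes> (v \<otimes> (b \<otimes> t'))"
   by (simp add: u v)
  also have "\<dots> = (u \<otimes> v) \<otimes> ((a \<otimes> t \<oplus> b \<otimes> s) \<otimes> (s' \<otimes> t'))"
   by (simp add: l_distr r_distr m_ac)
  finally show ?thesis by (intro frac_eqI'[of _ _ _ _ "u \<otimes> v"] mult_S assms i(2) j(2) u(1) v(1)) simp_all
 qed
 hence "{frac (a' \<otimes> t' \<oplus> b' \<otimes> s') (s' \<otimes> t') | a' s' b' t'. (a', s') \<in> frac a s \<and> (b', t') \<in> frac b t}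
   = {frac (a \<otimes> t \<oplus> b \<otimes> s) (s \<otimes> t)}"
  using frac_self[OF assms(1,3)] frac_self[OF assms(2,4)] by blast
 thus ?thesis by (simp add: localization_def)
qed

lemma loc_carrier: "x \<in> carrier L \<longleftrightarrow> (\<exists>a s. a \<in> carrier R \<and> s \<in> S \<and> x = frac a s)"
 by (auto simp: localization_def)

lemma loc_one: "\<one>\<^bsub>L\<^esub> = frac \<one> \<one>" and loc_zero: "\<zero>\<^bsub>L\<^esub> = frac \<zero> \<one>"
 by (auto simp: localization_def)

lemma loc_distr_aux:
 assumes "a \<in> carrier R" "b \<in> carrier R" "c \<in> carrier R" "s \<in> S" "t \<in> S" "r \<in> S"
 shows "frac ((a \<otimes> t \<oplus> b \<otimes> s) \<otimes> c) (s \<otimes> t \<otimes> r)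
  = frac (a \<otimes> c \<otimes> (t \<otimes> r) \<oplus> b \<otimes> c \<otimes> (s \<otimes> r)) (s \<otimes> r \<otimes> (t \<otimes> r))"
proof -
 have c [simp]: "s \<in> carrier R" "t \<in> carrier R" "r \<in> carrier R" using assms S_carrier by auto
 define N where "N = a \<otimes> t \<oplus> b \<otimes> s"
 have [simp]: "N \<in> carrier R" using assms by (simp add: N_def)
 have e: "a \<otimes> c \<otimes> (t \<otimes> r) \<oplus> b \<otimes> c \<otimes> (s \<otimes> r) = N \<otimes> c \<otimes> r"
  using assms by (simp add: N_def l_distr m_assoc) (simp add: m_ac)
 show ?thesis unfolding e N_def[symmetric] by (rule frac_eqI) (use assms mult_S in \<open>simp_all add: m_ac\<close>)
qed

lemma loc_cring: "cring L"
proof (rule cringI)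
 show "abelian_group L"
 proof (rule abelian_groupI)
  fix x y assume "x \<in> carrier L" "y \<in> carrier L"
  then obtain a s b t where *: "a \<in> carrier R" "s \<in> S" "x = frac a s" "b \<in> carrier R" "t \<in> S" "y = frac b t"
   by (auto simp: loc_carrier)
  note c = S_carrier[OF *(2)] S_carrier[OF *(5)]
  show "x \<oplus>\<^bsub>L\<^esub> y \<in> carrier L" unfolding loc_carrier using * c mult_S
   by (intro exI[of _ "a \<otimes> t \<oplus> b \<otimes> s"] exI[of _ "s \<otimes> t"]) (simp add: loc_add)
  show "x \<oplus>\<^bsub>L\<^esub> y = y \<oplus>\<^bsub>L\<^esub> x" using * c by (simp add: loc_add m_comm[of s t] a_comm)
 next
  show "\<zero>\<^bsub>L\<^esub> \<in> carrier L" unfolding loc_zero loc_carrier using one_S by blast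
 next
  fix x y z assume "x \<in> carrier L" "y \<in> carrier L" "z \<in> carrier L"
  then obtain a s b t c r where *: "a \<in> carrier R" "s \<in> S" "x = frac a s" "b \<in> carrier R" "t \<in> S" "y = frac b t"
   "c \<in> carrier R" "r \<in> S" "z = frac c r" by (auto simp: loc_carrier)
  note k = S_carrier[OF *(2)] S_carrier[OF *(5)] S_carrier[OF *(8)]
  have "(a \<otimes> t \<oplus> b \<otimes> s) \<otimes> r \<oplus> c \<otimes> (s \<otimes> t) = a \<otimes> (t \<otimes> r) \<oplus> (b \<otimes> r \<oplus> c \<otimes> t) \<otimes> s"
   using *(1,4,7) k by (simp add: l_distr m_assoc a_assoc m_comm[of r s] m_comm[of t s])
  thus "x \<oplus>\<^bsub>L\<^esub> y \<oplus>\<^bsub>L\<^esub> z = x \<oplus>\<^bsub>L\<^esub> (y \<oplus>\<^bsub>L\<^esub> z)"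
   unfolding *(3,6,9) using *(1,2,4,5,7,8) k by (simp add: loc_add mult_S m_assoc)
 next
  fix x assume "x \<in> carrier L"
  then obtain a s where *: "a \<in> carrier R" "s \<in> S" "x = frac a s" by (auto simp: loc_carrier)
  note c = S_carrier[OF *(2)]
  show "\<zero>\<^bsub>L\<^esub> \<oplus>\<^bsub>L\<^esub> x = x" using * c one_S by (simp add: loc_zero loc_add)
  have "frac (\<ominus> a) s \<oplus>\<^bsub>L\<^esub> x = frac ((\<ominus> a) \<otimes> s \<oplus> a \<otimes> s) (s \<otimes> s)" using * c by (simp add: loc_add)
  also have "\<dots> = frac \<zero> \<one>" using * c one_S mult_S by (intro frac_eqI) (simp_all add: l_minus l_neg)
  finally have "frac (\<ominus> a) s \<oplus>\<^bsub>L\<^esub> x = frac \<zero> \<one>" .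
  moreover have "frac (\<ominus> a) s \<in> carrier L" unfolding loc_carrier using * by blast
  ultimately show "\<exists>y\<in>carrier L. y \<oplus>\<^bsub>L\<^esub> x = \<zero>\<^bsub>L\<^esub>" unfolding loc_zero by blast
 qed
 show "comm_monoid L"
 proof (rule comm_monoidI)
  fix x y assume "x \<in> carrier L" "y \<in> carrier L"
  then obtain a s b t where *: "a \<in> carrier R" "s \<in> S" "x = frac a s" "b \<in> carrier R" "t \<in> S" "y = frac b t"
   by (auto simp: loc_carrier)
  note c = S_carrier[OF *(2)] S_carrier[OF *(5)]
  show "x \<otimes>\<^bsub>L\<^esub> y \<in> carrier L" unfolding loc_carrier using * c mult_S
   by (intro exI[of _ "a \<otimes> b"] exI[of _ "s \<otimes> t"]) (simp add: loc_mult)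
  show "x \<otimes>\<^bsub>L\<^esub> y = y \<otimes>\<^bsub>L\<^esub> x" using * c
   by (simp add: loc_mult m_comm[of s t] m_comm[of a b])
 next
  show "\<one>\<^bsub>L\<^esub> \<in> carrier L" unfolding loc_one loc_carrier using one_S by blast
 next
  fix x y z assume "x \<in> carrier L" "y \<in> carrier L" "z \<in> carrier L"
  then obtain a s b t c r where *: "a \<in> carrier R" "s \<in> S" "x = frac a s" "b \<in> carrier R" "t \<in> S" "y = frac b t"
   "c \<in> carrier R" "r \<in> S" "z = frac c r" by (auto simp: loc_carrier)
  note k = S_carrier[OF *(2)] S_carrier[OF *(5)] S_carrier[OF *(8)]
  show "x \<otimes>\<^bsub>L\<^esub> y \<otimes>\<^bsub>L\<^esub> z = x \<otimes>\<^bsub>L\<^esub> (y \<otimes>\<^bsub>L\<^esub> z)"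
   unfolding *(3,6,9) using *(1,2,4,5,7,8) k by (simp add: loc_mult mult_S m_assoc)
 next
  fix x assume "x \<in> carrier L"
  then obtain a s where *: "a \<in> carrier R" "s \<in> S" "x = frac a s" by (auto simp: loc_carrier)
  thus "\<one>\<^bsub>L\<^esub> \<otimes>\<^bsub>L\<^esub> x = x" using one_S S_carrier[OF *(2)] by (simp add: loc_one loc_mult)
 qed
next
 fix x y z assume "x \<in> carrier L" "y \<in> carrier L" "z \<in> carrier L"
 then obtain a s b t c r where *: "a \<in> carrier R" "s \<in> S" "x = frac a s" "b \<in> carrier R" "t \<in> S" "y = frac b t"
  "c \<in> carrier R" "r \<in> S" "z = frac c r" by (auto simp: loc_carrier)
 note k = S_carrier[OF *(2)] S_carrier[OF *(5)] S_carrier[OF *(8)]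
 have "(x \<oplus>\<^bsub>L\<^esub> y) \<otimes>\<^bsub>L\<^esub> z = frac ((a \<otimes> t \<oplus> b \<otimes> s) \<otimes> c) (s \<otimes> t \<otimes> r)"
  unfolding *(3,6,9) using *(1,2,4,5,7,8) k by (simp add: loc_add loc_mult mult_S)
 moreover have "x \<otimes>\<^bsub>L\<^esub> z \<oplus>\<^bsub>L\<^esub> y \<otimes>\<^bsub>L\<^esub> z
  = frac (a \<otimes> c \<otimes> (t \<otimes> r) \<oplus> b \<otimes> c \<otimes> (s \<otimes> r)) (s \<otimes> r \<otimes> (t \<otimes> r))"
  unfolding *(3,6,9) using *(1,2,4,5,7,8) k by (simp add: loc_add loc_mult mult_S)
 ultimately show "(x \<oplus>\<^bsub>L\<^esub> y) \<otimes>\<^bsub>L\<^esub> z = x \<otimes>\<^bsub>L\<^esub> z \<oplus>\<^bsub>L\<^esub> y \<otimes>\<^bsub>L\<^esub> z"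
  using loc_distr_aux[OF *(1,4,7,2,5,8)] by simp
qed

end

section \<open>Quotient rings\<close>

lemma trivial_free_quotient:
 assumes "H \<subseteq> carrier (free_Abelian_group S)"
  and "\<And>a. a \<in> S ==> frag_of a \<in> generate (free_Abelian_group S) H"
 shows "trivial_group (free_Abelian_group S Mod generate (free_Abelian_group S) H)"
proof -
 let ?G = "free_Abelian_group S" let ?K = "generate ?G H"
 interpret G: comm_group ?G by (rule abelian_free_Abelian_group)
 have sub: "subgroup ?K ?G" using assms(1) by (rule G.generate_is_subgroup)
 have "x \<in> ?K" if "Poly_Mapping.keys x \<subseteq> S" for x
 proof (rule free_Abelian_group_induct[OF that])
  show "0 \<in> ?K" using subgroup.one_closed[OF sub] by simp
  fix x y assume x: "Poly_Mapping.keys x \<subseteq> S" "Poly_Mapping.keys y \<subseteq> S" "x \<in> ?K" "y \<in> ?K"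
  have "x \<otimes>\<^bsub>?G\<^esub> inv\<^bsub>?G\<^esub> y \<in> ?K"
   using subgroup.m_closed[OF sub x(3) subgroup.m_inv_closed[OF sub x(4)]] .
  thus "x - y \<in> ?K" using x by simp
 next
  fix a assume "a \<in> S"
  thus "frag_of a \<in> ?K" by (rule assms(2))
 qed
 hence K: "?K = carrier ?G" using subgroup.subset[OF sub] by auto
 have "?K #>\<^bsub>?G\<^esub> x = ?K" if "x \<in> carrier ?G" for x by (rule G.coset_join2[OF that sub]) (use that K in blast)
 hence "carrier (?G Mod ?K) = (\<Union>x\<in>carrier ?G. {?K})"
  unfolding FactGroup_def RCOSETS_def by (auto simp del: carrier_free_Abelian_group_iff)
 hence "carrier (?G Mod ?K) = {?K}" using G.one_closed by blast
 hence "\<exists>a. carrier (?G Mod ?K) = {a}" by blast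
 moreover have "group (?G Mod ?K)" using G.subgroup_imp_normal[OF sub] normal.factorgroup_is_group by blast
 ultimately show ?thesis using group.trivial_group by blast
qed

context cring
begin

lemma quot_carrier: "carrier (R Quot I) = (%a. I +> a) ` carrier R" by (auto simp: FactRing_def A_RCOSETS_def')

lemma quot_in: "a \<in> carrier R ==> I +> a \<in> carrier (R Quot I)" by (simp add: quot_carrier)

lemma quot_eq:
 assumes "ideal I R" "a \<in> carrier R" "b \<in> carrier R"
 shows "I +> a = I +> b \<longleftrightarrow> a \<ominus> b \<in> I" using quotient_eq_iff_same_a_r_cos[OF assms] by simp

lemma quot_zero_iff:
 assumes "ideal I R" "a \<in> carrier R"
 shows "I +> a = \<zero>\<^bsub>R Quot I\<^esub> \<longleftrightarrow> a \<in> I"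
 using assms by (metis FactRing_def a_rcos_zero ideal.rcos_const_imp_mem ring.simps(1))

lemma quot_mult:
 assumes "ideal I R" "a \<in> carrier R" "b \<in> carrier R"
 shows "(I +> a) \<otimes>\<^bsub>R Quot I\<^esub> (I +> b) = I +> (a \<otimes> b)"
 using ring_hom_mult[OF ideal.rcos_ring_hom[OF assms(1)] assms(2,3)] by simp

lemma quot_add:
 assumes "ideal I R" "a \<in> carrier R" "b \<in> carrier R"
 shows "(I +> a) \<oplus>\<^bsub>R Quot I\<^esub> (I +> b) = I +> (a \<oplus> b)"
 using ring_hom_add[OF ideal.rcos_ring_hom[OF assms(1)] assms(2,3)] by simp

lemma quot_one: "\<one>\<^bsub>R Quot I\<^esub> = I +> \<one>" by (simp add: FactRing_def)

lemma quot_image_mem_iff: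
 assumes "ideal I R" "ideal J R" "I \<subseteq> J" "a \<in> carrier R"
 shows "I +> a \<in> (+>) I ` J \<longleftrightarrow> a \<in> J"
proof
 assume "I +> a \<in> (+>) I ` J"
 then obtain b where b: "b \<in> J" "I +> a = I +> b" by auto
 hence bc: "b \<in> carrier R" using assms ideal_subsetD by blast
 hence "a \<ominus> b \<in> J" using quot_eq[OF assms(1,4)] b assms(3) by auto
 hence "(a \<ominus> b) \<oplus> b \<in> J" using ideal_add assms(2) b by blast
 moreover have "(a \<ominus> b) \<oplus> b = a" using assms(4) bc by algebra
 ultimately show "a \<in> J" by simp
qed auto

text \<open>Primes of a quotient ring pull back to primes above the kernel, strictly increasing chains
  to strictly increasing chains.\<close>

lemma quot_prime_pullback:
 assumes I: "ideal I R" and K: "primeideal K (R Quot I)"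
 shows "primeideal {r \<in> carrier R. I +> r \<in> K} R" "I \<subseteq> {r \<in> carrier R. I +> r \<in> K}"
  "K = (+>) I ` {r \<in> carrier R. I +> r \<in> K}"
proof -
 interpret K: primeideal K "R Quot I" by fact
 interpret h: ring_hom_ring R "R Quot I" "(+>) I" by (rule ideal.rcos_ring_hom_ring[OF I])
 have id: "ideal {r \<in> carrier R. I +> r \<in> K} R" by (rule h.ideal_vimage[OF K.is_ideal])
 show "primeideal {r \<in> carrier R. I +> r \<in> K} R"
 proof (rule primeidealI[OF id])
  show "cring R" by (rule is_cring)
  show "carrier R \<noteq> {r \<in> carrier R. I +> r \<in> K}"
  proof
   assume "carrier R = {r \<in> carrier R. I +> r \<in> K}"
   hence "I +> \<one> \<in> K" using one_closed by blast
   hence "\<one>\<^bsub>R Quot I\<^esub> \<in> K" by (simp only: quot_one)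
   thus False using K.I_notcarr K.one_imp_carrier by simp
  qed
  fix a b assume ab: "a \<in> carrier R" "b \<in> carrier R" "a \<otimes> b \<in> {r \<in> carrier R. I +> r \<in> K}"
  hence "(I +> a) \<otimes>\<^bsub>R Quot I\<^esub> (I +> b) \<in> K" by simp
  hence "I +> a \<in> K \<or> I +> b \<in> K" by (rule K.I_prime[OF quot_in[OF ab(1)] quot_in[OF ab(2)]])
  thus "a \<in> {r \<in> carrier R. I +> r \<in> K} \<or> b \<in> {r \<in> carrier R. I +> r \<in> K}" using ab(1,2) by blast
 qed
 show "I \<subseteq> {r \<in> carrier R. I +> r \<in> K}"
 proof
  fix x assume "x \<in> I"
  moreover have "x \<in> carrier R" using \<open>x \<in> I\<close> ideal_subsetD[OF I] by blast
  ultimately show "x \<in> {r \<in> carrier R. I +> r \<in> K}" using quot_zero_iff[OF I, of x] K.zero_closed by simp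
 qed
 show "K = (+>) I ` {r \<in> carrier R. I +> r \<in> K}" using K.a_subset unfolding quot_carrier by blast
qed

lemma quot_maximal_image:
 assumes I: "ideal I R" and M: "maximalideal M R" "I \<subseteq> M"
 shows "maximalideal ((+>) I ` M) (R Quot I)"
proof -
 interpret M: maximalideal M R by fact
 interpret Q: cring "R Quot I" by (rule ideal.quotient_is_cring[OF I is_cring])
 have id: "ideal ((+>) I ` M) (R Quot I)" by (rule ring_ideal_imp_quot_ideal[OF I M.is_ideal])
 note mem = quot_image_mem_iff[OF I M.is_ideal M(2)]
 show ?thesis
 proof (rule maximalidealI[OF id])
  show "carrier (R Quot I) \<noteq> (+>) I ` M"
  proof
   assume "carrier (R Quot I) = (+>) I ` M"
   hence "I +> \<one> \<in> (+>) I ` M" using quot_carrier by blast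
   hence "\<one> \<in> M" using mem by simp
   thus False using M.one_imp_carrier M.I_notcarr by simp
  qed
  fix J assume J: "ideal J (R Quot I)" "(+>) I ` M \<subseteq> J" "J \<subseteq> carrier (R Quot I)"
  show "J = (+>) I ` M \<or> J = carrier (R Quot I)"
  proof (cases "J = (+>) I ` M")
   case False
   then obtain z where z: "z \<in> J" "z \<notin> (+>) I ` M" using J(2) by blast
   have "z \<in> (%a. I +> a) ` carrier R" using J(3) z(1) unfolding quot_carrier by (rule subsetD)
   then obtain u where "u \<in> carrier R" "z = I +> u" by (rule imageE)
   hence u: "u \<in> carrier R" "I +> u \<in> J" "I +> u \<notin> (+>) I ` M" using z by simp_all
   hence "u \<notin> M" by auto
   then obtain w y where w: "w \<in> carrier R" "y \<in> M" "\<one> = u \<otimes> w \<oplus> y"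
    using maximal_comax[OF M(1) u(1)] by blast
   have "I +> \<one> = (I +> u) \<otimes>\<^bsub>R Quot I\<^esub> (I +> w) \<oplus>\<^bsub>R Quot I\<^esub> (I +> y)"
    using u w M.Icarr by (simp add: quot_mult[OF I] quot_add[OF I])
   moreover have "\<dots> \<in> J"
    using J(2) w(2) u(2) by (intro Q.ideal_add[OF J(1)] ideal.I_r_closed[OF J(1)] quot_in w(1)) auto
   ultimately have "\<one>\<^bsub>R Quot I\<^esub> \<in> J" by (simp add: quot_one)
   thus ?thesis using Q.ideal_one[OF J(1)] by simp
  qed simp
 qed
qed

text \<open>A point at which the maximal ideal \<open>M\<close> is generated by \<open>a\<close>: the localization modulo \<open>a\<close>
 is the residue field, which has exactly two ideals.\<close>

lemma vanishing_order_one: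
 assumes M: "maximalideal M R" and a: "a \<in> carrier R" "M = PIdl a"
 shows "vanishing_order R M a = 1"
proof -
 interpret M: maximalideal M R by fact
 have prime: "primeideal M R" by (rule maximalideal_prime[OF M])
 define S where "S = carrier R - M"
 have one: "\<one> \<notin> M" using M.one_imp_carrier M.I_notcarr by auto
 interpret loc: localized R S
  by unfold_locales (use one primeideal.I_prime[OF prime] in \<open>auto simp: mult_closed_def S_def\<close>)
 interpret L: cring loc.L by (rule loc.loc_cring)
 define g where "g = loc.frac a \<one>"
 have g: "g \<in> carrier loc.L" using a loc.one_S by (auto simp: g_def loc.loc_carrier)
 define N where "N = PIdl\<^bsub>loc.L\<^esub> g"
 have idN: "ideal N loc.L" unfolding N_def by (rule L.cgenideal_ideal[OF g])
 have max: "maximalideal N loc.L"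
 proof (rule maximalidealI[OF idN])
  show "carrier loc.L \<noteq> N"
  proof
   assume "carrier loc.L = N"
   hence "\<one>\<^bsub>loc.L\<^esub> \<in> N" using L.one_closed by simp
   then obtain y where "y \<in> carrier loc.L" "\<one>\<^bsub>loc.L\<^esub> = y \<otimes>\<^bsub>loc.L\<^esub> g"
    by (auto simp: N_def cgenideal_def)
   then obtain x s where x: "x \<in> carrier R" "s \<in> S" "loc.frac \<one> \<one> = loc.frac x s \<otimes>\<^bsub>loc.L\<^esub> loc.frac a \<one>"
    by (auto simp: loc.loc_carrier g_def loc.loc_one)
   hence "loc.frac \<one> \<one> = loc.frac (x \<otimes> a) s" using loc.one_S loc.S_carrier a by (simp add: loc.loc_mult)
   then obtain u where u: "u \<in> S" "u \<otimes> (\<one> \<otimes> s) = u \<otimes> (x \<otimes> a \<otimes> \<one>)"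
    using loc.frac_eq_iff[of \<one> "x \<otimes> a" \<one> s] x a loc.one_S by auto
   have c: "u \<in> carrier R" "s \<in> carrier R" using u x loc.S_carrier by auto
   have "a \<in> M" using a cgenideal_self by blast
   hence "u \<otimes> (x \<otimes> a) \<in> M" using x(1) c(1) by (intro M.I_l_closed)
   hence "u \<otimes> (x \<otimes> a \<otimes> \<one>) \<in> M" using x(1) a(1) by simp
   hence "u \<otimes> s \<in> M" using u c by simp
   moreover have "u \<otimes> s \<in> S" using loc.mult_S u x by auto
   ultimately show False by (simp add: S_def)
  qed
  fix J assume J: "ideal J loc.L" "N \<subseteq> J" "J \<subseteq> carrier loc.L"
  show "J = N \<or> J = carrier loc.L"
  proof (cases "J \<subseteq> N")
   case False
   then obtain y where y: "y \<in> J" "y \<notin> N" by auto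
   then obtain x s where x: "x \<in> carrier R" "s \<in> S" "y = loc.frac x s"
    using J(3) by (auto simp: loc.loc_carrier dest!: subsetD)
   have sc: "s \<in> carrier R" using x loc.S_carrier by auto
   have "x \<notin> M"
   proof
    assume "x \<in> M"
    then obtain b where b: "b \<in> carrier R" "x = b \<otimes> a" using a(2) unfolding cgenideal_def by blast
    have "y = loc.frac b s \<otimes>\<^bsub>loc.L\<^esub> g"
     unfolding g_def x(3) b(2) using b(1) x(2) a(1) loc.one_S sc by (simp add: loc.loc_mult)
    moreover have "loc.frac b s \<in> carrier loc.L" unfolding loc.loc_carrier using b(1) x(2) by blast
    ultimately have "y \<in> N" unfolding N_def cgenideal_def by blast
    thus False using y by simp
   qed
   hence xS: "x \<in> S" using x by (simp add: S_def)
   have "loc.frac s x \<in> carrier loc.L" unfolding loc.loc_carrier using sc xS by blast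
   hence "loc.frac s x \<otimes>\<^bsub>loc.L\<^esub> y \<in> J" using y(1) ideal.I_l_closed[OF J(1)] by blast
   moreover have "loc.frac s x \<otimes>\<^bsub>loc.L\<^esub> y = \<one>\<^bsub>loc.L\<^esub>"
   proof -
    have "loc.frac s x \<otimes>\<^bsub>loc.L\<^esub> y = loc.frac (s \<otimes> x) (x \<otimes> s)"
     using x xS sc by (simp add: loc.loc_mult)
    also have "\<dots> = loc.frac \<one> \<one>" using x xS sc loc.one_S loc.mult_S by (intro loc.frac_eqI) (auto simp: m_comm)
    finally show ?thesis by (simp add: loc.loc_one)
   qed
   ultimately show ?thesis using L.ideal_one[OF J(1)] by auto
  qed (use J in auto)
 qed
 interpret F: field "loc.L Quot N" by (rule maximalideal.quotient_is_field[OF max L.is_cring])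
 have ideals: "ideal I (loc.L Quot N) \<longleftrightarrow> I = {\<zero>\<^bsub>loc.L Quot N\<^esub>} \<or> I = carrier (loc.L Quot N)" for I
  using F.all_ideals by auto
 have "ring_length (loc.L Quot N) = enat 1"
 proof (rule antisym)
  show "ring_length (loc.L Quot N) \<le> enat 1" unfolding ring_length_def
  proof (subst One_nat_def, rule chain_sup_le_Suc)
   fix c assume c: "\<And>i. i \<le> Suc (Suc 0) ==> ideal (c i) (loc.L Quot N)"
    "\<And>i. i < Suc (Suc 0) ==> c i \<subset> c (Suc i)"
   have "c 0 \<subset> c 1" "c 1 \<subset> c 2" using c(2)[of 0] c(2)[of 1] by (auto simp: numeral_2_eq_2)
   moreover have "{\<zero>\<^bsub>loc.L Quot N\<^esub>} \<subseteq> carrier (loc.L Quot N)" by auto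
   ultimately show False using c(1)[of 0] c(1)[of 1] c(1)[of 2] unfolding ideals by auto
  qed
  show "enat 1 \<le> ring_length (loc.L Quot N)" unfolding ring_length_def
  proof (rule chain_sup_ge[where c = "%i. if i = 0 then {\<zero>\<^bsub>loc.L Quot N\<^esub>} else carrier (loc.L Quot N)"])
   fix i :: nat
   show "ideal (if i = 0 then {\<zero>\<^bsub>loc.L Quot N\<^esub>} else carrier (loc.L Quot N)) (loc.L Quot N)"
    by (simp add: ideals)
   assume "i < 1"
   have "\<one>\<^bsub>loc.L Quot N\<^esub> \<noteq> \<zero>\<^bsub>loc.L Quot N\<^esub>" by simp
   hence "{\<zero>\<^bsub>loc.L Quot N\<^esub>} \<noteq> carrier (loc.L Quot N)" using F.one_closed by blast
   thus "(if i = 0 then {\<zero>\<^bsub>loc.L Quot N\<^esub>} else carrier (loc.L Quot N))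
     \<subset> (if Suc i = 0 then {\<zero>\<^bsub>loc.L Quot N\<^esub>} else carrier (loc.L Quot N))"
    using \<open>i < 1\<close> F.one_closed by auto
  qed
 qed
 thus ?thesis by (simp add: vanishing_order_def Let_def S_def N_def g_def)
qed

section \<open>Vanishing of the Chow group\<close>

text \<open>If the maximal ideal \<open>m\<close> is cut out by one equation \<open>a\<close> on a curve through the point, that
  equation has divisor exactly \<open>m\<close>.\<close>

lemma point_rationally_trivial:
 assumes m: "maximalideal m R" and p: "primeideal p R" "p \<subseteq> m"
  and between: "\<And>P. primeideal P R ==> p \<subseteq> P ==> P = p \<or> maximalideal P R"
  and a: "a \<in> m" "a \<notin> p" "\<And>x. x \<in> m ==> \<exists>y\<in>carrier R. x \<ominus> y \<otimes> a \<in> p"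
 shows "frag_of m \<in> rationally_trivial R"
proof -
 interpret m: maximalideal m R by fact
 interpret p: primeideal p R by fact
 let ?B = "R Quot p" let ?m = "(+>) p ` m" let ?a = "p +> a"
 interpret B: domain ?B by (rule p.quotient_is_domain)
 have ac: "a \<in> carrier R" using a m.Icarr by blast
 have maxB: "maximalideal ?m ?B" by (rule quot_maximal_image[OF p.is_ideal m p(2)])
 have dim: "krull_dim ?B = 1"
 proof (rule antisym)
  show "krull_dim ?B \<le> 1" unfolding krull_dim_def one_enat_def
  proof (subst One_nat_def, rule chain_sup_le_Suc)
   fix c assume c: "\<And>i. i \<le> Suc (Suc 0) ==> primeideal (c i) ?B"
    "\<And>i. i < Suc (Suc 0) ==> c i \<subset> c (Suc i)"
   define d where "d i = {r \<in> carrier R. p +> r \<in> c i}" for i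
   have d: "primeideal (d i) R" "p \<subseteq> d i" "c i = (+>) p ` d i" if "i \<le> 2" for i
    using quot_prime_pullback[OF p.is_ideal c(1)[of i]] that by (auto simp: d_def)
   have "c 0 \<subset> c 1" "c 1 \<subset> c 2" using c(2)[of 0] c(2)[of 1] by (auto simp: numeral_2_eq_2)
   moreover have "d 0 \<subseteq> d 1" "d 1 \<subseteq> d 2" using calculation by (auto simp: d_def)
   ultimately have s: "d 0 \<subset> d 1" "d 1 \<subset> d 2" using d(3)[of 0] d(3)[of 1] d(3)[of 2] by auto
   hence "d 1 \<noteq> p" using d(2)[of 0] by auto
   hence "maximalideal (d 1) R" using between[OF d(1)[of 1] d(2)[of 1]] by auto
   from maximalideal.I_maximal[OF this, of "d 2"] s primeideal.axioms(1)[OF d(1)[of 2]]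
   have "d 2 = carrier R" using ideal_subsetD by blast
   thus False using primeideal.I_notcarr[OF d(1)[of 2]] by simp
  qed
  show "1 \<le> krull_dim ?B" unfolding krull_dim_def one_enat_def
  proof (rule chain_sup_ge[where c = "%i. if i = 0 then {\<zero>\<^bsub>?B\<^esub>} else ?m"])
   fix i :: nat
   show "primeideal (if i = 0 then {\<zero>\<^bsub>?B\<^esub>} else ?m) ?B"
    using B.zeroprimeideal B.maximalideal_prime[OF maxB] by simp
   assume "i < 1"
   have "?a \<in> ?m" "?a \<noteq> \<zero>\<^bsub>?B\<^esub>" using a quot_zero_iff[OF p.is_ideal ac] by auto
   moreover have "\<zero>\<^bsub>?B\<^esub> \<in> ?m" using maximalideal.axioms(1)[OF maxB] B.ideal_zero by blast
   ultimately show "(if i = 0 then {\<zero>\<^bsub>?B\<^esub>} else ?m) \<subset> (if Suc i = 0 then {\<zero>\<^bsub>?B\<^esub>} else ?m)"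
    using \<open>i < 1\<close> by auto
  qed
 qed
 have gen: "?m = PIdl\<^bsub>?B\<^esub> ?a"
 proof
  show "?m \<subseteq> PIdl\<^bsub>?B\<^esub> ?a"
  proof
   fix z assume "z \<in> ?m"
   then obtain x where x: "x \<in> m" "z = p +> x" by auto
   then obtain y where y: "y \<in> carrier R" "x \<ominus> y \<otimes> a \<in> p" using a(3) by blast
   hence "z = p +> (y \<otimes> a)" using quot_eq[OF p.is_ideal] x m.Icarr ac by auto
   also have "\<dots> = (p +> y) \<otimes>\<^bsub>?B\<^esub> ?a" using quot_mult[OF p.is_ideal] y ac by simp
   finally show "z \<in> PIdl\<^bsub>?B\<^esub> ?a" using y by (auto simp: cgenideal_def quot_carrier)
  qed
  have "?a \<in> ?m" using a by auto
  thus "PIdl\<^bsub>?B\<^esub> ?a \<subseteq> ?m" using maximalideal.axioms(1)[OF maxB] B.cgenideal_minimal by blast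
 qed
 have ord: "vanishing_order ?B ?m ?a = 1" by (rule B.vanishing_order_one[OF maxB quot_in[OF ac] gen])
 have "{m'. maximalideal m' R \<and> p \<subseteq> m' \<and> a \<in> m'} = {m}"
 proof -
  have "m = m'" if m': "maximalideal m' R" "p \<subseteq> m'" "a \<in> m'" for m'
  proof (rule maximal_unique[OF m m'(1)])
   interpret m': maximalideal m' R by fact
   show "m \<subseteq> m'"
   proof
    fix x assume x: "x \<in> m"
    then obtain y where y: "y \<in> carrier R" "x \<ominus> y \<otimes> a \<in> p" using a(3) by blast
    have "(x \<ominus> y \<otimes> a) \<oplus> y \<otimes> a \<in> m'" using y m' by (intro m'.a_closed m'.I_l_closed) auto
    moreover have "(x \<ominus> y \<otimes> a) \<oplus> y \<otimes> a = x" using x y ac m.Icarr by algebra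
    ultimately show "x \<in> m'" by simp
   qed
  qed
  thus ?thesis using m p(2) a(1) by blast
 qed
 hence "curve_div R p a = frag_of m" by (simp add: curve_div_def ord)
 moreover have "curve_div R p \<one> = 0"
 proof -
  have "{m'. maximalideal m' R \<and> p \<subseteq> m' \<and> \<one> \<in> m'} = {}"
   using ideal_one maximalideal.I_notcarr maximalideal.axioms(1) by blast
  thus ?thesis by (simp only: curve_div_def sum.empty)
 qed
 ultimately have "frag_of m = curve_div R p a - curve_div R p \<one>" by simp
 moreover have "\<one> \<notin> p" using p.one_imp_carrier p.I_notcarr by auto
 ultimately have "frag_of m \<in> {curve_div R p a - curve_div R p b | p a b.
     primeideal p R \<and> krull_dim (R Quot p) = 1 \<and> a \<in> carrier R - p \<and> b \<in> carrier R - p}"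
  using p(1) dim ac a(2) by blast
 thus ?thesis unfolding rationally_trivial_def by (rule generate.incl)
qed

lemma curve_div_carrier: "Poly_Mapping.keys (curve_div R p a) \<subseteq> {m. maximalideal m R}" unfolding curve_div_def
 by (rule order_trans[OF keys_sum]) (use keys_cmul in \<open>fastforce split: if_splits\<close>)

theorem CH0_trivial:
 assumes "\<And>m. maximalideal m R ==> frag_of m \<in> rationally_trivial R"
 shows "trivial_group (CH0 R)" unfolding CH0_def zero_cycles_def rationally_trivial_def
proof (rule trivial_free_quotient)
 show "frag_of m \<in> generate (free_Abelian_group {m. maximalideal m R}) {curve_div R p a - curve_div R p b | p a b.
     primeideal p R \<and> krull_dim (R Quot p) = 1 \<and> a \<in> carrier R - p \<and> b \<in> carrier R - p}"
  if "m \<in> {m. maximalideal m R}" for m using assms that by (simp add: rationally_trivial_def zero_cycles_def)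
 have "Poly_Mapping.keys (curve_div R p a - curve_div R p b) \<subseteq> {m. maximalideal m R}" for p a b
  using keys_diff[of "curve_div R p a" "curve_div R p b"] curve_div_carrier[of p a] curve_div_carrier[of p b] by blast
 thus "{curve_div R p a - curve_div R p b | p a b.
     primeideal p R \<and> krull_dim (R Quot p) = 1 \<and> a \<in> carrier R - p \<and> b \<in> carrier R - p}
   \<subseteq> carrier (free_Abelian_group {m. maximalideal m R})" by (auto simp del: frag_of_in_free_Abelian_group)
qed

end

section \<open>Rings of complex-valued functions\<close>

abbreviation "sdet m f \<equiv> Determinant.det (Matrix.mat m m f)"

text \<open>Elements are handled through their values at the points: identities in the ring, above all those between
  determinants, become identities between complex numbers.\<close>

locale function_ring = cring R for R (structure) +
 fixes ev :: "'a => 'p => complex" and Y :: "'p set"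
 assumes ev_add: "a \<in> carrier R ==> b \<in> carrier R ==> p \<in> Y ==> ev (a \<oplus> b) p = ev a p + ev b p"
  and ev_mult: "a \<in> carrier R ==> b \<in> carrier R ==> p \<in> Y ==> ev (a \<otimes> b) p = ev a p * ev b p"
  and ev_one: "p \<in> Y ==> ev \<one> p = 1"
  and ev_inject: "a \<in> carrier R ==> b \<in> carrier R ==> (\<And>p. p \<in> Y ==> ev a p = ev b p) ==> a = b"
begin

lemma ev_zero: "p \<in> Y ==> ev \<zero> p = 0" using ev_add[of \<zero> \<zero> p] by simp

lemma ev_uminus: "a \<in> carrier R ==> p \<in> Y ==> ev (\<ominus> a) p = - ev a p"
 using ev_add[of a "\<ominus> a" p] ev_zero[of p] by (simp add: r_neg eq_neg_iff_add_eq_0 add.commute)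

lemma ev_minus: "a \<in> carrier R ==> b \<in> carrier R ==> p \<in> Y ==> ev (a \<ominus> b) p = ev a p - ev b p"
 by (simp add: minus_eq ev_add ev_uminus)

lemma ev_finsum:
 assumes "finite A" "\<And>i. i \<in> A ==> f i \<in> carrier R" "p \<in> Y"
 shows "ev (finsum R f A) p = (\<Sum>i\<in>A. ev (f i) p)" using assms(1,2)
proof (induction A rule: finite_induct)
 case (insert x A)
 hence "f \<in> A \<rightarrow> carrier R" "f x \<in> carrier R" by auto
 thus ?case using insert assms(3) by (simp add: ev_add)
qed (simp add: ev_zero assms(3))

lemma ev_finprod:
 assumes "finite A" "\<And>i. i \<in> A ==> f i \<in> carrier R" "p \<in> Y"
 shows "ev (finprod R f A) p = (\<Prod>i\<in>A. ev (f i) p)" using assms(1,2)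
proof (induction A rule: finite_induct)
 case (insert x A)
 hence "f \<in> A \<rightarrow> carrier R" "f x \<in> carrier R" by auto
 thus ?case using insert assms(3) by (simp add: ev_mult)
qed (simp add: ev_one assms(3))

lemmas ev_simps = ev_add ev_mult ev_one ev_zero ev_uminus ev_minus

definition tup :: "nat => (nat => 'a) => bool" where
 "tup n v \<longleftrightarrow> (\<forall>i<n. v i \<in> carrier R)"

definition matr :: "nat => (nat => nat => 'a) => bool" where
 "matr n a \<longleftrightarrow> (\<forall>i<n. \<forall>j<n. a i j \<in> carrier R)"

lemma tupD: "tup n v ==> i < n ==> v i \<in> carrier R"
 and matrD: "matr n a ==> i < n ==> j < n ==> a i j \<in> carrier R" by (auto simp: tup_def matr_def)

lemma add_pow_sign:
 assumes "a \<in> carrier R"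
 shows "add_pow R (sign \<pi>) a = (if sign \<pi> = 1 then a else \<ominus> a)"
proof -
 have "add_pow R (1::int) a = a" using assms add.int_pow_1[of a] by (simp add: add_pow_def)
 moreover have "add_pow R (-1::int) a = \<ominus> a"
  using assms add.int_pow_neg[of a 1] add.int_pow_1[of a] by (simp add: add_pow_def a_inv_def)
 ultimately show ?thesis by (cases "\<pi>" rule: sign_cases) auto
qed

lemma ev_add_pow_sign:
 assumes "a \<in> carrier R" "p \<in> Y"
 shows "ev (add_pow R (sign \<pi>) a) p = of_int (sign \<pi>) * ev a p" using assms add_pow_sign[OF assms(1), of \<pi>]
 by (cases "\<pi>" rule: sign_cases) (simp_all add: ev_uminus)

lemma add_pow_sign_closed: "a \<in> carrier R ==> add_pow R (sign \<pi>) a \<in> carrier R" by (simp add: add_pow_sign)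

lemma det_summand_closed:
 assumes "matr n a" "\<pi> permutes {..<n}"
 shows "(\<Otimes>i\<in>{..<n}. a i (\<pi> i)) \<in> carrier R"
 using assms(1) permutes_in_image[OF assms(2)] by (intro finprod_closed) (auto simp: matr_def)

lemma mat_det_closed:
 assumes "matr n a"
 shows "mat_det R n a \<in> carrier R" unfolding mat_det_def
 by (rule finsum_closed) (use det_summand_closed[OF assms] add_pow_sign_closed in blast)

lemma ev_mat_det:
 assumes "matr n a" "p \<in> Y"
 shows "ev (mat_det R n a) p = sdet n (%(i, j). ev (a i j) p)"
proof -
 have fin: "finite {\<pi>. \<pi> permutes {..<n}}" by (simp add: finite_permutations)
 have "ev (mat_det R n a) p
  = (\<Sum>\<pi> | \<pi> permutes {..<n}. ev (add_pow R (sign \<pi>) (\<Otimes>i\<in>{..<n}. a i (\<pi> i))) p)"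
  unfolding mat_det_def by (rule ev_finsum[OF fin _ assms(2)]) (use det_summand_closed[OF assms(1)] add_pow_sign_closed in blast)
 also have "\<dots> = (\<Sum>\<pi> | \<pi> permutes {..<n}. of_int (sign \<pi>) * (\<Prod>i<n. ev (a i (\<pi> i)) p))"
 proof (rule sum.cong[OF refl])
  fix \<pi> assume "\<pi> \<in> {\<pi>. \<pi> permutes {..<n}}"
  hence \<pi>: "\<pi> permutes {..<n}" by simp
  have "ev (\<Otimes>i\<in>{..<n}. a i (\<pi> i)) p = (\<Prod>i<n. ev (a i (\<pi> i)) p)"
   by (rule ev_finprod) (use assms permutes_in_image[OF \<pi>] in \<open>auto simp: matr_def\<close>)
  thus "ev (add_pow R (sign \<pi>) (\<Otimes>i\<in>{..<n}. a i (\<pi> i))) p = of_int (sign \<pi>) * (\<Prod>i<n. ev (a i (\<pi> i)) p)"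
   using ev_add_pow_sign[OF det_summand_closed[OF assms(1) \<pi>] assms(2)] by simp
 qed
 also have "\<dots> = sdet n (%(i, j). ev (a i j) p)" unfolding det_def'[OF mat_carrier] atLeast0LessThan
 proof (rule sum.cong[OF refl])
  fix \<pi> assume "\<pi> \<in> {\<pi>. \<pi> permutes {..<n}}"
  hence \<pi>: "\<pi> permutes {..<n}" by simp
  show "of_int (sign \<pi>) * (\<Prod>i<n. ev (a i (\<pi> i)) p)
   = of_int (sign \<pi>) * (\<Prod>i<n. Matrix.mat n n (%(i, j). ev (a i j) p) $$ (i, \<pi> i))"
   using permutes_in_image[OF \<pi>] by (intro arg_cong2[where f = "(*)"] prod.cong) auto
 qed
 finally show ?thesis .
qed

definition mat_times :: "nat => (nat => nat => 'a) => (nat => nat => 'a) => nat => nat => 'a" where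
 "mat_times n a b i j = (\<Oplus>k\<in>{..<n}. a i k \<otimes> b k j)"

definition lincomb :: "nat => (nat => 'a) => (nat => 'a) => 'a" where
 "lincomb n v f = (\<Oplus>i\<in>{..<n}. v i \<otimes> f i)"

definition row_mult :: "nat => (nat => 'a) => (nat => nat => 'a) => nat => 'a" where
 "row_mult n f a j = lincomb n (%i. a i j) f"

lemma tup_col: "matr n a ==> j < n ==> tup n (%i. a i j)" by (auto simp: tup_def matr_def)

lemma lincomb_closed: "tup n v ==> tup n f ==> lincomb n v f \<in> carrier R"
 unfolding lincomb_def by (intro finsum_closed) (auto simp: tup_def)

lemma ev_lincomb: "tup n v ==> tup n f ==> p \<in> Y ==> ev (lincomb n v f) p = (\<Sum>i<n. ev (v i) p * ev (f i) p)"
 unfolding lincomb_def by (subst ev_finsum) (auto simp: tup_def ev_mult)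

lemma mat_times_closed: "matr n a ==> matr n b ==> matr n (mat_times n a b)"
 unfolding matr_def mat_times_def by (auto intro!: finsum_closed)

lemma ev_mat_times: "matr n a ==> matr n b ==> i < n ==> j < n ==> p \<in> Y ==>
  ev (mat_times n a b i j) p = (\<Sum>k<n. ev (a i k) p * ev (b k j) p)"
 unfolding mat_times_def by (subst ev_finsum) (auto simp: matr_def ev_mult)

lemma row_mult_closed: "matr n a ==> tup n f ==> tup n (row_mult n f a)"
 unfolding tup_def row_mult_def using lincomb_closed[unfolded tup_def] by (auto simp: matr_def)

lemma ev_row_mult: "matr n a ==> tup n f ==> j < n ==> p \<in> Y ==>
  ev (row_mult n f a j) p = (\<Sum>i<n. ev (a i j) p * ev (f i) p)"
 unfolding row_mult_def by (subst ev_lincomb) (auto intro: tup_col)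

lemma det_mat_times:
 assumes "matr n a" "matr n b"
 shows "mat_det R n (mat_times n a b) = mat_det R n a \<otimes> mat_det R n b"
proof (rule ev_inject)
 note c = mat_times_closed[OF assms] assms
 show "mat_det R n (mat_times n a b) \<in> carrier R" "mat_det R n a \<otimes> mat_det R n b \<in> carrier R"
  using c mat_det_closed by auto
 fix p assume p: "p \<in> Y"
 have "Matrix.mat n n (%(i, j). ev (mat_times n a b i j) p)
   = Matrix.mat n n (%(i, j). ev (a i j) p) * Matrix.mat n n (%(i, j). ev (b i j) p)"
  by (rule eq_matI) (use p assms in \<open>auto simp: ev_mat_times scalar_prod_def atLeast0LessThan\<close>)
 thus "ev (mat_det R n (mat_times n a b)) p = ev (mat_det R n a \<otimes> mat_det R n b) p"
  using c p by (simp add: ev_mat_det ev_mult mat_det_closed det_mult[OF mat_carrier mat_carrier])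
qed

lemma row_mult_assoc:
 assumes "matr n a" "matr n b" "tup n f" "j < n"
 shows "row_mult n (row_mult n f a) b j = row_mult n f (mat_times n a b) j"
proof (rule ev_inject)
 note c = row_mult_closed[OF assms(1,3)] mat_times_closed[OF assms(1,2)]
 show "row_mult n (row_mult n f a) b j \<in> carrier R" "row_mult n f (mat_times n a b) j \<in> carrier R"
  using tupD[OF row_mult_closed[OF assms(2) c(1)]] tupD[OF row_mult_closed[OF c(2) assms(3)]] assms(4) by auto
 fix p assume p: "p \<in> Y"
 have "ev (row_mult n (row_mult n f a) b j) p = (\<Sum>k<n. ev (b k j) p * (\<Sum>i<n. ev (a i k) p * ev (f i) p))"
  using assms c p by (simp add: ev_row_mult)
 also have "\<dots> = (\<Sum>i<n. (\<Sum>k<n. ev (a i k) p * ev (b k j) p) * ev (f i) p)"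
  by (simp add: sum_distrib_left sum_distrib_right) (subst sum.swap, simp add: mult_ac)
 also have "\<dots> = ev (row_mult n f (mat_times n a b) j) p" using assms c p by (simp add: ev_row_mult ev_mat_times)
 finally show "ev (row_mult n (row_mult n f a) b j) p = ev (row_mult n f (mat_times n a b) j) p" .
qed

definition diag :: "(nat => 'a) => nat => nat => 'a" where
 "diag d i j = (if i = j then d i else \<zero>)"

lemma matr_diag: "tup n d ==> matr n (diag d)" by (auto simp: matr_def tup_def diag_def)

lemma det_diag:
 assumes "tup n d"
 shows "mat_det R n (diag d) = (\<Otimes>i\<in>{..<n}. d i)"
proof (rule ev_inject)
 show "mat_det R n (diag d) \<in> carrier R" by (rule mat_det_closed[OF matr_diag[OF assms]])
 show "(\<Otimes>i\<in>{..<n}. d i) \<in> carrier R" using assms by (intro finprod_closed) (auto simp: tup_def)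
 fix p assume p: "p \<in> Y"
 let ?M = "Matrix.mat n n (%(i, j). ev (diag d i j) p)"
 have "Determinant.det ?M = prod_list (diag_mat ?M)"
  by (rule det_upper_triangular) (use p in \<open>auto simp: diag_def ev_zero\<close>)
 also have "\<dots> = (\<Prod>i<n. ev (d i) p)" by (simp add: prod_list_diag_prod diag_def atLeast0LessThan)
 finally show "ev (mat_det R n (diag d)) p = ev (\<Otimes>i\<in>{..<n}. d i) p"
  using assms p by (subst ev_mat_det[OF matr_diag], simp, simp, subst ev_finprod) (auto simp: tup_def)
qed

lemma row_mult_diag:
 assumes "tup n d" "tup n f" "j < n"
 shows "row_mult n f (diag d) j = d j \<otimes> f j"
proof (rule ev_inject)
 show "row_mult n f (diag d) j \<in> carrier R" "d j \<otimes> f j \<in> carrier R"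
  using tupD[OF row_mult_closed[OF matr_diag]] assms tupD by auto
 fix p assume p: "p \<in> Y"
 have "ev (row_mult n f (diag d) j) p = (\<Sum>i<n. if i = j then ev (d i) p * ev (f i) p else 0)"
  using assms p matr_diag by (simp add: ev_row_mult diag_def ev_zero if_distrib[of "%z. ev z p"] if_distrib[of "%z. z * _"] cong: if_cong)
 also have "\<dots> = ev (d j) p * ev (f j) p" using assms by simp
 finally show "ev (row_mult n f (diag d) j) p = ev (d j \<otimes> f j) p" using assms p tupD by (simp add: ev_mult)
qed

lemma lincomb_in_ideal:
 assumes "ideal J R" "tup n v" "\<And>i. i < n ==> f i \<in> J"
 shows "lincomb n v f \<in> J" unfolding lincomb_def by (rule ideal_finsum[OF assms(1)]) (use assms ideal_absorb tupD in auto)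

lemma lincomb_diff_left:
 assumes "tup n v" "tup n w" "tup n f"
 shows "lincomb n v f \<ominus> lincomb n w f = lincomb n (%i. v i \<ominus> w i) f"
proof (rule ev_inject)
 have t: "tup n (%i. v i \<ominus> w i)" using assms by (auto simp: tup_def)
 show "lincomb n v f \<ominus> lincomb n w f \<in> carrier R" "lincomb n (%i. v i \<ominus> w i) f \<in> carrier R"
  using assms t by (auto simp: lincomb_closed)
 fix p assume p: "p \<in> Y"
 show "ev (lincomb n v f \<ominus> lincomb n w f) p = ev (lincomb n (%i. v i \<ominus> w i) f) p"
  using assms t p by (simp add: ev_lincomb ev_minus lincomb_closed tupD sum_subtractf algebra_simps)
qed

lemma lincomb_diff_right:
 assumes "tup n v" "tup n f" "tup n g"
 shows "lincomb n v f \<ominus> lincomb n v g = lincomb n v (%i. f i \<ominus> g i)"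
proof (rule ev_inject)
 have t: "tup n (%i. f i \<ominus> g i)" using assms by (auto simp: tup_def)
 show "lincomb n v f \<ominus> lincomb n v g \<in> carrier R" "lincomb n v (%i. f i \<ominus> g i) \<in> carrier R"
  using assms t by (auto simp: lincomb_closed)
 fix p assume p: "p \<in> Y"
 show "ev (lincomb n v f \<ominus> lincomb n v g) p = ev (lincomb n v (%i. f i \<ominus> g i)) p"
  using assms t p by (simp add: ev_lincomb ev_minus lincomb_closed tupD sum_subtractf algebra_simps)
qed

lemma lincomb_row_mult:
 assumes "tup n v" "tup n f" "matr n a"
 shows "lincomb n v (row_mult n f a) = lincomb n (%i. \<Oplus>j\<in>{..<n}. a i j \<otimes> v j) f"
proof (rule ev_inject)
 have t: "tup n (%i. \<Oplus>j\<in>{..<n}. a i j \<otimes> v j)" using assms by (auto simp: tup_def matr_def intro!: finsum_closed)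
 note c = row_mult_closed[OF assms(3,2)]
 show "lincomb n v (row_mult n f a) \<in> carrier R" "lincomb n (%i. \<Oplus>j\<in>{..<n}. a i j \<otimes> v j) f \<in> carrier R"
  using assms t c by (auto simp: lincomb_closed)
 fix p assume p: "p \<in> Y"
 have e: "ev (\<Oplus>j\<in>{..<n}. a i j \<otimes> v j) p = (\<Sum>j<n. ev (a i j) p * ev (v j) p)" if "i < n" for i
  using that assms p by (subst ev_finsum) (auto simp: tup_def matr_def ev_mult)
 have "ev (lincomb n v (row_mult n f a)) p = (\<Sum>j<n. \<Sum>i<n. ev (v j) p * (ev (a i j) p * ev (f i) p))"
  using assms c p by (simp add: ev_lincomb ev_row_mult sum_distrib_left)
 also have "\<dots> = (\<Sum>i<n. \<Sum>j<n. ev (v j) p * (ev (a i j) p * ev (f i) p))" by (rule sum.swap)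
 also have "\<dots> = ev (lincomb n (%i. \<Oplus>j\<in>{..<n}. a i j \<otimes> v j) f) p"
  using assms t p by (simp add: ev_lincomb e sum_distrib_left sum_distrib_right mult_ac)
 finally show "ev (lincomb n v (row_mult n f a)) p = ev (lincomb n (%i. \<Oplus>j\<in>{..<n}. a i j \<otimes> v j) f) p" .
qed

end

section \<open>Orientations as tuples of generators\<close>

context function_ring
begin

lemma prod_ideal: "ideal J R ==> ideal (J \<cdot> J) R" by (rule ideal_prod_is_ideal)

lemma prod_mem: "a \<in> J ==> b \<in> J ==> a \<otimes> b \<in> J \<cdot> J" by (rule ideal_prod.prod)

lemma prod_mono:
 assumes "J \<subseteq> N" shows "J \<cdot> J \<subseteq> N \<cdot> N"
proof
 fix x assume "x \<in> J \<cdot> J"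
 thus "x \<in> N \<cdot> N" by (induction rule: ideal_prod.induct) (use assms in \<open>auto intro: ideal_prod.intros\<close>)
qed

lemma prod_subset: "ideal J R ==> J \<cdot> J \<subseteq> J" using ideal_prod_inter[of J J] by blast

definition gens :: "nat => 'a set => (nat => 'a) => bool" where
 "gens n J f \<longleftrightarrow> (\<forall>i<n. f i \<in> J) \<and> (\<forall>x\<in>J. \<exists>v. tup n v \<and> x \<ominus> lincomb n v f \<in> J \<cdot> J)"

lemma gens_tup: "ideal J R ==> gens n J f ==> tup n f" using ideal_subsetD by (auto simp: gens_def tup_def)

text \<open>The linear map from \<open>(R/J)\<^sup>n\<close> to \<open>J/J\<^sup>2\<close> that sends the standard
  basis to the classes of the \<open>f i\<close>.\<close>

definition orient_of :: "nat => 'a set => (nat => 'a) => (nat => 'a set) => 'a set" where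
 "orient_of n J f = (\<lambda>w\<in>carrier (free_module (R Quot J) n).
   (J \<cdot> J) +> lincomb n (%i. SOME a. a \<in> carrier R \<and> J +> a = w i) f)"

lemma red_carrier:
 assumes "tup n v"
 shows "reduce_vec R n J v \<in> carrier (free_module (R Quot J) n)"
 using assms by (auto simp: reduce_vec_def free_module_def tup_def quot_in)

lemma red_surj:
 assumes "w \<in> carrier (free_module (R Quot J) n)"
 obtains v where "tup n v" "v \<in> carrier (free_module R n)" "w = reduce_vec R n J v"
proof -
 have w: "w \<in> {..<n} \<rightarrow>\<^sub>E carrier (R Quot J)" using assms by (simp add: free_module_def)
 hence "\<forall>i\<in>{..<n}. \<exists>a. a \<in> carrier R \<and> w i = J +> a" using quot_carrier by (metis PiE_mem imageE)
 then obtain v where v: "\<And>i. i < n ==> v i \<in> carrier R \<and> w i = J +> v i" by (metis lessThan_iff)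
 have "w = reduce_vec R n J (restrict v {..<n})" using w v by (auto simp: reduce_vec_def fun_eq_iff PiE_def extensional_def)
 moreover have "tup n (restrict v {..<n})" "restrict v {..<n} \<in> carrier (free_module R n)"
  using v by (auto simp: tup_def free_module_def)
 ultimately show ?thesis using that by blast
qed

lemma free_carrier_tup: "v \<in> carrier (free_module R n) ==> tup n v" by (auto simp: free_module_def tup_def)

lemma orient_of_red:
 assumes J: "ideal J R" and f: "\<And>i. i < n ==> f i \<in> J" and v: "tup n v"
 shows "orient_of n J f (reduce_vec R n J v) = (J \<cdot> J) +> lincomb n v f"
proof -
 define w where "w = (%i. SOME a. a \<in> carrier R \<and> J +> a = reduce_vec R n J v i)"
 have w: "w i \<in> carrier R \<and> J +> w i = J +> v i" if "i < n" for i
 proof -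
  have "\<exists>a. a \<in> carrier R \<and> J +> a = reduce_vec R n J v i" using that v by (auto simp: reduce_vec_def tup_def)
  from someI_ex[OF this] show ?thesis using that by (simp add: w_def reduce_vec_def)
 qed
 have tw: "tup n w" using w by (simp add: tup_def)
 have tf: "tup n f" using f ideal_subsetD[OF J] by (simp add: tup_def)
 have tr: "orient_of n J f (reduce_vec R n J v) = (J \<cdot> J) +> lincomb n w f"
  using red_carrier[OF v] by (simp add: orient_of_def w_def)
 have "w i \<ominus> v i \<in> J" if "i < n" for i using w[OF that] quot_eq[OF J, of "w i" "v i"] tupD[OF v that] by blast
 hence "lincomb n (%i. w i \<ominus> v i) f \<in> J \<cdot> J"
  unfolding lincomb_def by (intro ideal_finsum[OF prod_ideal[OF J]] prod_mem) (use f in auto)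
 hence "lincomb n w f \<ominus> lincomb n v f \<in> J \<cdot> J" unfolding lincomb_diff_left[OF tw v tf] .
 hence "(J \<cdot> J) +> lincomb n w f = (J \<cdot> J) +> lincomb n v f"
  using quot_eq[OF prod_ideal[OF J]] lincomb_closed tw v tf by simp
 thus ?thesis using tr by simp
qed

definition unit_vec' :: "nat => nat => nat => 'a" where
 "unit_vec' n k = (\<lambda>i\<in>{..<n}. if i = k then \<one> else \<zero>)"

lemma unit_vec_carrier: "unit_vec' n k \<in> carrier (free_module R n)" by (auto simp: unit_vec'_def free_module_def)

lemma tup_unit_vec: "tup n (unit_vec' n k)" by (rule free_carrier_tup[OF unit_vec_carrier])

lemma lincomb_unit_vec:
 assumes "tup n f" "k < n" shows "lincomb n (unit_vec' n k) f = f k"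
proof (rule ev_inject)
 show "lincomb n (unit_vec' n k) f \<in> carrier R" "f k \<in> carrier R" using assms lincomb_closed[OF tup_unit_vec] tupD by auto
 fix p assume p: "p \<in> Y"
 have "ev (lincomb n (unit_vec' n k) f) p = (\<Sum>i<n. if i = k then ev (f i) p else 0)"
  unfolding ev_lincomb[OF tup_unit_vec assms(1) p]
  by (rule sum.cong) (use p in \<open>auto simp: unit_vec'_def ev_one ev_zero\<close>)
 thus "ev (lincomb n (unit_vec' n k) f) p = ev (f k) p" using assms by simp
qed

lemma orient_of_unit_vec:
 assumes "ideal J R" "\<And>i. i < n ==> f i \<in> J" "k < n"
 shows "orient_of n J f (reduce_vec R n J (unit_vec' n k)) = (J \<cdot> J) +> f k"
proof -
 have "tup n f" using assms ideal_subsetD by (auto simp: tup_def)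
 thus ?thesis using orient_of_red[OF assms(1,2) tup_unit_vec] lincomb_unit_vec assms(3) by simp
qed

lemma rcos_self: "ideal J R ==> a \<in> carrier R ==> a \<in> J +> a"
 using ideal_zero[of J] l_zero[of a] unfolding a_r_coset_def' by force

lemma conormal_add:
 assumes "ideal J R" "x \<in> J" "y \<in> J"
 shows "((J \<cdot> J) +> x) \<oplus>\<^bsub>conormal_module R J\<^esub> ((J \<cdot> J) +> y) = (J \<cdot> J) +> (x \<oplus> y)"
 using quot_add[OF prod_ideal[OF assms(1)], of x y] assms ideal_subsetD[OF assms(1)]
 by (simp add: conormal_module_def FactRing_def)

lemma conormal_smult:
 assumes J: "ideal J R" and a: "a \<in> carrier R" and x: "x \<in> J"
 shows "(J +> a) \<odot>\<^bsub>conormal_module R J\<^esub> ((J \<cdot> J) +> x) = (J \<cdot> J) +> (a \<otimes> x)"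
proof -
 note J2 = prod_ideal[OF J]
 have xc: "x \<in> carrier R" using ideal_subsetD[OF J x] .
 have "(J \<cdot> J) +> (a' \<otimes> x') = (J \<cdot> J) +> (a \<otimes> x)" if h: "a' \<in> J +> a" "x' \<in> (J \<cdot> J) +> x" for a' x'
 proof -
  obtain j where j: "j \<in> J" "a' = j \<oplus> a" using h(1) by (auto simp: a_r_coset_def')
  obtain k where k: "k \<in> J \<cdot> J" "x' = k \<oplus> x" using h(2) by (auto simp: a_r_coset_def')
  have c: "j \<in> carrier R" "k \<in> carrier R" using j k ideal_subsetD J J2 by blast+
  have "a' \<otimes> x' \<ominus> a \<otimes> x = (j \<oplus> a) \<otimes> k \<oplus> j \<otimes> x"
   unfolding j k using a xc c by algebra
  also have "\<dots> \<in> J \<cdot> J" using ideal_add[OF J2 ideal_absorb[OF J2 k(1)] prod_mem[OF j(1) x]] a c by simp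
  finally show ?thesis using quot_eq[OF J2] a xc c j k by simp
 qed
 moreover have "a \<in> J +> a" "x \<in> (J \<cdot> J) +> x" using rcos_self[OF J a] rcos_self[OF J2 xc] by auto
 ultimately have "(\<Union>a'\<in>J +> a. \<Union>x'\<in>(J \<cdot> J) +> x. (J \<cdot> J) +> (a' \<otimes> x')) = (J \<cdot> J) +> (a \<otimes> x)"
  by blast
 thus ?thesis by (simp add: conormal_module_def rcoset_mult_def)
qed

lemma conormal_eq:
 assumes "ideal J R" "x \<in> J" "y \<in> J"
 shows "(J \<cdot> J) +> x = (J \<cdot> J) +> y \<longleftrightarrow> x \<ominus> y \<in> J \<cdot> J"
 using quot_eq[OF prod_ideal[OF assms(1)]] assms ideal_subsetD by blast

lemma free_add_red:
 assumes "ideal J R" "tup n v" "tup n w"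
 shows "reduce_vec R n J v \<oplus>\<^bsub>free_module (R Quot J) n\<^esub> reduce_vec R n J w = reduce_vec R n J (%i. v i \<oplus> w i)"
 using assms by (auto simp: free_module_def reduce_vec_def fun_eq_iff quot_add tup_def)

lemma free_smult_red:
 assumes "ideal J R" "tup n v" "a \<in> carrier R"
 shows "(J +> a) \<odot>\<^bsub>free_module (R Quot J) n\<^esub> reduce_vec R n J v = reduce_vec R n J (%i. a \<otimes> v i)"
 using assms by (auto simp: free_module_def reduce_vec_def fun_eq_iff quot_mult tup_def)

lemma lincomb_add:
 assumes "tup n v" "tup n w" "tup n f"
 shows "lincomb n (%i. v i \<oplus> w i) f = lincomb n v f \<oplus> lincomb n w f"
proof (rule ev_inject)
 have t: "tup n (%i. v i \<oplus> w i)" using assms by (auto simp: tup_def)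
 show "lincomb n v f \<oplus> lincomb n w f \<in> carrier R" "lincomb n (%i. v i \<oplus> w i) f \<in> carrier R"
  using assms t by (auto simp: lincomb_closed)
 fix p assume p: "p \<in> Y"
 show "ev (lincomb n (%i. v i \<oplus> w i) f) p = ev (lincomb n v f \<oplus> lincomb n w f) p"
  using assms t p by (simp add: ev_lincomb ev_add lincomb_closed tupD sum.distrib algebra_simps)
qed

lemma lincomb_smult:
 assumes "tup n v" "a \<in> carrier R" "tup n f"
 shows "lincomb n (%i. a \<otimes> v i) f = a \<otimes> lincomb n v f"
proof (rule ev_inject)
 have t: "tup n (%i. a \<otimes> v i)" using assms by (auto simp: tup_def)
 show "a \<otimes> lincomb n v f \<in> carrier R" "lincomb n (%i. a \<otimes> v i) f \<in> carrier R"
  using assms t by (auto simp: lincomb_closed)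
 fix p assume p: "p \<in> Y"
 show "ev (lincomb n (%i. a \<otimes> v i) f) p = ev (a \<otimes> lincomb n v f) p"
  using assms t p by (simp add: ev_lincomb ev_mult lincomb_closed tupD sum_distrib_left algebra_simps)
qed

lemma orient_of_surj:
 assumes J: "ideal J R" and f: "gens n J f"
 shows "orient_of n J f \<in> orient_surj R n J"
proof -
 let ?M = "free_module (R Quot J) n" let ?N = "conormal_module R J" let ?a = "orient_of n J f"
 have fJ: "\<And>i. i < n ==> f i \<in> J" and tf: "tup n f" using f gens_tup[OF J f] by (auto simp: gens_def)
 have red: "?a (reduce_vec R n J v) = (J \<cdot> J) +> lincomb n v f" if "tup n v" for v by (rule orient_of_red[OF J fJ that])
 have lin: "lincomb n v f \<in> J" if "tup n v" for v by (rule lincomb_in_ideal[OF J that fJ])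
 have val: "?a w \<in> carrier ?N" if wM: "w \<in> carrier ?M" for w
 proof -
  obtain v where "tup n v" "w = reduce_vec R n J v" using red_surj[OF wM] by blast
  thus ?thesis using red lin by (auto simp: conormal_module_def)
 qed
 have "?a \<in> carrier ?M \<rightarrow>\<^sub>E carrier ?N" using val by (auto simp: orient_of_def)
 moreover have "?a (x \<oplus>\<^bsub>?M\<^esub> y) = ?a x \<oplus>\<^bsub>?N\<^esub> ?a y" if xy: "x \<in> carrier ?M" "y \<in> carrier ?M" for x y
 proof -
  obtain v where v: "tup n v" "x = reduce_vec R n J v" using red_surj[OF xy(1)] by blast
  obtain w where w: "tup n w" "y = reduce_vec R n J w" using red_surj[OF xy(2)] by blast
  have t: "tup n (%i. v i \<oplus> w i)" using v w by (auto simp: tup_def)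
  show ?thesis unfolding v w free_add_red[OF J v(1) w(1)] red[OF t] red[OF v(1)] red[OF w(1)]
   using conormal_add[OF J lin[OF v(1)] lin[OF w(1)]] lincomb_add[OF v(1) w(1) tf] by simp
 qed
 moreover have "?a (c \<odot>\<^bsub>?M\<^esub> x) = c \<odot>\<^bsub>?N\<^esub> ?a x" if cx: "c \<in> carrier (R Quot J)" "x \<in> carrier ?M" for c x
 proof -
  obtain a where a: "a \<in> carrier R" "c = J +> a" using cx(1) unfolding quot_carrier by blast
  obtain v where v: "tup n v" "x = reduce_vec R n J v" using red_surj[OF cx(2)] by blast
  have t: "tup n (%i. a \<otimes> v i)" using v a by (auto simp: tup_def)
  show ?thesis unfolding v a free_smult_red[OF J v(1) a(1)] red[OF t] red[OF v(1)]
   using conormal_smult[OF J a(1) lin[OF v(1)]] lincomb_smult[OF v(1) a(1) tf] by simp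
 qed
 moreover have "?a ` carrier ?M = carrier ?N"
 proof
  show "?a ` carrier ?M \<subseteq> carrier ?N" using val by auto
  show "carrier ?N \<subseteq> ?a ` carrier ?M"
  proof
   fix z assume "z \<in> carrier ?N"
   then obtain x where x: "x \<in> J" "z = (J \<cdot> J) +> x" by (auto simp: conormal_module_def)
   then obtain v where v: "tup n v" "x \<ominus> lincomb n v f \<in> J \<cdot> J" using f by (auto simp: gens_def)
   hence "z = (J \<cdot> J) +> lincomb n v f" using conormal_eq[OF J x(1) lin[OF v(1)]] x by simp
   hence "z = ?a (reduce_vec R n J v)" using red[OF v(1)] by simp
   thus "z \<in> ?a ` carrier ?M" using red_carrier[OF v(1)] by blast
  qed
 qed
 ultimately show ?thesis unfolding orient_surj_def module_surj_def by blast
qed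

text \<open>A surjection is determined by the images of the standard basis, so it is the orientation of a
  tuple of representatives of these images.\<close>

lemma orient_surj_cases:
 assumes J: "ideal J R" and \<alpha>: "\<alpha> \<in> orient_surj R n J"
 obtains f where "gens n J f" "\<alpha> = orient_of n J f"
proof -
 let ?M = "free_module (R Quot J) n" let ?N = "conormal_module R J"
 note D = \<alpha>[unfolded orient_surj_def module_surj_def, THEN CollectD]
 note ext = D[THEN conjunct1]
 note add = D[THEN conjunct2, THEN conjunct1, rule_format]
 note smult = D[THEN conjunct2, THEN conjunct2, THEN conjunct1, rule_format]
 note onto = D[THEN conjunct2, THEN conjunct2, THEN conjunct2]
 have Ncar: "carrier ?N = (+>) (J \<cdot> J) ` J" by (simp add: conormal_module_def)
 have "\<exists>x. x \<in> J \<and> \<alpha> (reduce_vec R n J (unit_vec' n k)) = (J \<cdot> J) +> x" for k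
 proof -
  have "\<alpha> (reduce_vec R n J (unit_vec' n k)) \<in> carrier ?N" using ext red_carrier[OF tup_unit_vec] by blast
  thus ?thesis unfolding Ncar by blast
 qed
 then obtain f where f: "\<And>k. f k \<in> J" "\<And>k. \<alpha> (reduce_vec R n J (unit_vec' n k)) = (J \<cdot> J) +> f k"
  by metis
 have tf: "tup m f" for m using f ideal_subsetD[OF J] by (auto simp: tup_def)
 have partial: "\<alpha> (reduce_vec R n J (%i. if i < k then v i else \<zero>)) = (J \<cdot> J) +> lincomb k v f"
  if v: "tup n v" and "k \<le> n" for v k using that(2)
 proof (induction k)
  case 0
  have t: "tup n (%i. \<zero>)" by (auto simp: tup_def)
  obtain x where x: "x \<in> J" "\<alpha> (reduce_vec R n J (%i. \<zero>)) = (J \<cdot> J) +> x"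
   using ext red_carrier[OF t] unfolding Ncar by blast
  have xc: "x \<in> carrier R" using x ideal_subsetD[OF J] by blast
  have "reduce_vec R n J (%i. \<zero>) = (J +> \<zero>) \<odot>\<^bsub>?M\<^esub> reduce_vec R n J (%i. \<zero>)"
   using free_smult_red[OF J t, of \<zero>] by simp
  hence "\<alpha> (reduce_vec R n J (%i. \<zero>)) = (J +> \<zero>) \<odot>\<^bsub>?N\<^esub> ((J \<cdot> J) +> x)"
   using smult[OF quot_in red_carrier[OF t], of \<zero>] x(2) by simp
  also have "\<dots> = (J \<cdot> J) +> \<zero>" using conormal_smult[OF J _ x(1), of \<zero>] xc by simp
  finally show ?case by (simp add: lincomb_def)
 next
  case (Suc k)
  hence k: "k < n" by simp
  let ?v = "%i. if i < k then v i else \<zero>"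
  have t: "tup n ?v" "tup n (%i. v k \<otimes> unit_vec' n k i)" using v k tupD[OF tup_unit_vec] by (auto simp: tup_def)
  have tk: "tup k v" "v k \<in> carrier R" using v k by (auto simp: tup_def)
  have "reduce_vec R n J (%i. if i < Suc k then v i else \<zero>)
    = reduce_vec R n J (%i. ?v i \<oplus> v k \<otimes> unit_vec' n k i)" unfolding reduce_vec_def using v k tk
   by (intro restrict_ext arg_cong[of _ _ "(+>) J"]) (auto simp: unit_vec'_def tup_def less_Suc_eq)
  also have "\<dots> = reduce_vec R n J ?v \<oplus>\<^bsub>?M\<^esub> ((J +> v k) \<odot>\<^bsub>?M\<^esub> reduce_vec R n J (unit_vec' n k))"
   using free_add_red[OF J t] free_smult_red[OF J tup_unit_vec tk(2)] by simp
  finally have "\<alpha> (reduce_vec R n J (%i. if i < Suc k then v i else \<zero>))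
    = \<alpha> (reduce_vec R n J ?v) \<oplus>\<^bsub>?N\<^esub> \<alpha> ((J +> v k) \<odot>\<^bsub>?M\<^esub> reduce_vec R n J (unit_vec' n k))"
   using add[OF red_carrier[OF t(1)] red_carrier[OF t(2)]] free_smult_red[OF J tup_unit_vec tk(2)] by simp
  also have "\<alpha> ((J +> v k) \<odot>\<^bsub>?M\<^esub> reduce_vec R n J (unit_vec' n k)) = (J \<cdot> J) +> (v k \<otimes> f k)"
   using smult[OF quot_in[OF tk(2)] red_carrier[OF tup_unit_vec]] f conormal_smult[OF J tk(2) f(1)] by simp
  also have "\<alpha> (reduce_vec R n J ?v) = (J \<cdot> J) +> lincomb k v f" using Suc by simp
  also have "\<dots> \<oplus>\<^bsub>?N\<^esub> ((J \<cdot> J) +> (v k \<otimes> f k)) = (J \<cdot> J) +> (lincomb k v f \<oplus> v k \<otimes> f k)"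
   by (rule conormal_add[OF J lincomb_in_ideal[OF J tk(1) f(1)] ideal_absorb[OF J f(1) tk(2)]])
  also have "lincomb k v f \<oplus> v k \<otimes> f k = lincomb (Suc k) v f"
  proof -
   have "(%i. v i \<otimes> f i) \<in> {..<k} \<rightarrow> carrier R" using tk(1) tf by (auto simp: tup_def)
   moreover have "v k \<otimes> f k \<in> carrier R" using tk(2) tupD[OF tf, of k "Suc k"] by simp
   ultimately show ?thesis by (simp add: lincomb_def lessThan_Suc a_comm)
  qed
  finally show ?case .
 qed
 have red: "\<alpha> (reduce_vec R n J v) = (J \<cdot> J) +> lincomb n v f" if v: "tup n v" for v
 proof -
  have "reduce_vec R n J v = reduce_vec R n J (%i. if i < n then v i else \<zero>)"
   unfolding reduce_vec_def by (intro restrict_ext) auto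
  thus ?thesis using partial[OF v order.refl] by simp
 qed
 have "gens n J f" unfolding gens_def
 proof (intro conjI allI impI ballI)
  fix x assume x: "x \<in> J"
  hence "(J \<cdot> J) +> x \<in> \<alpha> ` carrier ?M" using onto unfolding Ncar by blast
  then obtain w where w: "w \<in> carrier ?M" "(J \<cdot> J) +> x = \<alpha> w" by (rule imageE)
  obtain v where v: "tup n v" "w = reduce_vec R n J v" using red_surj[OF w(1)] by blast
  hence "(J \<cdot> J) +> x = (J \<cdot> J) +> lincomb n v f" using w red by simp
  moreover have "lincomb n v f \<in> J" by (rule lincomb_in_ideal[OF J v(1)]) (rule f(1))
  ultimately have "x \<ominus> lincomb n v f \<in> J \<cdot> J" using conormal_eq[OF J x] by simp
  thus "\<exists>v. tup n v \<and> x \<ominus> lincomb n v f \<in> J \<cdot> J" using v(1) by blast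
 qed (use f in auto)
 moreover have "\<alpha> = orient_of n J f"
 proof
  fix w
  show "\<alpha> w = orient_of n J f w"
  proof (cases "w \<in> carrier ?M")
   case True
   obtain v where v: "tup n v" "w = reduce_vec R n J v" using red_surj[OF True] by blast
   thus ?thesis using red[OF v(1)] orient_of_red[OF J f(1) v(1)] by simp
  next
   case False
   thus ?thesis using ext by (auto simp: orient_of_def PiE_def extensional_def)
  qed
 qed
 ultimately show ?thesis using that by blast
qed

lemma orient_of_cong:
 assumes J: "ideal J R" and f: "\<And>i. i < n ==> f i \<in> J" and g: "\<And>i. i < n ==> g i \<in> J"
  and fg: "\<And>i. i < n ==> f i \<ominus> g i \<in> J \<cdot> J"
 shows "orient_of n J f = orient_of n J g"
proof
 fix w
 have tf: "tup n f" "tup n g" using f g ideal_subsetD[OF J] by (auto simp: tup_def)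
 show "orient_of n J f w = orient_of n J g w"
 proof (cases "w \<in> carrier (free_module (R Quot J) n)")
  case True
  obtain v where v: "tup n v" "w = reduce_vec R n J v" using red_surj[OF True] by blast
  have "lincomb n v f \<ominus> lincomb n v g \<in> J \<cdot> J"
   unfolding lincomb_diff_right[OF v(1) tf] by (rule lincomb_in_ideal[OF prod_ideal[OF J] v(1) fg])
  hence "(J \<cdot> J) +> lincomb n v f = (J \<cdot> J) +> lincomb n v g"
   using conormal_eq[OF J lincomb_in_ideal[OF J v(1) f] lincomb_in_ideal[OF J v(1) g]] by simp
  thus ?thesis using v orient_of_red[OF J f v(1)] orient_of_red[OF J g v(1)] by simp
 qed (simp add: orient_of_def)
qed

lemma orient_of_eqD:
 assumes J: "ideal J R" and f: "\<And>i. i < n ==> f i \<in> J" and g: "\<And>i. i < n ==> g i \<in> J"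
  and eq: "orient_of n J f = orient_of n J g" and i: "i < n"
 shows "f i \<ominus> g i \<in> J \<cdot> J"
 using orient_of_unit_vec[where f = f, OF J f i] orient_of_unit_vec[where f = g, OF J g i] eq conormal_eq[OF J f[OF i] g[OF i]] by simp

text \<open>Reduction modulo \<open>J\<close> is a ring homomorphism, so matrices over \<open>R/J\<close> can be
  replaced by lifts whose determinant is one modulo \<open>J\<close>.\<close>

lemma quot_det:
 assumes J: "ideal J R" and a: "matr n a" and \<theta>: "\<And>i j. i < n ==> j < n ==> \<theta> i j = J +> a i j"
 shows "mat_det (R Quot J) n \<theta> = J +> mat_det R n a"
proof -
 interpret h: ring_hom_cring R "R Quot J" "(+>) J" by (rule ideal.rcos_ring_hom_cring[OF J is_cring])
 have fin: "finite {\<pi>. \<pi> permutes {..<n}}" by (simp add: finite_permutations)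
 let ?s = "%\<pi>. add_pow R (sign \<pi>) (\<Otimes>i\<in>{..<n}. a i (\<pi> i))"
 have cl: "?s \<pi> \<in> carrier R" if "\<pi> permutes {..<n}" for \<pi>
  using det_summand_closed[OF a that] add_pow_sign_closed by blast
 have "J +> mat_det R n a = finsum (R Quot J) (%\<pi>. J +> ?s \<pi>) {\<pi>. \<pi> permutes {..<n}}"
  unfolding mat_det_def by (subst h.hom_finsum) (use cl in \<open>auto simp: comp_def\<close>)
 also have "\<dots> = mat_det (R Quot J) n \<theta>" unfolding mat_det_def
 proof -
  have key: "J +> ?s \<pi> = add_pow (R Quot J) (sign \<pi>) (\<Otimes>\<^bsub>R Quot J\<^esub>i\<in>{..<n}. \<theta> i (\<pi> i))"
   if \<pi>: "\<pi> permutes {..<n}" for \<pi>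
  proof -
  note im = permutes_in_image[OF \<pi>]
  let ?P = "\<Otimes>i\<in>{..<n}. a i (\<pi> i)"
  let ?Q = "\<Otimes>\<^bsub>R Quot J\<^esub>i\<in>{..<n}. \<theta> i (\<pi> i)"
  have P: "?P \<in> carrier R" by (rule det_summand_closed[OF a \<pi>])
  have "J +> ?P = (\<Otimes>\<^bsub>R Quot J\<^esub>i\<in>{..<n}. J +> a i (\<pi> i))"
   by (subst h.hom_finprod) (use a im in \<open>auto simp: matr_def comp_def\<close>)
  also have "\<dots> = ?Q" by (rule h.S.finprod_cong') (use a im \<theta> quot_in in \<open>auto simp: matr_def\<close>)
  finally have PQ: "J +> ?P = ?Q" .
  have Q: "?Q \<in> carrier (R Quot J)" using PQ quot_in[OF P] by metis
  have "add_pow (R Quot J) (1::int) ?Q = ?Q" using Q h.S.add.int_pow_1[of ?Q] by (simp add: add_pow_def)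
  moreover have "add_pow (R Quot J) (-1::int) ?Q = \<ominus>\<^bsub>R Quot J\<^esub> ?Q"
   using Q h.S.add.int_pow_neg[of ?Q 1] h.S.add.int_pow_1[of ?Q] by (simp add: add_pow_def a_inv_def)
  ultimately show ?thesis using P PQ add_pow_sign[OF P, of \<pi>] by (cases "\<pi>" rule: sign_cases) auto
  qed
  show "(\<Oplus>\<^bsub>R Quot J\<^esub>\<pi>\<in>{\<pi>. \<pi> permutes {..<n}}. J +> ?s \<pi>)
    = (\<Oplus>\<^bsub>R Quot J\<^esub>\<pi>\<in>{\<pi>. \<pi> permutes {..<n}}. add_pow (R Quot J) (sign \<pi>) (\<Otimes>\<^bsub>R Quot J\<^esub>i\<in>{..<n}. \<theta> i (\<pi> i)))"
  proof (rule h.S.finsum_cong'[OF refl])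
   show "(%\<pi>. add_pow (R Quot J) (sign \<pi>) (\<Otimes>\<^bsub>R Quot J\<^esub>i\<in>{..<n}. \<theta> i (\<pi> i)))
     \<in> {\<pi>. \<pi> permutes {..<n}} \<rightarrow> carrier (R Quot J)"
   proof (rule Pi_I)
    fix \<pi> assume "\<pi> \<in> {\<pi>. \<pi> permutes {..<n}}"
    hence \<pi>: "\<pi> permutes {..<n}" by simp
    show "add_pow (R Quot J) (sign \<pi>) (\<Otimes>\<^bsub>R Quot J\<^esub>i\<in>{..<n}. \<theta> i (\<pi> i)) \<in> carrier (R Quot J)"
     unfolding key[OF \<pi>, symmetric] by (rule quot_in[OF cl[OF \<pi>]])
   qed
  next
   fix \<pi> assume "\<pi> \<in> {\<pi>. \<pi> permutes {..<n}}"
   hence "\<pi> permutes {..<n}" by simp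
   from key[OF this] show "J +> ?s \<pi> = add_pow (R Quot J) (sign \<pi>) (\<Otimes>\<^bsub>R Quot J\<^esub>i\<in>{..<n}. \<theta> i (\<pi> i))" .
  qed
 qed
 finally show ?thesis by simp
qed

lemma mat_vec_red:
 assumes J: "ideal J R" and a: "matr n a" and v: "tup n v"
  and \<theta>: "\<And>i j. i < n ==> j < n ==> \<theta> i j = J +> a i j"
 shows "mat_vec (R Quot J) n \<theta> (reduce_vec R n J v) = reduce_vec R n J (%i. \<Oplus>j\<in>{..<n}. a i j \<otimes> v j)"
 unfolding mat_vec_def reduce_vec_def
proof (rule restrict_ext)
 interpret h: ring_hom_cring R "R Quot J" "(+>) J" by (rule ideal.rcos_ring_hom_cring[OF J is_cring])
 fix i assume i: "i \<in> {..<n}"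
 have "J +> (\<Oplus>j\<in>{..<n}. a i j \<otimes> v j) = (\<Oplus>\<^bsub>R Quot J\<^esub>j\<in>{..<n}. J +> (a i j \<otimes> v j))"
  by (subst h.hom_finsum) (use a v i in \<open>auto simp: matr_def tup_def comp_def\<close>)
 also have "\<dots> = (\<Oplus>\<^bsub>R Quot J\<^esub>j\<in>{..<n}. \<theta> i j \<otimes>\<^bsub>R Quot J\<^esub> (\<lambda>k\<in>{..<n}. J +> v k) j)"
  by (rule h.S.finsum_cong') (use a v i \<theta> in \<open>auto simp: matr_def tup_def\<close>)
 finally show "(\<Oplus>\<^bsub>R Quot J\<^esub>j\<in>{..<n}. \<theta> i j \<otimes>\<^bsub>R Quot J\<^esub> (\<lambda>k\<in>{..<n}. J +> v k) j)
  = J +> (\<Oplus>j\<in>{..<n}. a i j \<otimes> v j)" by simp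
qed

lemma orient_compose:
 assumes J: "ideal J R" and a: "matr n a" and f: "\<And>i. i < n ==> f i \<in> J"
  and \<theta>: "\<And>i j. i < n ==> j < n ==> \<theta> i j = J +> a i j"
 shows "compose (carrier (free_module (R Quot J) n)) (orient_of n J f) (mat_vec (R Quot J) n \<theta>)
    = orient_of n J (row_mult n f a)"
proof
 fix w
 let ?C = "carrier (free_module (R Quot J) n)"
 have tf: "tup n f" using f ideal_subsetD[OF J] by (auto simp: tup_def)
 have g: "row_mult n f a j \<in> J" if "j < n" for j unfolding row_mult_def by (rule lincomb_in_ideal[OF J tup_col[OF a that] f])
 show "compose ?C (orient_of n J f) (mat_vec (R Quot J) n \<theta>) w = orient_of n J (row_mult n f a) w"
 proof (cases "w \<in> ?C")
  case True
  obtain v where v: "tup n v" "w = reduce_vec R n J v" using red_surj[OF True] by blast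
  have t: "tup n (%i. \<Oplus>j\<in>{..<n}. a i j \<otimes> v j)" using a v by (auto simp: tup_def matr_def intro!: finsum_closed)
  have "compose ?C (orient_of n J f) (mat_vec (R Quot J) n \<theta>) w
    = orient_of n J f (reduce_vec R n J (%i. \<Oplus>j\<in>{..<n}. a i j \<otimes> v j))"
   using True mat_vec_red[OF J a v(1) \<theta>] v by (simp add: compose_def)
  also have "\<dots> = orient_of n J (row_mult n f a) w"
   using orient_of_red[OF J f t] orient_of_red[OF J g v(1)] lincomb_row_mult[OF v(1) tf a] v by simp
  finally show ?thesis .
 qed (simp add: compose_def orient_of_def)
qed

text \<open>In terms of tuples, two orientations are related when the tuples differ, modulo the square of
  the ideal, by a matrix over the ring whose determinant is one modulo the ideal.\<close>

lemma orient_relI: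
 assumes J: "ideal J R" and a: "matr n a" "mat_det R n a \<ominus> \<one> \<in> J"
  and f: "gens n J f" and g: "gens n J g"
  and fg: "\<And>i. i < n ==> g i \<ominus> row_mult n f a i \<in> J \<cdot> J"
 shows "(orient_of n J f, orient_of n J g) \<in> orient_rel R n J"
proof -
 have fJ: "\<And>i. i < n ==> f i \<in> J" and gJ: "\<And>i. i < n ==> g i \<in> J" using f g by (auto simp: gens_def)
 let ?\<theta> = "%i j. J +> a i j"
 have "mat_det (R Quot J) n ?\<theta> = \<one>\<^bsub>R Quot J\<^esub>"
  using quot_det[OF J a(1)] quot_eq[OF J mat_det_closed[OF a(1)] one_closed] a(2) by (simp add: quot_one)
 hence "?\<theta> \<in> special_linear (R Quot J) n" using a(1) quot_in by (auto simp: special_linear_def matr_def)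
 moreover have "orient_of n J g = orient_of n J (row_mult n f a)" by (rule orient_of_cong[OF J gJ _ fg])
   (auto simp: row_mult_def intro: lincomb_in_ideal[OF J tup_col[OF a(1)] fJ])
 hence "orient_of n J g = compose (carrier (free_module (R Quot J) n)) (orient_of n J f) (mat_vec (R Quot J) n ?\<theta>)"
  using orient_compose[OF J a(1) fJ, where \<theta> = ?\<theta>] by simp
 ultimately show ?thesis using orient_of_surj[OF J f] orient_of_surj[OF J g] unfolding orient_rel_def by blast
qed

lemma orient_relE:
 assumes J: "ideal J R" and f: "gens n J f" and rel: "(orient_of n J f, \<beta>) \<in> orient_rel R n J"
 obtains a where "matr n a" "mat_det R n a \<ominus> \<one> \<in> J" "gens n J (row_mult n f a)"
  "\<beta> = orient_of n J (row_mult n f a)"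
proof -
 have fJ: "\<And>i. i < n ==> f i \<in> J" and tf: "tup n f" using f gens_tup[OF J f] by (auto simp: gens_def)
 obtain \<theta> where \<theta>: "\<theta> \<in> special_linear (R Quot J) n" and \<beta>: "\<beta> \<in> orient_surj R n J"
  "\<beta> = compose (carrier (free_module (R Quot J) n)) (orient_of n J f) (mat_vec (R Quot J) n \<theta>)"
  using rel unfolding orient_rel_def by blast
 have "\<forall>i j. \<exists>x. i < n \<and> j < n --> x \<in> carrier R \<and> \<theta> i j = J +> x"
  using \<theta> unfolding special_linear_def quot_carrier by blast
 then obtain a where a: "\<And>i j. i < n ==> j < n ==> a i j \<in> carrier R \<and> \<theta> i j = J +> a i j" by metis
 have ma: "matr n a" using a by (auto simp: matr_def)
 have "J +> mat_det R n a = J +> \<one>"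
  using \<theta> quot_det[OF J ma, where \<theta> = \<theta>] a by (simp add: special_linear_def quot_one)
 hence d: "mat_det R n a \<ominus> \<one> \<in> J" using quot_eq[OF J mat_det_closed[OF ma] one_closed] by simp
 have \<beta>': "\<beta> = orient_of n J (row_mult n f a)"
  using orient_compose[OF J ma fJ, where \<theta> = \<theta>] a \<beta> by simp
 let ?g = "row_mult n f a"
 have gJ: "?g j \<in> J" if "j < n" for j unfolding row_mult_def by (rule lincomb_in_ideal[OF J tup_col[OF ma that] fJ])
 obtain h where h: "gens n J h" "\<beta> = orient_of n J h" using orient_surj_cases[OF J \<beta>(1)] .
 have hJ: "\<And>i. i < n ==> h i \<in> J" using h by (auto simp: gens_def)
 have tg: "tup n ?g" and th: "tup n h" using gJ hJ ideal_subsetD[OF J] by (auto simp: tup_def)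
 have hg: "h i \<ominus> ?g i \<in> J \<cdot> J" if "i < n" for i
  by (rule orient_of_eqD[OF J hJ gJ _ that]) (use h \<beta>' in auto)
 have "gens n J ?g" unfolding gens_def
 proof (intro conjI allI impI ballI)
  fix x assume x: "x \<in> J"
  then obtain v where v: "tup n v" "x \<ominus> lincomb n v h \<in> J \<cdot> J" using h by (auto simp: gens_def)
  have "lincomb n v h \<ominus> lincomb n v ?g \<in> J \<cdot> J"
   unfolding lincomb_diff_right[OF v(1) th tg] by (rule lincomb_in_ideal[OF prod_ideal[OF J] v(1) hg])
  hence "(x \<ominus> lincomb n v h) \<oplus> (lincomb n v h \<ominus> lincomb n v ?g) \<in> J \<cdot> J"
   using ideal_add[OF prod_ideal[OF J] v(2)] by blast
  moreover have "(x \<ominus> lincomb n v h) \<oplus> (lincomb n v h \<ominus> lincomb n v ?g) = x \<ominus> lincomb n v ?g"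
   using ideal_subsetD[OF J x] lincomb_closed[OF v(1) th] lincomb_closed[OF v(1) tg] by algebra
  ultimately show "\<exists>v. tup n v \<and> x \<ominus> lincomb n v ?g \<in> J \<cdot> J" using v(1) by auto
 qed (use gJ in auto)
 thus ?thesis using that ma d \<beta>' by blast
qed

end

section \<open>Induced orientations\<close>

context function_ring
begin

lemma matr_one: "matr n (diag (%i. \<one>))" by (rule matr_diag) (simp add: tup_def)

lemma det_one: "mat_det R n (diag (%i. \<one>)) = \<one>" by (subst det_diag) (simp_all add: tup_def finprod_one_eqI)

lemma row_mult_one:
 assumes "tup n f" "j < n" shows "row_mult n f (diag (%i. \<one>)) j = f j"
 using row_mult_diag[of n "%i. \<one>" f j] assms by (simp add: tup_def)

lemma orient_rel_refl:
 assumes J: "ideal J R" and f: "gens n J f"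
 shows "(orient_of n J f, orient_of n J f) \<in> orient_rel R n J"
proof (rule orient_relI[OF J matr_one _ f f])
 have tf: "tup n f" by (rule gens_tup[OF J f])
 show "mat_det R n (diag (%i. \<one>)) \<ominus> \<one> \<in> J" using ideal_zero[OF J] by (simp add: det_one r_neg minus_eq)
 fix i assume "i < n"
 thus "f i \<ominus> row_mult n f (diag (%i. \<one>)) i \<in> J \<cdot> J"
  using ideal_zero[OF prod_ideal[OF J]] tupD[OF tf] by (simp add: row_mult_one[OF tf] r_neg minus_eq)
qed

lemma local_orientation_iff:
 assumes J: "ideal J R"
 shows "\<omega> \<in> local_orientations R n J \<longleftrightarrow> (\<exists>f. gens n J f \<and> \<omega> = orient_rel R n J `` {orient_of n J f})"
proof
 assume "\<omega> \<in> local_orientations R n J"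
 then obtain \<alpha> where \<alpha>: "\<alpha> \<in> orient_surj R n J" "\<omega> = orient_rel R n J `` {\<alpha>}"
  unfolding local_orientations_def by (rule quotientE)
 from orient_surj_cases[OF J \<alpha>(1)] obtain f where "gens n J f" "\<alpha> = orient_of n J f" .
 thus "\<exists>f. gens n J f \<and> \<omega> = orient_rel R n J `` {orient_of n J f}" using \<alpha>(2) by blast
next
 assume "\<exists>f. gens n J f \<and> \<omega> = orient_rel R n J `` {orient_of n J f}"
 then obtain f where "gens n J f" "\<omega> = orient_rel R n J `` {orient_of n J f}" by blast
 thus "\<omega> \<in> local_orientations R n J" unfolding local_orientations_def using orient_of_surj[OF J] quotientI by fast
qed

lemma gens_extend:
 assumes J: "ideal J R" and N: "ideal N R" and JN: "J \<subseteq> N"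
  and ex: "\<And>x. x \<in> N ==> \<exists>y\<in>J. x \<ominus> y \<in> N \<cdot> N"
  and f: "gens n J f"
 shows "gens n N f" unfolding gens_def
proof (intro conjI allI impI ballI)
 fix i assume "i < n" thus "f i \<in> N" using f JN by (auto simp: gens_def)
next
 have tf: "tup n f" by (rule gens_tup[OF J f])
 fix x assume x: "x \<in> N"
 from ex[OF x] obtain y where y: "y \<in> J" "x \<ominus> y \<in> N \<cdot> N" by blast
 from f y(1) obtain v where v: "tup n v" "y \<ominus> lincomb n v f \<in> J \<cdot> J" by (auto simp: gens_def)
 have "(x \<ominus> y) \<oplus> (y \<ominus> lincomb n v f) \<in> N \<cdot> N"
  using ideal_add[OF prod_ideal[OF N] y(2)] v(2) prod_mono[OF JN] by blast
 moreover have "(x \<ominus> y) \<oplus> (y \<ominus> lincomb n v f) = x \<ominus> lincomb n v f"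
  using ideal_subsetD[OF N x] ideal_subsetD[OF J y(1)] lincomb_closed[OF v(1) tf] by algebra
 ultimately show "\<exists>v. tup n v \<and> x \<ominus> lincomb n v f \<in> N \<cdot> N" using v(1) by auto
qed

lemma induces_self:
 assumes J: "ideal J R" and N: "ideal N R" and JN: "J \<subseteq> N" and f: "gens n J f" and fN: "gens n N f"
 shows "induces R n J N (orient_of n J f) (orient_of n N f)" unfolding induces_def
proof (intro conjI ballI impI)
 show "orient_of n N f \<in> orient_surj R n N" by (rule orient_of_surj[OF N fN])
 have fJ: "\<And>i. i < n ==> f i \<in> J" and tf: "tup n f" using f gens_tup[OF J f] by (auto simp: gens_def)
 have fN': "\<And>i. i < n ==> f i \<in> N" using fJ JN by blast
 fix v x assume v: "v \<in> carrier (free_module R n)" and x: "x \<in> J"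
  and eq: "orient_of n J f (reduce_vec R n J v) = (J \<cdot> J) +> x"
 have tv: "tup n v" by (rule free_carrier_tup[OF v])
 have "(J \<cdot> J) +> lincomb n v f = (J \<cdot> J) +> x" using eq orient_of_red[where f = f, OF J fJ tv] by simp
 hence "lincomb n v f \<ominus> x \<in> J \<cdot> J" using conormal_eq[OF J lincomb_in_ideal[where f = f, OF J tv fJ] x] by simp
 hence "lincomb n v f \<ominus> x \<in> N \<cdot> N" using prod_mono[OF JN] by blast
 hence "(N \<cdot> N) +> lincomb n v f = (N \<cdot> N) +> x"
  using conormal_eq[OF N lincomb_in_ideal[where f = f, OF N tv fN']] x JN by blast
 thus "orient_of n N f (reduce_vec R n N v) = (N \<cdot> N) +> x" using orient_of_red[where f = f, OF N fN' tv] by simp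
qed

lemma induces_unique:
 assumes J: "ideal J R" and N: "ideal N R" and JN: "J \<subseteq> N" and f: "gens n J f"
  and ind: "induces R n J N (orient_of n J f) \<beta>"
 shows "\<beta> = orient_of n N f"
proof -
 have fJ: "\<And>i. i < n ==> f i \<in> J" using f by (auto simp: gens_def)
 have fN: "\<And>i. i < n ==> f i \<in> N" using fJ JN by blast
 have "\<beta> \<in> orient_surj R n N" using ind by (simp add: induces_def)
 from orient_surj_cases[OF N this] obtain h where h: "gens n N h" "\<beta> = orient_of n N h" .
 have hN: "\<And>i. i < n ==> h i \<in> N" using h(1) by (auto simp: gens_def)
 have "h i \<ominus> f i \<in> N \<cdot> N" if i: "i < n" for i
 proof -
  have "\<beta> (reduce_vec R n N (unit_vec' n i)) = (N \<cdot> N) +> f i"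
   using ind unit_vec_carrier fJ[OF i] orient_of_unit_vec[where f = f, OF J fJ i] unfolding induces_def by blast
  hence "(N \<cdot> N) +> h i = (N \<cdot> N) +> f i" using orient_of_unit_vec[where f = h, OF N hN i] h(2) by simp
  thus ?thesis using conormal_eq[OF N hN[OF i] fN[OF i]] by simp
 qed
 thus ?thesis unfolding h(2) by (intro orient_of_cong[OF N hN fN])
qed

text \<open>A tuple in \<open>J\<close> that represents an orientation of \<open>J\<close> also represents the induced
  orientation of \<open>N\<close>; passing to a related tuple commutes with this, since a matrix of determinant one
  modulo \<open>J\<close> has determinant one modulo \<open>N\<close>.\<close>

lemma induced_class:
 assumes J: "ideal J R" and N: "ideal N R" and JN: "J \<subseteq> N"
  and ex: "\<And>x. x \<in> N ==> \<exists>y\<in>J. x \<ominus> y \<in> N \<cdot> N"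
  and f: "gens n J f"
 shows "induced_orientation R n J N (orient_rel R n J `` {orient_of n J f})
    = orient_rel R n N `` {orient_of n N f}"
proof
 have fN: "gens n N f" by (rule gens_extend[OF J N JN ex f])
 have tf: "tup n f" by (rule gens_tup[OF J f])
 show "orient_rel R n N `` {orient_of n N f}
   \<subseteq> induced_orientation R n J N (orient_rel R n J `` {orient_of n J f})" unfolding induced_orientation_def
  using orient_rel_refl[OF J f] induces_self[OF J N JN f fN] by blast
 show "induced_orientation R n J N (orient_rel R n J `` {orient_of n J f})
   \<subseteq> orient_rel R n N `` {orient_of n N f}"
 proof
  fix z assume "z \<in> induced_orientation R n J N (orient_rel R n J `` {orient_of n J f})"
  then obtain \<beta> \<alpha> where h: "(orient_of n J f, \<alpha>) \<in> orient_rel R n J" "induces R n J N \<alpha> \<beta>"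
   "(\<beta>, z) \<in> orient_rel R n N" unfolding induced_orientation_def by blast
  from orient_relE[OF J f h(1)] obtain a where a: "matr n a" "mat_det R n a \<ominus> \<one> \<in> J"
   "gens n J (row_mult n f a)" "\<alpha> = orient_of n J (row_mult n f a)" .
  have \<beta>: "\<beta> = orient_of n N (row_mult n f a)" using induces_unique[OF J N JN a(3)] h(2) a(4) by blast
  have g: "gens n N (row_mult n f a)" by (rule gens_extend[OF J N JN ex a(3)])
  from orient_relE[OF N g] h(3) \<beta> obtain b where b: "matr n b" "mat_det R n b \<ominus> \<one> \<in> N"
   "gens n N (row_mult n (row_mult n f a) b)" "z = orient_of n N (row_mult n (row_mult n f a) b)" by blast
  note ab = mat_times_closed[OF a(1) b(1)]
  have "(orient_of n N f, orient_of n N (row_mult n (row_mult n f a) b)) \<in> orient_rel R n N"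
  proof (rule orient_relI[OF N ab _ fN b(3)])
   note c = mat_det_closed[OF a(1)] mat_det_closed[OF b(1)]
   have "mat_det R n a \<ominus> \<one> \<in> N" using a(2) JN by blast
   hence "mat_det R n b \<otimes> (mat_det R n a \<ominus> \<one>) \<oplus> (mat_det R n b \<ominus> \<one>) \<in> N"
    using ideal_add[OF N ideal_absorb[OF N _ c(2)] b(2)] by blast
   moreover have "mat_det R n b \<otimes> (mat_det R n a \<ominus> \<one>) \<oplus> (mat_det R n b \<ominus> \<one>)
     = mat_det R n a \<otimes> mat_det R n b \<ominus> \<one>" using c by algebra
   ultimately show "mat_det R n (mat_times n a b) \<ominus> \<one> \<in> N" by (simp add: det_mat_times[OF a(1) b(1)])
   fix i assume i: "i < n"
   have "row_mult n f (mat_times n a b) i \<in> carrier R" using tupD[OF row_mult_closed[OF ab tf] i] .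
   thus "row_mult n (row_mult n f a) b i \<ominus> row_mult n f (mat_times n a b) i \<in> N \<cdot> N"
    using row_mult_assoc[OF a(1) b(1) tf i] ideal_zero[OF prod_ideal[OF N]] by (simp add: minus_eq r_neg)
  qed
  thus "z \<in> orient_rel R n N `` {orient_of n N f}" using b(4) by blast
 qed
qed

section \<open>Radicals and primary components\<close>

lemma pow_closed_nat: "a \<in> carrier R ==> a [^] (k::nat) \<in> carrier R" by simp

lemma radical_ideal:
 assumes N: "ideal N R"
 shows "ideal (ideal_radical R N) R"
proof (rule idealI)
 show "ring R" by (rule ring_axioms)
 have mult: "x \<otimes> a \<in> ideal_radical R N" if ax: "a \<in> ideal_radical R N" "x \<in> carrier R" for a x
 proof -
  obtain k :: nat where k: "a \<in> carrier R" "a [^] k \<in> N" using ax by (auto simp: ideal_radical_def)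
  hence "(x \<otimes> a) [^] k \<in> N" using ax(2) ideal_absorb[OF N k(2), of "x [^] k"] by (simp add: nat_pow_distrib)
  thus ?thesis using k ax(2) by (auto simp: ideal_radical_def)
 qed
 thus "\<And>a x. a \<in> ideal_radical R N ==> x \<in> carrier R ==> x \<otimes> a \<in> ideal_radical R N" .
 show "a \<otimes> x \<in> ideal_radical R N" if "a \<in> ideal_radical R N" "x \<in> carrier R" for a x
 proof -
  have "a \<in> carrier R" using that by (auto simp: ideal_radical_def)
  thus ?thesis using mult[OF that] m_comm that by simp
 qed
 have add: "x \<oplus> y \<in> ideal_radical R N" if x: "x \<in> ideal_radical R N" and y: "y \<in> ideal_radical R N" for x y
 proof -
  obtain k :: nat where k: "x \<in> carrier R" "x [^] k \<in> N" using x by (auto simp: ideal_radical_def)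
  obtain l :: nat where l: "y \<in> carrier R" "y [^] l \<in> N" using y by (auto simp: ideal_radical_def)
  have "\<exists>m::nat. x [^] i \<otimes> y [^] j \<otimes> (x \<oplus> y) [^] m \<in> N" if "d = (k - i) + (l - j)" "i \<le> k" "j \<le> l" for d i j
   using that
  proof (induction d arbitrary: i j)
   case 0
   hence "i = k" by simp
   hence "x [^] i \<otimes> y [^] j \<in> N" using ideal_absorb[OF N k(2), of "y [^] j"] k l by (simp add: m_comm)
   thus ?case using k l by (intro exI[of _ "0::nat"]) simp
  next
   case (Suc d)
   show ?case
   proof (cases "i = k \<or> j = l")
    case True
    have "x [^] i \<otimes> y [^] j \<in> N"
     using True ideal_absorb[OF N k(2), of "y [^] j"] ideal_absorb[OF N l(2), of "x [^] i"] k l by (auto simp: m_comm)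
    thus ?thesis using k l by (intro exI[of _ "0::nat"]) simp
   next
    case False
    hence lt: "i < k" "j < l" using Suc.prems by auto
    have d: "d = (k - Suc i) + (l - j)" "d = (k - i) + (l - Suc j)" "Suc i \<le> k" "Suc j \<le> l"
     using lt Suc.prems(1) by linarith+
    obtain m1 :: nat where m1: "x [^] Suc i \<otimes> y [^] j \<otimes> (x \<oplus> y) [^] m1 \<in> N"
     using Suc.IH[OF d(1,3) Suc.prems(3)] by blast
    obtain m2 :: nat where m2: "x [^] i \<otimes> y [^] Suc j \<otimes> (x \<oplus> y) [^] m2 \<in> N"
     using Suc.IH[OF d(2) Suc.prems(2) d(4)] by blast
    define s where "s = x \<oplus> y"
    have sc: "s \<in> carrier R" using k l by (simp add: s_def)
    define A where "A = x [^] i" define B where "B = y [^] j"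
    define P where "P = s [^] m1" define Q where "Q = s [^] m2"
    have c: "A \<in> carrier R" "B \<in> carrier R" "P \<in> carrier R" "Q \<in> carrier R"
     using k l sc by (auto simp: A_def B_def P_def Q_def)
    have "Q \<otimes> (A \<otimes> x \<otimes> B \<otimes> P) \<oplus> P \<otimes> (A \<otimes> (B \<otimes> y) \<otimes> Q) \<in> N"
     using ideal_add[OF N ideal_absorb[OF N m1, of Q] ideal_absorb[OF N m2, of P]] c by (simp add: A_def B_def P_def Q_def s_def)
    moreover have "Q \<otimes> (A \<otimes> x \<otimes> B \<otimes> P) \<oplus> P \<otimes> (A \<otimes> (B \<otimes> y) \<otimes> Q) = A \<otimes> B \<otimes> (P \<otimes> Q \<otimes> s)"
     unfolding s_def using c k(1) l(1) by algebra
    moreover have "s [^] Suc (m1 + m2) = P \<otimes> Q \<otimes> s" using sc by (simp add: P_def Q_def nat_pow_mult)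
    ultimately have "A \<otimes> B \<otimes> s [^] Suc (m1 + m2) \<in> N" by simp
    thus ?thesis unfolding A_def B_def s_def by blast
   qed
  qed
  from this[of _ 0 0] obtain m :: nat where "(x \<oplus> y) [^] m \<in> N" using k l by auto
  thus ?thesis using k l by (auto simp: ideal_radical_def)
 qed
 show "subgroup (ideal_radical R N) (add_monoid R)"
 proof (rule group.subgroupI)
  show "group (add_monoid R)" by (rule add.is_group)
  show "ideal_radical R N \<subseteq> carrier (add_monoid R)" by (auto simp: ideal_radical_def)
  have "\<zero> [^] (1::nat) \<in> N" using ideal_zero[OF N] by simp
  hence "\<zero> \<in> ideal_radical R N" unfolding ideal_radical_def by blast
  thus "ideal_radical R N \<noteq> {}" by blast
  fix a assume a: "a \<in> ideal_radical R N"
  hence ac: "a \<in> carrier R" by (auto simp: ideal_radical_def)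
  have "\<ominus> \<one> \<otimes> a \<in> ideal_radical R N" by (rule mult[OF a]) simp
  thus "inv\<^bsub>add_monoid R\<^esub> a \<in> ideal_radical R N" using ac by (simp add: l_minus a_inv_def[symmetric])
 qed (use add in simp)
qed

lemma radical_superset: "ideal N R ==> N \<subseteq> ideal_radical R N"
proof
 fix x assume N: "ideal N R" and x: "x \<in> N"
 hence "x \<in> carrier R" "x [^] (1::nat) \<in> N" using ideal_subsetD by auto
 thus "x \<in> ideal_radical R N" unfolding ideal_radical_def by blast
qed

lemma prime_radical_subset:
 assumes P: "primeideal P R" and N: "N \<subseteq> P"
 shows "ideal_radical R N \<subseteq> P"
proof
 interpret P: primeideal P R by fact
 fix x assume "x \<in> ideal_radical R N"
 then obtain k :: nat where k: "x \<in> carrier R" "x [^] k \<in> P" using N by (auto simp: ideal_radical_def)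
 have "x [^] k \<in> P ==> x \<in> P" for k :: nat
 proof (induction k)
  case 0
  thus ?case using P.one_imp_carrier P.I_notcarr by simp
 next
  case (Suc k)
  thus ?case using P.I_prime[of "x [^] k" x] k(1) by auto
 qed
 thus "x \<in> P" using k(2) by blast
qed

lemma primary_radical_prime:
 assumes "primary_ideal N R"
 shows "primeideal (ideal_radical R N) R"
proof (rule primeidealI)
 have N: "ideal N R" "N \<noteq> carrier R"
  and pr: "\<And>a b. a \<in> carrier R ==> b \<in> carrier R ==> a \<otimes> b \<in> N ==> a \<in> N \<or> b \<in> ideal_radical R N"
  using assms unfolding primary_ideal_def by blast+
 show "ideal (ideal_radical R N) R" by (rule radical_ideal[OF N(1)])
 show "cring R" by (rule is_cring)
 show "carrier R \<noteq> ideal_radical R N"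
 proof
  assume "carrier R = ideal_radical R N"
  hence "\<one> \<in> ideal_radical R N" using one_closed by blast
  hence "\<one> \<in> N" by (simp add: ideal_radical_def)
  thus False using ideal_one[OF N(1)] N(2) by blast
 qed
 fix a b assume ab: "a \<in> carrier R" "b \<in> carrier R" "a \<otimes> b \<in> ideal_radical R N"
 then obtain k :: nat where "(a \<otimes> b) [^] k \<in> N" by (auto simp: ideal_radical_def)
 hence "a [^] k \<otimes> b [^] k \<in> N" using ab by (simp add: nat_pow_distrib)
 hence "a [^] k \<in> N \<or> b [^] k \<in> ideal_radical R N" using pr ab by simp
 moreover have "b [^] k \<in> ideal_radical R N ==> b \<in> ideal_radical R N"
 proof -
  assume "b [^] k \<in> ideal_radical R N"
  then obtain l :: nat where "(b [^] k) [^] l \<in> N" by (auto simp: ideal_radical_def)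
  hence "b [^] (k * l) \<in> N" using ab by (simp add: nat_pow_pow)
  thus ?thesis using ab by (auto simp: ideal_radical_def)
 qed
 ultimately show "a \<in> ideal_radical R N \<or> b \<in> ideal_radical R N" using ab by (auto simp: ideal_radical_def)
qed

lemma prime_avoid_inter:
 assumes P: "primeideal P R" and fin: "finite S"
  and S: "\<And>N. N \<in> S ==> ideal N R" "\<And>N. N \<in> S ==> \<not> N \<subseteq> P"
 shows "\<exists>u\<in>carrier R. u \<notin> P \<and> (\<forall>N\<in>S. u \<in> N)" using fin S
proof (induction S rule: finite_induct)
 case empty
 have "\<one> \<notin> P" using ideal_one primeideal.I_notcarr[OF P] primeideal.axioms(1)[OF P] by blast
 thus ?case by blast
next
 case (insert N S)
 obtain u where u: "u \<in> carrier R" "u \<notin> P" "\<forall>N\<in>S. u \<in> N" using insert by blast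
 obtain w where w: "w \<in> N" "w \<notin> P" using insert.prems(2) by blast
 have wc: "w \<in> carrier R" using w insert.prems(1) ideal_subsetD by blast
 have "u \<otimes> w \<notin> P" using primeideal.I_prime[OF P u(1) wc] u w by blast
 moreover have "u \<otimes> w \<in> N" using ideal_absorb[OF insert.prems(1) w(1) u(1)] by blast
 moreover have "u \<otimes> w \<in> N'" if "N' \<in> S" for N' using ideal.I_r_closed[OF insert.prems(1)] u(3) that wc by blast
 ultimately show ?case using u wc by blast
qed

text \<open>Away from the radical of \<open>N\<close> the other components are trivial, so \<open>J\<close> and its component \<open>N\<close>
 agree up to \<open>N\<^sup>2\<close>.\<close>

lemma component_mod_square:
 assumes J: "J = carrier R \<inter> \<Inter>\<N>" and fin: "finite \<N>" and id: "\<And>N. N \<in> \<N> ==> ideal N R"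
  and max: "\<And>N. N \<in> \<N> ==> maximalideal (ideal_radical R N) R"
  and inj: "inj_on (ideal_radical R) \<N>" and N: "N \<in> \<N>" and x: "x \<in> N"
 shows "\<exists>y\<in>J. x \<ominus> y \<in> N \<cdot> N"
proof -
 let ?M = "ideal_radical R N"
 have prime: "primeideal ?M R" by (rule maximalideal_prime[OF max[OF N]])
 have "\<not> N' \<subseteq> ?M" if "N' \<in> \<N> - {N}" for N'
 proof
  assume "N' \<subseteq> ?M"
  hence "ideal_radical R N' \<subseteq> ?M" by (rule prime_radical_subset[OF prime])
  hence "ideal_radical R N' = ?M" using maximal_unique max that N by blast
  thus False using inj that N by (auto simp: inj_on_def)
 qed
 then obtain u where u: "u \<in> carrier R" "u \<notin> ?M" "\<forall>N'\<in>\<N> - {N}. u \<in> N'"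
  using prime_avoid_inter[OF prime, of "\<N> - {N}"] fin id by blast
 obtain w y where w: "w \<in> carrier R" "y \<in> ?M" "\<one> = u \<otimes> w \<oplus> y"
  using maximal_comax[OF max[OF N] u(1,2)] by blast
 have yc: "y \<in> carrier R" using w by (simp add: ideal_radical_def)
 have xc: "x \<in> carrier R" using x ideal_subsetD id N by blast
 obtain k :: nat where k: "y [^] k \<in> N" using w by (auto simp: ideal_radical_def)
 have "\<exists>w'\<in>carrier R. u \<otimes> w' \<oplus> y [^] k = \<one>" for k :: nat
 proof (induction k)
  case 0 thus ?case using u by (intro bexI[of _ \<zero>]) auto
 next
  case (Suc k)
  then obtain w' where w': "w' \<in> carrier R" "u \<otimes> w' \<oplus> y [^] k = \<one>" by blast
  have "u \<otimes> (w \<oplus> w' \<otimes> y) \<oplus> y [^] k \<otimes> y = u \<otimes> w \<oplus> (u \<otimes> w' \<oplus> y [^] k) \<otimes> y"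
   using u(1) w(1) w'(1) yc pow_closed_nat[OF yc, of k] by algebra
  also have "\<dots> = \<one>" unfolding w'(2) using w(3)[symmetric] yc by simp
  finally show ?case using w(1) w'(1) yc by (intro bexI[of _ "w \<oplus> w' \<otimes> y"]) auto
 qed
 then obtain w' where w': "w' \<in> carrier R" "u \<otimes> w' \<oplus> y [^] k = \<one>" by blast
 let ?z = "u \<otimes> w' \<otimes> x"
 have "?z \<in> J"
 proof -
  have "?z \<in> N'" if N': "N' \<in> \<N>" for N'
  proof (cases "N' = N")
   case True
   thus ?thesis using ideal_absorb[OF id[OF N] x, of "u \<otimes> w'"] u w' by simp
  next
   case False
   hence "u \<in> N'" using u(3) N' by blast
   hence "(w' \<otimes> x) \<otimes> u \<in> N'" using ideal_absorb[OF id[OF N']] w' xc by simp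
   moreover have "(w' \<otimes> x) \<otimes> u = ?z" using u(1) w'(1) xc by algebra
   ultimately show ?thesis by simp
  qed
  thus ?thesis using J u w' xc by auto
 qed
 moreover have "x \<ominus> ?z \<in> N \<cdot> N"
 proof -
  have "x \<ominus> ?z = (u \<otimes> w' \<oplus> y [^] k) \<otimes> x \<ominus> ?z" using w' xc by simp
  also have "\<dots> = y [^] k \<otimes> x" using u(1) w'(1) xc pow_closed_nat[OF yc, of k] by algebra
  finally show ?thesis using prod_mem[OF k x] by simp
 qed
 ultimately show ?thesis by blast
qed

lemma lincomb_set_ideal:
 assumes f: "tup n f"
 shows "ideal {lincomb n v f | v. tup n v} R"
proof (rule idealI)
 let ?I = "{lincomb n v f | v. tup n v}"
 show "ring R" by (rule ring_axioms)
 have mult: "x \<otimes> a \<in> ?I" if ax: "a \<in> ?I" "x \<in> carrier R" for a x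
 proof -
  obtain v where v: "tup n v" "a = lincomb n v f" using ax by blast
  have "tup n (%i. x \<otimes> v i)" using v ax by (auto simp: tup_def)
  thus ?thesis using lincomb_smult[OF v(1) ax(2) f, symmetric] v(2) by blast
 qed
 have sub: "?I \<subseteq> carrier R" using lincomb_closed f by blast
 show "\<And>a x. a \<in> ?I ==> x \<in> carrier R ==> x \<otimes> a \<in> ?I" by (rule mult)
 show "a \<otimes> x \<in> ?I" if "a \<in> ?I" "x \<in> carrier R" for a x
 proof -
  have "a \<in> carrier R" using that sub by blast
  thus ?thesis using mult[OF that] m_comm[of x a] that(2) by simp
 qed
 show "subgroup ?I (add_monoid R)"
 proof (rule group.subgroupI)
  show "group (add_monoid R)" by (rule add.is_group)
  show "?I \<subseteq> carrier (add_monoid R)" using sub by simp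
  have "tup n (%i. \<zero>)" by (simp add: tup_def)
  thus "?I \<noteq> {}" by blast
  fix a assume a: "a \<in> ?I"
  hence ac: "a \<in> carrier R" using sub by blast
  have "\<ominus> \<one> \<otimes> a \<in> ?I" by (rule mult[OF a]) simp
  thus "inv\<^bsub>add_monoid R\<^esub> a \<in> ?I" using ac by (simp add: l_minus a_inv_def[symmetric])
 next
  fix a b assume "a \<in> ?I" "b \<in> ?I"
  then obtain v w where v: "tup n v" "a = lincomb n v f" and w: "tup n w" "b = lincomb n w f" by blast
  have "tup n (%i. v i \<oplus> w i)" using v w by (auto simp: tup_def)
  hence "a \<oplus> b \<in> ?I" using lincomb_add[OF v(1) w(1) f, symmetric] v(2) w(2) by blast
  thus "a \<otimes>\<^bsub>add_monoid R\<^esub> b \<in> ?I" by simp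
 qed
qed

lemma lincomb_set_gen: "tup n f ==> i < n ==> f i \<in> {lincomb n v f | v. tup n v}"
 using lincomb_unit_vec tup_unit_vec by (metis (mono_tags, lifting) mem_Collect_eq)

lemma global_orientation_of:
 assumes J: "ideal J R" and g: "\<And>i. i < n ==> g i \<in> J"
  and gen: "\<And>x. x \<in> J ==> \<exists>v. tup n v \<and> x = lincomb n v g"
  and \<omega>: "\<omega> \<in> local_orientations R n J" "orient_of n J g \<in> \<omega>"
 shows "global_orientation R n J \<omega>" unfolding global_orientation_def
proof (intro conjI bexI)
 show "\<omega> \<in> local_orientations R n J" "orient_of n J g \<in> \<omega>" by fact+
 have tg: "tup n g" using g ideal_subsetD[OF J] by (auto simp: tup_def)
 let ?F = "free_module R n"
 let ?\<phi> = "\<lambda>v\<in>carrier ?F. lincomb n v g"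
 show "\<forall>v\<in>carrier ?F. orient_of n J g (reduce_vec R n J v) = (J \<cdot> J) +> ?\<phi> v"
  using orient_of_red[where f = g, OF J g] free_carrier_tup by simp
 have add_in: "v \<oplus>\<^bsub>?F\<^esub> w \<in> carrier ?F" if "v \<in> carrier ?F" "w \<in> carrier ?F" for v w
  using that by (auto simp: free_module_def)
 have smult_in: "a \<odot>\<^bsub>?F\<^esub> v \<in> carrier ?F" if "a \<in> carrier R" "v \<in> carrier ?F" for a v
  using that by (auto simp: free_module_def)
 have cong: "lincomb n v g = lincomb n w g" if "\<And>i. i < n ==> v i = w i" "tup n w" for v w
  unfolding lincomb_def by (rule finsum_cong') (use that tg in \<open>auto simp: tup_def\<close>)
 have "?\<phi> \<in> carrier ?F \<rightarrow>\<^sub>E carrier (ideal_module R J)"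
  using lincomb_in_ideal[where f = g, OF J free_carrier_tup g] by (auto simp: ideal_module_def)
 moreover have "?\<phi> (v \<oplus>\<^bsub>?F\<^esub> w) = ?\<phi> v \<oplus>\<^bsub>ideal_module R J\<^esub> ?\<phi> w"
  if v: "v \<in> carrier ?F" and w: "w \<in> carrier ?F" for v w
 proof -
  have "lincomb n (v \<oplus>\<^bsub>?F\<^esub> w) g = lincomb n (%i. v i \<oplus> w i) g"
   by (rule cong) (use free_carrier_tup[OF v] free_carrier_tup[OF w] in \<open>auto simp: free_module_def tup_def\<close>)
  thus ?thesis using v w add_in[OF v w] lincomb_add[OF free_carrier_tup[OF v] free_carrier_tup[OF w] tg]
   by (simp add: ideal_module_def)
 qed
 moreover have "?\<phi> (a \<odot>\<^bsub>?F\<^esub> v) = a \<odot>\<^bsub>ideal_module R J\<^esub> ?\<phi> v"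
  if a: "a \<in> carrier R" and v: "v \<in> carrier ?F" for a v
 proof -
  have "lincomb n (a \<odot>\<^bsub>?F\<^esub> v) g = lincomb n (%i. a \<otimes> v i) g"
   by (rule cong) (use a free_carrier_tup[OF v] in \<open>auto simp: free_module_def tup_def\<close>)
  thus ?thesis using v smult_in[OF a v] lincomb_smult[OF free_carrier_tup[OF v] a tg] by (simp add: ideal_module_def)
 qed
 moreover have "?\<phi> ` carrier ?F = carrier (ideal_module R J)"
 proof
  show "?\<phi> ` carrier ?F \<subseteq> carrier (ideal_module R J)"
   using lincomb_in_ideal[where f = g, OF J free_carrier_tup g] by (auto simp: ideal_module_def)
  show "carrier (ideal_module R J) \<subseteq> ?\<phi> ` carrier ?F"
  proof
   fix x assume "x \<in> carrier (ideal_module R J)"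
   hence "x \<in> J" by (simp add: ideal_module_def)
   then obtain v where v: "tup n v" "x = lincomb n v g" using gen by blast
   have r: "restrict v {..<n} \<in> carrier ?F" using v(1) by (auto simp: free_module_def tup_def)
   have "lincomb n (restrict v {..<n}) g = lincomb n v g" by (rule cong) (use v in auto)
   hence "x = ?\<phi> (restrict v {..<n})" using r v(2) by simp
   thus "x \<in> ?\<phi> ` carrier ?F" using r by blast
  qed
 qed
 ultimately show "?\<phi> \<in> module_surj R ?F (ideal_module R J)" unfolding module_surj_def by blast
qed

end

section \<open>The Euler class group\<close>

lemma chain_sup_geD:
 assumes "enat n \<le> chain_sup F" "n > 0"
 shows "\<exists>c. (\<forall>i\<le>n. F (c i)) \<and> (\<forall>i<n. c i \<subset> c (Suc i))"
proof (rule ccontr)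
 assume no: "\<not> ?thesis"
 have "chain_sup F \<le> enat (n - 1)"
 proof (rule chain_sup_le)
  fix k c assume c: "\<And>i. i \<le> k ==> F (c i)" "\<And>i. i < k ==> c i \<subset> c (Suc i)"
  show "k \<le> n - 1"
  proof (rule ccontr)
   assume "\<not> k \<le> n - 1"
   hence "n \<le> k" by simp
   hence "(\<forall>i\<le>n. F (c i)) \<and> (\<forall>i<n. c i \<subset> c (Suc i))" using c by auto
   thus False using no by blast
  qed
 qed
 hence "enat n \<le> enat (n - 1)" using assms(1) by (rule order_trans[rotated])
 thus False using assms(2) by simp
qed

locale euler_setting = function_ring R ev Y for R (structure) and ev :: "'a => 'p => complex" and Y +
 fixes n :: nat
 assumes n2: "n \<ge> 2" and dim: "krull_dim R = enat n"
  and height: "\<And>m. maximalideal m R ==> ideal_height R m = enat n"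
  and params: "\<And>m. maximalideal m R ==> \<exists>l. (\<forall>i<n. l i \<in> m) \<and>
    (\<forall>x\<in>m. \<exists>v. tup n v \<and> x = lincomb n v l) \<and>
    (\<forall>v. tup n v --> lincomb n v l \<in> m \<cdot> m --> (\<forall>i<n. v i \<in> m))"
  and sqrt: "\<And>m a. maximalideal m R ==> a \<in> carrier R ==> \<exists>b\<in>carrier R. a \<ominus> b \<otimes> b \<in> m"
  and bertini: "\<And>N m f. ideal N R ==> maximalideal m R ==> ideal_radical R N = m ==> gens n N f ==>
    \<exists>g \<M>. (\<forall>i<n. g i \<in> N \<and> g i \<ominus> f i \<in> N \<cdot> N) \<and> finite \<M> \<and>
     (\<forall>M\<in>\<M>. maximalideal M R) \<and> m \<notin> \<M> \<and>
     (\<forall>x\<in>N. (\<forall>M\<in>\<M>. x \<in> M) --> (\<exists>v. tup n v \<and> x = lincomb n v g)) \<and>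
     (\<forall>M\<in>\<M>. \<forall>i<n. g i \<in> M)"
begin

abbreviation "E_gens \<equiv> euler_gens R n"
abbreviation "E_rels \<equiv> euler_rels R n"

lemma primes_above_maximal: "maximalideal m R ==> {P. primeideal P R \<and> m \<subseteq> P} = {m}"
proof -
 assume m: "maximalideal m R"
 have "P = m" if P: "primeideal P R" "m \<subseteq> P" for P
 proof -
  have id: "ideal P R" by (rule primeideal.axioms(1)[OF P(1)])
  have "P \<subseteq> carrier R" using ideal_subsetD[OF id] by blast
  from maximalideal.I_maximal[OF m id P(2) this] primeideal.I_notcarr[OF P(1)]
  show ?thesis by blast
 qed
 thus ?thesis using maximalideal_prime[OF m] by blast
qed

lemma prime_height_maximal: "maximalideal m R ==> prime_height R m = enat n"
 using height[of m] primes_above_maximal[of m] by (simp add: ideal_height_def)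

text \<open>By dimension, an ideal of height \<open>n\<close> is contained in no prime but maximal ones.\<close>

lemma prime_over_height_n:
 assumes J: "ideal J R" "ideal_height R J = enat n" and P: "primeideal P R" "J \<subseteq> P"
 shows "maximalideal P R"
proof -
 have "ideal_height R J \<le> prime_height R P" unfolding ideal_height_def by (rule INF_lower) (use P in blast)
 hence "enat n \<le> prime_height R P" using J(2) by simp
 then obtain c where c: "\<forall>i\<le>n. primeideal (c i) R \<and> c i \<subseteq> P" "\<forall>i<n. c i \<subset> c (Suc i)"
  using chain_sup_geD[of n "%Q. primeideal Q R \<and> Q \<subseteq> P"] n2 unfolding prime_height_def by force
 have id: "ideal P R" by (rule primeideal.axioms(1)[OF P(1)])
 obtain M where M: "maximalideal M R" "P \<subseteq> M" using exists_maximal_above[OF id] primeideal.I_notcarr[OF P(1)] by metis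
 have "P = M"
 proof (rule ccontr)
  assume ne: "P \<noteq> M"
  define d where "d i = (if i \<le> n then c i else M)" for i
  have "enat (Suc n) \<le> krull_dim R" unfolding krull_dim_def
  proof (rule chain_sup_ge[where c = d])
   show "primeideal (d i) R" if "i \<le> Suc n" for i using c(1) maximalideal_prime[OF M(1)] by (simp add: d_def)
   show "d i \<subset> d (Suc i)" if "i < Suc n" for i
   proof (cases "i < n")
    case True
    thus ?thesis using c(2) by (simp add: d_def)
   next
    case False
    hence "i = n" using that by simp
    moreover have "c n \<subset> M" using c(1) M(2) ne by blast
    ultimately show ?thesis by (simp add: d_def)
   qed
  qed
  thus False using dim by simp
 qed
 thus ?thesis using M(1) by simp
qed

lemma height_of_components:
 assumes J: "J = carrier R \<inter> \<Inter>\<N>" and fin: "finite \<N>" and ne: "\<N> \<noteq> {}"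
  and id: "\<And>N. N \<in> \<N> ==> ideal N R"
  and max: "\<And>N. N \<in> \<N> ==> maximalideal (ideal_radical R N) R"
 shows "ideal_height R J = enat n"
proof -
 have above: "maximalideal P R" if P: "primeideal P R" "J \<subseteq> P" for P
 proof -
  have "\<exists>N\<in>\<N>. N \<subseteq> P"
  proof (rule ccontr)
   assume "\<not> ?thesis"
   then obtain u where "u \<in> carrier R" "u \<notin> P" "\<forall>N\<in>\<N>. u \<in> N"
    using prime_avoid_inter[OF P(1) fin id] by blast
   thus False using J P(2) by blast
  qed
  then obtain N where N: "N \<in> \<N>" "N \<subseteq> P" by blast
  have "ideal_radical R N \<subseteq> P" by (rule prime_radical_subset[OF P(1) N(2)])
  hence "P = ideal_radical R N" using primes_above_maximal[OF max[OF N(1)]] P(1) by blast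
  thus ?thesis using max[OF N(1)] by simp
 qed
 obtain N where N: "N \<in> \<N>" using ne by blast
 have "J \<subseteq> ideal_radical R N" using J N radical_superset[OF id[OF N]] by blast
 moreover have "primeideal (ideal_radical R N) R" by (rule maximalideal_prime[OF max[OF N]])
 ultimately have ne': "{P. primeideal P R \<and> J \<subseteq> P} \<noteq> {}" by blast
 have "ideal_height R J = (INF P \<in> {P. primeideal P R \<and> J \<subseteq> P}. enat n)" unfolding ideal_height_def
  by (rule INF_cong[OF refl]) (use above prime_height_maximal in blast)
 thus ?thesis using ne' by simp
qed

lemma component_is_gen:
 assumes J: "ideal J R" "ideal_height R J = enat n" and \<omega>: "\<omega> \<in> local_orientations R n J"
  and dec: "irredundant_primary_decomposition R J \<N>" and N: "N \<in> \<N>"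
 shows "(N, induced_orientation R n J N \<omega>) \<in> E_gens"
proof -
 have fin: "finite \<N>" and prim: "\<And>N. N \<in> \<N> ==> primary_ideal N R"
  and inj: "inj_on (ideal_radical R) \<N>" and int: "J = carrier R \<inter> \<Inter>\<N>"
  using dec unfolding irredundant_primary_decomposition_def by blast+
 have id: "ideal N R" if "N \<in> \<N>" for N using prim[OF that] by (simp add: primary_ideal_def)
 have max: "maximalideal (ideal_radical R N) R" if N: "N \<in> \<N>" for N
  by (rule prime_over_height_n[OF J primary_radical_prime[OF prim[OF N]]])
   (use int N radical_superset[OF id[OF N]] in blast)
 have "{P. primeideal P R \<and> N \<subseteq> P} = {ideal_radical R N}"
  using primes_above_maximal[OF max[OF N]] prime_radical_subset[of _ N] radical_superset[OF id[OF N]] by blast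
 hence hN: "ideal_height R N = enat n" using prime_height_maximal[OF max[OF N]] by (simp add: ideal_height_def)
 obtain f where f: "gens n J f" "\<omega> = orient_rel R n J `` {orient_of n J f}"
  using \<omega> local_orientation_iff[OF J(1)] by blast
 have JN: "J \<subseteq> N" using int N by blast
 have ex: "\<exists>y\<in>J. x \<ominus> y \<in> N \<cdot> N" if "x \<in> N" for x
  by (rule component_mod_square[OF int fin id max inj N that])
 have "induced_orientation R n J N \<omega> = orient_rel R n N `` {orient_of n N f}"
  unfolding f(2) by (rule induced_class[OF J(1) id[OF N] JN ex f(1)])
 moreover have "gens n N f" by (rule gens_extend[OF J(1) id[OF N] JN ex f(1)])
 ultimately have "induced_orientation R n J N \<omega> \<in> local_orientations R n N"
  using local_orientation_iff[OF id[OF N]] by blast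
 thus ?thesis using prim[OF N] hN max[OF N] height[OF max[OF N]] by (simp add: euler_gens_def)
qed

lemma rels_carrier: "E_rels \<subseteq> carrier (free_Abelian_group E_gens)"
proof
 fix z assume "z \<in> E_rels"
 then obtain J \<omega> \<N> where z: "z = (\<Sum>N\<in>\<N>. frag_of (N, induced_orientation R n J N \<omega>))"
  and J: "ideal J R" "ideal_height R J = enat n" "global_orientation R n J \<omega>"
  and dec: "irredundant_primary_decomposition R J \<N>" unfolding euler_rels_def by blast
 have \<omega>: "\<omega> \<in> local_orientations R n J" using J(3) by (simp add: global_orientation_def)
 have "Poly_Mapping.keys z \<subseteq> (\<Union>N\<in>\<N>. Poly_Mapping.keys (frag_of (N, induced_orientation R n J N \<omega>) :: _ \<Rightarrow>\<^sub>0 int))"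
  unfolding z by (rule keys_sum)
 also have "\<dots> \<subseteq> E_gens" using component_is_gen[OF J(1,2) \<omega> dec] by auto
 finally show "z \<in> carrier (free_Abelian_group E_gens)" by simp
qed

text \<open>The trick for changing an orientation by a square: if \<open>a\<close> is invertible modulo \<open>m = (l)\<close>, then
  \<open>1 - a a' = c\<^sub>0 l\<^sub>0 + c\<^sub>1 l\<^sub>1 + \<dots>\<close> with all \<open>c\<^sub>i \<in> m\<close>, and with \<open>w = c\<^sub>0 l\<^sub>0 + c\<^sub>1 l\<^sub>1\<close> the elements
  \<open>a l\<^sub>0 - c\<^sub>1 w, a l\<^sub>1 + c\<^sub>0 w, l\<^sub>2, \<dots>\<close> generate \<open>m\<close> again.\<close>

lemma square_twist:
 assumes m: "maximalideal m R" and l: "\<And>i. i < n ==> l i \<in> m"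
  and gen: "\<And>x. x \<in> m ==> \<exists>v. tup n v \<and> x = lincomb n v l"
  and a: "a \<in> carrier R" "a \<notin> m"
 obtains g where "\<And>i. i < n ==> g i \<in> m" "\<And>x. x \<in> m ==> \<exists>v. tup n v \<and> x = lincomb n v g"
  "\<And>i. i < n ==> g i \<ominus> (if i < 2 then a else \<one>) \<otimes> l i \<in> m \<cdot> m"
proof -
 interpret m: maximalideal m R by fact
 note mi = m.is_ideal
 note m2 = prod_ideal[OF mi]
 have tl: "tup n l" using l ideal_subsetD[OF mi] by (auto simp: tup_def)
 obtain b y where b: "b \<in> carrier R" "y \<in> m" "\<one> = a \<otimes> b \<oplus> y" using maximal_comax[OF m a] by blast
 obtain v where v: "tup n v" "y = lincomb n v l" using gen[OF b(2)] by blast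
 have yc: "y \<in> carrier R" using b(2) m.Icarr by blast
 define c where "c i = y \<otimes> v i" for i
 have tc: "tup n c" using v yc by (auto simp: tup_def c_def)
 have cm: "c i \<in> m" if "i < n" for i using ideal.I_r_closed[OF mi b(2)] tupD[OF v(1) that] by (simp add: c_def)
 have n01: "0 < n" "1 < n" using n2 by auto
 define r where "r = (\<Oplus>i\<in>{2..<n}. c i \<otimes> l i)"
 define w where "w = c 0 \<otimes> l 0 \<oplus> c 1 \<otimes> l 1"
 define g where "g i = (if i = 0 then a \<otimes> l 0 \<ominus> c 1 \<otimes> w else if i = 1 then a \<otimes> l 1 \<oplus> c 0 \<otimes> w else l i)" for i
 have car: "c 0 \<in> carrier R" "c 1 \<in> carrier R" "l 0 \<in> carrier R" "l 1 \<in> carrier R" using tupD tc tl n01 by auto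
 have rc: "r \<in> carrier R" unfolding r_def using tc tl by (intro finsum_closed) (auto simp: tup_def)
 have wm2: "w \<in> m \<cdot> m" unfolding w_def using ideal_add[OF m2 prod_mem prod_mem] cm l n01 by blast
 have wc: "w \<in> carrier R" using car by (simp add: w_def)
 have wm: "w \<in> m" using wm2 prod_subset[OF mi] by blast
 have g_m: "g i \<in> m" if "i < n" for i
  unfolding g_def using l that n01 ideal_minus[OF mi ideal_absorb[OF mi l a(1)] ideal_absorb[OF mi wm]]
   ideal_add[OF mi ideal_absorb[OF mi l a(1)] ideal_absorb[OF mi wm]] car by auto
 have tg: "tup n g" using g_m m.Icarr by (auto simp: tup_def)
 define I where "I = {lincomb n v g | v. tup n v}"
 have I: "ideal I R" unfolding I_def by (rule lincomb_set_ideal[OF tg])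
 have gI: "g i \<in> I" if "i < n" for i unfolding I_def by (rule lincomb_set_gen[OF tg that])
 have g0: "a \<otimes> l 0 \<ominus> c 1 \<otimes> w \<in> I" and g1: "a \<otimes> l 1 \<oplus> c 0 \<otimes> w \<in> I"
  using gI[OF n01(1)] gI[OF n01(2)] by (simp_all add: g_def)
 have lI: "l i \<in> I" if "2 \<le> i" "i < n" for i using gI[OF that(2)] that(1) by (simp add: g_def)
 have rI: "r \<in> I" unfolding r_def
  by (rule ideal_finsum[OF I]) (use lI tc in \<open>auto simp: tup_def intro: ideal_absorb[OF I]\<close>)
 have sum: "y \<otimes> y = w \<oplus> r"
 proof (rule ev_inject)
  show "y \<otimes> y \<in> carrier R" "w \<oplus> r \<in> carrier R" using yc wc rc by auto
  fix p assume p: "p \<in> Y"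
  have split: "(\<Sum>i<n. h i) = h 0 + h 1 + (\<Sum>i\<in>{2..<n}. h i)" for h :: "nat => complex"
  proof -
   have "{..<n} = {0, 1} \<union> {2..<n}" using n2 by auto
   hence "(\<Sum>i<n. h i) = (\<Sum>i\<in>{0, 1} \<union> {2..<n}. h i)" by simp
   also have "\<dots> = (\<Sum>i\<in>{0, 1}. h i) + (\<Sum>i\<in>{2..<n}. h i)" by (rule sum.union_disjoint) auto
   finally show ?thesis by simp
  qed
  have "ev (y \<otimes> y) p = ev y p * (\<Sum>i<n. ev (v i) p * ev (l i) p)"
   using ev_mult[OF yc yc p] ev_lincomb[OF v(1) tl p] v(2) by simp
  also have "\<dots> = (\<Sum>i<n. ev (c i) p * ev (l i) p)"
   unfolding sum_distrib_left using yc v(1) p by (intro sum.cong) (auto simp: c_def ev_mult tup_def)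
  also have "\<dots> = ev w p + ev r p" unfolding split w_def r_def using car p tc tl
   by (subst ev_finsum) (auto simp: ev_simps tup_def)
  also have "\<dots> = ev (w \<oplus> r) p" using wc rc p by (simp add: ev_add)
  finally show "ev (y \<otimes> y) p = ev (w \<oplus> r) p" .
 qed
 have one: "\<one> = a \<otimes> (b \<oplus> b \<otimes> y) \<oplus> w \<oplus> r"
 proof -
  have "a \<otimes> (b \<oplus> b \<otimes> y) \<oplus> y \<otimes> y = a \<otimes> b \<oplus> (a \<otimes> b \<oplus> y) \<otimes> y" using a(1) b(1) yc by algebra
  also have "\<dots> = \<one>" unfolding b(3)[symmetric] using b(3)[symmetric] yc by simp
  finally show ?thesis using sum a(1) b(1) yc wc rc by (simp add: a_assoc)
 qed
 define b' where "b' = b \<oplus> b \<otimes> y"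
 have b'c: "b' \<in> carrier R" using b yc by (simp add: b'_def)
 have aw: "a \<otimes> w \<in> I"
 proof -
  have "c 0 \<otimes> (a \<otimes> l 0 \<ominus> c 1 \<otimes> w) \<oplus> c 1 \<otimes> (a \<otimes> l 1 \<oplus> c 0 \<otimes> w) \<in> I"
   by (rule ideal_add[OF I ideal_absorb[OF I g0 car(1)] ideal_absorb[OF I g1 car(2)]])
  moreover have "c 0 \<otimes> (a \<otimes> l 0 \<ominus> c 1 \<otimes> w) \<oplus> c 1 \<otimes> (a \<otimes> l 1 \<oplus> c 0 \<otimes> w) = a \<otimes> w"
   unfolding w_def using car a(1) by algebra
  ultimately show ?thesis by simp
 qed
 have ww: "w \<otimes> w \<in> I"
 proof -
  have "l 0 \<otimes> (a \<otimes> l 1 \<oplus> c 0 \<otimes> w) \<ominus> l 1 \<otimes> (a \<otimes> l 0 \<ominus> c 1 \<otimes> w) \<in> I"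
   by (rule ideal_minus[OF I ideal_absorb[OF I g1 car(3)] ideal_absorb[OF I g0 car(4)]])
  moreover have "l 0 \<otimes> (a \<otimes> l 1 \<oplus> c 0 \<otimes> w) \<ominus> l 1 \<otimes> (a \<otimes> l 0 \<ominus> c 1 \<otimes> w) = w \<otimes> w"
   unfolding w_def using car a(1) by algebra
  ultimately show ?thesis by simp
 qed
 have aaI: "x \<in> I" if x: "x \<in> carrier R" and aax: "a \<otimes> (a \<otimes> x) \<in> I" for x
 proof -
  have T: "a \<otimes> b' \<oplus> w \<oplus> r = \<one>" using one[symmetric] by (simp only: b'_def)
  have "x = (a \<otimes> b' \<oplus> w \<oplus> r) \<otimes> (a \<otimes> b' \<oplus> w \<oplus> r) \<otimes> x" unfolding T using x by simp
  also have "\<dots> = ((b' \<otimes> b') \<otimes> (a \<otimes> (a \<otimes> x)) \<oplus> (b' \<otimes> x \<oplus> b' \<otimes> x) \<otimes> (a \<otimes> w))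
    \<oplus> (x \<otimes> (w \<otimes> w) \<oplus> (((a \<otimes> b' \<oplus> w) \<oplus> (a \<otimes> b' \<oplus> w) \<oplus> r) \<otimes> x) \<otimes> r)"
   using x a(1) b'c wc rc by algebra
  also have "\<dots> \<in> I" by (intro ideal_add[OF I] ideal_absorb[OF I] aax aw ww rI) (use x a(1) b'c wc rc in simp_all)
  finally show ?thesis .
 qed
 have l0: "l 0 \<in> I"
 proof (rule aaI[OF car(3)])
  have "a \<otimes> (a \<otimes> l 0 \<ominus> c 1 \<otimes> w) \<oplus> c 1 \<otimes> (a \<otimes> w) \<in> I"
   by (rule ideal_add[OF I ideal_absorb[OF I g0 a(1)] ideal_absorb[OF I aw car(2)]])
  moreover have "a \<otimes> (a \<otimes> l 0 \<ominus> c 1 \<otimes> w) \<oplus> c 1 \<otimes> (a \<otimes> w) = a \<otimes> (a \<otimes> l 0)"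
   using car a(1) wc by algebra
  ultimately show "a \<otimes> (a \<otimes> l 0) \<in> I" by simp
 qed
 have l1: "l 1 \<in> I"
 proof (rule aaI[OF car(4)])
  have "a \<otimes> (a \<otimes> l 1 \<oplus> c 0 \<otimes> w) \<ominus> c 0 \<otimes> (a \<otimes> w) \<in> I"
   by (rule ideal_minus[OF I ideal_absorb[OF I g1 a(1)] ideal_absorb[OF I aw car(1)]])
  moreover have "a \<otimes> (a \<otimes> l 1 \<oplus> c 0 \<otimes> w) \<ominus> c 0 \<otimes> (a \<otimes> w) = a \<otimes> (a \<otimes> l 1)"
   using car a(1) wc by algebra
  ultimately show "a \<otimes> (a \<otimes> l 1) \<in> I" by simp
 qed
 have l_all: "l i \<in> I" if "i < n" for i
 proof -
  consider "i = 0" | "i = 1" | "2 \<le> i" by linarith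
  thus ?thesis using l0 l1 lI that by cases auto
 qed
 show ?thesis
 proof (rule that[of g])
  show "g i \<in> m" if "i < n" for i by (rule g_m[OF that])
  show "\<exists>v. tup n v \<and> x = lincomb n v g" if x: "x \<in> m" for x
  proof -
   obtain u where u: "tup n u" "x = lincomb n u l" using gen[OF x] by blast
   have "x \<in> I" unfolding u(2) by (rule lincomb_in_ideal[OF I u(1) l_all])
   thus ?thesis unfolding I_def by blast
  qed
  show "g i \<ominus> (if i < 2 then a else \<one>) \<otimes> l i \<in> m \<cdot> m" if i: "i < n" for i
  proof -
   consider "i = 0" | "i = 1" | "2 \<le> i" by linarith
   thus ?thesis
   proof cases
    case 1
    have "\<ominus> c 1 \<otimes> w \<in> m \<cdot> m" using ideal_absorb[OF m2 wm2, of "\<ominus> c 1"] car by simp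
    moreover have "(a \<otimes> l 0 \<ominus> c 1 \<otimes> w) \<ominus> a \<otimes> l 0 = \<ominus> c 1 \<otimes> w" using car a(1) wc by algebra
    ultimately show ?thesis using 1 by (simp add: g_def)
   next
    case 2
    have "c 0 \<otimes> w \<in> m \<cdot> m" using ideal_absorb[OF m2 wm2, of "c 0"] car by simp
    moreover have "(a \<otimes> l 1 \<oplus> c 0 \<otimes> w) \<ominus> a \<otimes> l 1 = c 0 \<otimes> w" using car a(1) wc by algebra
    ultimately show ?thesis using 2 by (simp add: g_def)
   next
    case 3
    have "l i \<ominus> \<one> \<otimes> l i = \<zero>" using tupD[OF tl i] by algebra
    thus ?thesis using 3 ideal_zero[OF m2] by (simp add: g_def)
   qed
  qed
 qed
qed

lemma neg_diff: "x \<in> carrier R ==> y \<in> carrier R ==> \<ominus> \<one> \<otimes> (x \<ominus> y) = y \<ominus> x"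
 by algebra

lemma det_cong:
 assumes J: "ideal J R" and a: "matr n a" and b: "matr n b"
  and ab: "\<And>i j. i < n ==> j < n ==> a i j \<ominus> b i j \<in> J"
 shows "mat_det R n a \<ominus> mat_det R n b \<in> J"
proof -
 have "mat_det (R Quot J) n (%i j. J +> b i j) = J +> mat_det R n a"
 proof (rule quot_det[OF J a])
  fix i j assume ij: "i < n" "j < n"
  show "J +> b i j = J +> a i j" using quot_eq[OF J matrD[OF a ij] matrD[OF b ij]] ab[OF ij] by simp
 qed
 moreover have "mat_det (R Quot J) n (%i j. J +> b i j) = J +> mat_det R n b" by (rule quot_det[OF J b]) simp
 ultimately show ?thesis using quot_eq[OF J mat_det_closed[OF a] mat_det_closed[OF b]] by simp
qed

text \<open>Every local orientation of a maximal ideal is global: by the independence of the parameters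
  the transition matrix to a set of generators is invertible modulo \<open>m\<close>, and its determinant is a
  square there.\<close>

lemma point_orientation_global:
 assumes m: "maximalideal m R" and \<omega>: "\<omega> \<in> local_orientations R n m"
 shows "global_orientation R n m \<omega>"
proof -
 interpret m: maximalideal m R by fact
 note mi = m.is_ideal
 note m2 = prod_ideal[OF mi]
 obtain f where f: "gens n m f" "\<omega> = orient_rel R n m `` {orient_of n m f}"
  using \<omega> local_orientation_iff[OF mi] by blast
 have fm: "\<And>i. i < n ==> f i \<in> m" and tf: "tup n f" using f gens_tup[OF mi] by (auto simp: gens_def)
 obtain l where l: "\<And>i. i < n ==> l i \<in> m" "\<And>x. x \<in> m ==> \<exists>v. tup n v \<and> x = lincomb n v l"
  and indep: "\<And>v. tup n v ==> lincomb n v l \<in> m \<cdot> m ==> (\<forall>i<n. v i \<in> m)" using params[OF m] by metis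
 have tl: "tup n l" using l(1) ideal_subsetD[OF mi] by (auto simp: tup_def)
 have "\<forall>k. \<exists>v. k < n --> tup n v \<and> l k \<ominus> lincomb n v f \<in> m \<cdot> m"
  using f(1) l(1) unfolding gens_def by metis
 then obtain B where B: "\<And>k. k < n ==> tup n (B k) \<and> l k \<ominus> lincomb n (B k) f \<in> m \<cdot> m" by metis
 define b where "b i k = B k i" for i k
 have mb: "matr n b" using B by (auto simp: matr_def b_def tup_def)
 have lb: "l k \<ominus> row_mult n f b k \<in> m \<cdot> m" if "k < n" for k using B[OF that] by (simp add: row_mult_def b_def)
 have "\<forall>k. \<exists>v. k < n --> tup n v \<and> f k = lincomb n v l" using l(2) fm by metis
 then obtain A where A: "\<And>k. k < n ==> tup n (A k) \<and> f k = lincomb n (A k) l" by metis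
 define a where "a i k = A k i" for i k
 have ma: "matr n a" using A by (auto simp: matr_def a_def tup_def)
 have fa: "f k = row_mult n l a k" if "k < n" for k using A[OF that] by (simp add: row_mult_def a_def)
 note mab = mat_times_closed[OF ma mb]
 let ?id = "diag (%i. \<one>)"
 have ab_id: "mat_times n a b i k \<ominus> ?id i k \<in> m" if i: "i < n" and k: "k < n" for i k
 proof -
  have "row_mult n f b k = row_mult n (row_mult n l a) b k"
   unfolding row_mult_def[of n f] row_mult_def[of n "row_mult n l a"] lincomb_def
   by (rule finsum_cong') (use fa k mb tupD[OF row_mult_closed[OF ma tl]] in \<open>auto simp: matr_def\<close>)
  also have "\<dots> = row_mult n l (mat_times n a b) k" by (rule row_mult_assoc[OF ma mb tl k])
  finally have 1: "l k \<ominus> row_mult n l (mat_times n a b) k \<in> m \<cdot> m" using lb[OF k] by simp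
  have 2: "l k = lincomb n (%i. ?id i k) l" using row_mult_one[OF tl k] by (simp add: row_mult_def)
  have ti: "tup n (%i. ?id i k)" by (auto simp: tup_def diag_def)
  have tm: "tup n (%i. mat_times n a b i k)" by (rule tup_col[OF mab k])
  have td: "tup n (%i. ?id i k \<ominus> mat_times n a b i k)" using ti tm by (auto simp: tup_def)
  have "lincomb n (%i. ?id i k \<ominus> mat_times n a b i k) l \<in> m \<cdot> m"
   using 1 lincomb_diff_left[OF ti tm tl] 2 by (simp add: row_mult_def)
  hence "?id i k \<ominus> mat_times n a b i k \<in> m" using indep[OF td] i by blast
  hence "\<ominus> \<one> \<otimes> (?id i k \<ominus> mat_times n a b i k) \<in> m" by (rule ideal_absorb[OF mi]) simp
  moreover have "\<ominus> \<one> \<otimes> (?id i k \<ominus> mat_times n a b i k) = mat_times n a b i k \<ominus> ?id i k"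
   by (rule neg_diff[OF tupD[OF ti i] tupD[OF tm i]])
  ultimately show ?thesis by simp
 qed
 note dc = mat_det_closed[OF ma] mat_det_closed[OF mb]
 have dab: "mat_det R n a \<otimes> mat_det R n b \<ominus> \<one> \<in> m"
  using det_cong[OF mi mab matr_one ab_id] by (simp add: det_mat_times[OF ma mb] det_one)
 obtain s where s: "s \<in> carrier R" "mat_det R n a \<ominus> s \<otimes> s \<in> m" using sqrt[OF m dc(1)] by blast
 have ds: "mat_det R n b \<otimes> (s \<otimes> s) \<ominus> \<one> \<in> m"
 proof -
  have "(mat_det R n a \<otimes> mat_det R n b \<ominus> \<one>) \<ominus> mat_det R n b \<otimes> (mat_det R n a \<ominus> s \<otimes> s) \<in> m"
   by (rule ideal_minus[OF mi dab ideal_absorb[OF mi s(2) dc(2)]])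
  moreover have "(mat_det R n a \<otimes> mat_det R n b \<ominus> \<one>) \<ominus> mat_det R n b \<otimes> (mat_det R n a \<ominus> s \<otimes> s)
    = mat_det R n b \<otimes> (s \<otimes> s) \<ominus> \<one>" using dc s(1) by algebra
  ultimately show ?thesis by simp
 qed
 have sm: "s \<notin> m"
 proof
  assume "s \<in> m"
  hence "(mat_det R n b \<otimes> s) \<otimes> s \<in> m" by (rule ideal_absorb[OF mi]) (use dc s in simp)
  hence "(mat_det R n b \<otimes> s) \<otimes> s \<ominus> (mat_det R n b \<otimes> (s \<otimes> s) \<ominus> \<one>) \<in> m" by (rule ideal_minus[OF mi _ ds])
  moreover have "(mat_det R n b \<otimes> s) \<otimes> s \<ominus> (mat_det R n b \<otimes> (s \<otimes> s) \<ominus> \<one>) = \<one>" using dc(2) s(1) by algebra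
  ultimately show False using m.one_imp_carrier m.I_notcarr by simp
 qed
 obtain g where g: "\<And>i. i < n ==> g i \<in> m" "\<And>x. x \<in> m ==> \<exists>v. tup n v \<and> x = lincomb n v g"
  "\<And>i. i < n ==> g i \<ominus> (if i < 2 then s else \<one>) \<otimes> l i \<in> m \<cdot> m"
  using square_twist[OF m l s(1) sm] by blast
 have tg: "tup n g" using g(1) m.Icarr by (auto simp: tup_def)
 define d where "d i = (if i < 2 then s else \<one>)" for i :: nat
 have td: "tup n d" using s by (auto simp: tup_def d_def)
 have gg: "gens n m g" unfolding gens_def
 proof (intro conjI allI impI ballI)
  fix x assume x: "x \<in> m"
  then obtain v where v: "tup n v" "x = lincomb n v g" using g(2) by blast
  have "x \<ominus> lincomb n v g = \<zero>" using v m.Icarr[OF x] by (simp add: r_neg minus_eq)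
  thus "\<exists>v. tup n v \<and> x \<ominus> lincomb n v g \<in> m \<cdot> m" using v(1) ideal_zero[OF m2] by auto
 qed (use g in auto)
 note md = matr_diag[OF td]
 have "(orient_of n m f, orient_of n m g) \<in> orient_rel R n m"
 proof (rule orient_relI[OF mi mat_times_closed[OF mb md] _ f(1) gg])
  have "mat_det R n (diag d) = s \<otimes> s"
  proof -
   have "(\<Otimes>i\<in>{..<n}. d i) = (\<Otimes>i\<in>{0, 1}. d i)"
    by (rule finprod_mono_neutral_cong_right) (use n2 s in \<open>auto simp: d_def\<close>)
   also have "\<dots> = s \<otimes> s" using s by (simp add: d_def)
   finally show ?thesis by (simp add: det_diag[OF td])
  qed
  thus "mat_det R n (mat_times n b (diag d)) \<ominus> \<one> \<in> m" using ds by (simp add: det_mat_times[OF mb md])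
  fix i assume i: "i < n"
  note tfb = row_mult_closed[OF mb tf]
  note c = tupD[OF tg i] tupD[OF td i] tupD[OF tl i] tupD[OF tfb i]
  have e: "row_mult n f (mat_times n b (diag d)) i = d i \<otimes> row_mult n f b i"
   using row_mult_assoc[OF mb md tf i] row_mult_diag[OF td tfb i] by simp
  have "(g i \<ominus> d i \<otimes> l i) \<oplus> d i \<otimes> (l i \<ominus> row_mult n f b i) \<in> m \<cdot> m"
   using ideal_add[OF m2 g(3)[OF i] ideal_absorb[OF m2 lb[OF i] c(2)]] by (simp add: d_def)
  moreover have "(g i \<ominus> d i \<otimes> l i) \<oplus> d i \<otimes> (l i \<ominus> row_mult n f b i) = g i \<ominus> d i \<otimes> row_mult n f b i"
   using c by algebra
  ultimately show "g i \<ominus> row_mult n f (mat_times n b (diag d)) i \<in> m \<cdot> m" by (simp add: e)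
 qed
 hence mem: "orient_of n m g \<in> \<omega>" using f(2) by blast
 show ?thesis
 proof (rule global_orientation_of[where g = g, OF mi _ _ \<omega> mem])
  show "g i \<in> m" if "i < n" for i by (rule g(1)[OF that])
  show "\<exists>v. tup n v \<and> x = lincomb n v g" if "x \<in> m" for x by (rule g(2)[OF that])
 qed
qed

lemma maximal_primary: "maximalideal m R ==> primary_ideal m R"
 and maximal_radical: "maximalideal m R ==> ideal_radical R m = m"
proof -
 assume m: "maximalideal m R"
 have id: "ideal m R" by (rule maximalideal.axioms(1)[OF m])
 have pr: "primeideal m R" by (rule maximalideal_prime[OF m])
 show rad: "ideal_radical R m = m" using prime_radical_subset[OF pr order.refl] radical_superset[OF id] by blast
 show "primary_ideal m R" unfolding primary_ideal_def rad using id primeideal.I_notcarr[OF pr] primeideal.I_prime[OF pr] by blast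
qed

lemma point_in_rels:
 assumes m: "maximalideal m R" and \<omega>: "\<omega> \<in> local_orientations R n m"
 shows "frag_of (m, \<omega>) \<in> E_rels"
proof -
 have id: "ideal m R" by (rule maximalideal.axioms(1)[OF m])
 obtain f where f: "gens n m f" "\<omega> = orient_rel R n m `` {orient_of n m f}"
  using \<omega> local_orientation_iff[OF id] by blast
 have "induced_orientation R n m m \<omega> = \<omega>" unfolding f(2)
 proof (rule induced_class[OF id id order.refl _ f(1)])
  fix x assume x: "x \<in> m"
  hence "x \<ominus> x = \<zero>" using ideal_subsetD[OF id] by (simp add: minus_eq r_neg)
  thus "\<exists>y\<in>m. x \<ominus> y \<in> m \<cdot> m" using x ideal_zero[OF prod_ideal[OF id]] by force
 qed
 moreover have "irredundant_primary_decomposition R m {m}" unfolding irredundant_primary_decomposition_def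
  using maximal_primary[OF m] ideal_subsetD[OF id] maximalideal.I_notcarr[OF m] by auto
 ultimately have "\<exists>\<N>. frag_of (m, \<omega>) = (\<Sum>N\<in>\<N>. frag_of (N, induced_orientation R n m N \<omega>)) \<and>
   irredundant_primary_decomposition R m \<N>" by (intro exI[of _ "{m}"]) simp
 thus ?thesis unfolding euler_rels_def using id height[OF m] point_orientation_global[OF m \<omega>] by blast
qed

text \<open>The elements \<open>g\<close> that \<open>bertini\<close> yields generate \<open>J = N \<inter>
  \<Inter>\<M>\<close>, so they define a global orientation of \<open>J\<close> with component \<open>(N,
  \<omega>)\<close> at \<open>N\<close>. The other components are orientations of maximal ideals, hence relations
  themselves.\<close>

lemma gen_in_span:
 assumes gen: "(N, \<omega>) \<in> E_gens"
 shows "frag_of (N, \<omega>) \<in> generate (free_Abelian_group E_gens) E_rels"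
proof -
 let ?G = "free_Abelian_group E_gens" let ?H = "generate ?G E_rels"
 interpret G: comm_group ?G by (rule abelian_free_Abelian_group)
 have sub: "subgroup ?H ?G" by (rule G.generate_is_subgroup[OF rels_carrier])
 define m where "m = ideal_radical R N"
 have prim: "primary_ideal N R" and m: "maximalideal m R" and \<omega>: "\<omega> \<in> local_orientations R n N"
  using gen by (auto simp: euler_gens_def m_def)
 have N: "ideal N R" using prim by (simp add: primary_ideal_def)
 obtain f where f: "gens n N f" "\<omega> = orient_rel R n N `` {orient_of n N f}"
  using \<omega> local_orientation_iff[OF N] by blast
 obtain g \<M> where bert: "(\<forall>i<n. g i \<in> N \<and> g i \<ominus> f i \<in> N \<cdot> N) \<and> finite \<M> \<and>
     (\<forall>M\<in>\<M>. maximalideal M R) \<and> m \<notin> \<M> \<and>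
     (\<forall>x\<in>N. (\<forall>M\<in>\<M>. x \<in> M) --> (\<exists>v. tup n v \<and> x = lincomb n v g)) \<and>
     (\<forall>M\<in>\<M>. \<forall>i<n. g i \<in> M)" using bertini[OF N m m_def[symmetric] f(1)] by (elim exE)
 have g: "\<And>i. i < n ==> g i \<in> N" "\<And>i. i < n ==> g i \<ominus> f i \<in> N \<cdot> N" and fin: "finite \<M>"
  and max: "\<And>M. M \<in> \<M> ==> maximalideal M R" and mM: "m \<notin> \<M>"
  and span: "\<And>x. x \<in> N ==> (\<And>M. M \<in> \<M> ==> x \<in> M) ==> \<exists>v. tup n v \<and> x = lincomb n v g"
  and gM: "\<And>M i. M \<in> \<M> ==> i < n ==> g i \<in> M" using bert by simp_all
 have fN: "\<And>i. i < n ==> f i \<in> N" using f(1) by (auto simp: gens_def)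
 have tg: "tup n g" using g(1) ideal_subsetD[OF N] by (auto simp: tup_def)
 define I where "I = {lincomb n v g | v. tup n v}"
 have I: "ideal I R" unfolding I_def by (rule lincomb_set_ideal[OF tg])
 have gI: "g i \<in> I" if "i < n" for i unfolding I_def by (rule lincomb_set_gen[OF tg that])
 have idM: "ideal M R" if "M \<in> \<M>" for M by (rule maximalideal.axioms(1)[OF max[OF that]])
 define \<N> where "\<N> = insert N \<M>"
 have NM: "N \<notin> \<M>" using maximal_radical[OF max] mM by (metis m_def)
 have rad: "ideal_radical R N = m" "\<And>M. M \<in> \<M> ==> ideal_radical R M = M"
  using maximal_radical max by (auto simp: m_def)
 have int: "I = carrier R \<inter> \<Inter>\<N>"
 proof
  show "I \<subseteq> carrier R \<inter> \<Inter>\<N>"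
  proof
   fix x assume "x \<in> I"
   then obtain v where v: "tup n v" "x = lincomb n v g" unfolding I_def by blast
   have "x \<in> N" unfolding v(2) by (rule lincomb_in_ideal[OF N v(1) g(1)])
   moreover have "x \<in> M" if "M \<in> \<M>" for M unfolding v(2) by (rule lincomb_in_ideal[OF idM[OF that] v(1) gM[OF that]])
   ultimately show "x \<in> carrier R \<inter> \<Inter>\<N>" using ideal_subsetD[OF N] by (auto simp: \<N>_def)
  qed
  show "carrier R \<inter> \<Inter>\<N> \<subseteq> I" unfolding I_def \<N>_def using span by blast
 qed
 have finN: "finite \<N>" using fin by (simp add: \<N>_def)
 have idN: "ideal Q R" if "Q \<in> \<N>" for Q using that N idM by (auto simp: \<N>_def)
 have maxN: "maximalideal (ideal_radical R Q) R" if "Q \<in> \<N>" for Q using that m max rad by (auto simp: \<N>_def)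
 have inj: "inj_on (ideal_radical R) \<N>"
 proof (rule inj_onI)
  fix P Q assume "P \<in> \<N>" "Q \<in> \<N>" "ideal_radical R P = ideal_radical R Q"
  moreover have "ideal_radical R Q' = Q'" "Q' \<noteq> m" if "Q' \<in> \<N>" "Q' \<noteq> N" for Q'
   using that rad(2) mM by (auto simp: \<N>_def)
  ultimately show "P = Q" using rad(1) by (cases "P = N"; cases "Q = N") auto
 qed
 have hI: "ideal_height R I = enat n" by (rule height_of_components[OF int finN _ idN maxN]) (auto simp: \<N>_def)
 have dec: "irredundant_primary_decomposition R I \<N>" unfolding irredundant_primary_decomposition_def
 proof (intro conjI ballI)
  show "primary_ideal Q R" if "Q \<in> \<N>" for Q using that prim maximal_primary max by (auto simp: \<N>_def)
  show "carrier R \<inter> \<Inter>\<N> = I" using int by simp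
  fix Q assume Q: "Q \<in> \<N>"
  have prime: "primeideal (ideal_radical R Q) R" by (rule maximalideal_prime[OF maxN[OF Q]])
  have "\<not> Q' \<subseteq> ideal_radical R Q" if "Q' \<in> \<N> - {Q}" for Q'
  proof
   assume "Q' \<subseteq> ideal_radical R Q"
   hence "ideal_radical R Q' \<subseteq> ideal_radical R Q" by (rule prime_radical_subset[OF prime])
   hence "ideal_radical R Q' = ideal_radical R Q" using maximal_unique maxN Q that by blast
   thus False using inj that Q by (auto simp: inj_on_def)
  qed
  then obtain u where u: "u \<in> carrier R" "u \<notin> ideal_radical R Q" "\<forall>Q'\<in>\<N> - {Q}. u \<in> Q'"
   using prime_avoid_inter[OF prime, of "\<N> - {Q}"] finN idN by blast
  have "u \<notin> I" using u(2) int Q radical_superset[OF idN[OF Q]] by blast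
  thus "carrier R \<inter> \<Inter>(\<N> - {Q}) \<noteq> I" using u(1,3) by blast
 qed (use finN inj in auto)
 have gg: "gens n I g" unfolding gens_def
 proof (intro conjI allI impI ballI)
  fix x assume x: "x \<in> I"
  then obtain v where v: "tup n v" "x = lincomb n v g" unfolding I_def by blast
  have "x \<ominus> lincomb n v g = \<zero>" using v ideal_subsetD[OF I x] by (simp add: r_neg minus_eq)
  thus "\<exists>v. tup n v \<and> x \<ominus> lincomb n v g \<in> I \<cdot> I" using v(1) ideal_zero[OF prod_ideal[OF I]] by auto
 qed (use gI in auto)
 define \<theta> where "\<theta> = orient_rel R n I `` {orient_of n I g}"
 have \<theta>: "\<theta> \<in> local_orientations R n I" using local_orientation_iff[OF I] gg \<theta>_def by blast
 have "global_orientation R n I \<theta>" by (rule global_orientation_of[OF I gI _ \<theta>])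
   (use I_def orient_rel_refl[OF I gg] \<theta>_def in blast)+
 hence rel: "(\<Sum>Q\<in>\<N>. frag_of (Q, induced_orientation R n I Q \<theta>)) \<in> E_rels"
  unfolding euler_rels_def using I hI dec by blast
 have ind: "induced_orientation R n I Q \<theta> = orient_rel R n Q `` {orient_of n Q g}"
  and gQ: "gens n Q g" if Q: "Q \<in> \<N>" for Q
 proof -
  have IQ: "I \<subseteq> Q" using int Q by blast
  have ex: "\<exists>y\<in>I. x \<ominus> y \<in> Q \<cdot> Q" if "x \<in> Q" for x
   by (rule component_mod_square[OF int finN idN maxN inj Q that])
  show "induced_orientation R n I Q \<theta> = orient_rel R n Q `` {orient_of n Q g}"
   unfolding \<theta>_def by (rule induced_class[OF I idN[OF Q] IQ ex gg])
  show "gens n Q g" by (rule gens_extend[OF I idN[OF Q] IQ ex gg])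
 qed
 have N_in: "N \<in> \<N>" by (simp add: \<N>_def)
 have indN: "induced_orientation R n I N \<theta> = \<omega>" using ind[OF N_in] f(2) orient_of_cong[OF N g(1) fN g(2)] by simp
 have ptH: "frag_of (M, induced_orientation R n I M \<theta>) \<in> ?H" if M: "M \<in> \<M>" for M
 proof -
  have MN: "M \<in> \<N>" using M by (simp add: \<N>_def)
  have "induced_orientation R n I M \<theta> \<in> local_orientations R n M"
   using ind[OF MN] gQ[OF MN] local_orientation_iff[OF idM[OF M]] by blast
  from point_in_rels[OF max[OF M] this] show ?thesis by (rule generate.incl)
 qed
 have sumH: "(\<Sum>M\<in>\<M>. frag_of (M, induced_orientation R n I M \<theta>)) \<in> ?H" using fin ptH
 proof (induction \<M> rule: finite_induct)
  case empty
  thus ?case using subgroup.one_closed[OF sub] by simp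
 next
  case (insert M S)
  thus ?case using subgroup.m_closed[OF sub] by simp
 qed
 have "frag_of (N, \<omega>) + (\<Sum>M\<in>\<M>. frag_of (M, induced_orientation R n I M \<theta>)) \<in> ?H"
  using generate.incl[OF rel, of ?G] fin NM indN by (simp add: \<N>_def)
 from subgroup.m_closed[OF sub this subgroup.m_inv_closed[OF sub sumH]]
 show ?thesis using subgroup.subset[OF sub] sumH by (auto simp del: keys_sum)
qed

theorem euler_class_group_trivial: "trivial_group (euler_class_group R)"
 unfolding euler_class_group_def Let_def dim the_enat.simps
 by (rule trivial_free_quotient[OF rels_carrier]) (metis gen_in_span prod.exhaust)

end

section \<open>Real polynomial functions of complex variables\<close>

text \<open>The coefficients are real, the arguments complex: a maximal ideal of the ring is a pair of conjugate
  complex points.\<close>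

inductive rpoly :: "nat => nat => ((nat => complex) => complex) => bool" for k where
 const: "rpoly k d (%p. of_real r)"
| var: "i < k ==> d \<ge> 1 ==> rpoly k d (%p. p i)"
| add: "rpoly k d F ==> rpoly k d G ==> rpoly k d (%p. F p + G p)"
| mult: "rpoly k d F ==> rpoly k e G ==> d + e \<le> f ==> rpoly k f (%p. F p * G p)"

lemma rpoly_mono: "rpoly k d F ==> d \<le> e ==> k \<le> l ==> rpoly l e F"
proof (induction arbitrary: e rule: rpoly.induct)
 case (mult d F e' G f e)
 have "rpoly l d F" "rpoly l e' G" using mult.IH mult.prems by auto
 thus ?case by (rule rpoly.mult) (use mult in auto)
qed (auto intro: rpoly.intros)

lemma rpoly_0: "rpoly k d (%p. 0)" and rpoly_1: "rpoly k d (%p. 1)" using rpoly.const[of k d 0] rpoly.const[of k d 1] by simp_all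

lemma rpoly_scale: "rpoly k d F ==> rpoly k d (%p. of_real r * F p)" by (rule rpoly.mult[OF rpoly.const[where d = 0]]) auto

lemma rpoly_uminus: "rpoly k d F ==> rpoly k d (%p. - F p)" using rpoly_scale[of k d F "-1"] by simp

lemma rpoly_diff: "rpoly k d F ==> rpoly k d G ==> rpoly k d (%p. F p - G p)" using rpoly.add[OF _ rpoly_uminus] by fastforce

lemma rpoly_sum: "(\<And>i. i \<in> A ==> rpoly k d (F i)) ==> rpoly k d (%p. \<Sum>i\<in>A. F i p)"
 by (induction A rule: infinite_finite_induct) (auto intro: rpoly_0 rpoly.add)

lemma rpoly_power: "rpoly k d F ==> d * m \<le> e ==> rpoly k e (%p. F p ^ m)"
proof (induction m arbitrary: e)
 case 0 thus ?case by (simp add: rpoly_1)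
next
 case (Suc m)
 have "rpoly k (d * m) (%p. F p ^ m)" using Suc by simp
 from rpoly.mult[OF Suc.prems(1) this] show ?case using Suc.prems(2) by simp
qed

lemma rpoly_prod:
 "finite A ==> (\<And>i. i \<in> A ==> rpoly k (d i) (F i)) ==> (\<Sum>i\<in>A. d i) \<le> e ==> rpoly k e (%p. \<Prod>i\<in>A. F i p)"
proof (induction A arbitrary: e rule: finite_induct)
 case empty thus ?case by (simp add: rpoly_1)
next
 case (insert x A)
 have "rpoly k (\<Sum>i\<in>A. d i) (%p. \<Prod>i\<in>A. F i p)" using insert by simp
 from rpoly.mult[OF insert.prems(1)[of x] this] show ?case using insert by simp
qed

lemma rpoly_cong: "rpoly k d F ==> (\<And>i. i < k ==> p i = q i) ==> F p = F q" by (induction rule: rpoly.induct) auto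

lemma rpoly_cnj: "rpoly k d F ==> F (%i. cnj (p i)) = cnj (F p)" by (induction rule: rpoly.induct) auto

lemma rpoly_real: "rpoly k d F ==> (\<And>i. i < k ==> p i \<in> \<real>) ==> F p \<in> \<real>"
 by (induction rule: rpoly.induct) auto

lemma rpoly_comp:
 assumes "rpoly k d F" "\<And>i. i < k ==> rpoly l 1 (T i)"
 shows "rpoly l d (%p. F (%i. T i p))" using assms
proof (induction rule: rpoly.induct)
 case (var i d) thus ?case using rpoly_mono[of l 1 "T i" d l] by auto
next
 case (mult d F e G f) thus ?case using rpoly.mult by blast
qed (auto intro: rpoly.intros)

lemma rpoly_line:
 "rpoly k d F ==> \<exists>P::complex poly. \<forall>s. F (%i. u i + s * v i) = poly P s"
proof (induction rule: rpoly.induct)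
 case (const d r) thus ?case by (intro exI[of _ "[:of_real r:]"]) simp
next
 case (var i d) thus ?case by (intro exI[of _ "[:u i, v i:]"]) (simp add: mult.commute)
next
 case (add d F G)
 then obtain P Q where "\<forall>s. F (%i. u i + s * v i) = poly P s" "\<forall>s. G (%i. u i + s * v i) = poly Q s" by blast
 thus ?case by (intro exI[of _ "P + Q"]) simp
next
 case (mult d F e G f)
 then obtain P Q where "\<forall>s. F (%i. u i + s * v i) = poly P s" "\<forall>s. G (%i. u i + s * v i) = poly Q s" by blast
 thus ?case by (intro exI[of _ "P * Q"]) simp
qed

lemma rpoly_partial:
 "rpoly k d F ==> \<exists>F'. rpoly k d F' \<and>
   (\<forall>p. ((%s. F (p(j := p j + s))) has_field_derivative F' p) (at 0))"
proof (induction rule: rpoly.induct)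
 case (const d r) thus ?case by (intro exI[of _ "%p. 0"]) (auto intro: rpoly_0)
next
 case (var i d)
 show ?case
 proof (cases "i = j")
  case True
  show ?thesis by (intro exI[of _ "%p. 1"]) (auto simp: True intro!: rpoly_1 derivative_eq_intros)
 next
  case False
  thus ?thesis by (intro exI[of _ "%p. 0"]) (auto intro: rpoly_0)
 qed
next
 case (add d F G)
 then obtain F' G' where "rpoly k d F'" "rpoly k d G'"
  "\<And>p. ((%s. F (p(j := p j + s))) has_field_derivative F' p) (at 0)"
  "\<And>p. ((%s. G (p(j := p j + s))) has_field_derivative G' p) (at 0)" by blast
 thus ?case by (intro exI[of _ "%p. F' p + G' p"] conjI allI rpoly.add DERIV_add)
next
 case (mult d F e G f)
 then obtain F' G' where D: "rpoly k d F'" "rpoly k e G'"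
  "\<And>p. ((%s. F (p(j := p j + s))) has_field_derivative F' p) (at 0)"
  "\<And>p. ((%s. G (p(j := p j + s))) has_field_derivative G' p) (at 0)" by blast
 show ?case
 proof (intro exI conjI allI)
  show "rpoly k f (%p. F' p * G p + G' p * F p)"
   using rpoly.add[OF rpoly.mult[OF D(1) mult.hyps(2,3)] rpoly.mult[OF D(2) mult.hyps(1)]] mult.hyps(3) by (simp add: add.commute)
  show "((%s. F (p(j := p j + s)) * G (p(j := p j + s))) has_field_derivative F' p * G p + G' p * F p) (at 0)" for p
   using DERIV_mult[OF D(3,4), of p p] by simp
 qed
qed

lemma rpoly_at_0:
 "rpoly k d F ==> \<exists>F'. (\<forall>i<k. rpoly k d (F' i)) \<and> (\<forall>p. F p = F (%i. 0) + (\<Sum>i<k. p i * F' i p))"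
proof (induction rule: rpoly.induct)
 case (const d r) thus ?case by (intro exI[of _ "%i p. 0"]) (auto intro: rpoly_0)
next
 case (var i d)
 have "(\<Sum>j<k. p j * (if j = i then 1 else 0)) = p i" for p :: "nat => complex"
  using var by (simp add: if_distrib[of "(*) _"] cong: if_cong)
 thus ?case by (intro exI[of _ "%j p. if j = i then 1 else 0"]) (auto intro: rpoly_0 rpoly_1)
next
 case (add d F G)
 then obtain F' G' where D: "\<And>i. i < k ==> rpoly k d (F' i)" "\<And>p. F p = F (%i. 0) + (\<Sum>i<k. p i * F' i p)"
  "\<And>i. i < k ==> rpoly k d (G' i)" "\<And>p. G p = G (%i. 0) + (\<Sum>i<k. p i * G' i p)" by blast
 show ?case
 proof (intro exI conjI allI impI)
  show "rpoly k d (%p. F' i p + G' i p)" if "i < k" for i using rpoly.add[OF D(1)[OF that] D(3)[OF that]] .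
  show "F p + G p = F (%i. 0) + G (%i. 0) + (\<Sum>i<k. p i * (F' i p + G' i p))" for p
  proof -
   have "F p + G p = (F (%i. 0) + (\<Sum>i<k. p i * F' i p)) + (G (%i. 0) + (\<Sum>i<k. p i * G' i p))"
    by (rule arg_cong2[where f = "(+)", OF D(2) D(4)])
   thus ?thesis by (simp only: distrib_left sum.distrib add_ac)
  qed
 qed
next
 case (mult d F e G f)
 then obtain F' G' where D: "\<And>i. i < k ==> rpoly k d (F' i)" "\<And>p. F p = F (%i. 0) + (\<Sum>i<k. p i * F' i p)"
  "\<And>i. i < k ==> rpoly k e (G' i)" "\<And>p. G p = G (%i. 0) + (\<Sum>i<k. p i * G' i p)" by blast
 have "F (%i. 0) \<in> \<real>" by (rule rpoly_real[OF mult.hyps(1)]) simp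
 then obtain r where r: "F (%i. 0) = of_real r" by (auto elim: Reals_cases)
 show ?case
 proof (intro exI conjI allI impI)
  show "rpoly k f (%p. F' i p * G p + of_real r * G' i p)" if "i < k" for i
   by (intro rpoly.add) (rule rpoly.mult[OF D(1)[OF that]], use mult in simp, use mult in simp,
     rule rpoly_mono[OF rpoly_scale[OF D(3)[OF that]]], use mult in auto)
  show "F p * G p = F (%i. 0) * G (%i. 0) + (\<Sum>i<k. p i * (F' i p * G p + of_real r * G' i p))" for p
  proof -
   have "(\<Sum>i<k. p i * (F' i p * G p + of_real r * G' i p))
     = (\<Sum>i<k. p i * F' i p) * G p + of_real r * (\<Sum>i<k. p i * G' i p)"
    by (simp add: algebra_simps sum.distrib sum_distrib_left sum_distrib_right)
   also have "(\<Sum>i<k. p i * F' i p) = F p - of_real r" using D(2)[of p] r by simp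
   also have "(\<Sum>i<k. p i * G' i p) = G p - G (%i. 0)" using D(4)[of p] by (simp add: algebra_simps)
   finally show ?thesis using r by (simp add: algebra_simps)
  qed
 qed
qed

text \<open>On the line through \<open>Re p\<close> in direction \<open>Im p\<close> the function is a polynomial in
  one variable with infinitely many roots.\<close>

lemma rpoly_vanish_real:
 assumes F: "rpoly k d F" and z: "\<And>p. (\<And>i. p i \<in> \<real>) ==> F p = 0"
 shows "F p = 0"
proof -
 let ?u = "%i. complex_of_real (Re (p i))" let ?v = "%i. complex_of_real (Im (p i))"
 obtain P where P: "\<And>s. F (%i. ?u i + s * ?v i) = poly P s" using rpoly_line[OF F, of ?u ?v] by blast
 have "poly P (of_real s) = 0" for s :: real unfolding P[symmetric] by (rule z) auto
 hence "range complex_of_real \<subseteq> {s. poly P s = 0}" by auto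
 moreover have "infinite (range complex_of_real)" using infinite_UNIV_char_0 by (simp add: finite_image_iff inj_on_def)
 ultimately have "P = 0" using poly_roots_finite finite_subset by blast
 moreover have "p = (%i. ?u i + \<i> * ?v i)" by (auto simp: complex_eq_iff)
 ultimately show ?thesis using P[of \<i>] by simp
qed

section \<open>Monomials\<close>

definition monom_val :: "nat => (nat => nat) => (nat => complex) => complex" where
 "monom_val n \<alpha> p = (\<Prod>i<n. p i ^ \<alpha> i)"

definition exps :: "nat => nat => (nat => nat) set" where
 "exps n d = {\<alpha> \<in> {..<n} \<rightarrow>\<^sub>E UNIV. (\<Sum>i<n. \<alpha> i) \<le> d}"

definition expbox :: "nat => nat => (nat => nat) set" where
 "expbox n D = {..<n} \<rightarrow>\<^sub>E {..<D}"

lemma finite_box: "finite (expbox n D)" and card_box: "card (expbox n D) = D ^ n"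
 by (simp_all add: expbox_def finite_PiE card_PiE)

lemma exps_subset_box: "exps n d \<subseteq> expbox n (Suc d)"
proof
 fix \<alpha> assume a: "\<alpha> \<in> exps n d"
 have "\<alpha> i \<le> d" if "i < n" for i using a member_le_sum[of i "{..<n}" \<alpha>] that by (auto simp: exps_def)
 thus "\<alpha> \<in> expbox n (Suc d)" using a by (auto simp: exps_def expbox_def PiE_def Pi_def less_Suc_eq_le)
qed

lemma finite_exps: "finite (exps n d)" by (rule finite_subset[OF exps_subset_box finite_box])

lemma card_exps: "card (exps n d) \<le> Suc d ^ n" using card_mono[OF finite_box exps_subset_box, of n d] by (simp add: card_box)

lemma rpoly_monom: "(\<Sum>i<n. \<alpha> i) \<le> d ==> n \<le> k ==> rpoly k d (monom_val n \<alpha>)" unfolding monom_val_def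
 by (rule rpoly_prod[where d = \<alpha>]) (auto intro!: rpoly_power[where d = 1] rpoly.var)

lemma rpoly_expand:
 "rpoly n d F ==> \<exists>c::(nat => nat) => real. \<forall>p. F p = (\<Sum>\<alpha>\<in>exps n d. of_real (c \<alpha>) * monom_val n \<alpha> p)"
proof (induction rule: rpoly.induct)
 case (const d r)
 let ?z = "restrict (%i. 0) {..<n} :: nat => nat"
 have z: "?z \<in> exps n d" by (simp add: exps_def)
 have "monom_val n ?z p = 1" for p by (simp add: monom_val_def)
 hence "(\<Sum>\<alpha>\<in>exps n d. of_real (if \<alpha> = ?z then r else 0) * monom_val n \<alpha> p) = complex_of_real r" for p
  using z finite_exps by (subst sum.remove[OF finite_exps z]) (auto intro!: sum.neutral)
 thus ?case by (intro exI[of _ "%\<alpha>. if \<alpha> = ?z then r else 0"]) simp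
next
 case (var i d)
 let ?e = "restrict (%j. if j = i then 1 else 0) {..<n} :: nat => nat"
 have e: "?e \<in> exps n d" using var by (simp add: exps_def)
 have "monom_val n ?e p = p i" for p
 proof -
  have "monom_val n ?e p = (\<Prod>j<n. if j = i then p i else 1)" unfolding monom_val_def by (rule prod.cong) auto
  thus ?thesis using var by simp
 qed
 hence "(\<Sum>\<alpha>\<in>exps n d. of_real (if \<alpha> = ?e then 1 else 0) * monom_val n \<alpha> p) = p i" for p
  using e finite_exps by (subst sum.remove[OF finite_exps e]) (auto intro!: sum.neutral)
 thus ?case by (intro exI[of _ "%\<alpha>. if \<alpha> = ?e then 1 else 0"]) simp
next
 case (add d F G)
 then obtain c c' where "\<forall>p. F p = (\<Sum>\<alpha>\<in>exps n d. of_real (c \<alpha>) * monom_val n \<alpha> p)"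
  "\<forall>p. G p = (\<Sum>\<alpha>\<in>exps n d. of_real (c' \<alpha>) * monom_val n \<alpha> p)" by blast
 thus ?case by (intro exI[of _ "%\<alpha>. c \<alpha> + c' \<alpha>"]) (simp add: algebra_simps sum.distrib)
next
 case (mult d F e G f)
 then obtain c c' where F: "\<forall>p. F p = (\<Sum>\<alpha>\<in>exps n d. of_real (c \<alpha>) * monom_val n \<alpha> p)"
  and G: "\<forall>p. G p = (\<Sum>\<alpha>\<in>exps n e. of_real (c' \<alpha>) * monom_val n \<alpha> p)" by blast
 let ?S = "exps n d \<times> exps n e"
 let ?g = "%(\<alpha>, \<beta>). restrict (%i. \<alpha> i + \<beta> i) {..<n}"
 have im: "?g ` ?S \<subseteq> exps n f"
 proof
  fix \<gamma> assume "\<gamma> \<in> ?g ` ?S"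
  then obtain \<alpha> \<beta> where ab: "\<alpha> \<in> exps n d" "\<beta> \<in> exps n e" "\<gamma> = restrict (%i. \<alpha> i + \<beta> i) {..<n}" by auto
  have "(\<Sum>i<n. \<gamma> i) = (\<Sum>i<n. \<alpha> i) + (\<Sum>i<n. \<beta> i)" unfolding ab(3) by (simp add: sum.distrib)
  also have "\<dots> \<le> f" using ab(1,2) mult.hyps(3) by (simp add: exps_def)
  finally show "\<gamma> \<in> exps n f" using ab(3) by (simp add: exps_def)
 qed
 have mon: "monom_val n \<alpha> p * monom_val n \<beta> p = monom_val n (restrict (%i. \<alpha> i + \<beta> i) {..<n}) p" for \<alpha> \<beta> p
  by (simp add: monom_val_def power_add prod.distrib)
 have "F p * G p = (\<Sum>\<gamma>\<in>exps n f. of_real (\<Sum>x | x \<in> ?S \<and> ?g x = \<gamma>. c (fst x) * c' (snd x)) * monom_val n \<gamma> p)" for p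
 proof -
  have "F p * G p = (\<Sum>x\<in>?S. of_real (c (fst x) * c' (snd x)) * monom_val n (?g x) p)"
   unfolding F[rule_format] G[rule_format] sum_product sum.cartesian_product by (rule sum.cong) (auto simp: mon[symmetric])
  also have "\<dots> = (\<Sum>\<gamma>\<in>exps n f. \<Sum>x | x \<in> ?S \<and> ?g x = \<gamma>. of_real (c (fst x) * c' (snd x)) * monom_val n (?g x) p)"
   by (rule sum.group[symmetric]) (use im finite_exps in auto)
  also have "\<dots> = (\<Sum>\<gamma>\<in>exps n f. of_real (\<Sum>x | x \<in> ?S \<and> ?g x = \<gamma>. c (fst x) * c' (snd x)) * monom_val n \<gamma> p)"
   by (intro sum.cong refl) (simp add: sum_distrib_right)
  finally show ?thesis .
 qed
 thus ?case by (intro exI[of _ "%\<gamma>. \<Sum>x | x \<in> ?S \<and> ?g x = \<gamma>. c (fst x) * c' (snd x)"] allI)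
qed

lemma box_sum:
 "(\<Sum>\<alpha>\<in>expbox (Suc k) D. F \<alpha>) = (\<Sum>e<D. \<Sum>\<beta>\<in>expbox k D. F (\<beta>(k := e)))"
proof -
 have "expbox (Suc k) D = (%(e, \<beta>). \<beta>(k := e)) ` ({..<D} \<times> expbox k D)"
  unfolding expbox_def lessThan_Suc by (rule PiE_insert_eq)
 moreover have "inj_on (%(e, \<beta>). \<beta>(k := e)) ({..<D} \<times> expbox k D)"
  unfolding expbox_def by (rule inj_combinator) simp
 ultimately have "(\<Sum>\<alpha>\<in>expbox (Suc k) D. F \<alpha>) = (\<Sum>x\<in>{..<D} \<times> expbox k D. F ((%(e, \<beta>). \<beta>(k := e)) x))"
  by (simp add: sum.reindex)
 thus ?thesis by (simp add: sum.cartesian_product case_prod_unfold)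
qed

lemma box_split:
 assumes "\<alpha> \<in> expbox (Suc k) D"
 obtains \<beta> e where "\<beta> \<in> expbox k D" "e < D" "\<alpha> = \<beta>(k := e)"
proof -
 have "expbox (Suc k) D = (%(e, \<beta>). \<beta>(k := e)) ` ({..<D} \<times> expbox k D)"
  unfolding expbox_def lessThan_Suc by (rule PiE_insert_eq)
 thus ?thesis using assms that by auto
qed

text \<open>Induction on the number of variables. Bounding every exponent separately lets the coefficients with
  respect to the last variable be polynomials of the same shape.\<close>

lemma poly_function_nonzero:
 assumes "\<And>s::nat => real. (\<Sum>\<alpha>\<in>expbox k D. c \<alpha> * (\<Prod>i<k. s i ^ \<alpha> i)) = 0"
 shows "\<forall>\<alpha>\<in>expbox k D. c \<alpha> = (0::real)" using assms
proof (induction k arbitrary: c)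
 case 0
 have "expbox 0 D = {%x. undefined}" by (simp add: expbox_def)
 thus ?case using 0 by simp
next
 case (Suc k)
 have "\<forall>\<beta>\<in>expbox k D. c (\<beta>(k := e)) = 0" if e: "e < D" for e
 proof (rule Suc.IH)
  fix s :: "nat => real"
  define q where "q e = (\<Sum>\<beta>\<in>expbox k D. c (\<beta>(k := e)) * (\<Prod>i<k. s i ^ \<beta> i))" for e
  have "(\<Sum>e<D. q e * x ^ e) = 0" for x
  proof -
   have "(\<Sum>\<alpha>\<in>expbox (Suc k) D. c \<alpha> * (\<Prod>i<Suc k. (s(k := x)) i ^ \<alpha> i)) = (\<Sum>e<D. q e * x ^ e)"
    unfolding box_sum q_def by (simp add: sum_distrib_right mult.assoc)
   thus ?thesis using Suc.prems[of "s(k := x)"] by (rule trans[OF sym])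
  qed
  hence "poly (\<Sum>e<D. monom (q e) e) x = 0" for x by (simp add: poly_sum poly_monom)
  hence "(\<Sum>e<D. monom (q e) e) = 0" using poly_all_0_iff_0 by blast
  hence "coeff (\<Sum>e<D. monom (q e) e) e = 0" by simp
  thus "q e = 0" using e by (simp add: coeff_sum)
 qed
 thus ?case by (auto elim!: box_split)
qed

section \<open>Linear dependence by counting\<close>

lemma lin_dep:
 fixes a :: "'i => 'e => real"
 assumes "finite E" "finite I" "card E < card I"
 shows "\<exists>c. (\<exists>i\<in>I. c i \<noteq> 0) \<and> (\<forall>e\<in>E. (\<Sum>i\<in>I. c i * a i e) = 0)" using assms
proof (induction E arbitrary: I a rule: finite_induct)
 case empty
 then obtain i where "i \<in> I" by fastforce
 thus ?case by (intro exI[of _ "%_. 1"]) auto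
next
 case (insert e E)
 show ?case
 proof (cases "\<forall>i\<in>I. a i e = 0")
  case True
  obtain c where "\<exists>i\<in>I. c i \<noteq> 0" "\<forall>e\<in>E. (\<Sum>i\<in>I. c i * a i e) = 0"
   using insert.IH[where I = I and a = a] insert.prems insert.hyps by auto
  thus ?thesis using True by (intro exI[of _ c]) auto
 next
  case False
  then obtain j where j: "j \<in> I" "a j e \<noteq> 0" by auto
  let ?I = "I - {j}" let ?a = "%i e'. a i e' - a i e / a j e * a j e'"
  have "card E < card ?I" using insert j by simp
  then obtain c where c: "\<exists>i\<in>?I. c i \<noteq> 0" "\<forall>e'\<in>E. (\<Sum>i\<in>?I. c i * ?a i e') = 0"
   using insert.IH[where I = ?I and a = ?a] insert.prems by auto
  define c' where "c' i = (if i = j then - (\<Sum>i\<in>?I. c i * a i e) / a j e else c i)" for i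
  have "(\<Sum>i\<in>I. c' i * a i e') = (\<Sum>i\<in>?I. c i * ?a i e')" for e'
  proof -
   have "(\<Sum>i\<in>I. c' i * a i e') = c' j * a j e' + (\<Sum>i\<in>?I. c i * a i e')"
    using insert.prems(1) j by (subst sum.remove[of I j]) (auto simp: c'_def intro!: sum.cong)
   also have "\<dots> = (\<Sum>i\<in>?I. c i * ?a i e')"
    by (simp add: c'_def algebra_simps sum_subtractf sum_distrib_left sum_distrib_right sum_divide_distrib)
   finally show ?thesis .
  qed
  hence "(\<Sum>i\<in>I. c' i * a i e') = 0" if "e' \<in> insert e E" for e' using c(2) j that by auto
  moreover have "\<exists>i\<in>I. c' i \<noteq> 0" using c(1) by (auto simp: c'_def)
  ultimately show ?thesis by blast
 qed
qed

section \<open>Functions represented in a ring or an ideal\<close>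

context function_ring
begin

definition repr :: "('p => complex) => bool" where
 "repr F \<longleftrightarrow> (\<exists>a\<in>carrier R. \<forall>p\<in>Y. ev a p = F p)"

text \<open>The ring is often known only through functions such as polynomials in the coordinates; this is membership
  of the element that such a function represents.\<close>

definition mem :: "'a set => ('p => complex) => bool" where
 "mem I F \<longleftrightarrow> (\<exists>a\<in>I. \<forall>p\<in>Y. ev a p = F p)"

lemma repr_ev: "a \<in> carrier R ==> repr (ev a)" by (auto simp: repr_def)

lemma repr_0: "repr (%p. 0)" unfolding repr_def by (rule bexI[of _ \<zero>]) (simp_all add: ev_zero)

lemma repr_1: "repr (%p. 1)" unfolding repr_def by (rule bexI[of _ \<one>]) (simp_all add: ev_one)

lemma repr_add:
 assumes F: "repr F" and G: "repr G" shows "repr (%p. F p + G p)"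
proof -
 obtain a where a: "a \<in> carrier R" "\<forall>p\<in>Y. ev a p = F p" using F unfolding repr_def by blast
 obtain b where b: "b \<in> carrier R" "\<forall>p\<in>Y. ev b p = G p" using G unfolding repr_def by blast
 show ?thesis unfolding repr_def by (rule bexI[of _ "a \<oplus> b"]) (use a b in \<open>simp_all add: ev_add\<close>)
qed

lemma repr_diff:
 assumes F: "repr F" and G: "repr G" shows "repr (%p. F p - G p)"
proof -
 obtain a where a: "a \<in> carrier R" "\<forall>p\<in>Y. ev a p = F p" using F unfolding repr_def by blast
 obtain b where b: "b \<in> carrier R" "\<forall>p\<in>Y. ev b p = G p" using G unfolding repr_def by blast
 show ?thesis unfolding repr_def by (rule bexI[of _ "a \<ominus> b"]) (use a b in \<open>simp_all add: ev_minus\<close>)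
qed

lemma repr_mult:
 assumes F: "repr F" and G: "repr G" shows "repr (%p. F p * G p)"
proof -
 obtain a where a: "a \<in> carrier R" "\<forall>p\<in>Y. ev a p = F p" using F unfolding repr_def by blast
 obtain b where b: "b \<in> carrier R" "\<forall>p\<in>Y. ev b p = G p" using G unfolding repr_def by blast
 show ?thesis unfolding repr_def by (rule bexI[of _ "a \<otimes> b"]) (use a b in \<open>simp_all add: ev_mult\<close>)
qed

lemma repr_power: "repr F ==> repr (%p. F p ^ k)" by (induction k) (simp_all add: repr_1 repr_mult)

lemma repr_sum: "(\<And>i. i \<in> A ==> repr (F i)) ==> repr (%p. \<Sum>i\<in>A. F i p)"
 by (induction A rule: infinite_finite_induct) (simp_all add: repr_0 repr_add)

lemma repr_prod: "(\<And>i. i \<in> A ==> repr (F i)) ==> repr (%p. \<Prod>i\<in>A. F i p)"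
 by (induction A rule: infinite_finite_induct) (simp_all add: repr_1 repr_mult)

lemma mem_cong: "mem I F ==> (\<And>p. p \<in> Y ==> F p = G p) ==> mem I G" unfolding mem_def by auto

lemma mem_repr: "ideal I R ==> mem I F ==> repr F" unfolding mem_def repr_def using ideal_subsetD by blast

lemma mem_mono: "I \<subseteq> J ==> mem I F ==> mem J F" unfolding mem_def by blast

lemma mem_ev: "ideal I R ==> a \<in> carrier R ==> mem I (ev a) \<longleftrightarrow> a \<in> I"
 unfolding mem_def using ev_inject ideal_subsetD by metis

lemma mem_0: "ideal I R ==> mem I (%p. 0)" unfolding mem_def by (rule bexI[of _ \<zero>]) (simp_all add: ev_zero ideal_zero)

lemma mem_add:
 assumes I: "ideal I R" and F: "mem I F" and G: "mem I G"
 shows "mem I (%p. F p + G p)"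
proof -
 obtain a where a: "a \<in> I" "\<forall>p\<in>Y. ev a p = F p" using F unfolding mem_def by blast
 obtain b where b: "b \<in> I" "\<forall>p\<in>Y. ev b p = G p" using G unfolding mem_def by blast
 have c: "a \<in> carrier R" "b \<in> carrier R" using a b ideal_subsetD[OF I] by blast+
 show ?thesis unfolding mem_def by (rule bexI[OF _ ideal_add[OF I a(1) b(1)]]) (use a b c in \<open>simp add: ev_add\<close>)
qed

lemma mem_diff:
 assumes I: "ideal I R" and F: "mem I F" and G: "mem I G"
 shows "mem I (%p. F p - G p)"
proof -
 obtain a where a: "a \<in> I" "\<forall>p\<in>Y. ev a p = F p" using F unfolding mem_def by blast
 obtain b where b: "b \<in> I" "\<forall>p\<in>Y. ev b p = G p" using G unfolding mem_def by blast
 have c: "a \<in> carrier R" "b \<in> carrier R" using a b ideal_subsetD[OF I] by blast+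
 show ?thesis unfolding mem_def by (rule bexI[OF _ ideal_minus[OF I a(1) b(1)]]) (use a b c in \<open>simp add: ev_minus\<close>)
qed

lemma mem_mult:
 assumes I: "ideal I R" and F: "mem I F" and G: "repr G"
 shows "mem I (%p. G p * F p)"
proof -
 obtain a where a: "a \<in> I" "\<forall>p\<in>Y. ev a p = F p" using F unfolding mem_def by blast
 obtain b where b: "b \<in> carrier R" "\<forall>p\<in>Y. ev b p = G p" using G unfolding repr_def by blast
 have c: "a \<in> carrier R" "b \<in> carrier R" using a b ideal_subsetD[OF I] by blast+
 show ?thesis unfolding mem_def by (rule bexI[OF _ ideal_absorb[OF I a(1) b(1)]]) (use a b c in \<open>simp add: ev_mult\<close>)
qed

lemma mem_sum: "ideal I R ==> (\<And>i. i \<in> A ==> mem I (F i)) ==> mem I (%p. \<Sum>i\<in>A. F i p)"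
 by (induction A rule: infinite_finite_induct) (simp_all add: mem_0 mem_add)

lemma mem_one: "ideal I R ==> mem I (%p. 1) ==> I = carrier R"
 using mem_ev[of I \<one>] mem_cong[of I "%p. 1" "ev \<one>"] ideal_one[of I] by (simp add: ev_one)

lemma mem_prime:
 assumes P: "primeideal P R" and FG: "mem P (%p. F p * G p)" and F: "repr F" and G: "repr G"
 shows "mem P F \<or> mem P G"
proof -
 have id: "ideal P R" by (rule primeideal.axioms(1)[OF P])
 obtain a where a: "a \<in> carrier R" "\<And>p. p \<in> Y ==> ev a p = F p" using F by (auto simp: repr_def)
 obtain b where b: "b \<in> carrier R" "\<And>p. p \<in> Y ==> ev b p = G p" using G by (auto simp: repr_def)
 have "mem P (ev (a \<otimes> b))" by (rule mem_cong[OF FG]) (simp add: a b ev_mult)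
 hence "a \<otimes> b \<in> P" using mem_ev[OF id] a b by simp
 hence "a \<in> P \<or> b \<in> P" by (rule primeideal.I_prime[OF P a(1) b(1)])
 thus ?thesis unfolding mem_def using a b by blast
qed

lemma mem_prime_power:
 assumes P: "primeideal P R" and F: "repr F" and m: "mem P (%p. F p ^ k)"
 shows "mem P F" using m
proof (induction k)
 case 0
 hence "P = carrier R" using mem_one[OF primeideal.axioms(1)[OF P]] by simp
 thus ?case using primeideal.I_notcarr[OF P] by simp
next
 case (Suc k)
 thus ?case using mem_prime[OF P, of F "%p. F p ^ k"] F repr_power[OF F, of k] by auto
qed

text \<open>Elements picked from the successive differences of a descending chain of primes satisfy no
  polynomial relation modulo the last prime: divide by the highest possible power of the last
  element and pass to the next prime of the chain.\<close>

lemma chain_independent: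
 assumes scalar: "\<And>r::real. repr (%p. of_real r)"
  and Q: "\<And>i. i \<le> k ==> primeideal (Q i) R" "\<And>i. i < k ==> Q (Suc i) \<subseteq> Q i"
  and G: "\<And>i. i < k ==> repr (G i)" "\<And>i. i < k ==> mem (Q i) (G i)" "\<And>i. i < k ==> \<not> mem (Q (Suc i)) (G i)"
  and rel: "mem (Q k) (%p. \<Sum>\<alpha>\<in>expbox k D. of_real (c \<alpha>) * (\<Prod>i<k. G i p ^ \<alpha> i))"
 shows "\<forall>\<alpha>\<in>expbox k D. c \<alpha> = 0" using Q G rel
proof (induction k arbitrary: c)
 case 0
 have b: "expbox 0 D = {%x. undefined}" by (simp add: expbox_def)
 have P: "primeideal (Q 0) R" using 0(1) by simp
 have id: "ideal (Q 0) R" by (rule primeideal.axioms(1)[OF P])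
 let ?r = "c (%x. undefined)"
 have m: "mem (Q 0) (%p. of_real ?r)" using 0(6) by (simp add: b)
 have "?r = 0"
 proof (rule ccontr)
  assume "?r \<noteq> 0"
  hence "mem (Q 0) (%p. 1)" using mem_mult[OF id m scalar[of "1 / ?r"]] by (simp flip: of_real_mult)
  thus False using mem_one[OF id] primeideal.I_notcarr[OF P] by simp
 qed
 thus ?case by (simp add: b)
next
 case (Suc k)
 define S where "S e p = (\<Sum>\<beta>\<in>expbox k D. of_real (c (\<beta>(k := e))) * (\<Prod>i<k. G i p ^ \<beta> i))" for e p
 have total: "(\<Sum>\<alpha>\<in>expbox (Suc k) D. of_real (c \<alpha>) * (\<Prod>i<Suc k. G i p ^ \<alpha> i)) = (\<Sum>e<D. S e p * G k p ^ e)" for p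
  unfolding box_sum S_def by (simp add: sum_distrib_right mult.assoc)
 have rel: "mem (Q (Suc k)) (%p. \<Sum>e<D. S e p * G k p ^ e)" using Suc.prems(6) unfolding total .
 have P: "primeideal (Q (Suc k)) R" "primeideal (Q k) R" using Suc.prems(1) by auto
 note id = primeideal.axioms(1)[OF P(1)] primeideal.axioms(1)[OF P(2)]
 have G_repr: "repr (G i)" if "i < Suc k" for i using Suc.prems(3)[OF that] .
 have S_repr: "repr (S e)" for e unfolding S_def by (intro repr_sum repr_mult scalar repr_prod repr_power) (simp add: G_repr)
 have "\<forall>\<beta>\<in>expbox k D. c (\<beta>(k := e)) = 0" if "e < D" for e using that
 proof (induction e rule: less_induct)
  case (less e)
  have z: "S e' p = 0" if "e' < e" for e' p unfolding S_def
  proof (rule sum.neutral, rule ballI)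
   fix \<beta> assume "\<beta> \<in> expbox k D"
   hence "c (\<beta>(k := e')) = 0" using less.IH[OF that] that less.prems less_trans by blast
   thus "of_real (c (\<beta>(k := e'))) * (\<Prod>i<k. G i p ^ \<beta> i) = 0" by (simp only: of_real_0 mult_zero_left)
  qed
  let ?U = "%p. \<Sum>e'\<in>{Suc e..<D}. S e' p * G k p ^ (e' - Suc e)"
  have "(\<Sum>e<D. S e p * G k p ^ e) = G k p ^ e * (S e p + G k p * ?U p)" for p
  proof -
   have e: "{e..<D} = insert e {Suc e..<D}" using less.prems by auto
   have "(\<Sum>e<D. S e p * G k p ^ e) = (\<Sum>e'\<in>{..<e}. S e' p * G k p ^ e') + (\<Sum>e'\<in>insert e {Suc e..<D}. S e' p * G k p ^ e')"
    using sum.atLeastLessThan_concat[of 0 e D "%e'. S e' p * G k p ^ e'"] less.prems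
    unfolding e[symmetric] by (simp add: lessThan_atLeast0)
   also have "(\<Sum>e'\<in>{..<e}. S e' p * G k p ^ e') = 0" using z by simp
   also have "(\<Sum>e'\<in>insert e {Suc e..<D}. S e' p * G k p ^ e')
    = S e p * G k p ^ e + (\<Sum>e'\<in>{Suc e..<D}. S e' p * G k p ^ e')" by simp
   also have "(\<Sum>e'\<in>{Suc e..<D}. S e' p * G k p ^ e') = G k p ^ Suc e * ?U p" unfolding sum_distrib_left
   proof (rule sum.cong[OF refl])
    fix e' assume "e' \<in> {Suc e..<D}"
    hence "Suc e + (e' - Suc e) = e'" by auto
    hence "G k p ^ e' = G k p ^ Suc e * G k p ^ (e' - Suc e)" by (metis power_add)
    thus "S e' p * G k p ^ e' = G k p ^ Suc e * (S e' p * G k p ^ (e' - Suc e))" by (simp add: mult_ac)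
   qed
   finally show ?thesis by (simp add: algebra_simps)
  qed
  hence m: "mem (Q (Suc k)) (%p. G k p ^ e * (S e p + G k p * ?U p))" using rel by simp
  have U: "repr ?U" by (intro repr_sum repr_mult S_repr repr_power G_repr) simp
  have Gk: "repr (G k)" by (rule G_repr) simp
  have "mem (Q (Suc k)) (%p. G k p ^ e) \<or> mem (Q (Suc k)) (%p. S e p + G k p * ?U p)"
   by (rule mem_prime[OF P(1) m repr_power[OF Gk] repr_add[OF S_repr repr_mult[OF Gk U]]])
  moreover have "\<not> mem (Q (Suc k)) (%p. G k p ^ e)" using mem_prime_power[OF P(1) Gk] Suc.prems(5)[of k] by auto
  ultimately have "mem (Q k) (%p. S e p + G k p * ?U p)" using mem_mono Suc.prems(2)[of k] by blast
  moreover have "mem (Q k) (%p. ?U p * G k p)" by (rule mem_mult[OF id(2) _ U]) (use Suc.prems(4) in simp)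
  ultimately have "mem (Q k) (%p. (S e p + G k p * ?U p) - ?U p * G k p)" by (rule mem_diff[OF id(2)])
  hence "mem (Q k) (S e)" by (rule mem_cong) simp
  hence "mem (Q k) (%p. \<Sum>\<beta>\<in>expbox k D. of_real (c (\<beta>(k := e))) * (\<Prod>i<k. G i p ^ \<beta> i))"
   by (rule mem_cong) (simp add: S_def)
  thus ?case by (intro Suc.IH[of "%\<beta>. c (\<beta>(k := e))"] Suc.prems) auto
 qed
 thus ?case by (auto elim!: box_split)
qed

end

section \<open>Anisotropic quadrics over an affine space\<close>

text \<open>The double cover \<open>t\<^sup>2 = - c(y)\<close> of affine space, with \<open>t\<close> as the
  coordinate of index \<open>n\<close>. Positivity of \<open>c\<close> says that there are no real points.\<close>

locale chart = function_ring R ev Y for R (structure) and ev :: "'a => (nat => complex) => complex" and Y +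
 fixes n :: nat and c :: "(nat => complex) => complex"
 assumes npos: "n \<ge> 1"
  and c_poly: "rpoly n 2 c"
  and c_pos: "(\<And>i. i < n ==> p i \<in> \<real>) ==> 0 < Re (c p)"
  and Y_eq: "Y = {p. p n ^ 2 + c p = 0}"
  and ev_poly: "a \<in> carrier R ==> \<exists>d F. rpoly (Suc n) d F \<and> (\<forall>p\<in>Y. ev a p = F p)"
  and poly_repr: "rpoly (Suc n) d F ==> repr F"
begin

lemma c_upd: "c (p(n := t)) = c p" by (rule rpoly_cong[OF c_poly]) simp

lemma rpoly_upd: "rpoly n d F ==> F (p(n := t)) = F p" using rpoly_cong[of n d F "p(n := t)" p] by simp

lemma rpoly_Suc: "rpoly n d F ==> rpoly (Suc n) d F" by (erule rpoly_mono) simp_all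

lemma scalar_repr: "repr (%p. of_real r)" by (rule poly_repr[OF rpoly.const[of _ 0]])

lemma coord_repr: "i \<le> n ==> repr (%p. p i)" by (rule poly_repr[where d = 1]) (auto intro: rpoly.var)

lemma normal_form:
 "rpoly (Suc n) d F ==> \<exists>A B. rpoly n d A \<and> (B = (%p. 0) \<or> (d \<ge> 1 \<and> rpoly n (d - 1) B)) \<and>
   (\<forall>p\<in>Y. F p = A p + B p * p n)"
proof (induction rule: rpoly.induct)
 case (const d r)
 show ?case by (intro exI[of _ "%p. of_real r"] exI[of _ "%p. 0"]) (auto intro: rpoly.const)
next
 case (var i d)
 show ?case
 proof (cases "i = n")
  case True
  show ?thesis using var by (intro exI[of _ "%p. 0"] exI[of _ "%p. 1"]) (auto simp: True intro: rpoly_0 rpoly_1)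
 next
  case False
  thus ?thesis using var by (intro exI[of _ "%p. p i"] exI[of _ "%p. 0"]) (auto intro: rpoly.var)
 qed
next
 case (add d F G)
 then obtain A B A' B' where 1: "rpoly n d A" "B = (%p. 0) \<or> (d \<ge> 1 \<and> rpoly n (d - 1) B)"
   "\<forall>p\<in>Y. F p = A p + B p * p n"
  and 2: "rpoly n d A'" "B' = (%p. 0) \<or> (d \<ge> 1 \<and> rpoly n (d - 1) B')" "\<forall>p\<in>Y. G p = A' p + B' p * p n" by blast
 have "(%p. B p + B' p) = (%p. 0) \<or> (d \<ge> 1 \<and> rpoly n (d - 1) (%p. B p + B' p))"
  using 1(2) 2(2) by (auto intro: rpoly.add)
 moreover have "\<forall>p\<in>Y. F p + G p = (A p + A' p) + (B p + B' p) * p n" using 1(3) 2(3) by (simp add: algebra_simps)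
 ultimately show ?case using rpoly.add[OF 1(1) 2(1)] by (intro exI[of _ "%p. A p + A' p"] exI[of _ "%p. B p + B' p"]) blast
next
 case (mult d F e G f)
 then obtain A B A' B' where 1: "rpoly n d A" "B = (%p. 0) \<or> (d \<ge> 1 \<and> rpoly n (d - 1) B)"
   "\<forall>p\<in>Y. F p = A p + B p * p n"
  and 2: "rpoly n e A'" "B' = (%p. 0) \<or> (e \<ge> 1 \<and> rpoly n (e - 1) B')" "\<forall>p\<in>Y. G p = A' p + B' p * p n" by blast
 let ?A = "%p. A p * A' p - (B p * B' p) * c p" let ?B = "%p. A p * B' p + B p * A' p"
 have "rpoly n f (%p. (B p * B' p) * c p)"
 proof (cases "B = (%p. 0) \<or> B' = (%p. 0)")
  case True thus ?thesis by (auto intro: rpoly_0)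
 next
  case False
  hence b: "d \<ge> 1" "rpoly n (d - 1) B" "e \<ge> 1" "rpoly n (e - 1) B'" using 1(2) 2(2) by auto
  have "rpoly n ((d - 1) + (e - 1)) (%p. B p * B' p)" by (rule rpoly.mult[OF b(2,4)]) simp
  thus ?thesis by (rule rpoly.mult[OF _ c_poly]) (use b mult.hyps in auto)
 qed
 hence A: "rpoly n f ?A" by (intro rpoly_diff rpoly.mult[OF 1(1) 2(1)] mult.hyps)
 have p1: "(%p. A p * B' p) = (%p. 0) \<or> (f \<ge> 1 \<and> rpoly n (f - 1) (%p. A p * B' p))"
  using 2(2) mult.hyps by (auto intro!: rpoly.mult[OF 1(1)])
 have p2: "(%p. B p * A' p) = (%p. 0) \<or> (f \<ge> 1 \<and> rpoly n (f - 1) (%p. B p * A' p))"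
  using 1(2) mult.hyps by (auto intro!: rpoly.mult[OF _ 2(1)])
 have B: "?B = (%p. 0) \<or> (f \<ge> 1 \<and> rpoly n (f - 1) ?B)"
 proof (cases "f \<ge> 1")
  case True
  have "rpoly n (f - 1) (%p. A p * B' p)" "rpoly n (f - 1) (%p. B p * A' p)" using p1 p2 rpoly_0[of n "f - 1"] by presburger+
  thus ?thesis using True rpoly.add by blast
 next
  case False
  hence z: "A p * B' p = 0" "B p * A' p = 0" for p using p1 p2 by (meson fun_cong)+
  have "?B = (%p. 0)" by (rule ext) (simp only: z add_0_left)
  thus ?thesis by (rule disjI1)
 qed
 have "F p * G p = ?A p + ?B p * p n" if "p \<in> Y" for p
 proof -
  have e: "p n * p n = - c p" using that by (simp add: Y_eq power2_eq_square eq_neg_iff_add_eq_0)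
  have "F p * G p = A p * A' p + ?B p * p n + B p * B' p * (p n * p n)" using 1(3) 2(3) that by (simp add: algebra_simps)
  thus ?thesis unfolding e by (simp add: algebra_simps)
 qed
 thus ?case using A B by blast
qed

lemma expand:
 assumes "rpoly (Suc n) d F"
 shows "\<exists>C::(nat => nat) \<times> nat => real. \<forall>p\<in>Y. F p =
  (\<Sum>x\<in>exps n d \<times> {0, 1}. of_real (C x) * (monom_val n (fst x) p * p n ^ snd x))"
proof -
 obtain A B where AB: "rpoly n d A" "B = (%p. 0) \<or> (d \<ge> 1 \<and> rpoly n (d - 1) B)" "\<forall>p\<in>Y. F p = A p + B p * p n"
  using normal_form[OF assms] by blast
 have "rpoly n d B" using AB(2) rpoly_mono[of n "d - 1" B d n] by (auto intro: rpoly_0)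
 then obtain b where b: "\<forall>p. B p = (\<Sum>\<alpha>\<in>exps n d. of_real (b \<alpha>) * monom_val n \<alpha> p)" using rpoly_expand by blast
 obtain a where a: "\<forall>p. A p = (\<Sum>\<alpha>\<in>exps n d. of_real (a \<alpha>) * monom_val n \<alpha> p)" using rpoly_expand[OF AB(1)] by blast
 let ?C = "%x. if snd x = 0 then a (fst x) else b (fst x)"
 have "F p = (\<Sum>x\<in>exps n d \<times> {0, 1}. of_real (?C x) * (monom_val n (fst x) p * p n ^ snd x))" if "p \<in> Y" for p
 proof -
  have "(\<Sum>x\<in>exps n d \<times> {0, 1::nat}. of_real (?C x) * (monom_val n (fst x) p * p n ^ snd x))
   = (\<Sum>\<alpha>\<in>exps n d. \<Sum>\<epsilon>\<in>{0, 1::nat}. of_real (?C (\<alpha>, \<epsilon>)) * (monom_val n \<alpha> p * p n ^ \<epsilon>))"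
   by (simp only: sum.cartesian_product case_prod_unfold prod.collapse fst_conv snd_conv)
  also have "\<dots> = A p + B p * p n" using a b by (simp add: sum.distrib sum_distrib_left sum_distrib_right mult_ac)
  finally show ?thesis using AB(3) that by simp
 qed
 thus ?thesis by (intro exI[of _ ?C] ballI)
qed

end

context chart
begin

text \<open>By the normal form \<open>A + B t\<close>, functions of degree at most \<open>d\<close> lie in a real
  vector space of dimension at most \<open>2 (d + 1)\<^sup>n\<close>.\<close>

lemma dependent:
 assumes I: "finite I" and G: "\<And>i. i \<in> I ==> rpoly (Suc n) d (G i)" and card: "2 * Suc d ^ n < card I"
 shows "\<exists>r::'i => real. (\<exists>i\<in>I. r i \<noteq> 0) \<and> (\<forall>p\<in>Y. (\<Sum>i\<in>I. of_real (r i) * G i p) = 0)"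
proof -
 let ?E = "exps n d \<times> {0, 1::nat}"
 let ?m = "%x p. monom_val n (fst x) p * p n ^ snd x"
 have "\<forall>i\<in>I. \<exists>C::(nat => nat) \<times> nat => real. \<forall>p\<in>Y. G i p = (\<Sum>x\<in>?E. of_real (C x) * ?m x p)"
  using expand[OF G] by blast
 from bchoice[OF this] obtain C :: "'i => (nat => nat) \<times> nat => real"
  where C0: "\<forall>i\<in>I. \<forall>p\<in>Y. G i p = (\<Sum>x\<in>?E. of_real (C i x) * ?m x p)" ..
 note C = C0[rule_format]
 have "card ?E \<le> 2 * Suc d ^ n" using card_exps[of n d] by (simp add: card_cartesian_product)
 hence "card ?E < card I" using card by simp
 from lin_dep[OF _ I this, of C] finite_exps obtain r where r: "\<exists>i\<in>I. r i \<noteq> 0" "\<forall>e\<in>?E. (\<Sum>i\<in>I. r i * C i e) = 0" by auto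
 have "(\<Sum>i\<in>I. of_real (r i) * G i p) = 0" if p: "p \<in> Y" for p
 proof -
  have "(\<Sum>i\<in>I. of_real (r i) * G i p) = (\<Sum>i\<in>I. \<Sum>x\<in>?E. of_real (r i) * (of_real (C i x) * ?m x p))"
   using C p by (simp add: sum_distrib_left)
  also have "\<dots> = (\<Sum>x\<in>?E. \<Sum>i\<in>I. of_real (r i) * (of_real (C i x) * ?m x p))" by (rule sum.swap)
  also have "\<dots> = (\<Sum>x\<in>?E. of_real (\<Sum>i\<in>I. r i * C i x) * ?m x p)"
   by (intro sum.cong refl) (simp only: of_real_sum of_real_mult sum_distrib_right mult.assoc)
  also have "\<dots> = 0"
  proof (rule sum.neutral, rule ballI)
   fix x assume "x \<in> ?E"
   hence "(\<Sum>i\<in>I. r i * C i x) = 0" using r(2) by blast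
   thus "of_real (\<Sum>i\<in>I. r i * C i x) * ?m x p = 0" by (simp only: of_real_0 mult_zero_left)
  qed
  finally show ?thesis .
 qed
 thus ?thesis using r(1) by blast
qed

lemma ev_poly_bounded:
 assumes "finite A" "\<And>i. i \<in> A ==> a i \<in> carrier R"
 shows "\<exists>d F. \<forall>i\<in>A. rpoly (Suc n) d (F i) \<and> (\<forall>p\<in>Y. ev (a i) p = F i p)"
proof -
 have "\<forall>i\<in>A. \<exists>x. rpoly (Suc n) (fst x) (snd x) \<and> (\<forall>p\<in>Y. ev (a i) p = snd x p)"
  using ev_poly[OF assms(2)] by (metis fst_conv snd_conv)
 from bchoice[OF this] obtain x
  where x: "\<forall>i\<in>A. rpoly (Suc n) (fst (x i)) (snd (x i)) \<and> (\<forall>p\<in>Y. ev (a i) p = snd (x i) p)" ..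
 define d where "d i = fst (x i)" for i
 define F where "F i = snd (x i)" for i
 have dF: "rpoly (Suc n) (d i) (F i) \<and> (\<forall>p\<in>Y. ev (a i) p = F i p)" if "i \<in> A" for i
  using bspec[OF x that] by (simp add: d_def F_def)
 have "rpoly (Suc n) (\<Sum>i\<in>A. d i) (F i)" if "i \<in> A" for i
  using rpoly_mono[of "Suc n" "d i" "F i" "\<Sum>i\<in>A. d i" "Suc n"] dF[OF that]
   member_le_sum[OF that, of d] assms(1) by simp
 thus ?thesis using dF by (intro exI[of _ "\<Sum>i\<in>A. d i"] exI[of _ F]) blast
qed

text \<open>A chain of length \<open>n + 1\<close> would yield \<open>n + 1\<close> elements without polynomial
  relation, but their monomials with exponents below \<open>D\<close> are \<open>D\<^sup>n\<^sup>+\<^sup>1\<close>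
 functions of degree \<open>O(D)\<close>, too many for \<open>dependent\<close> when \<open>D\<close> is large.\<close>

lemma krull_dim_le: "krull_dim R \<le> enat n" unfolding krull_dim_def
proof (rule chain_sup_le_Suc)
 fix ch assume ch: "\<And>i. i \<le> Suc n ==> primeideal (ch i) R" "\<And>i. i < Suc n ==> ch i \<subset> ch (Suc i)"
 let ?k = "Suc n"
 define Q where "Q i = ch (?k - i)" for i
 have Qp: "primeideal (Q i) R" if "i \<le> ?k" for i using ch(1) by (simp add: Q_def)
 have Qs: "Q (Suc i) \<subset> Q i" if "i < ?k" for i using ch(2)[of "?k - Suc i"] that by (simp add: Q_def Suc_diff_le)
 define a where "a i = (SOME x. x \<in> Q i \<and> x \<notin> Q (Suc i))" for i
 have a: "a i \<in> Q i \<and> a i \<notin> Q (Suc i)" if "i < ?k" for i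
  unfolding a_def by (rule someI_ex) (use Qs[OF that] in blast)
 have Qid: "ideal (Q i) R" if "i \<le> ?k" for i by (rule primeideal.axioms(1)[OF Qp[OF that]])
 have ac: "a i \<in> carrier R" if "i < ?k" for i using a[OF that] ideal_subsetD[OF Qid[of i]] that by auto
 have "\<exists>d F. \<forall>i\<in>{..<?k}. rpoly (Suc n) d (F i) \<and> (\<forall>p\<in>Y. ev (a i) p = F i p)"
  by (rule ev_poly_bounded) (use ac in auto)
 then obtain d F where dF0: "\<forall>i\<in>{..<?k}. rpoly (Suc n) d (F i) \<and> (\<forall>p\<in>Y. ev (a i) p = F i p)" by (elim exE)
 have dF: "rpoly (Suc n) d (F i)" "p \<in> Y ==> ev (a i) p = F i p" if "i < ?k" for i p using dF0 that by blast+
 define D where "D = Suc (2 * Suc (?k * d) ^ n)"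
 define e where "e = ?k * D * d"
 let ?G = "%\<alpha> p. \<Prod>i<?k. F i p ^ \<alpha> i"
 have poly: "rpoly (Suc n) e (?G \<alpha>)" if al: "\<alpha> \<in> expbox ?k D" for \<alpha>
 proof (rule rpoly_prod[where d = "%i. D * d"])
  show "rpoly (Suc n) (D * d) (%p. F i p ^ \<alpha> i)" if "i \<in> {..<?k}" for i
  proof (rule rpoly_power[OF dF(1)])
   have "\<alpha> i < D" using al that by (auto simp: expbox_def PiE_def Pi_def)
   thus "d * \<alpha> i \<le> D * d" by (simp add: mult.commute)
  qed (use that in simp)
 qed (simp_all add: e_def algebra_simps)
 have "2 * Suc e ^ n < card (expbox ?k D)"
 proof -
  have "Suc e \<le> Suc (?k * d) * D" unfolding e_def by (simp add: D_def algebra_simps)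
  hence "2 * Suc e ^ n \<le> 2 * (Suc (?k * d) * D) ^ n" by (intro mult_left_mono power_mono) auto
  also have "\<dots> = (2 * Suc (?k * d) ^ n) * D ^ n" by (simp only: power_mult_distrib mult.assoc)
  also have "\<dots> < D * D ^ n" by (intro mult_strict_right_mono) (auto simp: D_def)
  finally show ?thesis by (simp add: card_box)
 qed
 hence "\<exists>r::(nat => nat) => real. (\<exists>\<alpha>\<in>expbox ?k D. r \<alpha> \<noteq> 0) \<and>
   (\<forall>p\<in>Y. (\<Sum>\<alpha>\<in>expbox ?k D. of_real (r \<alpha>) * ?G \<alpha> p) = 0)"
  by (intro dependent[where d = e] finite_box poly)
 then obtain r :: "(nat => nat) => real" where r: "\<exists>\<alpha>\<in>expbox ?k D. r \<alpha> \<noteq> 0"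
  "\<forall>p\<in>Y. (\<Sum>\<alpha>\<in>expbox ?k D. of_real (r \<alpha>) * ?G \<alpha> p) = 0" by (elim exE conjE)
 have "mem (Q ?k) (%p. \<Sum>\<alpha>\<in>expbox ?k D. of_real (r \<alpha>) * ?G \<alpha> p)"
  by (rule mem_cong[OF mem_0[OF Qid[of ?k]]]) (use r(2) in simp_all)
 hence "\<forall>\<alpha>\<in>expbox ?k D. r \<alpha> = 0"
 proof (rule chain_independent[OF scalar_repr Qp _ _ _ _ , rotated -1])
  fix i assume i: "i < ?k"
  show "Q (Suc i) \<subseteq> Q i" using Qs[OF i] by blast
  show "repr (F i)" by (rule poly_repr[OF dF(1)[OF i]])
  show "mem (Q i) (F i)" unfolding mem_def using a[OF i] dF(2)[OF i] by blast
  show "\<not> mem (Q (Suc i)) (F i)"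
  proof
   assume "mem (Q (Suc i)) (F i)"
   hence "mem (Q (Suc i)) (ev (a i))" by (rule mem_cong) (simp add: dF(2)[OF i])
   thus False using mem_ev[OF Qid ac] a[OF i] i by simp
  qed
 qed
 thus False using r(1) by blast
qed

section \<open>Real points\<close>

lemma real_c: "(\<And>i. i < n ==> p i \<in> \<real>) ==> c p = of_real (Re (c p))"
 using rpoly_real[OF c_poly] by (simp add: of_real_Re)

lemma cnj_last:
 assumes p: "p \<in> Y" and re: "\<And>i. i < n ==> p i \<in> \<real>"
 shows "cnj (p n) = - p n" "p n \<noteq> 0"
proof -
 have e: "p n ^ 2 = of_real (- Re (c p))" using p real_c[OF re] by (simp add: Y_eq eq_neg_iff_add_eq_0)
 have neg: "- Re (c p) < 0" using c_pos[of p] re by simp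
 show "p n \<noteq> 0" using e neg by auto
 have "Im (p n ^ 2) = 0" "Re (p n ^ 2) < 0" using e neg by auto
 hence "Re (p n) * Im (p n) = 0" "Re (p n) ^ 2 < Im (p n) ^ 2" by (auto simp: power2_eq_square)
 hence "Re (p n) = 0" by auto
 thus "cnj (p n) = - p n" by (simp add: complex_eq_iff)
qed

definition lift :: "(nat => complex) => nat => complex" where
 "lift p = p(n := csqrt (- c p))"

lemma lift_Y: "lift p \<in> Y" by (simp add: Y_eq lift_def c_upd)

lemma lift_coord: "i < n ==> lift p i = p i" by (simp add: lift_def)

text \<open>Complex conjugation separates the two parts of a normal form at the real points, and the
  real points are Zariski dense in affine space.\<close>

lemma vanish_on_real_points:
 assumes F: "rpoly (Suc n) d F" and z: "\<And>p. p \<in> Y ==> (\<And>i. i < n ==> p i \<in> \<real>) ==> F p = 0" and p: "p \<in> Y"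
 shows "F p = 0"
proof -
 obtain A B where AB: "rpoly n d A" "B = (%p. 0) \<or> (d \<ge> 1 \<and> rpoly n (d - 1) B)" "\<forall>p\<in>Y. F p = A p + B p * p n"
  using normal_form[OF F] by blast
 have B: "rpoly n d B" using AB(2) rpoly_mono[of n "d - 1" B d n] by (auto intro: rpoly_0)
 have "A p = 0 \<and> B p = 0" if re: "\<And>i. p i \<in> \<real>" for p
 proof -
  let ?q = "lift p"
  have q: "?q \<in> Y" "\<And>i. i < n ==> ?q i \<in> \<real>" using lift_Y lift_coord re by auto
  note t = cnj_last[OF q]
  have "A ?q + B ?q * ?q n = 0" using AB(3) q z by auto
  hence e: "A p + B p * ?q n = 0" using rpoly_upd[OF AB(1)] rpoly_upd[OF B] by (simp add: lift_def)
  have "A p \<in> \<real>" "B p \<in> \<real>" using rpoly_real[OF AB(1)] rpoly_real[OF B] re by auto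
  hence "A p - B p * ?q n = cnj (A p + B p * ?q n)" using t(1) by (simp add: Reals_cnj_iff)
  hence e2: "A p - B p * ?q n = 0" using e by simp
  have "2 * A p = (A p + B p * ?q n) + (A p - B p * ?q n)" by simp
  hence "A p = 0" using e e2 by simp
  thus ?thesis using e t(2) by simp
 qed
 hence "A p = 0" "B p = 0" for p using rpoly_vanish_real[OF AB(1)] rpoly_vanish_real[OF B] by auto
 thus ?thesis using AB(3) p by simp
qed

text \<open>Only points over real \<open>y\<close> are tested: there conjugation interchanges the two sheets of the
  cover, and \<open>F\<close> times its conjugate is a real polynomial along real lines.\<close>

definition plane_prime :: "nat => 'a set" where
 "plane_prime k = {a \<in> carrier R. \<forall>p\<in>Y. (\<forall>i<n. p i \<in> \<real>) --> (\<forall>i<n. i < k --> p i = 0) --> ev a p = 0}"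

lemma norm_on_line:
 assumes F: "rpoly (Suc n) d F" and re: "\<And>i. u i \<in> \<real>" "\<And>i. v i \<in> \<real>"
 shows "\<exists>N::complex poly. \<forall>s::real. \<forall>p\<in>Y. (\<forall>i<n. p i = u i + of_real s * v i) --> F p * cnj (F p) = poly N (of_real s)"
proof -
 obtain A B where AB: "rpoly n d A" "B = (%p. 0) \<or> (d \<ge> 1 \<and> rpoly n (d - 1) B)" "\<forall>p\<in>Y. F p = A p + B p * p n"
  using normal_form[OF F] by blast
 have B: "rpoly n d B" using AB(2) rpoly_mono[of n "d - 1" B d n] by (auto intro: rpoly_0)
 obtain PA where PA: "\<And>s. A (%i. u i + s * v i) = poly PA s" using rpoly_line[OF AB(1)] by blast
 obtain PB where PB: "\<And>s. B (%i. u i + s * v i) = poly PB s" using rpoly_line[OF B] by blast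
 obtain PC where PC: "\<And>s. c (%i. u i + s * v i) = poly PC s" using rpoly_line[OF c_poly] by blast
 have "F p * cnj (F p) = poly (PA * PA + PB * PB * PC) (of_real s)"
  if p: "p \<in> Y" and line: "\<forall>i<n. p i = u i + of_real s * v i" for s p
 proof -
  let ?w = "%i. u i + of_real s * v i"
  have w: "A p = poly PA (of_real s)" "B p = poly PB (of_real s)" "c p = poly PC (of_real s)"
   using rpoly_cong[OF AB(1), of p ?w] rpoly_cong[OF B, of p ?w] rpoly_cong[OF c_poly, of p ?w] line PA PB PC by auto
  have pre: "p i \<in> \<real>" if "i < n" for i using line re that by auto
  have AR: "A p \<in> \<real>" "B p \<in> \<real>" using rpoly_real[OF AB(1) pre] rpoly_real[OF B pre] by auto
  have eF: "F p = A p + B p * p n" using AB(3) p by blast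
  have "cnj (A p) = A p" "cnj (B p) = B p" using AR by (simp_all add: Reals_cnj_iff)
  hence eC: "cnj (F p) = A p - B p * p n" unfolding eF using cnj_last(1)[OF p pre] by simp
  have "F p * cnj (F p) = A p * A p - B p * B p * (p n ^ 2)"
   unfolding eC unfolding eF by (simp add: algebra_simps power2_eq_square)
  moreover have "p n ^ 2 = - c p" using p by (simp add: Y_eq eq_neg_iff_add_eq_0)
  ultimately show ?thesis by (simp add: w)
 qed
 thus ?thesis by blast
qed

text \<open>Irreducibility: along a real line joining two points, the norms of two functions are nonzero
  polynomials in one variable.\<close>

lemma plane_prime_prime: "primeideal (plane_prime k) R"
proof (rule primeidealI)
 show "cring R" by (rule is_cring)
 show id: "ideal (plane_prime k) R"
 proof (rule idealI)
  show "ring R" by (rule ring_axioms)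
  show "subgroup (plane_prime k) (add_monoid R)"
  proof (rule group.subgroupI)
   show "group (add_monoid R)" by (rule add.is_group)
   show "plane_prime k \<subseteq> carrier (add_monoid R)" by (auto simp: plane_prime_def)
   have "\<zero> \<in> plane_prime k" by (simp add: plane_prime_def ev_zero)
   thus "plane_prime k \<noteq> {}" by blast
   show "inv\<^bsub>add_monoid R\<^esub> a \<in> plane_prime k" if "a \<in> plane_prime k" for a
    using that by (simp add: plane_prime_def a_inv_def[symmetric] ev_uminus)
   show "a \<otimes>\<^bsub>add_monoid R\<^esub> b \<in> plane_prime k" if "a \<in> plane_prime k" "b \<in> plane_prime k" for a b
    using that by (simp add: plane_prime_def ev_add)
  qed
  show "x \<otimes> a \<in> plane_prime k" if "a \<in> plane_prime k" "x \<in> carrier R" for a x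
   using that by (simp add: plane_prime_def ev_mult)
  show "a \<otimes> x \<in> plane_prime k" if "a \<in> plane_prime k" "x \<in> carrier R" for a x
   using that by (simp add: plane_prime_def ev_mult)
 qed
 show "carrier R \<noteq> plane_prime k"
 proof
  assume "carrier R = plane_prime k"
  hence one: "\<one> \<in> plane_prime k" using one_closed by blast
  have oY: "lift (%i. 0) \<in> Y" by (rule lift_Y)
  have "ev \<one> (lift (%i. 0)) = 0" using one oY lift_coord[of _ "%i. 0"] by (simp add: plane_prime_def)
  thus False using ev_one[OF oY] by simp
 qed
 show "a \<in> plane_prime k \<or> b \<in> plane_prime k"
  if a: "a \<in> carrier R" and b: "b \<in> carrier R" and ab: "a \<otimes> b \<in> plane_prime k" for a b
 proof (rule ccontr)
  assume "\<not> ?thesis"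
  then obtain p q where p: "p \<in> Y" "\<forall>i<n. p i \<in> \<real>" "\<forall>i<n. i < k --> p i = 0" "ev a p \<noteq> 0"
   and q: "q \<in> Y" "\<forall>i<n. q i \<in> \<real>" "\<forall>i<n. i < k --> q i = 0" "ev b q \<noteq> 0"
   using a b unfolding plane_prime_def by blast
  obtain d F where F: "rpoly (Suc n) d F" "\<And>p. p \<in> Y ==> ev a p = F p" using ev_poly[OF a] by blast
  obtain e G where G: "rpoly (Suc n) e G" "\<And>p. p \<in> Y ==> ev b p = G p" using ev_poly[OF b] by blast
  let ?u = "%i. if i < n then p i else 0" let ?v = "%i. if i < n then q i - p i else 0"
  have re: "?u i \<in> \<real>" "?v i \<in> \<real>" for i using p(2) q(2) by auto
  obtain N where N: "\<And>s::real. \<And>x. x \<in> Y ==> (\<forall>i<n. x i = ?u i + of_real s * ?v i) ==> F x * cnj (F x) = poly N (of_real s)"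
   using norm_on_line[where u = ?u and v = ?v, OF F(1) re] by blast
  obtain M where M: "\<And>s::real. \<And>x. x \<in> Y ==> (\<forall>i<n. x i = ?u i + of_real s * ?v i) ==> G x * cnj (G x) = poly M (of_real s)"
   using norm_on_line[where u = ?u and v = ?v, OF G(1) re] by blast
  have "poly N (of_real 0) \<noteq> 0" using N[OF p(1), of 0] F(2)[OF p(1)] p(4) by auto
  hence N0: "N \<noteq> 0" by auto
  have "poly M (of_real 1) \<noteq> 0" using M[OF q(1), of 1] G(2)[OF q(1)] q(4) by auto
  hence M0: "M \<noteq> 0" by auto
  have "finite {s. poly (N * M) s = 0}" using N0 M0 by (intro poly_roots_finite) auto
  moreover have "infinite (range complex_of_real)" using infinite_UNIV_char_0 by (simp add: finite_image_iff inj_on_def)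
  ultimately obtain s :: real where s: "poly (N * M) (of_real s) \<noteq> 0"
   by (metis (mono_tags, lifting) finite_subset image_subsetI mem_Collect_eq)
  let ?x = "lift (%i. ?u i + of_real s * ?v i)"
  have x: "?x \<in> Y" by (rule lift_Y)
  have xi: "?x i = ?u i + of_real s * ?v i" if "i < n" for i by (rule lift_coord[OF that])
  have "F ?x \<noteq> 0" "G ?x \<noteq> 0" using s N[OF x] M[OF x] xi by auto
  moreover have "ev (a \<otimes> b) ?x = F ?x * G ?x" using F(2)[OF x] G(2)[OF x] ev_mult[OF a b x] by simp
  moreover have "ev (a \<otimes> b) ?x = 0"
  proof -
   have "?x i \<in> \<real>" if "i < n" for i unfolding xi[OF that] by (intro Reals_add Reals_mult re Reals_of_real)
   moreover have "\<forall>i<n. i < k --> ?x i = 0" using xi p(3) q(3) by simp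
   ultimately have "\<forall>i<n. ?x i \<in> \<real>" "\<forall>i<n. i < k --> ?x i = 0" by blast+
   thus ?thesis using ab x unfolding plane_prime_def by blast
  qed
  ultimately show False by simp
 qed
qed

end

section \<open>Points and maximal ideals\<close>

context chart
begin

definition point_ideal :: "(nat => complex) => 'a set" where
 "point_ideal z = {a \<in> carrier R. ev a z = 0}"

lemma nonreal_coord:
 assumes z: "z \<in> Y" obtains i where "i \<le> n" "Im (z i) \<noteq> 0"
proof (cases "\<forall>i<n. z i \<in> \<real>")
 case True
 hence "cnj (z n) = - z n" "z n \<noteq> 0" using cnj_last[OF z] by auto
 hence "Im (z n) \<noteq> 0" by (auto simp: complex_eq_iff)
 thus ?thesis using that by blast
next
 case False
 then obtain i where "i < n" "Im (z i) \<noteq> 0" using complex_is_Real_iff by auto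
 thus ?thesis using that[of i] by simp
qed

text \<open>Some coordinate of \<open>z\<close> is not real, so together with the real numbers it spans
  \<open>\<complex>\<close>.\<close>

lemma value_lift:
 assumes z: "z \<in> Y" shows "\<exists>b\<in>carrier R. ev b z = w"
proof -
 obtain i where i: "i \<le> n" "Im (z i) \<noteq> 0" using nonreal_coord[OF z] .
 define b where "b = Im w / Im (z i)"
 define a where "a = Re w - b * Re (z i)"
 have "repr (%p. of_real a + of_real b * p i)" by (intro repr_add repr_mult scalar_repr coord_repr i(1))
 moreover have "of_real a + of_real b * z i = w" using i(2) by (simp add: complex_eq_iff a_def b_def)
 ultimately show ?thesis using z unfolding repr_def by metis
qed

lemma point_ideal_maximal:
 assumes z: "z \<in> Y" shows "maximalideal (point_ideal z) R"
proof (rule maximalidealI)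
 show id: "ideal (point_ideal z) R"
 proof (rule idealI)
  show "ring R" by (rule ring_axioms)
  show "subgroup (point_ideal z) (add_monoid R)"
  proof (rule group.subgroupI)
   show "group (add_monoid R)" by (rule add.is_group)
   show "point_ideal z \<subseteq> carrier (add_monoid R)" by (auto simp: point_ideal_def)
   have "\<zero> \<in> point_ideal z" using z by (simp add: point_ideal_def ev_zero)
   thus "point_ideal z \<noteq> {}" by blast
   show "inv\<^bsub>add_monoid R\<^esub> a \<in> point_ideal z" if "a \<in> point_ideal z" for a
    using that z by (simp add: point_ideal_def a_inv_def[symmetric] ev_uminus)
   show "a \<otimes>\<^bsub>add_monoid R\<^esub> b \<in> point_ideal z" if "a \<in> point_ideal z" "b \<in> point_ideal z" for a b
    using that z by (simp add: point_ideal_def ev_add)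
  qed
  show "x \<otimes> a \<in> point_ideal z" if "a \<in> point_ideal z" "x \<in> carrier R" for a x
   using that z by (simp add: point_ideal_def ev_mult)
  show "a \<otimes> x \<in> point_ideal z" if "a \<in> point_ideal z" "x \<in> carrier R" for a x
   using that z by (simp add: point_ideal_def ev_mult)
 qed
 have one: "\<one> \<notin> point_ideal z" using z by (simp add: point_ideal_def ev_one)
 thus "carrier R \<noteq> point_ideal z" using one_closed by blast
 fix J assume J: "ideal J R" "point_ideal z \<subseteq> J" "J \<subseteq> carrier R"
 show "J = point_ideal z \<or> J = carrier R"
 proof (cases "J \<subseteq> point_ideal z")
  case False
  then obtain a where a: "a \<in> J" "a \<notin> point_ideal z" by blast
  have ac: "a \<in> carrier R" using a(1) J(3) by blast
  have nz: "ev a z \<noteq> 0" using a(2) ac by (simp add: point_ideal_def)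
  obtain b where b: "b \<in> carrier R" "ev b z = 1 / ev a z" using value_lift[OF z] by blast
  have "\<one> \<ominus> b \<otimes> a \<in> point_ideal z" using ac b z nz by (simp add: point_ideal_def ev_minus ev_mult ev_one)
  hence "\<one> \<ominus> b \<otimes> a \<in> J" using J(2) by blast
  hence "(\<one> \<ominus> b \<otimes> a) \<oplus> b \<otimes> a \<in> J" using ideal_add[OF J(1) _ ideal_absorb[OF J(1) a(1) b(1)]] by blast
  moreover have "(\<one> \<ominus> b \<otimes> a) \<oplus> b \<otimes> a = \<one>" using ac b(1) by algebra
  ultimately show ?thesis using ideal_one[OF J(1)] by simp
 qed (use J in blast)
qed

lemma real_not_in_maximal:
 assumes M: "primeideal M R" and m: "mem M (%p. of_real r)"
 shows "r = 0"
proof (rule ccontr)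
 assume r: "r \<noteq> 0"
 have id: "ideal M R" by (rule primeideal.axioms(1)[OF M])
 have "mem M (%p. of_real (1 / r) * of_real r)" by (rule mem_mult[OF id m scalar_repr])
 moreover have "complex_of_real (1 / r) * of_real r = 1" using r by (simp flip: of_real_mult)
 ultimately have "mem M (%p. 1)" by simp
 thus False using mem_one[OF id] primeideal.I_notcarr[OF M] by simp
qed

text \<open>If no \<open>F - x\<close> with \<open>x\<close> real lay in \<open>M\<close>, the uncountably many inverses of the \<open>F - x\<close>
 would lie in the union of countably many finite-dimensional spaces; a linear relation between some
 of them is an algebraic equation for \<open>F\<close>.\<close>

lemma algebraic_mod_maximal:
 assumes M: "maximalideal M R" and F: "rpoly (Suc n) d F"
 shows "\<exists>P::complex poly. P \<noteq> 0 \<and> (\<forall>w. poly P (cnj w) = cnj (poly P w)) \<and> mem M (%p. poly P (F p))"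
proof (cases "\<exists>x::real. mem M (%p. F p - of_real x)")
 case True
 then obtain x :: real where x: "mem M (%p. F p - of_real x)" by blast
 show ?thesis
 proof (intro exI[of _ "[:- of_real x, 1:]"] conjI allI)
  show "mem M (%p. poly [:- of_real x, 1:] (F p))" by (rule mem_cong[OF x]) simp
 qed simp_all
next
 case False
 have prime: "primeideal M R" by (rule maximalideal_prime[OF M])
 have id: "ideal M R" by (rule maximalideal.axioms(1)[OF M])
 have reprF: "repr F" by (rule poly_repr[OF F])
 have ex: "\<exists>e G. rpoly (Suc n) e G \<and> mem M (%p. (F p - of_real x) * G p - 1)" for x :: real
 proof -
  obtain a where a: "a \<in> carrier R" "\<forall>p\<in>Y. ev a p = F p - of_real x"
   using repr_diff[OF reprF scalar_repr, of x] unfolding repr_def by blast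
  have "a \<notin> M"
  proof
   assume "a \<in> M"
   hence "mem M (%p. F p - of_real x)" unfolding mem_def using a(2) by blast
   thus False using False by blast
  qed
  then obtain w y where w: "w \<in> carrier R" "y \<in> M" "\<one> = a \<otimes> w \<oplus> y" using maximal_comax[OF M a(1)] by blast
  obtain e G where G: "rpoly (Suc n) e G" "\<forall>p\<in>Y. ev w p = G p" using ev_poly[OF w(1)] by blast
  have yc: "y \<in> carrier R" using ideal_subsetD[OF id w(2)] .
  have "\<ominus> \<one> \<otimes> y \<in> M" by (rule ideal_absorb[OF id w(2)]) simp
  moreover have "ev (\<ominus> \<one> \<otimes> y) p = (F p - of_real x) * G p - 1" if p: "p \<in> Y" for p
  proof -
   have "ev \<one> p = ev a p * ev w p + ev y p" using w(3) a(1) w(1) yc p ev_add ev_mult by (metis m_closed)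
   hence "(F p - of_real x) * G p + ev y p = 1" using a(2) G(2) p ev_one by simp
   hence "ev y p = 1 - (F p - of_real x) * G p" by (simp add: eq_diff_eq add.commute)
   thus ?thesis using yc p by (simp add: ev_mult ev_uminus ev_one)
  qed
  ultimately have "mem M (%p. (F p - of_real x) * G p - 1)" unfolding mem_def by blast
  thus ?thesis using G(1) by blast
 qed
 have "\<forall>x::real. \<exists>y. rpoly (Suc n) (fst y) (snd y) \<and> mem M (%p. (F p - of_real x) * snd y p - 1)"
  using ex by (metis fst_conv snd_conv)
 from choice[OF this] obtain y
  where y: "\<forall>x::real. rpoly (Suc n) (fst (y x)) (snd (y x)) \<and> mem M (%p. (F p - of_real x) * snd (y x) p - 1)" ..
 define D where "D x = fst (y x)" for x
 define G where "G x = snd (y x)" for x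
 have G: "rpoly (Suc n) (D x) (G x)" "mem M (%p. (F p - of_real x) * G x p - 1)" for x using y by (auto simp: D_def G_def)
 have "\<exists>m. infinite {x. D x = m}"
 proof (rule ccontr)
  assume "\<not> ?thesis"
  hence "countable (\<Union>m. {x. D x = m})" by (intro countable_UN) (auto intro: countable_finite)
  moreover have "(\<Union>m. {x. D x = m}) = (UNIV :: real set)" by auto
  ultimately show False using uncountable_UNIV_real by simp
 qed
 then obtain m where m: "infinite {x. D x = m}" by blast
 obtain C where C: "C \<subseteq> {x. D x = m}" "finite C" "card C = 2 * Suc m ^ n + 1"
  using infinite_arbitrarily_large[OF m] by blast
 have CG: "rpoly (Suc n) m (G x)" if "x \<in> C" for x using G(1)[of x] C(1) that by auto
 obtain r where r: "\<exists>x\<in>C. r x \<noteq> 0" "\<forall>p\<in>Y. (\<Sum>x\<in>C. of_real (r x) * G x p) = 0"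
  using dependent[where I = C and G = G and d = m, OF C(2) CG] C(3) by auto
 define P where "P = (\<Sum>x\<in>C. smult (complex_of_real (r x)) (\<Prod>y\<in>C - {x}. [:- complex_of_real y, 1:]))"
 have Pval: "poly P w = (\<Sum>x\<in>C. of_real (r x) * (\<Prod>y\<in>C - {x}. w - of_real y))" for w
  by (simp add: P_def poly_sum poly_prod)
 obtain x0 where x0: "x0 \<in> C" "r x0 \<noteq> 0" using r(1) by blast
 have "poly P (of_real x0) = of_real (r x0) * (\<Prod>y\<in>C - {x0}. of_real x0 - of_real y)" unfolding Pval
 proof (subst sum.remove[OF C(2) x0(1)], rule trans[OF arg_cong2[where f = "(+)", OF refl] add_0_right], rule sum.neutral, rule ballI)
  fix x assume x: "x \<in> C - {x0}"
  have "(\<Prod>y\<in>C - {x}. complex_of_real x0 - of_real y) = 0" using x x0 C(2) by (subst prod_zero_iff) auto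
  thus "of_real (r x) * (\<Prod>y\<in>C - {x}. complex_of_real x0 - of_real y) = 0" by simp
 qed
 also have "\<dots> \<noteq> 0" using x0 C(2) by simp
 finally have "P \<noteq> 0" by auto
 moreover have "poly P (cnj w) = cnj (poly P w)" for w by (simp add: Pval)
 moreover have "mem M (%p. poly P (F p))"
 proof -
  have "mem M (%p. \<Sum>x\<in>C. (of_real (r x) * (\<Prod>y\<in>C - {x}. F p - of_real y)) * ((F p - of_real x) * G x p - 1))"
   by (intro mem_sum[OF id] mem_mult[OF id G(2)] repr_mult scalar_repr repr_prod repr_diff reprF)
  hence "mem M (%p. of_real (-1) * (\<Sum>x\<in>C. (of_real (r x) * (\<Prod>y\<in>C - {x}. F p - of_real y)) * ((F p - of_real x) * G x p - 1)))"
   by (rule mem_mult[OF id _ scalar_repr])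
  thus ?thesis
  proof (rule mem_cong)
   fix p assume p: "p \<in> Y"
   let ?Q = "\<Prod>y\<in>C. F p - of_real y"
   have "(\<Sum>x\<in>C. (of_real (r x) * (\<Prod>y\<in>C - {x}. F p - of_real y)) * ((F p - of_real x) * G x p - 1))
    = (\<Sum>x\<in>C. ?Q * (of_real (r x) * G x p) - of_real (r x) * (\<Prod>y\<in>C - {x}. F p - of_real y))"
   proof (rule sum.cong[OF refl])
    fix x assume x: "x \<in> C"
    show "(of_real (r x) * (\<Prod>y\<in>C - {x}. F p - of_real y)) * ((F p - of_real x) * G x p - 1)
     = ?Q * (of_real (r x) * G x p) - of_real (r x) * (\<Prod>y\<in>C - {x}. F p - of_real y)"
     unfolding prod.remove[OF C(2) x] by (simp add: algebra_simps)
   qed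
   also have "\<dots> = ?Q * (\<Sum>x\<in>C. of_real (r x) * G x p) - poly P (F p)"
    by (simp add: sum_subtractf sum_distrib_left Pval)
   also have "\<dots> = - poly P (F p)" using r(2) p by simp
   finally show "of_real (-1) * (\<Sum>x\<in>C. (of_real (r x) * (\<Prod>y\<in>C - {x}. F p - of_real y)) * ((F p - of_real x) * G x p - 1))
     = poly P (F p)" by simp
  qed
 qed
 ultimately show ?thesis by blast
qed

lemma quadratic_mod_maximal:
 assumes M: "maximalideal M R" and F: "rpoly (Suc n) d F"
 shows "\<exists>u v::real. mem M (%p. (F p - of_real u)^2 + of_real (v^2))"
proof -
 have prime: "primeideal M R" by (rule maximalideal_prime[OF M])
 have id: "ideal M R" by (rule maximalideal.axioms(1)[OF M])
 have reprF: "repr F" by (rule poly_repr[OF F])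
 obtain P :: "complex poly" where P: "P \<noteq> 0" "\<And>w. poly P (cnj w) = cnj (poly P w)" "mem M (%p. poly P (F p))"
  using algebraic_mod_maximal[OF M F] by blast
 let ?Z = "{z. poly P z = 0}" let ?l = "lead_coeff P"
 let ?q = "%z w. (w - of_real (Re z))^2 + of_real (Im z ^ 2) :: complex"
 have fin: "finite ?Z" using P(1) by (rule poly_roots_finite)
 have val: "poly P w = ?l * (\<Prod>z\<in>?Z. (w - z) ^ order z P)" for w
 proof -
  have "poly P w = poly (smult ?l (\<Prod>z\<in>?Z. [:- z, 1:] ^ order z P)) w" by (simp only: complex_poly_decompose)
  thus ?thesis by (simp add: poly_prod poly_power)
 qed
 have val': "poly P w = cnj ?l * (\<Prod>z\<in>?Z. (w - cnj z) ^ order z P)" for w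
 proof -
  have "poly P w = cnj (poly P (cnj w))" using P(2)[of "cnj w"] by simp
  thus ?thesis unfolding val[of "cnj w"] by simp
 qed
 have q: "(w - z) * (w - cnj z) = ?q z w" for w z
 proof -
  have e: "z = of_real (Re z) + \<i> * of_real (Im z)" "cnj z = of_real (Re z) - \<i> * of_real (Im z)"
   by (simp_all add: complex_eq_iff)
  show ?thesis by (subst e(2), subst e(1)) (simp add: algebra_simps power2_eq_square)
 qed
 have sq: "poly P w * poly P w = of_real (cmod ?l ^ 2) * (\<Prod>z\<in>?Z. ?q z w ^ order z P)" for w
 proof -
  have "poly P w * poly P w = (?l * cnj ?l) * (\<Prod>z\<in>?Z. ((w - z) * (w - cnj z)) ^ order z P)"
   by (subst val, subst val') (simp only: power_mult_distrib prod.distrib mult_ac)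
  thus ?thesis by (simp only: q complex_norm_square)
 qed
 have reprq: "repr (%p. ?q z (F p))" for z by (intro repr_add repr_power repr_diff reprF scalar_repr)
 have "mem M (%p. poly P (F p) * poly P (F p))" by (rule mem_mult[OF id P(3) mem_repr[OF id P(3)]])
 hence "mem M (%p. of_real (cmod ?l ^ 2) * (\<Prod>z\<in>?Z. ?q z (F p) ^ order z P))" by (simp only: sq)
 hence "mem M (%p. of_real (cmod ?l ^ 2)) \<or> mem M (%p. \<Prod>z\<in>?Z. ?q z (F p) ^ order z P)"
  by (intro mem_prime[OF prime] scalar_repr repr_prod repr_power[OF reprq])
 moreover have "\<not> mem M (%p. of_real (cmod ?l ^ 2))" using real_not_in_maximal[OF prime, of "cmod ?l ^ 2"] P(1) by auto
 ultimately have m: "mem M (%p. \<Prod>z\<in>?Z. ?q z (F p) ^ order z P)" by blast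
 have "\<exists>z\<in>Z. mem M (%p. ?q z (F p))" if "finite Z" "mem M (%p. \<Prod>z\<in>Z. ?q z (F p) ^ order z P)" for Z
  using that
 proof (induction Z rule: finite_induct)
  case empty
  hence "M = carrier R" using mem_one[OF id] by simp
  thus ?case using primeideal.I_notcarr[OF prime] by simp
 next
  case (insert z Z)
  have "mem M (%p. ?q z (F p) ^ order z P * (\<Prod>z\<in>Z. ?q z (F p) ^ order z P))" using insert.prems insert.hyps by simp
  hence "mem M (%p. ?q z (F p) ^ order z P) \<or> mem M (%p. \<Prod>z\<in>Z. ?q z (F p) ^ order z P)"
   by (intro mem_prime[OF prime] repr_prod repr_power[OF reprq])
  thus ?case using insert.IH mem_prime_power[OF prime reprq, of z] by blast
 qed
 from this[OF fin m] show ?thesis by blast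
qed

text \<open>Modulo \<open>M\<close> every function satisfies a real quadratic equation, so the residue field is
  \<open>\<complex>\<close>, and the residues of the coordinates are the coordinates of a point.\<close>

theorem nullstellensatz:
 assumes M: "maximalideal M R"
 shows "\<exists>z\<in>Y. M = point_ideal z"
proof -
 have prime: "primeideal M R" by (rule maximalideal_prime[OF M])
 have id: "ideal M R" by (rule maximalideal.axioms(1)[OF M])
 have "\<forall>i. \<exists>u v::real. i \<le> n --> mem M (%p. (p i - of_real u)^2 + of_real (v^2))"
  using quadratic_mod_maximal[OF M rpoly.var[where d = 1]] by (metis le_imp_less_Suc order.refl)
 then obtain U V :: "nat => real" where UV: "\<And>i. i \<le> n ==> mem M (%p. (p i - of_real (U i))^2 + of_real (V i ^ 2))"
  by metis
 let ?Q = "%p. p n ^ 2 + c p"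
 have Qpoly: "rpoly (Suc n) 2 ?Q" by (intro rpoly.add rpoly_power[where d = 1] rpoly_Suc[OF c_poly]) (auto intro: rpoly.var)
 have Q0: "?Q p = 0" if "p \<in> Y" for p using that by (simp add: Y_eq)
 obtain k where k: "k \<le> n" "V k \<noteq> 0"
 proof (rule ccontr)
  assume no: "\<not> thesis"
  hence V0: "V i = 0" if "i \<le> n" for i using that \<open>\<And>k. k \<le> n ==> V k \<noteq> 0 ==> thesis\<close> by blast
  have lin: "mem M (%p. p i - of_real (U i))" if i: "i \<le> n" for i
   by (rule mem_prime_power[OF prime repr_diff[OF coord_repr[OF i] scalar_repr], of _ 2])
    (use UV[OF i] V0[OF i] in simp)
  let ?U = "%i. complex_of_real (U i)"
  have "mem M (%p. F p - F ?U)" if "rpoly (Suc n) d F" for d F using that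
  proof (induction rule: rpoly.induct)
   case (const d r)
   show ?case by (rule mem_cong[OF mem_0[OF id]]) simp
  next
   case (var i d)
   thus ?case using lin by simp
  next
   case (add d F G)
   show ?case by (rule mem_cong[OF mem_add[OF id add.IH]]) simp
  next
   case (mult d F e G f)
   have "F ?U \<in> \<real>" by (rule rpoly_real[OF mult.hyps(1)]) simp
   then obtain r where r: "F ?U = of_real r" by (auto elim: Reals_cases)
   have "mem M (%p. G p * (F p - F ?U))" by (rule mem_mult[OF id mult.IH(1) poly_repr[OF mult.hyps(2)]])
   moreover have "mem M (%p. of_real r * (G p - G ?U))" by (rule mem_mult[OF id mult.IH(2) scalar_repr])
   ultimately have "mem M (%p. G p * (F p - F ?U) + of_real r * (G p - G ?U))" by (rule mem_add[OF id])
   thus ?case by (rule mem_cong) (simp add: r algebra_simps)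
  qed
  from this[OF Qpoly] have "mem M (%p. ?Q p - ?Q ?U)" .
  hence m: "mem M (%p. - ?Q ?U)" by (rule mem_cong) (use Q0 in simp)
  have cU: "c ?U = of_real (Re (c ?U))" by (rule real_c) simp
  have "- ?Q ?U = of_real (- (U n ^ 2 + Re (c ?U)))" by (subst cU) simp
  hence "mem M (%p. of_real (- (U n ^ 2 + Re (c ?U))))" using m by simp
  hence "- (U n ^ 2 + Re (c ?U)) = 0" by (rule real_not_in_maximal[OF prime])
  moreover have "0 < Re (c ?U)" by (rule c_pos) simp
  moreover have "0 \<le> U n ^ 2" by simp
  ultimately show False by linarith
 qed
 define \<tau> where "\<tau> p = of_real (1 / V k) * (p k - of_real (U k))" for p :: "nat => complex"
 have \<tau>r: "repr \<tau>" unfolding \<tau>_def by (intro repr_mult scalar_repr repr_diff coord_repr k(1))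
 have \<tau>2: "mem M (%p. \<tau> p ^ 2 + 1)"
 proof -
  have "mem M (%p. of_real ((1 / V k)^2) * ((p k - of_real (U k))^2 + of_real (V k ^ 2)))"
   by (rule mem_mult[OF id UV[OF k(1)] scalar_repr])
  thus ?thesis
  proof (rule mem_cong)
   fix p :: "nat => complex"
   have "complex_of_real ((1 / V k)^2) * of_real (V k ^ 2) = 1" using k(2) by (simp flip: of_real_mult add: power_divide)
   thus "of_real ((1 / V k)^2) * ((p k - of_real (U k))^2 + of_real (V k ^ 2)) = \<tau> p ^ 2 + 1"
    by (simp add: \<tau>_def power_mult_distrib distrib_left power_divide)
  qed
 qed
 have indep: "a = 0 \<and> b = 0" if ab: "mem M (%p. of_real a + of_real b * \<tau> p)" for a b :: real
 proof -
  have "mem M (%p. (of_real a - of_real b * \<tau> p) * (of_real a + of_real b * \<tau> p))"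
   by (rule mem_mult[OF id ab]) (intro repr_diff repr_mult scalar_repr \<tau>r)
  moreover have "mem M (%p. of_real (b^2) * (\<tau> p ^ 2 + 1))" by (rule mem_mult[OF id \<tau>2 scalar_repr])
  ultimately have "mem M (%p. (of_real a - of_real b * \<tau> p) * (of_real a + of_real b * \<tau> p) + of_real (b^2) * (\<tau> p ^ 2 + 1))"
   by (rule mem_add[OF id])
  hence "mem M (%p. of_real (a^2 + b^2))" by (rule mem_cong) (simp add: algebra_simps power2_eq_square)
  hence "a^2 + b^2 = 0" by (rule real_not_in_maximal[OF prime])
  thus ?thesis by (simp add: sum_power2_eq_zero_iff)
 qed
 have "\<forall>i. \<exists>w::real. i \<le> n --> mem M (%p. p i - (of_real (U i) + of_real w * \<tau> p))"
 proof
  fix i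
  show "\<exists>w::real. i \<le> n --> mem M (%p. p i - (of_real (U i) + of_real w * \<tau> p))"
  proof (cases "i \<le> n")
   case True
   have "mem M (%p. of_real (V i ^ 2) * (\<tau> p ^ 2 + 1))" by (rule mem_mult[OF id \<tau>2 scalar_repr])
   with UV[OF True] have "mem M (%p. ((p i - of_real (U i))^2 + of_real (V i ^ 2)) - of_real (V i ^ 2) * (\<tau> p ^ 2 + 1))"
    by (rule mem_diff[OF id])
   hence "mem M (%p. (p i - (of_real (U i) + of_real (V i) * \<tau> p)) * (p i - (of_real (U i) + of_real (- V i) * \<tau> p)))"
    by (rule mem_cong) (simp add: algebra_simps power2_eq_square)
   hence "mem M (%p. p i - (of_real (U i) + of_real (V i) * \<tau> p)) \<or> mem M (%p. p i - (of_real (U i) + of_real (- V i) * \<tau> p))"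
    by (rule mem_prime[OF prime]) (intro repr_diff repr_add repr_mult scalar_repr \<tau>r coord_repr True)+
   thus ?thesis by blast
  qed simp
 qed
 from choice[OF this] obtain W :: "nat => real"
  where W: "\<forall>i. i \<le> n --> mem M (%p. p i - (of_real (U i) + of_real (W i) * \<tau> p))" ..
 define z where "z i = Complex (U i) (W i)" for i
 have red: "mem M (%p. F p - (of_real (Re (F z)) + of_real (Im (F z)) * \<tau> p))" if "rpoly (Suc n) d F" for d F using that
 proof (induction rule: rpoly.induct)
  case (const d r)
  show ?case by (rule mem_cong[OF mem_0[OF id]]) simp
 next
  case (var i d)
  thus ?case using W by (simp add: z_def less_Suc_eq_le)
 next
  case (add d F G)
  show ?case by (rule mem_cong[OF mem_add[OF id add.IH]]) (simp add: algebra_simps)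
 next
  case (mult d F e G f)
  define f1 where "f1 = Re (F z)" define f2 where "f2 = Im (F z)"
  define g1 where "g1 = Re (G z)" define g2 where "g2 = Im (G z)"
  have "mem M (%p. F p * (G p - (of_real g1 + of_real g2 * \<tau> p)))"
   unfolding g1_def g2_def by (rule mem_mult[OF id mult.IH(2) poly_repr[OF mult.hyps(1)]])
  moreover have "mem M (%p. (of_real g1 + of_real g2 * \<tau> p) * (F p - (of_real f1 + of_real f2 * \<tau> p)))"
   unfolding f1_def f2_def by (rule mem_mult[OF id mult.IH(1)]) (intro repr_add repr_mult scalar_repr \<tau>r)
  ultimately have "mem M (%p. F p * (G p - (of_real g1 + of_real g2 * \<tau> p))
    + (of_real g1 + of_real g2 * \<tau> p) * (F p - (of_real f1 + of_real f2 * \<tau> p)))" by (rule mem_add[OF id])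
  moreover have "mem M (%p. of_real (f2 * g2) * (\<tau> p ^ 2 + 1))" by (rule mem_mult[OF id \<tau>2 scalar_repr])
  ultimately have T: "mem M (%p. F p * (G p - (of_real g1 + of_real g2 * \<tau> p))
    + (of_real g1 + of_real g2 * \<tau> p) * (F p - (of_real f1 + of_real f2 * \<tau> p)) + of_real (f2 * g2) * (\<tau> p ^ 2 + 1))"
   by (rule mem_add[OF id])
  have e: "Re (F z * G z) = f1 * g1 - f2 * g2" "Im (F z * G z) = f1 * g2 + f2 * g1" by (simp_all add: f1_def f2_def g1_def g2_def)
  show ?case unfolding e by (rule mem_cong[OF T]) (simp add: algebra_simps power2_eq_square)
 qed
 have iff: "mem M F \<longleftrightarrow> F z = 0" if F: "rpoly (Suc n) d F" for d F
 proof
  assume "mem M F"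
  from mem_diff[OF id this red[OF F]] have "mem M (%p. of_real (Re (F z)) + of_real (Im (F z)) * \<tau> p)"
   by (rule mem_cong) simp
  thus "F z = 0" using indep by (simp add: complex_eq_iff)
 next
  assume z: "F z = 0"
  show "mem M F" by (rule mem_cong[OF red[OF F]]) (simp add: z)
 qed
 have "mem M ?Q" by (rule mem_cong[OF mem_0[OF id]]) (use Q0 in simp)
 hence zY: "z \<in> Y" using iff[OF Qpoly] by (simp add: Y_eq)
 have "a \<in> M \<longleftrightarrow> ev a z = 0" if a: "a \<in> carrier R" for a
 proof -
  obtain d F where F: "rpoly (Suc n) d F" "\<forall>p\<in>Y. ev a p = F p" using ev_poly[OF a] by blast
  have "a \<in> M \<longleftrightarrow> mem M (ev a)" using mem_ev[OF id a] by simp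
  also have "\<dots> \<longleftrightarrow> mem M F" using mem_cong[of M "ev a" F] mem_cong[of M F "ev a"] F(2) by auto
  also have "\<dots> \<longleftrightarrow> ev a z = 0" using iff[OF F(1)] F(2) zY by simp
  finally show ?thesis .
 qed
 hence "M = point_ideal z" unfolding point_ideal_def using ideal_subsetD[OF id] by blast
 thus ?thesis using zY by blast
qed

end

section \<open>The origin of a chart\<close>

context chart
begin

definition yel :: "nat => 'a" where
 "yel i = (SOME a. a \<in> carrier R \<and> (\<forall>p\<in>Y. ev a p = p i))"

lemma yel:
 assumes "i \<le> n" shows "yel i \<in> carrier R" "p \<in> Y ==> ev (yel i) p = p i"
proof -
 have "\<exists>a. a \<in> carrier R \<and> (\<forall>p\<in>Y. ev a p = p i)" using coord_repr[OF assms] unfolding repr_def by blast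
 from someI_ex[OF this] show "yel i \<in> carrier R" "p \<in> Y ==> ev (yel i) p = p i" by (auto simp: yel_def)
qed

lemma tup_yel: "tup n yel" using yel by (simp add: tup_def)

definition origin :: "nat => complex" where
 "origin = lift (%i. 0)"

lemma origin_Y: "origin \<in> Y" and origin_coord: "i < n ==> origin i = 0" by (simp_all add: origin_def lift_Y lift_coord)

lemma origin_last: "cnj (origin n) = - origin n" "origin n \<noteq> 0" using cnj_last[OF origin_Y] origin_coord by auto

abbreviation "m0 \<equiv> point_ideal origin"

lemma m0_maximal: "maximalideal m0 R" by (rule point_ideal_maximal[OF origin_Y])

lemma yel_m0: "i < n ==> yel i \<in> m0" using yel[of i] origin_Y origin_coord by (simp add: point_ideal_def)

text \<open>The origin stands for two conjugate points over \<open>y = 0\<close>. A function \<open>A + B t\<close>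
 that vanishes at one of them has \<open>A(0) = B(0) = 0\<close>, as \<open>t\<close> is imaginary there.\<close>

lemma origin_expand:
 assumes F: "rpoly (Suc n) d F" and z: "F origin = 0"
 shows "\<exists>G. (\<forall>i<n. repr (G i)) \<and> (\<forall>p\<in>Y. F p = (\<Sum>i<n. G i p * p i))"
proof -
 obtain A B where AB: "rpoly n d A" "B = (%p. 0) \<or> (d \<ge> 1 \<and> rpoly n (d - 1) B)" "\<forall>p\<in>Y. F p = A p + B p * p n"
  using normal_form[OF F] by blast
 have B: "rpoly n d B" using AB(2) rpoly_mono[of n "d - 1" B d n] by (auto intro: rpoly_0)
 obtain A' where A': "\<forall>i<n. rpoly n d (A' i)" "\<forall>p. A p = A (%i. 0) + (\<Sum>i<n. p i * A' i p)"
  using rpoly_at_0[OF AB(1)] by blast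
 obtain B' where B': "\<forall>i<n. rpoly n d (B' i)" "\<forall>p. B p = B (%i. 0) + (\<Sum>i<n. p i * B' i p)"
  using rpoly_at_0[OF B] by blast
 let ?a = "A (%i. 0)" let ?b = "B (%i. 0)" let ?t = "origin n"
 have re: "cnj ?a = ?a" "cnj ?b = ?b"
  using rpoly_real[OF AB(1), of "%i. 0"] rpoly_real[OF B, of "%i. 0"] by (simp_all add: Reals_cnj_iff)
 have "A origin = ?a" "B origin = ?b"
  using rpoly_cong[OF AB(1), of origin "%i. 0"] rpoly_cong[OF B, of origin "%i. 0"] origin_coord by auto
 hence e: "?a + ?b * ?t = 0" using AB(3) origin_Y z by auto
 have "cnj (?a + ?b * ?t) = ?a - ?b * ?t" using re origin_last(1) by simp
 hence e': "?a - ?b * ?t = 0" using e by simp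
 have "2 * ?a = (?a + ?b * ?t) + (?a - ?b * ?t)" by simp
 hence a0: "?a = 0" using e e' by simp
 hence b0: "?b = 0" using e origin_last(2) by simp
 show ?thesis
 proof (intro exI conjI allI impI ballI)
  show "repr (%p. A' i p + B' i p * p n)" if "i < n" for i
  proof (intro repr_add repr_mult coord_repr)
   show "repr (A' i)" "repr (B' i)" using A'(1) B'(1) that poly_repr[OF rpoly_Suc] by blast+
  qed simp
  show "F p = (\<Sum>i<n. (A' i p + B' i p * p n) * p i)" if "p \<in> Y" for p
  proof -
   have "A p = (\<Sum>i<n. p i * A' i p)" "B p = (\<Sum>i<n. p i * B' i p)" using A'(2) B'(2) a0 b0 by auto
   thus ?thesis using AB(3) that by (simp add: sum.distrib sum_distrib_left sum_distrib_right algebra_simps)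
  qed
 qed
qed

lemma repr_family:
 assumes "\<And>i. i < k ==> repr (G i)"
 shows "\<exists>v. tup k v \<and> (\<forall>i<k. \<forall>p\<in>Y. ev (v i) p = G i p)"
proof -
 have "\<forall>i. \<exists>a. i < k --> a \<in> carrier R \<and> (\<forall>p\<in>Y. ev a p = G i p)" using assms unfolding repr_def by blast
 from choice[OF this] obtain v where "\<forall>i. i < k --> v i \<in> carrier R \<and> (\<forall>p\<in>Y. ev (v i) p = G i p)" ..
 thus ?thesis unfolding tup_def by blast
qed

lemma origin_gen:
 assumes x: "x \<in> m0" shows "\<exists>v. tup n v \<and> x = lincomb n v yel"
proof -
 have xc: "x \<in> carrier R" "ev x origin = 0" using x by (auto simp: point_ideal_def)
 obtain d F where F: "rpoly (Suc n) d F" "\<forall>p\<in>Y. ev x p = F p" using ev_poly[OF xc(1)] by blast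
 have "F origin = 0" using F(2) xc(2) origin_Y by auto
 then obtain G where G: "\<forall>i<n. repr (G i)" "\<forall>p\<in>Y. F p = (\<Sum>i<n. G i p * p i)" using origin_expand[OF F(1)] by blast
 obtain v where v: "tup n v" "\<forall>i<n. \<forall>p\<in>Y. ev (v i) p = G i p" using repr_family[of n G] G(1) by blast
 have "x = lincomb n v yel"
 proof (rule ev_inject[OF xc(1) lincomb_closed[OF v(1) tup_yel]])
  fix p assume p: "p \<in> Y"
  have "ev (lincomb n v yel) p = (\<Sum>i<n. G i p * p i)"
   unfolding ev_lincomb[OF v(1) tup_yel p] using v(2) yel p by (intro sum.cong) auto
  thus "ev x p = ev (lincomb n v yel) p" using F(2) G(2) p by simp
 qed
 thus ?thesis using v(1) by blast
qed

lemma plane_prime_origin: "plane_prime n = m0"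
proof
 show "plane_prime n \<subseteq> m0"
 proof
  fix a assume "a \<in> plane_prime n"
  thus "a \<in> m0" using origin_Y origin_coord by (simp add: plane_prime_def point_ideal_def)
 qed
 show "m0 \<subseteq> plane_prime n"
 proof
  fix a assume a: "a \<in> m0"
  then obtain v where v: "tup n v" "a = lincomb n v yel" using origin_gen by blast
  have "ev a p = 0" if "p \<in> Y" "\<forall>i<n. p i = 0" for p
   unfolding v(2) ev_lincomb[OF v(1) tup_yel that(1)] using yel(2) that by simp
  thus "a \<in> plane_prime n" using a by (simp add: plane_prime_def point_ideal_def)
 qed
qed

lemma plane_prime_strict:
 assumes k: "k < n" shows "plane_prime k \<subset> plane_prime (Suc k)"
proof
 show "plane_prime k \<subseteq> plane_prime (Suc k)" by (auto simp: plane_prime_def)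
 let ?p = "lift (%i. if i = k then 1 else 0)"
 have "ev (yel k) ?p = 1" using yel(2)[of k ?p] lift_Y lift_coord[OF k] k by simp
 moreover have "\<forall>i<n. ?p i \<in> \<real>" "\<forall>i<n. i < k --> ?p i = 0" using lift_coord by auto
 ultimately have "yel k \<notin> plane_prime k" unfolding plane_prime_def using lift_Y by fastforce
 moreover have "yel k \<in> plane_prime (Suc k)" using yel[of k] k by (simp add: plane_prime_def)
 ultimately show "plane_prime k \<noteq> plane_prime (Suc k)" by blast
qed

lemma krull_dim_eq: "krull_dim R = enat n"
proof (rule antisym[OF krull_dim_le])
 show "enat n \<le> krull_dim R" unfolding krull_dim_def
  by (rule chain_sup_ge[where c = plane_prime]) (use plane_prime_prime plane_prime_strict in auto)
qed

lemma prime_height_origin: "prime_height R m0 = enat n"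
proof (rule antisym)
 show "prime_height R m0 \<le> enat n"
 proof -
  have "prime_height R m0 \<le> krull_dim R" unfolding prime_height_def krull_dim_def by (rule chain_sup_mono) (rule conjunct1)
  thus ?thesis using krull_dim_le by (rule order_trans)
 qed
 have sub: "plane_prime i \<subseteq> m0" if "i \<le> n" for i
  unfolding plane_prime_origin[symmetric] using that by (auto simp: plane_prime_def)
 show "enat n \<le> prime_height R m0" unfolding prime_height_def
  by (rule chain_sup_ge[where c = plane_prime]) (use plane_prime_prime plane_prime_strict sub in auto)
qed

lemma ideal_height_origin: "ideal_height R m0 = enat n"
proof -
 have "P = m0" if P: "primeideal P R" "m0 \<subseteq> P" for P
 proof -
  have id: "ideal P R" by (rule primeideal.axioms(1)[OF P(1)])
  have "P \<subseteq> carrier R" using ideal_subsetD[OF id] by blast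
  from maximalideal.I_maximal[OF m0_maximal id P(2) this] primeideal.I_notcarr[OF P(1)]
  show ?thesis by blast
 qed
 hence "{P. primeideal P R \<and> m0 \<subseteq> P} = {m0}" using maximalideal_prime[OF m0_maximal] by blast
 thus ?thesis by (simp add: ideal_height_def prime_height_origin)
qed

text \<open>The line through the point: its last coordinate generates the maximal ideal on the curve cut
  out by the other coordinates.\<close>

lemma origin_rationally_trivial: "frag_of m0 \<in> rationally_trivial R"
proof (rule point_rationally_trivial)
 let ?k = "n - 1"
 have k: "Suc ?k = n" "?k < n" using npos by auto
 show "maximalideal m0 R" by (rule m0_maximal)
 show "primeideal (plane_prime ?k) R" by (rule plane_prime_prime)
 show "plane_prime ?k \<subseteq> m0" using plane_prime_strict[OF k(2)] plane_prime_origin k(1) by auto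
 show "yel ?k \<in> m0" by (rule yel_m0[OF k(2)])
 show "yel ?k \<notin> plane_prime ?k"
 proof
  let ?p = "lift (%i. if i = ?k then 1 else 0)"
  assume "yel ?k \<in> plane_prime ?k"
  moreover have "\<forall>i<n. ?p i \<in> \<real>" "\<forall>i<n. i < ?k --> ?p i = 0" using lift_coord by auto
  ultimately have "ev (yel ?k) ?p = 0" unfolding plane_prime_def using lift_Y by blast
  moreover have "ev (yel ?k) ?p = 1" using yel(2)[of ?k ?p] lift_Y lift_coord[OF k(2)] k by simp
  ultimately show False by simp
 qed
 show "\<exists>y\<in>carrier R. x \<ominus> y \<otimes> yel ?k \<in> plane_prime ?k" if x: "x \<in> m0" for x
 proof -
  obtain v where v: "tup n v" "x = lincomb n v yel" using origin_gen[OF x] by blast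
  have vk: "v ?k \<in> carrier R" "yel ?k \<in> carrier R" using tupD[OF v(1) k(2)] yel(1)[of ?k] by auto
  have xc: "x \<in> carrier R" using x by (simp add: point_ideal_def)
  have "ev (x \<ominus> v ?k \<otimes> yel ?k) p = 0" if p: "p \<in> Y" "\<forall>i<n. i < ?k --> p i = 0" for p
  proof -
   have "ev x p = (\<Sum>i<n. ev (v i) p * ev (yel i) p)" unfolding v(2) by (rule ev_lincomb[OF v(1) tup_yel p(1)])
   also have "\<dots> = ev (v ?k) p * ev (yel ?k) p"
    by (subst sum.remove[of _ ?k]) (use k p yel(2) in \<open>auto intro!: sum.neutral\<close>)
   finally show ?thesis using xc vk p(1) by (simp add: ev_minus ev_mult)
  qed
  hence "x \<ominus> v ?k \<otimes> yel ?k \<in> plane_prime ?k" using xc vk by (simp add: plane_prime_def)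
  thus ?thesis using vk by blast
 qed
 show "P = plane_prime ?k \<or> maximalideal P R" if P: "primeideal P R" "plane_prime ?k \<subseteq> P" for P
 proof (rule ccontr)
  assume no: "\<not> ?thesis"
  have id: "ideal P R" by (rule primeideal.axioms(1)[OF P(1)])
  obtain M where M: "maximalideal M R" "P \<subseteq> M" using exists_maximal_above[OF id] primeideal.I_notcarr[OF P(1)] by metis
  have PM: "P \<subset> M" using M no by blast
  define d where "d i = (if i < n then plane_prime i else if i = n then P else M)" for i
  have "enat (Suc n) \<le> krull_dim R" unfolding krull_dim_def
  proof (rule chain_sup_ge[where c = d])
   show "primeideal (d i) R" if "i \<le> Suc n" for i
    using plane_prime_prime P(1) maximalideal_prime[OF M(1)] by (simp add: d_def)
   show "d i \<subset> d (Suc i)" if i: "i < Suc n" for i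
   proof -
    consider "Suc i < n" | "Suc i = n" | "i = n" using i by linarith
    thus ?thesis
    proof cases
     case 1 thus ?thesis using plane_prime_strict[of i] by (simp add: d_def)
    next
     case 2
     hence "i = ?k" by simp
     moreover have "plane_prime ?k \<subset> P" using P(2) no by blast
     ultimately show ?thesis using 2 k by (simp add: d_def)
    next
     case 3 thus ?thesis using PM by (simp add: d_def)
    qed
   qed
  qed
  thus False using krull_dim_eq by simp
 qed
qed

section \<open>Derivatives along the coordinates\<close>

text \<open>The \<open>j\<close>-th coordinate moves by \<open>s\<close>, and \<open>t\<close> follows on the branch
  of the square root through the given point; this is the flow of the vector field dual to \<open>dy\<^sub>j\<close>.\<close>

definition flow :: "(nat => complex) => nat => complex => nat => complex" where
 "flow p j s = (p(j := p j + s))(n := p n * csqrt (c (p(j := p j + s)) / c p))"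

lemma c_nonzero: "p \<in> Y ==> p n \<noteq> 0 ==> c p \<noteq> 0" by (auto simp: Y_eq)

lemma flow_Y:
 assumes p: "p \<in> Y" "p n \<noteq> 0" and j: "j < n" shows "flow p j s \<in> Y"
proof -
 have "c (flow p j s) = c (p(j := p j + s))" unfolding flow_def by (rule c_upd)
 moreover have "p n ^ 2 = - c p" using p(1) by (simp add: Y_eq eq_neg_iff_add_eq_0)
 ultimately show ?thesis using c_nonzero[OF p] by (simp add: Y_eq flow_def power_mult_distrib)
qed

lemma flow_0: "p \<in> Y ==> p n \<noteq> 0 ==> j < n ==> flow p j 0 = p"
 using c_nonzero[of p] by (auto simp: flow_def fun_eq_iff)

lemma flow_deriv:
 assumes p: "p \<in> Y" "p n \<noteq> 0" and j: "j < n"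
 shows "rpoly (Suc n) d F ==> (%s. F (flow p j s)) field_differentiable (at 0)"
proof (induction rule: rpoly.induct)
 case (var i d)
 obtain c' where c': "((%s. c (p(j := p j + s))) has_field_derivative c' p) (at 0)" using rpoly_partial[OF c_poly, of j] by blast
 have "((%s. csqrt (c (p(j := p j + s)) / c p)) has_field_derivative (1 / (2 * csqrt 1)) * (c' p / c p)) (at 0)"
 proof (rule DERIV_chain2[where f = csqrt and g = "%s. c (p(j := p j + s)) / c p"])
  show "(csqrt has_field_derivative 1 / (2 * csqrt 1)) (at (c (p(j := p j + 0)) / c p))"
   using has_field_derivative_csqrt[of 1] c_nonzero[OF p] by (simp add: field_simps)
  show "((%s. c (p(j := p j + s)) / c p) has_field_derivative c' p / c p) (at 0)" by (rule DERIV_cdivide[OF c'])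
 qed
 hence t: "(%s. p n * csqrt (c (p(j := p j + s)) / c p)) field_differentiable (at 0)"
  by (intro field_differentiable_mult field_differentiable_const) (auto simp: field_differentiable_def)
 consider "i = n" | "i = j" "i \<noteq> n" | "i \<noteq> j" "i \<noteq> n" by blast
 thus ?case
 proof cases
  case 1 thus ?thesis using t by (simp add: flow_def)
 next
  case 2
  hence "(%s. flow p j s i) = (%s. p j + s)" by (simp add: flow_def)
  thus ?thesis by (simp add: field_differentiable_add field_differentiable_const field_differentiable_ident)
 next
  case 3
  hence "(%s. flow p j s i) = (%s. p i)" by (simp add: flow_def)
  thus ?thesis by (simp add: field_differentiable_const)
 qed
qed (auto intro: field_differentiable_add field_differentiable_mult field_differentiable_const)

definition dd :: "nat => ((nat => complex) => complex) => (nat => complex) => complex" where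
 "dd j F p = deriv (%s. F (flow p j s)) 0"

lemma dd_cong:
 assumes "p \<in> Y" "p n \<noteq> 0" "j < n" "\<And>q. q \<in> Y ==> F q = G q"
 shows "dd j F p = dd j G p"
proof -
 have "(%s. F (flow p j s)) = (%s. G (flow p j s))" using assms(4)[OF flow_Y[OF assms(1-3)]] by (rule ext)
 thus ?thesis by (simp add: dd_def)
qed

lemma dd_DERIV:
 assumes p: "p \<in> Y" "p n \<noteq> 0" and j: "j < n" and F: "repr F"
 shows "((%s. F (flow p j s)) has_field_derivative dd j F p) (at 0)"
proof -
 obtain a where a: "a \<in> carrier R" "\<forall>q\<in>Y. ev a q = F q" using F by (auto simp: repr_def)
 obtain d G where G: "rpoly (Suc n) d G" "\<forall>q\<in>Y. ev a q = G q" using ev_poly[OF a(1)] by blast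
 have "(%s. F (flow p j s)) = (%s. G (flow p j s))" using flow_Y[OF p j] a(2) G(2) by auto
 hence "(%s. F (flow p j s)) field_differentiable (at 0)" using flow_deriv[OF p j G(1)] by simp
 thus ?thesis unfolding dd_def by (rule field_differentiable_derivI)
qed

lemma dd_add:
 assumes p: "p \<in> Y" "p n \<noteq> 0" "j < n" and "repr F" "repr G"
 shows "dd j (%q. F q + G q) p = dd j F p + dd j G p"
 using DERIV_imp_deriv[OF DERIV_add[OF dd_DERIV[OF p assms(4)] dd_DERIV[OF p assms(5)]]]
 by (simp add: dd_def[of j "%q. F q + G q"])

lemma dd_mult:
 assumes p: "p \<in> Y" "p n \<noteq> 0" "j < n" and "repr F" "repr G"
 shows "dd j (%q. F q * G q) p = dd j F p * G p + dd j G p * F p"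
 using DERIV_imp_deriv[OF DERIV_mult[OF dd_DERIV[OF p assms(4)] dd_DERIV[OF p assms(5)]]] flow_0[OF p]
 by (simp add: dd_def[of j "%q. F q * G q"])

lemma dd_const: "dd j (%q. k) p = 0" by (simp add: dd_def)

lemma dd_sum:
 assumes p: "p \<in> Y" "p n \<noteq> 0" "j < n" and F: "\<And>i. i \<in> A ==> repr (F i)"
 shows "dd j (%q. \<Sum>i\<in>A. F i q) p = (\<Sum>i\<in>A. dd j (F i) p)" using F
proof (induction A rule: infinite_finite_induct)
 case (insert x A)
 have "dd j (%q. F x q + (\<Sum>i\<in>A. F i q)) p = dd j (F x) p + dd j (%q. \<Sum>i\<in>A. F i q) p"
  by (rule dd_add[OF p]) (use insert.prems in \<open>auto intro: repr_sum\<close>)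
 thus ?case using insert by simp
qed (simp_all add: dd_const)

lemma dd_coord:
 assumes p: "p \<in> Y" "p n \<noteq> 0" "j < n" and i: "i < n"
 shows "dd j (%q. q i) p = (if i = j then 1 else 0)"
proof -
 have "(%s. flow p j s i) = (%s. if i = j then p i + s else p i)" using i by (auto simp: flow_def)
 moreover have "((%s. if i = j then p i + s else p i) has_field_derivative (if i = j then 1 else 0)) (at 0)"
  by (auto intro!: derivative_eq_intros)
 ultimately show ?thesis by (simp add: dd_def DERIV_imp_deriv)
qed

lemma dd_square:
 assumes p: "p \<in> Y" "p n \<noteq> 0" "j < n" and x: "x \<in> point_ideal p \<cdot> point_ideal p"
 shows "dd j (ev x) p = 0" using x
proof (induction rule: ideal_prod.induct)
 case (prod i k)
 hence c: "i \<in> carrier R" "k \<in> carrier R" "ev i p = 0" "ev k p = 0" by (auto simp: point_ideal_def)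
 have "dd j (ev (i \<otimes> k)) p = dd j (%q. ev i q * ev k q) p" by (rule dd_cong[OF p]) (simp add: ev_mult c)
 also have "\<dots> = 0" using dd_mult[OF p repr_ev[OF c(1)] repr_ev[OF c(2)]] c by simp
 finally show ?case .
next
 case (sum s1 s2)
 have id: "ideal (point_ideal p \<cdot> point_ideal p) R"
  using prod_ideal maximalideal.axioms(1)[OF point_ideal_maximal[OF p(1)]] by blast
 have c: "s1 \<in> carrier R" "s2 \<in> carrier R" using sum.hyps ideal_subsetD[OF id] by blast+
 have "dd j (ev (s1 \<oplus> s2)) p = dd j (%q. ev s1 q + ev s2 q) p" by (rule dd_cong[OF p]) (simp add: ev_add c)
 also have "\<dots> = 0" using dd_add[OF p repr_ev[OF c(1)] repr_ev[OF c(2)]] sum.IH by simp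
 finally show ?case .
qed

lemma dd_lincomb:
 assumes p: "p \<in> Y" "p n \<noteq> 0" "j < n" and v: "tup m v" and l: "tup m l" and z: "\<And>i. i < m ==> ev (l i) p = 0"
 shows "dd j (ev (lincomb m v l)) p = (\<Sum>i<m. ev (v i) p * dd j (ev (l i)) p)"
proof -
 have "dd j (ev (lincomb m v l)) p = dd j (%q. \<Sum>i<m. ev (v i) q * ev (l i) q) p"
  by (rule dd_cong[OF p]) (rule ev_lincomb[OF v l])
 also have "\<dots> = (\<Sum>i<m. dd j (%q. ev (v i) q * ev (l i) q) p)"
  by (rule dd_sum[OF p]) (use v l in \<open>auto simp: tup_def intro: repr_mult repr_ev\<close>)
 also have "\<dots> = (\<Sum>i<m. ev (v i) p * dd j (ev (l i)) p)"
 proof (rule sum.cong[OF refl])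
  fix i assume i: "i \<in> {..<m}"
  hence c: "v i \<in> carrier R" "l i \<in> carrier R" using v l by (auto simp: tup_def)
  show "dd j (%q. ev (v i) q * ev (l i) q) p = ev (v i) p * dd j (ev (l i)) p"
   using dd_mult[OF p repr_ev[OF c(1)] repr_ev[OF c(2)]] z i by simp
 qed
 finally show ?thesis .
qed

text \<open>The derivative along the \<open>i\<close>-th coordinate kills the square of the maximal ideal and picks
  the \<open>i\<close>-th coefficient.\<close>

lemma origin_independent:
 assumes v: "tup n v" and m: "lincomb n v yel \<in> m0 \<cdot> m0" and i: "i < n"
 shows "v i \<in> m0"
proof -
 note o = origin_Y origin_last(2) i
 have "0 = (\<Sum>k<n. ev (v k) origin * dd i (ev (yel k)) origin)"
  using dd_square[OF o m] dd_lincomb[OF o v tup_yel] yel(2)[OF _ origin_Y] origin_coord by simp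
 also have "\<dots> = (\<Sum>k<n. ev (v k) origin * (if k = i then 1 else 0))"
 proof (rule sum.cong[OF refl])
  fix k assume k: "k \<in> {..<n}"
  have "dd i (ev (yel k)) origin = dd i (%q. q k) origin" by (rule dd_cong[OF o]) (use yel(2)[of k] k in auto)
  thus "ev (v k) origin * dd i (ev (yel k)) origin = ev (v k) origin * (if k = i then 1 else 0)" using dd_coord[OF o] k by simp
 qed
 also have "\<dots> = ev (v i) origin" using i by (simp add: if_distrib[of "(*) _"] cong: if_cong)
 finally show ?thesis using tupD[OF v i] by (simp add: point_ideal_def)
qed

text \<open>The Jacobian criterion: elements of a maximal ideal with \<open>n\<close> generators whose Jacobian does
  not vanish at the point generate it modulo its square.\<close>

lemma jacobian_criterion:
 assumes z: "z \<in> Y" "z n \<noteq> 0" and l: "\<And>i. i < n ==> l i \<in> point_ideal z"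
  and gen: "\<And>x. x \<in> point_ideal z ==> \<exists>v. tup n v \<and> x = lincomb n v l"
  and g: "\<And>i. i < n ==> g i \<in> point_ideal z"
  and jac: "sdet n (%(i, j). dd j (ev (g i)) z) \<noteq> 0"
 shows "gens n (point_ideal z) g"
proof -
 let ?q = "point_ideal z"
 have q: "ideal ?q R" by (rule maximalideal.axioms(1)[OF point_ideal_maximal[OF z(1)]])
 note q2 = prod_ideal[OF q]
 have tl: "tup n l" and tg: "tup n g" using l g ideal_subsetD[OF q] by (auto simp: tup_def)
 have lz: "ev (l i) z = 0" if "i < n" for i using l[OF that] by (simp add: point_ideal_def)
 have "\<forall>i. \<exists>v. i < n --> tup n v \<and> g i = lincomb n v l" using gen g by blast
 from choice[OF this] obtain A where A: "\<forall>i. i < n --> tup n (A i) \<and> g i = lincomb n (A i) l" ..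
 define a where "a k i = A i k" for k i
 have ma: "matr n a" using A by (auto simp: matr_def a_def tup_def)
 have ga: "g i = row_mult n l a i" if "i < n" for i using A that by (simp add: row_mult_def a_def)
 define NA where "NA = Matrix.mat n n (%(i, k). ev (A i k) z)"
 define ND where "ND = Matrix.mat n n (%(k, j). dd j (ev (l k)) z)"
 have "Matrix.mat n n (%(i, j). dd j (ev (g i)) z) = NA * ND"
 proof (rule eq_matI)
  fix i j assume "i < dim_row (NA * ND)" "j < dim_col (NA * ND)"
  hence ij: "i < n" "j < n" by (simp_all add: NA_def ND_def)
  have "dd j (ev (g i)) z = (\<Sum>k<n. ev (A i k) z * dd j (ev (l k)) z)" using dd_lincomb[OF z ij(2) _ tl lz] A ij(1) by simp
  thus "Matrix.mat n n (%(i, j). dd j (ev (g i)) z) $$ (i, j) = (NA * ND) $$ (i, j)"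
   using ij by (simp add: NA_def ND_def scalar_prod_def atLeast0LessThan)
 qed (simp_all add: NA_def ND_def)
 hence "Determinant.det NA \<noteq> 0" using jac det_mult[of NA n ND] by (auto simp: NA_def ND_def)
 hence "NA \<in> Units (ring_mat TYPE(complex) n ())" by (intro det_non_zero_imp_unit) (simp_all add: NA_def)
 then obtain B where B: "B \<in> carrier_mat n n" "B * NA = 1\<^sub>m n" by (auto simp: Units_def ring_mat_def)
 have "\<forall>x::nat \<times> nat. \<exists>y. y \<in> carrier R \<and> ev y z = B $$ (snd x, fst x)" using value_lift[OF z(1)] by blast
 from choice[OF this] obtain b' :: "nat \<times> nat => 'a"
  where b': "\<forall>x. b' x \<in> carrier R \<and> ev (b' x) z = B $$ (snd x, fst x)" ..
 define b where "b i k = b' (i, k)" for i k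
 have mb: "matr n b" using b' by (auto simp: matr_def b_def)
 have bz: "ev (b i k) z = B $$ (k, i)" for i k using b' by (simp add: b_def)
 note mab = mat_times_closed[OF ma mb]
 have key: "l k \<ominus> row_mult n g b k \<in> ?q \<cdot> ?q" if k: "k < n" for k
 proof -
  have "row_mult n g b k = row_mult n (row_mult n l a) b k"
   unfolding row_mult_def[of n g] row_mult_def[of n "row_mult n l a"] lincomb_def
   by (rule finsum_cong') (use ga k mb tupD[OF row_mult_closed[OF ma tl]] in \<open>auto simp: matr_def\<close>)
  hence e: "row_mult n g b k = lincomb n (%i. mat_times n a b i k) l"
   using row_mult_assoc[OF ma mb tl k] by (simp add: row_mult_def)
  have e1: "l k = lincomb n (%i. diag (%i. \<one>) i k) l" using row_mult_one[OF tl k] by (simp add: row_mult_def)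
  have t: "tup n (%i. diag (%i. \<one>) i k)" "tup n (%i. mat_times n a b i k)"
   using tup_col[OF matr_one k] tup_col[OF mab k] by auto
  have coef: "diag (%i. \<one>) i k \<ominus> mat_times n a b i k \<in> ?q" if i: "i < n" for i
  proof -
   have "ev (mat_times n a b i k) z = (\<Sum>j<n. B $$ (k, j) * ev (A j i) z)"
    unfolding ev_mat_times[OF ma mb i k z(1)] by (simp add: bz a_def mult.commute)
   also have "\<dots> = (B * NA) $$ (k, i)" using B(1) i k by (simp add: NA_def scalar_prod_def atLeast0LessThan)
   also have "\<dots> = (if i = k then 1 else 0)" using B(2) i k by auto
   finally have "ev (diag (%i. \<one>) i k \<ominus> mat_times n a b i k) z = 0"
    using tupD[OF t(1) i] tupD[OF t(2) i] z(1) by (simp add: ev_minus diag_def ev_one ev_zero)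
   thus ?thesis using tupD[OF t(1) i] tupD[OF t(2) i] by (simp add: point_ideal_def)
  qed
  have "lincomb n (%i. diag (%i. \<one>) i k \<ominus> mat_times n a b i k) l \<in> ?q \<cdot> ?q"
   unfolding lincomb_def by (rule ideal_finsum[OF q2]) (use coef l prod_mem in auto)
  thus ?thesis using lincomb_diff_left[OF t tl] e e1 by simp
 qed
 show ?thesis unfolding gens_def
 proof (intro conjI allI impI ballI)
  fix x assume "x \<in> ?q"
  then obtain w where w: "tup n w" "x = lincomb n w l" using gen by blast
  note tgb = row_mult_closed[OF mb tg]
  have "x \<ominus> lincomb n w (row_mult n g b) \<in> ?q \<cdot> ?q"
   unfolding w(2) lincomb_diff_right[OF w(1) tl tgb] by (rule lincomb_in_ideal[OF q2 w(1) key])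
  moreover have "tup n (%i. \<Oplus>j\<in>{..<n}. b i j \<otimes> w j)" using mb w(1) by (auto simp: tup_def matr_def intro!: finsum_closed)
  ultimately show "\<exists>v. tup n v \<and> x \<ominus> lincomb n v g \<in> ?q \<cdot> ?q"
   unfolding lincomb_row_mult[OF w(1) tg mb] by blast
 qed (use g in auto)
qed

end

section \<open>Finiteness of generic zero sets\<close>

context chart
begin

lemma mem_point: "z \<in> Y ==> mem (point_ideal z) F \<longleftrightarrow> repr F \<and> F z = 0"
 unfolding mem_def repr_def point_ideal_def by auto

text \<open>On \<open>W\<close> the function is a real combination of the monomials with all exponents of the
  \<open>y\<^sub>i\<close> below \<open>K\<close>.\<close>

definition spanned :: "nat => (nat => complex) set => ((nat => complex) => complex) => bool" where
 "spanned K W F \<longleftrightarrow> (\<exists>C::(nat => nat) \<times> nat => real. \<forall>p\<in>W. F p =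
   (\<Sum>x\<in>expbox n K \<times> {0, 1}. of_real (C x) * (monom_val n (fst x) p * p n ^ snd x)))"

lemma spanned_cong: "spanned K W F ==> (\<And>p. p \<in> W ==> F p = G p) ==> spanned K W G" unfolding spanned_def by auto

lemma spanned_add:
 assumes "spanned K W F" "spanned K W G" shows "spanned K W (%p. F p + G p)"
proof -
 obtain C D where "\<forall>p\<in>W. F p = (\<Sum>x\<in>expbox n K \<times> {0, 1}. of_real (C x) * (monom_val n (fst x) p * p n ^ snd x))"
  "\<forall>p\<in>W. G p = (\<Sum>x\<in>expbox n K \<times> {0, 1}. of_real (D x) * (monom_val n (fst x) p * p n ^ snd x))"
  using assms unfolding spanned_def by blast
 thus ?thesis unfolding spanned_def by (intro exI[of _ "%x. C x + D x"]) (simp add: sum.distrib distrib_right)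
qed

lemma spanned_scale:
 assumes "spanned K W F" shows "spanned K W (%p. of_real r * F p)"
proof -
 obtain C where "\<forall>p\<in>W. F p = (\<Sum>x\<in>expbox n K \<times> {0, 1}. of_real (C x) * (monom_val n (fst x) p * p n ^ snd x))"
  using assms unfolding spanned_def by blast
 thus ?thesis unfolding spanned_def by (intro exI[of _ "%x. r * C x"]) (simp add: sum_distrib_left mult.assoc)
qed

lemma spanned_sum: "(\<And>i. i \<in> A ==> spanned K W (F i)) ==> spanned K W (%p. \<Sum>i\<in>A. F i p)"
proof (induction A rule: infinite_finite_induct)
 case (insert x A) thus ?case by (simp add: spanned_add)
qed (auto simp: spanned_def intro: exI[of _ "%x. 0"])

lemma spanned_monom:
 assumes a: "\<alpha> \<in> expbox n K" and e: "e \<in> {0, 1}"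
 shows "spanned K W (%p. monom_val n \<alpha> p * p n ^ e)"
proof -
 let ?E = "expbox n K \<times> {0, 1::nat}"
 have "(\<Sum>x\<in>?E. of_real (if x = (\<alpha>, e) then 1 else 0) * (monom_val n (fst x) p * p n ^ snd x))
   = monom_val n \<alpha> p * p n ^ e" for p
  by (subst sum.remove[of _ "(\<alpha>, e)"]) (use a e finite_box in \<open>auto intro!: sum.neutral\<close>)
 thus ?thesis unfolding spanned_def by (intro exI[of _ "%x. if x = (\<alpha>, e) then 1 else 0"]) simp
qed

lemma monom_reduce:
 assumes i: "i < n" "K \<le> \<alpha> i"
 shows "monom_val n \<alpha> p = p i ^ K * monom_val n (\<alpha>(i := \<alpha> i - K)) p"
  and "(\<Sum>j<n. (\<alpha>(i := \<alpha> i - K)) j) + K = (\<Sum>j<n. \<alpha> j)"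
proof -
 have "monom_val n \<alpha> p = p i ^ \<alpha> i * (\<Prod>j\<in>{..<n} - {i}. p j ^ \<alpha> j)"
  unfolding monom_val_def by (rule prod.remove) (use i in auto)
 moreover have "monom_val n (\<alpha>(i := \<alpha> i - K)) p = p i ^ (\<alpha> i - K) * (\<Prod>j\<in>{..<n} - {i}. p j ^ \<alpha> j)"
  unfolding monom_val_def by (subst prod.remove[of _ i]) (use i in auto)
 moreover have "p i ^ \<alpha> i = p i ^ K * p i ^ (\<alpha> i - K)" using i by (simp flip: power_add)
 ultimately show "monom_val n \<alpha> p = p i ^ K * monom_val n (\<alpha>(i := \<alpha> i - K)) p" by simp
 have "(\<Sum>j<n. \<alpha> j) = \<alpha> i + (\<Sum>j\<in>{..<n} - {i}. \<alpha> j)" by (rule sum.remove) (use i in auto)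
 moreover have "(\<Sum>j<n. (\<alpha>(i := \<alpha> i - K)) j) = \<alpha> i - K + (\<Sum>j\<in>{..<n} - {i}. \<alpha> j)"
  by (subst sum.remove[of _ i]) (use i in auto)
 ultimately show "(\<Sum>j<n. (\<alpha>(i := \<alpha> i - K)) j) + K = (\<Sum>j<n. \<alpha> j)" using i by simp
qed

text \<open>On \<open>W\<close> the power \<open>y\<^sub>i\<^sup>K\<close> equals a function of lower degree, so
  monomials with a large exponent can be reduced, by induction on the degree.\<close>

lemma spanned_poly:
 assumes mu: "\<mu> \<noteq> 0" and K: "K \<ge> 1" and H: "\<And>i. i < n ==> rpoly (Suc n) (K - 1) (H i)"
  and W: "W \<subseteq> Y" "\<And>p i. p \<in> W ==> i < n ==> of_real \<mu> * p i ^ K + H i p = 0"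
 shows "rpoly (Suc n) D F ==> spanned K W F"
proof (induction D arbitrary: F rule: less_induct)
 case (less D)
 have mon: "spanned K W (%p. monom_val n \<alpha> p * p n ^ e)"
  if a: "\<alpha> \<in> {..<n} \<rightarrow>\<^sub>E UNIV" "(\<Sum>i<n. \<alpha> i) + e \<le> D" "e \<in> {0, 1}" for \<alpha> e
 proof (cases "\<alpha> \<in> expbox n K")
  case True thus ?thesis using spanned_monom a(3) by blast
 next
  case False
  then obtain i where i: "i < n" "K \<le> \<alpha> i" using a(1) by (force simp: expbox_def PiE_iff)
  let ?b = "\<alpha>(i := \<alpha> i - K)"
  note red = monom_reduce[of i K \<alpha>, OF i]
  have lt: "D - 1 < D" using red(2) a(2) K by linarith
  have "rpoly (Suc n) (D - 1) (%p. H i p * (monom_val n ?b p * p n ^ e))"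
  proof (rule rpoly.mult[OF H[OF i(1)]])
   show "rpoly (Suc n) ((\<Sum>j<n. ?b j) + e) (%p. monom_val n ?b p * p n ^ e)"
   proof (rule rpoly.mult)
    show "rpoly (Suc n) (\<Sum>j<n. ?b j) (monom_val n ?b)" by (rule rpoly_monom) auto
    show "rpoly (Suc n) e (%p. p n ^ e)" by (rule rpoly_power[OF rpoly.var[of n "Suc n" 1]]) auto
   qed simp
   show "K - 1 + ((\<Sum>j<n. ?b j) + e) \<le> D - 1" using red(2) a(2) K by linarith
  qed
  from spanned_scale[OF less.IH[OF lt this], of "- 1 / \<mu>"]
  show ?thesis
  proof (rule spanned_cong)
   fix p assume p: "p \<in> W"
   have mc: "complex_of_real \<mu> \<noteq> 0" using mu by simp
   have "H i p = - (of_real \<mu> * p i ^ K)" using W(2)[OF p i(1)] by (simp add: eq_neg_iff_add_eq_0 add.commute)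
   thus "of_real (- 1 / \<mu>) * (H i p * (monom_val n ?b p * p n ^ e)) = monom_val n \<alpha> p * p n ^ e"
    unfolding red(1)[of p] using mc by simp
  qed
 qed
 obtain A B where AB: "rpoly n D A" "B = (%p. 0) \<or> (D \<ge> 1 \<and> rpoly n (D - 1) B)" "\<forall>p\<in>Y. F p = A p + B p * p n"
  using normal_form[OF less.prems] by blast
 have "spanned K W A"
 proof -
  obtain a :: "(nat => nat) => real" where a: "\<forall>p. A p = (\<Sum>\<alpha>\<in>exps n D. of_real (a \<alpha>) * monom_val n \<alpha> p)"
   using rpoly_expand[OF AB(1)] by blast
  have "spanned K W (%p. \<Sum>\<alpha>\<in>exps n D. of_real (a \<alpha>) * (monom_val n \<alpha> p * p n ^ 0))"
   by (intro spanned_sum spanned_scale mon) (auto simp: exps_def)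
  thus ?thesis by (rule spanned_cong) (use a in simp)
 qed
 moreover have "spanned K W (%p. B p * p n)" using AB(2)
 proof
  assume "B = (%p. 0)" thus ?thesis by (auto simp: spanned_def intro: exI[of _ "%x. 0"])
 next
  assume B: "D \<ge> 1 \<and> rpoly n (D - 1) B"
  then obtain a :: "(nat => nat) => real" where a: "\<forall>p. B p = (\<Sum>\<alpha>\<in>exps n (D - 1). of_real (a \<alpha>) * monom_val n \<alpha> p)"
   using rpoly_expand by blast
  have "spanned K W (%p. \<Sum>\<alpha>\<in>exps n (D - 1). of_real (a \<alpha>) * (monom_val n \<alpha> p * p n ^ 1))"
  proof (rule spanned_sum, rule spanned_scale, rule mon)
   fix \<alpha> assume "\<alpha> \<in> exps n (D - 1)"
   hence a: "\<alpha> \<in> {..<n} \<rightarrow>\<^sub>E UNIV" "(\<Sum>i<n. \<alpha> i) \<le> D - 1" by (simp_all add: exps_def)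
   show "\<alpha> \<in> {..<n} \<rightarrow>\<^sub>E UNIV" by (rule a(1))
   show "(\<Sum>i<n. \<alpha> i) + 1 \<le> D" using a(2) B by linarith
  qed simp
  thus ?thesis by (rule spanned_cong) (use a in \<open>simp add: sum_distrib_right mult.assoc\<close>)
 qed
 ultimately have "spanned K W (%p. A p + B p * p n)" by (rule spanned_add)
 thus ?case by (rule spanned_cong) (use AB(3) W(1) in auto)
qed

text \<open>Functions that separate finitely many maximal ideals are linearly independent, so
  \<open>spanned_poly\<close> bounds the number of maximal ideals.\<close>

lemma finite_zero_set:
 assumes mu: "\<mu> \<noteq> 0" and K: "K \<ge> 1" and H: "\<And>i. i < n ==> rpoly (Suc n) (K - 1) (H i)"
 shows "finite {M. maximalideal M R \<and> (\<forall>i<n. mem M (%p. of_real \<mu> * p i ^ K + H i p))}" (is "finite ?V")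
proof (rule ccontr)
 assume inf: "infinite ?V"
 define W where "W = {p\<in>Y. \<forall>i<n. of_real \<mu> * p i ^ K + H i p = 0}"
 let ?E = "expbox n K \<times> {0, 1::nat}"
 obtain S where S: "finite S" "card S = Suc (card ?E)" "S \<subseteq> ?V" using infinite_arbitrarily_large[OF inf] by blast
 have mx: "maximalideal M R" if "M \<in> S" for M using S(3) that by blast
 have "\<forall>M. \<exists>z. M \<in> S --> z \<in> Y \<and> M = point_ideal z" using nullstellensatz mx by blast
 from choice[OF this] obtain z where z: "\<forall>M. M \<in> S --> z M \<in> Y \<and> M = point_ideal (z M)" ..
 have "\<exists>u. M \<in> S --> u \<in> carrier R \<and> u \<notin> M \<and> (\<forall>N\<in>S - {M}. u \<in> N)" for M
 proof (cases "M \<in> S")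
  case True
  have "\<exists>u\<in>carrier R. u \<notin> M \<and> (\<forall>N\<in>S - {M}. u \<in> N)"
  proof (rule prime_avoid_inter)
   show "primeideal M R" by (rule maximalideal_prime[OF mx[OF True]])
   show "finite (S - {M})" using S(1) by simp
   show "ideal N R" if "N \<in> S - {M}" for N using mx[of N] that maximalideal.axioms(1) by blast
   show "\<not> N \<subseteq> M" if "N \<in> S - {M}" for N using maximal_unique[OF mx mx, of N M] that True by blast
  qed
  thus ?thesis by blast
 qed simp
 hence "\<forall>M. \<exists>u. M \<in> S --> u \<in> carrier R \<and> u \<notin> M \<and> (\<forall>N\<in>S - {M}. u \<in> N)" by blast
 from choice[OF this] obtain u where u: "\<forall>M. M \<in> S --> u M \<in> carrier R \<and> u M \<notin> M \<and> (\<forall>N\<in>S - {M}. u M \<in> N)" ..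
 have W: "W \<subseteq> Y" "\<And>p i. p \<in> W ==> i < n ==> of_real \<mu> * p i ^ K + H i p = 0" by (auto simp: W_def)
 have "spanned K W (ev (u M))" if M: "M \<in> S" for M
 proof -
  obtain d F where F: "rpoly (Suc n) d F" "\<forall>p\<in>Y. ev (u M) p = F p" using ev_poly u M by blast
  have "spanned K W F" by (rule spanned_poly[OF mu K H W F(1)])
  thus ?thesis by (rule spanned_cong) (use F(2) W(1) in auto)
 qed
 hence "\<forall>M. \<exists>C::(nat => nat) \<times> nat => real. M \<in> S --> (\<forall>p\<in>W. ev (u M) p =
   (\<Sum>x\<in>?E. of_real (C x) * (monom_val n (fst x) p * p n ^ snd x)))" unfolding spanned_def by blast
 from choice[OF this] obtain C :: "'a set => (nat => nat) \<times> nat => real"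
  where C: "\<forall>M. M \<in> S --> (\<forall>p\<in>W. ev (u M) p = (\<Sum>x\<in>?E. of_real (C M x) * (monom_val n (fst x) p * p n ^ snd x)))" ..
 obtain r where r: "\<exists>M\<in>S. r M \<noteq> 0" "\<forall>x\<in>?E. (\<Sum>M\<in>S. r M * C M x) = 0"
  using lin_dep[of ?E S C] S finite_box[of n K] by (auto simp: finite_cartesian_product)
 have rel: "(\<Sum>M\<in>S. of_real (r M) * ev (u M) p) = 0" if p: "p \<in> W" for p
 proof -
  have "(\<Sum>M\<in>S. of_real (r M) * ev (u M) p)
   = (\<Sum>M\<in>S. \<Sum>x\<in>?E. of_real (r M * C M x) * (monom_val n (fst x) p * p n ^ snd x))"
   using C p by (intro sum.cong refl) (simp add: sum_distrib_left mult.assoc)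
  also have "\<dots> = (\<Sum>x\<in>?E. of_real (\<Sum>M\<in>S. r M * C M x) * (monom_val n (fst x) p * p n ^ snd x))"
   by (subst sum.swap) (simp add: sum_distrib_right)
  also have "\<dots> = 0"
  proof (rule sum.neutral, rule ballI)
   fix x assume "x \<in> ?E"
   hence "(\<Sum>M\<in>S. r M * C M x) = 0" using r(2) by blast
   thus "of_real (\<Sum>M\<in>S. r M * C M x) * (monom_val n (fst x) p * p n ^ snd x) = 0"
    by (simp only: of_real_0 mult_zero_left)
  qed
  finally show ?thesis .
 qed
 obtain M where M: "M \<in> S" "r M \<noteq> 0" using r(1) by blast
 have zY: "z M \<in> Y" "M = point_ideal (z M)" using z M(1) by auto
 have "z M \<in> W" unfolding W_def
 proof (intro CollectI conjI allI impI)
  fix i assume "i < n"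
  hence "mem M (%p. of_real \<mu> * p i ^ K + H i p)" using S(3) M(1) by blast
  thus "of_real \<mu> * z M i ^ K + H i (z M) = 0" using mem_point[OF zY(1)] zY(2) by metis
 qed (rule zY(1))
 from rel[OF this] have "0 = (\<Sum>N\<in>S. of_real (r N) * ev (u N) (z M))" by simp
 also have "\<dots> = of_real (r M) * ev (u M) (z M) + (\<Sum>N\<in>S - {M}. of_real (r N) * ev (u N) (z M))"
  by (rule sum.remove[OF S(1) M(1)])
 also have "(\<Sum>N\<in>S - {M}. of_real (r N) * ev (u N) (z M)) = 0"
 proof (rule sum.neutral, rule ballI)
  fix N assume N: "N \<in> S - {M}"
  hence "u N \<in> M" using u M(1) by blast
  hence "u N \<in> point_ideal (z M)" using zY(2) by simp
  thus "of_real (r N) * ev (u N) (z M) = 0" by (simp add: point_ideal_def)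
 qed
 finally have "ev (u M) (z M) = 0" using M(2) by simp
 moreover have "u M \<in> carrier R" "u M \<notin> point_ideal (z M)" using u M(1) zY(2) by auto
 ultimately show False by (simp add: point_ideal_def)
qed

section \<open>Avoiding the critical locus\<close>

text \<open>The ring is a domain, its zero ideal being \<open>plane_prime 0\<close>.\<close>

lemma vanish_cancel:
 assumes F: "repr F" and G: "repr G" and z: "\<And>p. p \<in> Y ==> F p * G p = 0"
  and p0: "p0 \<in> Y" "F p0 \<noteq> 0" and p: "p \<in> Y"
 shows "G p = 0"
proof -
 have van: "H q = 0" if H: "mem (plane_prime 0) H" and q: "q \<in> Y" for H q
 proof -
  obtain a where a: "a \<in> plane_prime 0" "\<forall>p\<in>Y. ev a p = H p" using H by (auto simp: mem_def)
  have ac: "a \<in> carrier R" using a(1) by (simp add: plane_prime_def)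
  obtain d E where E: "rpoly (Suc n) d E" "\<forall>p\<in>Y. ev a p = E p" using ev_poly[OF ac] by blast
  have "E q = 0" by (rule vanish_on_real_points[OF E(1) _ q]) (use a(1) E(2) in \<open>auto simp: plane_prime_def\<close>)
  thus ?thesis using a(2) E(2) q by simp
 qed
 have "mem (plane_prime 0) (%p. 0)" using mem_0 primeideal.axioms(1)[OF plane_prime_prime] by blast
 hence "mem (plane_prime 0) (%p. F p * G p)" by (rule mem_cong) (use z in simp)
 hence "mem (plane_prime 0) F \<or> mem (plane_prime 0) G" by (rule mem_prime[OF plane_prime_prime _ F G])
 thus ?thesis using van[of F p0] van[of G p] p0 p by blast
qed

text \<open>For \<open>D\<close> large, the functions \<open>f\<^sup>\<alpha>
  h\<^sup>n\<^sup>D\<^sup>-\<^sup>|\<^sup>\<alpha>\<^sup>| J\<^sup>j\<close> with \<open>\<alpha>\<^sub>i < D\<close>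
 and \<open>j < M\<close> outnumber the dimension of the space that contains them. In the resulting relation the
 lowest power of \<open>J\<close> cancels, and then a zero of \<open>J\<close> is a zero of the lowest coefficient, a
 polynomial in the \<open>f\<^sub>i / h\<close>. So any \<open>s\<close> at which this polynomial does not vanish
 will do.\<close>

lemma generic_values:
 assumes f: "\<And>i. i < n ==> rpoly (Suc n) K (f i)" and h: "rpoly (Suc n) K h"
  and J: "rpoly (Suc n) e J" and p0: "p0 \<in> Y" "J p0 \<noteq> 0"
 shows "\<exists>s::nat => real. \<forall>z\<in>Y. h z \<noteq> 0 --> (\<forall>i<n. f i z = of_real (s i) * h z) --> J z \<noteq> 0"
proof -
 define M where "M = 2 * Suc (n * K) ^ n + 1"
 define D where "D = Suc (e * M)"
 define deg where "deg \<alpha> = (\<Sum>i<n. \<alpha> i)" for \<alpha> :: "nat => nat"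
 define mon where "mon \<alpha> p = (\<Prod>i<n. f i p ^ \<alpha> i) * h p ^ (n * D - deg \<alpha>)" for \<alpha> p
 have degle: "deg \<alpha> \<le> n * D" if "\<alpha> \<in> expbox n D" for \<alpha>
 proof -
  have "deg \<alpha> \<le> (\<Sum>i<n. D)" unfolding deg_def by (rule sum_mono) (use that in \<open>force simp: expbox_def PiE_iff\<close>)
  thus ?thesis by simp
 qed
 have monr: "rpoly (Suc n) (n * D * K) (mon \<alpha>)" if a: "\<alpha> \<in> expbox n D" for \<alpha> unfolding mon_def
 proof (rule rpoly.mult)
  show "rpoly (Suc n) (\<Sum>i<n. K * \<alpha> i) (%p. \<Prod>i<n. f i p ^ \<alpha> i)"
   by (rule rpoly_prod[where d = "%i. K * \<alpha> i"]) (auto intro: rpoly_power[OF f])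
  show "rpoly (Suc n) (K * (n * D - deg \<alpha>)) (%p. h p ^ (n * D - deg \<alpha>))" by (rule rpoly_power[OF h]) simp
  have "(\<Sum>i<n. K * \<alpha> i) + K * (n * D - deg \<alpha>) = K * (deg \<alpha> + (n * D - deg \<alpha>))"
   by (simp add: deg_def sum_distrib_left distrib_left)
  thus "(\<Sum>i<n. K * \<alpha> i) + K * (n * D - deg \<alpha>) \<le> n * D * K" using degle[OF a] by simp
 qed
 let ?I = "expbox n D \<times> {..<M}"
 have "\<exists>r::(nat => nat) \<times> nat => real. (\<exists>x\<in>?I. r x \<noteq> 0) \<and> (\<forall>p\<in>Y. (\<Sum>x\<in>?I. of_real (r x) * (mon (fst x) p * J p ^ snd x)) = 0)"
 proof (rule dependent)
  show "finite ?I" using finite_box by blast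
  show "rpoly (Suc n) (n * D * K + e * M) (%p. mon (fst x) p * J p ^ snd x)" if "x \<in> ?I" for x
  proof (rule rpoly.mult)
   show "rpoly (Suc n) (n * D * K) (mon (fst x))" using monr that by auto
   show "rpoly (Suc n) (e * snd x) (%p. J p ^ snd x)" by (rule rpoly_power[OF J]) simp
   show "n * D * K + e * snd x \<le> n * D * K + e * M" using that by auto
  qed
  have "Suc (n * D * K + e * M) = Suc (n * K) * D" by (simp add: D_def algebra_simps)
  hence "2 * Suc (n * D * K + e * M) ^ n = (2 * Suc (n * K) ^ n) * D ^ n" by (simp only: power_mult_distrib mult.assoc)
  also have "\<dots> < M * D ^ n" by (rule mult_strict_right_mono) (simp_all add: M_def D_def)
  finally show "2 * Suc (n * D * K + e * M) ^ n < card ?I" by (simp add: card_cartesian_product card_box mult.commute)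
 qed
 then obtain r :: "(nat => nat) \<times> nat => real" where r: "\<exists>x\<in>?I. r x \<noteq> 0"
  "\<forall>p\<in>Y. (\<Sum>x\<in>?I. of_real (r x) * (mon (fst x) p * J p ^ snd x)) = 0" by blast
 define Q where "Q j p = (\<Sum>\<alpha>\<in>expbox n D. of_real (r (\<alpha>, j)) * mon \<alpha> p)" for j p
 define j0 where "j0 = (LEAST j. j < M \<and> (\<exists>\<alpha>\<in>expbox n D. r (\<alpha>, j) \<noteq> 0))"
 have ex: "\<exists>j. j < M \<and> (\<exists>\<alpha>\<in>expbox n D. r (\<alpha>, j) \<noteq> 0)" using r(1) by auto
 have j0: "j0 < M" "\<exists>\<alpha>\<in>expbox n D. r (\<alpha>, j0) \<noteq> 0"
  using LeastI_ex[OF ex] by (simp_all add: j0_def)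
 have less: "r (\<alpha>, j) = 0" if "j < j0" "\<alpha> \<in> expbox n D" for j \<alpha>
  using not_less_Least[of j "%j. j < M \<and> (\<exists>\<alpha>\<in>expbox n D. r (\<alpha>, j) \<noteq> 0)"] that j0(1) by (auto simp: j0_def)
 have rel: "J p ^ j0 * (\<Sum>j\<in>{j0..<M}. Q j p * J p ^ (j - j0)) = 0" if p: "p \<in> Y" for p
 proof -
  have "0 = (\<Sum>\<alpha>\<in>expbox n D. \<Sum>j<M. of_real (r (\<alpha>, j)) * (mon \<alpha> p * J p ^ j))"
   using r(2) p by (simp add: sum.cartesian_product case_prod_unfold)
  also have "\<dots> = (\<Sum>j<M. Q j p * J p ^ j)" by (subst sum.swap) (simp add: Q_def sum_distrib_right mult.assoc)
  also have "\<dots> = (\<Sum>j\<in>{j0..<M}. Q j p * J p ^ j)" by (rule sum.mono_neutral_right) (auto simp: Q_def less not_le)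
  also have "\<dots> = J p ^ j0 * (\<Sum>j\<in>{j0..<M}. Q j p * J p ^ (j - j0))" unfolding sum_distrib_left
  proof (rule sum.cong[OF refl])
   fix j assume "j \<in> {j0..<M}"
   hence "J p ^ j = J p ^ j0 * J p ^ (j - j0)" by (simp flip: power_add)
   thus "Q j p * J p ^ j = J p ^ j0 * (Q j p * J p ^ (j - j0))" by simp
  qed
  finally show ?thesis by simp
 qed
 have Qr: "repr (Q j)" for j unfolding Q_def by (intro repr_sum repr_mult scalar_repr poly_repr[OF monr])
 note Jr = poly_repr[OF J]
 have cancel: "(\<Sum>j\<in>{j0..<M}. Q j p * J p ^ (j - j0)) = 0" if p: "p \<in> Y" for p
 proof (rule vanish_cancel[of "%p. J p ^ j0" "%p. \<Sum>j\<in>{j0..<M}. Q j p * J p ^ (j - j0)" p0])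
  show "repr (%p. J p ^ j0)" by (rule repr_power[OF Jr])
  show "repr (%p. \<Sum>j\<in>{j0..<M}. Q j p * J p ^ (j - j0))" by (intro repr_sum repr_mult repr_power Qr Jr)
  show "J q ^ j0 * (\<Sum>j\<in>{j0..<M}. Q j q * J q ^ (j - j0)) = 0" if "q \<in> Y" for q by (rule rel[OF that])
 qed (use p0 p in simp_all)
 have "\<exists>s::nat => real. (\<Sum>\<alpha>\<in>expbox n D. r (\<alpha>, j0) * (\<Prod>i<n. s i ^ \<alpha> i)) \<noteq> 0"
  using poly_function_nonzero[where k = n and D = D and c = "%\<alpha>. r (\<alpha>, j0)"] j0(2) by blast
 then obtain s :: "nat => real" where s: "(\<Sum>\<alpha>\<in>expbox n D. r (\<alpha>, j0) * (\<Prod>i<n. s i ^ \<alpha> i)) \<noteq> 0" (is "?T \<noteq> 0") by blast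
 show ?thesis
 proof (intro exI[of _ s] ballI impI)
  fix z assume z: "z \<in> Y" "h z \<noteq> 0" "\<forall>i<n. f i z = of_real (s i) * h z"
  have "Q j0 z = (\<Sum>\<alpha>\<in>expbox n D. of_real (r (\<alpha>, j0) * (\<Prod>i<n. s i ^ \<alpha> i)) * h z ^ (n * D))"
   unfolding Q_def
  proof (rule sum.cong[OF refl])
   fix \<alpha> assume a: "\<alpha> \<in> expbox n D"
   have "(\<Prod>i<n. f i z ^ \<alpha> i) = (\<Prod>i<n. of_real (s i) ^ \<alpha> i * h z ^ \<alpha> i)"
    using z(3) by (intro prod.cong) (simp_all add: power_mult_distrib)
   also have "\<dots> = of_real (\<Prod>i<n. s i ^ \<alpha> i) * h z ^ deg \<alpha>" by (simp add: prod.distrib deg_def power_sum)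
   finally have "mon \<alpha> z = of_real (\<Prod>i<n. s i ^ \<alpha> i) * (h z ^ deg \<alpha> * h z ^ (n * D - deg \<alpha>))"
    by (simp add: mon_def mult.assoc)
   also have "h z ^ deg \<alpha> * h z ^ (n * D - deg \<alpha>) = h z ^ (n * D)" using degle[OF a] by (simp flip: power_add)
   finally show "of_real (r (\<alpha>, j0)) * mon \<alpha> z = of_real (r (\<alpha>, j0) * (\<Prod>i<n. s i ^ \<alpha> i)) * h z ^ (n * D)" by simp
  qed
  also have "\<dots> = of_real ?T * h z ^ (n * D)" by (simp add: sum_distrib_right)
  finally have Qz: "Q j0 z \<noteq> 0" using s z(2) by (simp del: of_real_sum)
  show "J z \<noteq> 0"
  proof
   assume J0: "J z = 0"
   have "0 = (\<Sum>j\<in>{j0..<M}. Q j z * J z ^ (j - j0))" using cancel[OF z(1)] by simp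
   also have "\<dots> = (\<Sum>j\<in>{j0..<M}. if j = j0 then Q j z else 0)" by (rule sum.cong) (use J0 in auto)
   also have "\<dots> = Q j0 z" using j0(1) by simp
   finally show False using Qz by simp
  qed
 qed
qed

end

section \<open>Local generation\<close>

context function_ring
begin

text \<open>The last generator is eliminated in each step of the induction. Coefficients \<open>C\<close> congruent to
  one modulo \<open>M\<close>, in place of \<open>1\<close>, make the statement stable under elimination without
  division.\<close>

lemma nakayama:
 fixes r :: nat
 assumes I: "ideal I R" and M: "ideal M R"
 shows "(\<And>k. k < r ==> repr (L k)) ==>
  (\<And>k. k < r ==> \<exists>C V. mem M (%p. 1 - C p) \<and> (\<forall>j<r. mem M (V j)) \<and>
    mem I (%p. C p * L k p - (\<Sum>j<r. V j p * L j p))) ==>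
  \<exists>A. mem M (%p. 1 - A p) \<and> (\<forall>k<r. mem I (%p. A p * L k p))"
proof (induction r)
 case 0
 have "mem M (%p. 1 - 1)" using mem_0[OF M] by simp
 thus ?case by (intro exI[of _ "%p. 1"]) simp
next
 case (Suc r)
 have one: "repr C" if "mem M (%p. 1 - C p)" for C using repr_diff[OF repr_1 mem_repr[OF M that]] by simp
 have prod1: "mem M (%p. 1 - C p * D p)" if c: "mem M (%p. 1 - C p)" and d: "mem M (%p. 1 - D p)" for C D
  by (rule mem_cong[OF mem_add[OF M mem_mult[OF M c one[OF d]] d]]) (simp add: algebra_simps)
 obtain C V where CV: "mem M (%p. 1 - C p)" "\<forall>j<Suc r. mem M (V j)"
  "mem I (%p. C p * L r p - (\<Sum>j<Suc r. V j p * L j p))" using Suc.prems(2)[of r] by blast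
 have Vr: "mem M (V r)" "repr (V r)" using CV(2) mem_repr[OF M] by auto
 define U where "U = (%p. C p - V r p)"
 have U1: "mem M (%p. 1 - U p)" by (rule mem_cong[OF mem_add[OF M CV(1) Vr(1)]]) (simp add: U_def)
 note Ur = one[OF U1]
 have rel: "mem I (%p. U p * L r p - (\<Sum>j<r. V j p * L j p))" by (rule mem_cong[OF CV(3)]) (simp add: U_def algebra_simps)
 have "\<exists>C' W. mem M (%p. 1 - C' p) \<and> (\<forall>j<r. mem M (W j)) \<and>
    mem I (%p. C' p * L k p - (\<Sum>j<r. W j p * L j p))" if k: "k < r" for k
 proof -
  obtain D W where DW: "mem M (%p. 1 - D p)" "\<forall>j<Suc r. mem M (W j)"
   "mem I (%p. D p * L k p - (\<Sum>j<Suc r. W j p * L j p))" using Suc.prems(2)[of k] k by auto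
  have Wr: "repr (W r)" using DW(2) mem_repr[OF M] by auto
  let ?W = "%j p. U p * W j p + W r p * V j p"
  have "mem M (?W j)" if "j < r" for j using DW(2) CV(2) that by (intro mem_add[OF M] mem_mult[OF M] Ur Wr) auto
  moreover have "mem I (%p. (U p * D p) * L k p - (\<Sum>j<r. ?W j p * L j p))"
  proof (rule mem_cong)
   show "mem I (%p. U p * (D p * L k p - (\<Sum>j<Suc r. W j p * L j p))
     + W r p * (U p * L r p - (\<Sum>j<r. V j p * L j p)))" by (intro mem_add[OF I] mem_mult[OF I] DW(3) rel Ur Wr)
   fix p
   have "(\<Sum>j<r. ?W j p * L j p) = U p * (\<Sum>j<r. W j p * L j p) + W r p * (\<Sum>j<r. V j p * L j p)"
    by (simp add: sum.distrib sum_distrib_left algebra_simps)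
   thus "U p * (D p * L k p - (\<Sum>j<Suc r. W j p * L j p)) + W r p * (U p * L r p - (\<Sum>j<r. V j p * L j p))
    = (U p * D p) * L k p - (\<Sum>j<r. ?W j p * L j p)" by (simp add: algebra_simps)
  qed
  ultimately show ?thesis using prod1[OF U1 DW(1)] by (intro exI[of _ "%p. U p * D p"] exI[of _ ?W]) blast
 qed
 then obtain A where A: "mem M (%p. 1 - A p)" "\<forall>k<r. mem I (%p. A p * L k p)" using Suc.IH[OF Suc.prems(1)] by force
 note Ar = one[OF A(1)]
 have "mem I (%p. (U p * A p) * L k p)" if k: "k < Suc r" for k
 proof (cases "k < r")
  case True
  have "mem I (%p. U p * (A p * L k p))" by (rule mem_mult[OF I _ Ur]) (use A(2) True in blast)
  thus ?thesis by (simp add: mult.assoc)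
 next
  case False
  hence k: "k = r" using k by simp
  have "mem I (%p. A p * (U p * L r p - (\<Sum>j<r. V j p * L j p)) + (\<Sum>j<r. V j p * (A p * L j p)))"
  proof (rule mem_add[OF I mem_mult[OF I rel Ar]], rule mem_sum[OF I])
   fix j assume "j \<in> {..<r}"
   hence j: "j < r" by simp
   show "mem I (%p. V j p * (A p * L j p))" by (rule mem_mult[OF I _ mem_repr[OF M]]) (use A(2) CV(2) j in auto)
  qed
  thus ?thesis unfolding k by (rule mem_cong) (simp add: sum_distrib_left algebra_simps)
 qed
 thus ?case using prod1[OF U1 A(1)] by (intro exI[of _ "%p. U p * A p"]) blast
qed

lemma prod_lincomb:
 assumes M: "ideal M R" and l: "tup r l" and x: "x \<in> M \<cdot> {lincomb r v l | v. tup r v}"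
 shows "\<exists>v. (\<forall>j<r. v j \<in> M) \<and> x = lincomb r v l" using x
proof (induction rule: ideal_prod.induct)
 case (prod a b)
 then obtain v where v: "tup r v" "b = lincomb r v l" by blast
 have ac: "a \<in> carrier R" by (rule ideal_subsetD[OF M prod(1)])
 have t: "tup r (%j. a \<otimes> v j)" using v(1) ac by (auto simp: tup_def)
 have "a \<otimes> b = lincomb r (%j. a \<otimes> v j) l"
  by (rule ev_inject) (use v ac l t in \<open>auto simp: ev_mult ev_lincomb lincomb_closed tup_def sum_distrib_left mult.assoc\<close>)
 moreover have "\<forall>j<r. a \<otimes> v j \<in> M" using ideal.I_r_closed[OF M prod(1)] v(1) by (simp add: tup_def)
 ultimately show ?case by (intro exI[of _ "%j. a \<otimes> v j"] conjI)
next
 case (sum a b)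
 then obtain v w where vw: "\<forall>j<r. v j \<in> M" "a = lincomb r v l" "\<forall>j<r. w j \<in> M" "b = lincomb r w l" by blast
 have t: "tup r v" "tup r w" using vw ideal_subsetD[OF M] by (auto simp: tup_def)
 have t3: "tup r (%j. v j \<oplus> w j)" using t by (auto simp: tup_def)
 have "a \<oplus> b = lincomb r (%j. v j \<oplus> w j) l" unfolding vw(2,4)
  by (rule ev_inject) (use t t3 l in \<open>auto simp: ev_add ev_lincomb lincomb_closed tupD sum.distrib distrib_right\<close>)
 moreover have "\<forall>j<r. v j \<oplus> w j \<in> M" using vw(1,3) ideal_add[OF M] by simp
 ultimately show ?case by (intro exI[of _ "%j. v j \<oplus> w j"] conjI)
qed

lemma colon_ideal:
 assumes I: "ideal I R" and x: "x \<in> carrier R"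
 shows "ideal {a \<in> carrier R. a \<otimes> x \<in> I} R"
proof (rule idealI)
 show "ring R" by (rule ring_axioms)
 show "subgroup {a \<in> carrier R. a \<otimes> x \<in> I} (add_monoid R)"
 proof (rule add.subgroupI)
  have "\<zero> \<otimes> x \<in> I" using x ideal_zero[OF I] by simp
  thus "{a \<in> carrier R. a \<otimes> x \<in> I} \<noteq> {}" by blast
  show "\<ominus> a \<in> {a \<in> carrier R. a \<otimes> x \<in> I}" if a: "a \<in> {a \<in> carrier R. a \<otimes> x \<in> I}" for a
  proof -
   have c: "a \<in> carrier R" "a \<otimes> x \<in> I" using a by auto
   have "\<ominus> (a \<otimes> x) \<in> I" using ideal_minus[OF I ideal_zero[OF I] c(2)] c x by (simp add: minus_eq)
   thus ?thesis using c x by (simp add: l_minus)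
  qed
  show "a \<oplus> b \<in> {a \<in> carrier R. a \<otimes> x \<in> I}"
   if a: "a \<in> {a \<in> carrier R. a \<otimes> x \<in> I}" "b \<in> {a \<in> carrier R. a \<otimes> x \<in> I}" for a b
   using a x ideal_add[OF I] by (simp add: l_distr)
 qed auto
 show "b \<otimes> a \<in> {a \<in> carrier R. a \<otimes> x \<in> I}"
  if a: "a \<in> {a \<in> carrier R. a \<otimes> x \<in> I}" and b: "b \<in> carrier R" for a b
  using a b x ideal.I_l_closed[OF I, of "a \<otimes> x" b] by (simp add: m_assoc)
 then show "a \<otimes> b \<in> {a \<in> carrier R. a \<otimes> x \<in> I}"
  if a: "a \<in> {a \<in> carrier R. a \<otimes> x \<in> I}" and b: "b \<in> carrier R" for a b using a b m_comm[of a b] by simp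
qed

text \<open>Nakayama's lemma in the form in which it is used: local generators give a multiplier outside
  the maximal ideal.\<close>

lemma local_multiplier:
 assumes I: "ideal I R" and M: "maximalideal M R" and l: "tup r l"
  and h: "\<And>k. k < r ==> \<exists>v. (\<forall>j<r. v j \<in> M) \<and> l k \<ominus> lincomb r v l \<in> I"
 shows "\<exists>a\<in>carrier R. a \<notin> M \<and> (\<forall>v. tup r v --> a \<otimes> lincomb r v l \<in> I)"
proof -
 have Mi: "ideal M R" by (rule maximalideal.axioms(1)[OF M])
 have "\<exists>A. mem M (%p. 1 - A p) \<and> (\<forall>k<r. mem I (%p. A p * ev (l k) p))"
 proof (rule nakayama[OF I Mi])
  show "repr (ev (l k))" if "k < r" for k using repr_ev tupD[OF l that] by blast
  show "\<exists>C V. mem M (%p. 1 - C p) \<and> (\<forall>j<r. mem M (V j)) \<and>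
    mem I (%p. C p * ev (l k) p - (\<Sum>j<r. V j p * ev (l j) p))" if k: "k < r" for k
  proof -
   obtain v where v: "\<forall>j<r. v j \<in> M" "l k \<ominus> lincomb r v l \<in> I" using h[OF k] by blast
   have tv: "tup r v" using v(1) ideal_subsetD[OF Mi] by (auto simp: tup_def)
   have "mem I (ev (l k \<ominus> lincomb r v l))" using v(2) unfolding mem_def by blast
   hence "mem I (%p. 1 * ev (l k) p - (\<Sum>j<r. ev (v j) p * ev (l j) p))"
    by (rule mem_cong) (simp add: ev_minus tupD[OF l k] lincomb_closed[OF tv l] ev_lincomb[OF tv l])
   moreover have "mem M (%p. 1 - 1)" using mem_0[OF Mi] by simp
   moreover have "\<forall>j<r. mem M (ev (v j))" using v(1) unfolding mem_def by blast
   ultimately show ?thesis by (intro exI[of _ "%p. 1"] exI[of _ "%j. ev (v j)"] conjI)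
  qed
 qed
 then obtain A where A: "mem M (%p. 1 - A p)" "\<forall>k<r. mem I (%p. A p * ev (l k) p)" by blast
 obtain b where b: "b \<in> M" "\<forall>p\<in>Y. ev b p = 1 - A p" using A(1) by (auto simp: mem_def)
 have bc: "b \<in> carrier R" by (rule ideal_subsetD[OF Mi b(1)])
 define a where "a = \<one> \<ominus> b"
 have ac: "a \<in> carrier R" and ea: "\<And>p. p \<in> Y ==> ev a p = A p" using bc b(2) by (simp_all add: a_def ev_minus ev_one)
 have "a \<notin> M"
 proof
  assume "a \<in> M"
  hence "a \<oplus> b \<in> M" using ideal_add[OF Mi] b(1) by blast
  moreover have "a \<oplus> b = \<one>" by (rule ev_inject) (use ac bc ea b(2) in \<open>auto simp: ev_add ev_one\<close>)
  ultimately show False using ideal_one[OF Mi] maximalideal.I_notcarr[OF M] by simp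
 qed
 moreover have "a \<otimes> lincomb r v l \<in> I" if v: "tup r v" for v
 proof -
  have "mem I (%p. \<Sum>k<r. ev (v k) p * (A p * ev (l k) p))"
  proof (rule mem_sum[OF I])
   fix k assume "k \<in> {..<r}"
   hence k: "k < r" by simp
   show "mem I (%p. ev (v k) p * (A p * ev (l k) p))" by (rule mem_mult[OF I _ repr_ev[OF tupD[OF v k]]]) (use A(2) k in blast)
  qed
  hence "mem I (ev (a \<otimes> lincomb r v l))"
   by (rule mem_cong) (simp add: ev_mult ac lincomb_closed[OF v l] ev_lincomb[OF v l] ea sum_distrib_left algebra_simps)
  thus ?thesis using mem_ev[OF I] ac lincomb_closed[OF v l] by simp
 qed
 ultimately show ?thesis using ac by blast
qed

end

section \<open>The critical locus\<close>

lemma det_closure: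
 fixes E :: "nat => nat => 'x => complex"
 assumes P: "P (%x. 0)" "P (%x. 1)" "P (%x. - 1)"
  "\<And>F G. P F ==> P G ==> P (%x. F x + G x)" "\<And>F G. P F ==> P G ==> P (%x. F x * G x)"
  and E: "\<And>i j. i < m ==> j < m ==> P (E i j)"
 shows "P (%x. sdet m (%(i, j). E i j x))"
proof -
 have s: "P (%x. \<Sum>i\<in>A. F i x)" if f: "finite A" and F: "\<And>i. i \<in> A ==> P (F i)" for A and F :: "(nat => nat) => 'x => complex"
  using f F by (induction A rule: finite_induct) (simp_all add: P)
 have p: "P (%x. \<Prod>i\<in>A. F i x)" if f: "finite A" and F: "\<And>i. i \<in> A ==> P (F i)" for A and F :: "nat => 'x => complex"
  using f F by (induction A rule: finite_induct) (simp_all add: P)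
 have "P (%x. \<Sum>\<pi>\<in>{\<pi>. \<pi> permutes {0..<m}}. signof \<pi> * (\<Prod>i\<in>{0..<m}. E i (\<pi> i) x))"
 proof (rule s, rule finite_permutations[OF finite_atLeastLessThan], rule P(5))
  fix \<pi> assume "\<pi> \<in> {\<pi>. \<pi> permutes {0..<m}}"
  hence pi: "\<pi> permutes {0..<m}" by simp
  show "P (%x. signof \<pi>)" using P(2,3) by (simp add: sign_def)
  show "P (%x. \<Prod>i\<in>{0..<m}. E i (\<pi> i) x)"
  proof (rule p[OF finite_atLeastLessThan])
   fix i assume i: "i \<in> {0..<m}"
   have "\<pi> i \<in> {0..<m}" using permutes_in_image[OF pi] i by blast
   thus "P (E i (\<pi> i))" using E i by simp
  qed
 qed
 moreover have "sdet m (%(i, j). E i j x)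
   = (\<Sum>\<pi>\<in>{\<pi>. \<pi> permutes {0..<m}}. signof \<pi> * (\<Prod>i\<in>{0..<m}. E i (\<pi> i) x))" for x
  unfolding det_def'[OF mat_carrier]
 proof (rule sum.cong[OF refl])
  fix \<pi> assume "\<pi> \<in> {\<pi>. \<pi> permutes {0..<m}}"
  hence "\<pi> i < m" if "i < m" for i using permutes_in_image[of \<pi> "{0..<m}" i] that by simp
  thus "signof \<pi> * (\<Prod>i = 0..<m. Matrix.mat m m (%(i, j). E i j x) $$ (i, \<pi> i))
    = signof \<pi> * (\<Prod>i\<in>{0..<m}. E i (\<pi> i) x)" by (intro arg_cong2[of _ _ _ _ "(*)"] prod.cong) auto
 qed
 ultimately show ?thesis by simp
qed

lemma det_polynomial:
 fixes E :: "nat => nat => complex => complex"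
 assumes "\<And>i j. i < m ==> j < m ==> \<exists>P. \<forall>x. E i j x = poly P x"
 shows "\<exists>P. \<forall>x. sdet m (%(i, j). E i j x) = poly P x"
proof (rule det_closure[of "%F. \<exists>P. \<forall>x. F x = poly P x"])
 show "\<exists>P. \<forall>x. 0 = poly P x" by (intro exI[of _ "[:0:]"]) simp
 show "\<exists>P. \<forall>x. 1 = poly P x" by (intro exI[of _ "[:1:]"]) simp
 show "\<exists>P. \<forall>x. - 1 = poly P x" by (intro exI[of _ "[:- 1:]"]) simp
 fix F G :: "complex => complex" assume "\<exists>P. \<forall>x. F x = poly P x" "\<exists>P. \<forall>x. G x = poly P x"
 then obtain P Q where PQ: "\<forall>x. F x = poly P x" "\<forall>x. G x = poly Q x" by blast
 show "\<exists>P. \<forall>x. F x + G x = poly P x" using PQ by (intro exI[of _ "P + Q"]) simp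
 show "\<exists>P. \<forall>x. F x * G x = poly P x" using PQ by (intro exI[of _ "P * Q"]) simp
qed (rule assms)

lemma real_avoiding:
 assumes "finite (S::complex set)" shows "\<exists>x::real. of_real x \<notin> S"
proof -
 have "finite ((of_real :: real => complex) -` S)" by (rule finite_vimageI[OF assms inj_of_real])
 from ex_new_if_finite[OF infinite_UNIV_char_0 this] show ?thesis by auto
qed

lemma nonzero_entry_det:
 fixes K :: complex
 assumes K: "K \<noteq> 0"
 shows "sdet m (%(i, j). (if i = j then K else 0) - 0 ^ j * (K - 1)) \<noteq> 0" (is "Determinant.det ?A \<noteq> 0")
proof -
 have "Determinant.det ?A = prod_list (diag_mat ?A)" by (rule det_lower_triangular[where n = m]) (auto simp: power_0_left)
 moreover have "0 \<notin> set (diag_mat ?A)" using K by (auto simp: diag_mat_def power_0_left split: if_splits)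
 ultimately show ?thesis by (simp add: prod_list_zero_iff)
qed

context chart
begin

lemma dd_scale:
 assumes p: "p \<in> Y" "p n \<noteq> 0" "j < n" and F: "repr F"
 shows "dd j (%q. of_real r * F q) p = of_real r * dd j F p" using dd_mult[OF p scalar_repr F] by (simp add: dd_const)

lemma dd_power:
 assumes p: "p \<in> Y" "p n \<noteq> 0" "j < n" and i: "i < n" and pi: "p i = 1"
 shows "dd j (%q. q i ^ m) p = (if i = j then of_nat m else 0)"
proof (induction m)
 case 0 show ?case by (simp add: dd_const)
next
 case (Suc m)
 have r: "repr (%q. q i)" by (rule coord_repr) (use i in simp)
 have "dd j (%q. q i * q i ^ m) p = dd j (%q. q i) p * p i ^ m + dd j (%q. q i ^ m) p * p i"
  by (rule dd_mult[OF p r repr_power[OF r]])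
 thus ?case using Suc dd_coord[OF p i] pi by simp
qed

lemma dd_c:
 assumes p: "p \<in> Y" "p n \<noteq> 0" "j < n"
  and c': "((%s. c (p(j := p j + s))) has_field_derivative c' p) (at 0)"
 shows "2 * p n * dd j (%q. q n) p = - c' p"
proof -
 have t: "repr (%q. q n)" by (rule coord_repr) simp
 have "(%s. c (flow p j s)) = (%s. c (p(j := p j + s)))" unfolding flow_def by (simp add: c_upd)
 hence dc: "dd j c p = c' p" using DERIV_imp_deriv[OF c'] by (simp add: dd_def)
 have "dd j (%q. q n * q n) p = dd j (%q. of_real (- 1) * c q) p"
  by (rule dd_cong[OF p]) (simp add: Y_eq power2_eq_square eq_neg_iff_add_eq_0)
 also have "\<dots> = - dd j c p" using dd_scale[OF p poly_repr[OF rpoly_Suc[OF c_poly]], of "- 1"] by simp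
 finally have "dd j (%q. q n) p * p n + dd j (%q. q n) p * p n = - c' p" unfolding dd_mult[OF p t t] dc .
 moreover have "2 * a * b = b * a + b * a" for a b :: complex by simp
 ultimately show ?thesis by (simp only:)
qed

text \<open>The vector field \<open>2 t \<partial>\<^sub>j\<close> preserves polynomials, since it maps
  \<open>t\<close> to \<open>- \<partial>\<^sub>j c\<close>.\<close>

lemma dd_poly:
 assumes j: "j < n"
 shows "rpoly (Suc n) d F ==> \<exists>e F'. rpoly (Suc n) e F' \<and> (\<forall>p\<in>Y. p n \<noteq> 0 --> 2 * p n * dd j F p = F' p)"
proof (induction rule: rpoly.induct)
 case (const d r)
 show ?case by (intro exI[of _ 0] exI[of _ "%p. 0"]) (simp add: dd_const rpoly_0)
next
 case (var i d)
 show ?case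
 proof (cases "i = n")
  case True
  obtain c' where c': "rpoly n 2 c'" "\<forall>p. ((%s. c (p(j := p j + s))) has_field_derivative c' p) (at 0)"
   using rpoly_partial[OF c_poly] by blast
  have "2 * p n * dd j (%p. p i) p = - c' p" if "p \<in> Y" "p n \<noteq> 0" for p
   unfolding True by (rule dd_c[OF that j]) (use c'(2) in blast)
  thus ?thesis using rpoly_uminus[OF rpoly_Suc[OF c'(1)]] by blast
 next
  case False
  hence i: "i < n" using var by simp
  have "rpoly (Suc n) 1 (%p. of_real (if i = j then 2 else 0) * p n)" by (intro rpoly_scale rpoly.var) auto
  moreover have "2 * p n * dd j (%p. p i) p = of_real (if i = j then 2 else 0) * p n" if "p \<in> Y" "p n \<noteq> 0" for p
   using dd_coord[OF that j i] by simp
  ultimately show ?thesis by blast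
 qed
next
 case (add d F G)
 then obtain e F' e' G' where h: "rpoly (Suc n) e F'" "\<forall>p\<in>Y. p n \<noteq> 0 --> 2 * p n * dd j F p = F' p"
  "rpoly (Suc n) e' G'" "\<forall>p\<in>Y. p n \<noteq> 0 --> 2 * p n * dd j G p = G' p" by blast
 have "rpoly (Suc n) (e + e') (%p. F' p + G' p)" by (intro rpoly.add rpoly_mono[OF h(1)] rpoly_mono[OF h(3)]) auto
 moreover have "2 * p n * dd j (%p. F p + G p) p = F' p + G' p" if "p \<in> Y" "p n \<noteq> 0" for p
  using dd_add[OF that j poly_repr[OF add.hyps(1)] poly_repr[OF add.hyps(2)]] h(2,4) that by (simp add: distrib_left)
 ultimately show ?case by blast
next
 case (mult d F e G f)
 then obtain e1 F' e2 G' where h: "rpoly (Suc n) e1 F'" "\<forall>p\<in>Y. p n \<noteq> 0 --> 2 * p n * dd j F p = F' p"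
  "rpoly (Suc n) e2 G'" "\<forall>p\<in>Y. p n \<noteq> 0 --> 2 * p n * dd j G p = G' p" by blast
 let ?e = "e1 + e + (e2 + d)"
 have "rpoly (Suc n) ?e (%p. F' p * G p + G' p * F p)"
  by (intro rpoly.add rpoly.mult[OF h(1) mult.hyps(2)] rpoly.mult[OF h(3) mult.hyps(1)]) auto
 moreover have "2 * p n * dd j (%p. F p * G p) p = F' p * G p + G' p * F p" if p: "p \<in> Y" "p n \<noteq> 0" for p
 proof -
  have e: "2 * p n * dd j F p = F' p" "2 * p n * dd j G p = G' p" using h(2,4) p by auto
  show ?thesis unfolding dd_mult[OF p j poly_repr[OF mult.hyps(1)] poly_repr[OF mult.hyps(2)]] e[symmetric]
   by (simp add: algebra_simps)
 qed
 ultimately show ?case by blast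
qed

text \<open>Up to a power of \<open>h\<close>, the Jacobian of the quotients \<open>f\<^sub>i / h\<close>; it is
  invariant under \<open>f\<^sub>i \<mapsto> f\<^sub>i - s\<^sub>i h\<close>.\<close>

definition jac :: "(nat => (nat => complex) => complex) => ((nat => complex) => complex) => (nat => complex) => complex" where
 "jac f h p = sdet n (%(i, j). dd j (f i) p * h p - f i p * dd j h p)"

lemma jac_poly:
 assumes f: "\<And>i. i < n ==> rpoly (Suc n) d (f i)" and h: "rpoly (Suc n) d h"
 shows "\<exists>e J. rpoly (Suc n) e J \<and> (\<forall>p\<in>Y. (p n = 0 --> J p = 0) \<and> (p n \<noteq> 0 --> J p = p n * ((2 * p n) ^ n * jac f h p)))"
proof -
 have "\<exists>F'. fst x < n \<and> snd x < n --> (\<exists>e. rpoly (Suc n) e F') \<and> (\<forall>p\<in>Y. p n \<noteq> 0 --> 2 * p n * dd (snd x) (f (fst x)) p = F' p)" for x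
 proof (cases "fst x < n \<and> snd x < n")
  case True
  obtain e F' where "rpoly (Suc n) e F'" "\<forall>p\<in>Y. p n \<noteq> 0 --> 2 * p n * dd (snd x) (f (fst x)) p = F' p"
   using dd_poly[OF conjunct2[OF True] f[OF conjunct1[OF True]]] by (elim exE conjE)
  thus ?thesis by (intro exI[of _ F'] impI conjI exI[of _ e])
 next
  case False
  show ?thesis by (rule exI, rule impI, erule notE[OF False])
 qed
 hence "\<forall>x. \<exists>F'. fst x < n \<and> snd x < n --> (\<exists>e. rpoly (Suc n) e F') \<and> (\<forall>p\<in>Y. p n \<noteq> 0 --> 2 * p n * dd (snd x) (f (fst x)) p = F' p)" ..
 from choice[OF this] obtain A where A: "\<forall>x. fst x < n \<and> snd x < n --> (\<exists>e. rpoly (Suc n) e (A x)) \<and>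
   (\<forall>p\<in>Y. p n \<noteq> 0 --> 2 * p n * dd (snd x) (f (fst x)) p = A x p)" ..
 have "\<exists>F'. j < n --> (\<exists>e. rpoly (Suc n) e F') \<and> (\<forall>p\<in>Y. p n \<noteq> 0 --> 2 * p n * dd j h p = F' p)" for j
 proof (cases "j < n")
  case True
  obtain e F' where "rpoly (Suc n) e F'" "\<forall>p\<in>Y. p n \<noteq> 0 --> 2 * p n * dd j h p = F' p"
   using dd_poly[OF True h] by (elim exE conjE)
  thus ?thesis by (intro exI[of _ F'] impI conjI exI[of _ e])
 next
  case False
  show ?thesis by (rule exI, rule impI, erule notE[OF False])
 qed
 hence "\<forall>j. \<exists>F'. j < n --> (\<exists>e. rpoly (Suc n) e F') \<and> (\<forall>p\<in>Y. p n \<noteq> 0 --> 2 * p n * dd j h p = F' p)" ..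
 from choice[OF this] obtain B where B: "\<forall>j. j < n --> (\<exists>e. rpoly (Suc n) e (B j)) \<and>
   (\<forall>p\<in>Y. p n \<noteq> 0 --> 2 * p n * dd j h p = B j p)" ..
 let ?E = "%i j p. A (i, j) p * h p - f i p * B j p"
 have "\<exists>e. rpoly (Suc n) e (%p. sdet n (%(i, j). ?E i j p))"
 proof (rule det_closure[where E = ?E and P = "%F. \<exists>e. rpoly (Suc n) e F"])
  show "\<exists>e. rpoly (Suc n) e (%p. 0)" "\<exists>e. rpoly (Suc n) e (%p. 1)" "\<exists>e. rpoly (Suc n) e (%p. - 1)"
   using rpoly_0 rpoly_1 rpoly_uminus[OF rpoly_1] by blast+
  fix F G :: "(nat => complex) => complex"
  assume "\<exists>e. rpoly (Suc n) e F" "\<exists>e. rpoly (Suc n) e G"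
  then obtain e1 e2 where e: "rpoly (Suc n) e1 F" "rpoly (Suc n) e2 G" by blast
  show "\<exists>e. rpoly (Suc n) e (%p. F p * G p)" using rpoly.mult[OF e order_refl] by blast
  have "rpoly (Suc n) (e1 + e2) (%p. F p + G p)" by (intro rpoly.add rpoly_mono[OF e(1)] rpoly_mono[OF e(2)]) auto
  thus "\<exists>e. rpoly (Suc n) e (%p. F p + G p)" by blast
 next
  fix i j assume ij: "i < n" "j < n"
  obtain e1 e2 where e: "rpoly (Suc n) e1 (A (i, j))" "rpoly (Suc n) e2 (B j)"
   using A[rule_format, of "(i, j)"] B[rule_format, of j] ij by (simp del: split_paired_All) (elim exE conjE)
  have "rpoly (Suc n) (e1 + d + (d + e2)) (?E i j)"
   by (intro rpoly_diff rpoly.mult[OF e(1) h] rpoly.mult[OF f[OF ij(1)] e(2)]) auto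
  thus "\<exists>e. rpoly (Suc n) e (?E i j)" by blast
 qed
 then obtain e where e: "rpoly (Suc n) e (%p. sdet n (%(i, j). ?E i j p))" by blast
 show ?thesis
 proof (intro exI conjI ballI impI)
  show "rpoly (Suc n) (1 + e) (%p. p n * sdet n (%(i, j). ?E i j p))" by (rule rpoly.mult[OF rpoly.var e order_refl]) auto
  fix p assume p: "p \<in> Y"
  show "p n * sdet n (%(i, j). ?E i j p) = 0" if "p n = 0" using that by simp
  assume pn: "p n \<noteq> 0"
  have "Matrix.mat n n (%(i, j). ?E i j p)
    = (2 * p n) \<cdot>\<^sub>m Matrix.mat n n (%(i, j). dd j (f i) p * h p - f i p * dd j h p)"
  proof (rule eq_matI)
   fix i j assume "i < dim_row ((2 * p n) \<cdot>\<^sub>m Matrix.mat n n (%(i, j). dd j (f i) p * h p - f i p * dd j h p))"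
    "j < dim_col ((2 * p n) \<cdot>\<^sub>m Matrix.mat n n (%(i, j). dd j (f i) p * h p - f i p * dd j h p))"
   hence ij: "i < n" "j < n" by simp_all
   have e: "A (i, j) p = 2 * p n * dd j (f i) p" "B j p = 2 * p n * dd j h p"
    using A[rule_format, of "(i, j)"] B[rule_format, of j] ij p pn by simp_all
   show "Matrix.mat n n (%(i, j). ?E i j p) $$ (i, j)
    = ((2 * p n) \<cdot>\<^sub>m Matrix.mat n n (%(i, j). dd j (f i) p * h p - f i p * dd j h p)) $$ (i, j)"
    using ij by (simp add: e algebra_simps)
  qed simp_all
  thus "p n * sdet n (%(i, j). ?E i j p) = p n * ((2 * p n) ^ n * jac f h p)" by (simp add: jac_def det_smult)
 qed
qed

lemma jac_specialize:
 assumes p: "p \<in> Y" "p n \<noteq> 0" and f: "\<And>i. i < n ==> repr (f i)" and h: "repr h"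
  and s: "\<And>i. i < n ==> f i p = of_real (s i) * h p"
  and g: "\<And>i q. i < n ==> q \<in> Y ==> g i q = f i q - of_real (s i) * h q"
 shows "jac f h p = h p ^ n * sdet n (%(i, j). dd j (g i) p)"
proof -
 have "Matrix.mat n n (%(i, j). dd j (f i) p * h p - f i p * dd j h p) = h p \<cdot>\<^sub>m Matrix.mat n n (%(i, j). dd j (g i) p)"
 proof (rule eq_matI)
  fix i j assume "i < dim_row (h p \<cdot>\<^sub>m Matrix.mat n n (%(i, j). dd j (g i) p))"
   "j < dim_col (h p \<cdot>\<^sub>m Matrix.mat n n (%(i, j). dd j (g i) p))"
  hence ij: "i < n" "j < n" by simp_all
  have "dd j (g i) p = dd j (%q. f i q + of_real (- s i) * h q) p" by (rule dd_cong[OF p ij(2)]) (use g ij(1) in simp)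
  also have "\<dots> = dd j (f i) p + of_real (- s i) * dd j h p"
   using dd_add[OF p ij(2) f[OF ij(1)] repr_mult[OF scalar_repr h]] dd_scale[OF p ij(2) h] by metis
  finally have e: "dd j (f i) p = dd j (g i) p + of_real (s i) * dd j h p" by simp
  show "Matrix.mat n n (%(i, j). dd j (f i) p * h p - f i p * dd j h p) $$ (i, j)
    = (h p \<cdot>\<^sub>m Matrix.mat n n (%(i, j). dd j (g i) p)) $$ (i, j)" using ij by (simp add: e s[OF ij(1)] algebra_simps)
 qed simp_all
 thus ?thesis by (simp add: jac_def det_smult)
qed

end

section \<open>A generic deformation\<close>

context chart
begin

text \<open>At a point with some nonzero coordinate this is a nonzero polynomial in \<open>\<nu>\<close>, so finitely
  many such points can be avoided at once.\<close>

definition hsum :: "nat => real => (nat => complex) => complex" where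
 "hsum e \<nu> p = (\<Sum>k<n. of_real \<nu> ^ k * p k ^ e)"

lemma hsum_poly: "rpoly (Suc n) e (hsum e \<nu>)" unfolding hsum_def
proof (rule rpoly_sum)
 fix k assume "k \<in> {..<n}"
 hence "rpoly (Suc n) e (%p. of_real (\<nu> ^ k) * p k ^ e)" by (intro rpoly_scale rpoly_power[OF rpoly.var[of k "Suc n" 1]]) auto
 thus "rpoly (Suc n) e (%p. of_real \<nu> ^ k * p k ^ e)" by simp
qed

lemma hsum_roots:
 assumes "k < n" "z k \<noteq> 0"
 shows "\<exists>P. P \<noteq> 0 \<and> (\<forall>\<nu>. hsum e \<nu> z = poly P (of_real \<nu>))"
proof (intro exI conjI allI)
 let ?P = "\<Sum>i<n. Polynomial.monom (z i ^ e) i"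
 have "Polynomial.coeff ?P k = z k ^ e" using assms(1) by (simp add: coeff_sum)
 thus "?P \<noteq> 0" using assms(2) by auto
 show "hsum e \<nu> z = poly ?P (of_real \<nu>)" for \<nu> by (simp add: hsum_def poly_sum poly_monom mult.commute)
qed

lemma jac_at_one:
 assumes p: "p \<in> Y" "p n \<noteq> 0" "\<And>i. i < n ==> p i = 1" and F: "\<And>i. i < n ==> repr (F i)"
 shows "jac (%i q. of_real \<mu> * q i ^ Suc e + F i q) (hsum e \<nu>) p =
  sdet n (%(i, j). (of_real \<mu> * (if i = j then of_nat (Suc e) else 0) + dd j (F i) p) * (\<Sum>k<n. of_real \<nu> ^ k)
   - (of_real \<mu> + F i p) * (of_real \<nu> ^ j * of_nat e))" unfolding jac_def
proof (intro arg_cong[of _ _ Determinant.det] eq_matI)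
 fix i j
 let ?B = "Matrix.mat n n (%(i, j). (of_real \<mu> * (if i = j then of_nat (Suc e) else 0) + dd j (F i) p) * (\<Sum>k<n. of_real \<nu> ^ k)
   - (of_real \<mu> + F i p) * (of_real \<nu> ^ j * of_nat e))"
 assume "i < dim_row ?B" "j < dim_col ?B"
 hence ij: "i < n" "j < n" by simp_all
 note pj = p(1,2) ij(2)
 have cr: "repr (%q. q k ^ m)" if "k < n" for k m using repr_power[OF coord_repr] that by simp
 have h: "hsum e \<nu> p = (\<Sum>k<n. of_real \<nu> ^ k)" unfolding hsum_def by (intro sum.cong) (simp_all add: p(3))
 have "dd j (hsum e \<nu>) p = dd j (%q. \<Sum>k<n. of_real (\<nu> ^ k) * q k ^ e) p" by (simp add: hsum_def[abs_def])
 also have "\<dots> = (\<Sum>k<n. dd j (%q. of_real (\<nu> ^ k) * q k ^ e) p)"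
 proof (rule dd_sum[OF pj])
  fix k assume "k \<in> {..<n}"
  thus "repr (%q. of_real (\<nu> ^ k) * q k ^ e)" by (intro repr_mult[OF scalar_repr cr]) simp
 qed
 also have "\<dots> = (\<Sum>k<n. if k = j then of_real \<nu> ^ j * of_nat e else 0)"
 proof (rule sum.cong[OF refl])
  fix k assume "k \<in> {..<n}"
  hence k: "k < n" by simp
  show "dd j (%q. of_real (\<nu> ^ k) * q k ^ e) p = (if k = j then of_real \<nu> ^ j * of_nat e else 0)"
   unfolding dd_scale[OF pj cr[OF k]] dd_power[OF pj k p(3)[OF k]] by simp
 qed
 also have "\<dots> = of_real \<nu> ^ j * of_nat e" using ij(2) by simp
 finally have dh: "dd j (hsum e \<nu>) p = of_real \<nu> ^ j * of_nat e" .
 have "dd j (%q. of_real \<mu> * q i ^ Suc e + F i q) p = dd j (%q. of_real \<mu> * q i ^ Suc e) p + dd j (F i) p"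
  by (rule dd_add[OF pj repr_mult[OF scalar_repr cr[OF ij(1)]] F[OF ij(1)]])
 also have "dd j (%q. of_real \<mu> * q i ^ Suc e) p = of_real \<mu> * (if i = j then of_nat (Suc e) else 0)"
  unfolding dd_scale[OF pj cr[OF ij(1)]] dd_power[OF pj ij(1) p(3)[OF ij(1)]] ..
 finally have df: "dd j (%q. of_real \<mu> * q i ^ Suc e + F i q) p = of_real \<mu> * (if i = j then of_nat (Suc e) else 0) + dd j (F i) p" .
 show "Matrix.mat n n (%(i, j). dd j (%q. of_real \<mu> * q i ^ Suc e + F i q) p * hsum e \<nu> p
   - (of_real \<mu> * p i ^ Suc e + F i p) * dd j (hsum e \<nu>) p) $$ (i, j) = ?B $$ (i, j)"
  using ij by (simp only: index_mat dim_row_mat dim_col_mat case_prod_conv df dh h p(3)[OF ij(1)] power_one mult_1_right)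
qed simp_all

text \<open>After division by \<open>\<mu>\<close> the matrix tends, as \<open>\<mu>\<close> grows, to that of the
  powers \<open>y\<^sub>i\<^sup>e\<^sup>+\<^sup>1\<close> alone, which is triangular at the point with all
  \<open>y\<^sub>i = 1\<close>. In terms of \<open>\<epsilon> = 1/\<mu>\<close> the determinant is a polynomial that
  does not vanish at \<open>0\<close>.\<close>

lemma generic_mu:
 assumes p: "p \<in> Y" "p n \<noteq> 0" "\<And>i. i < n ==> p i = 1" and F: "\<And>i. i < n ==> repr (F i)"
 shows "\<exists>\<mu>::real. \<mu> \<noteq> 0 \<and> jac (%i q. of_real \<mu> * q i ^ Suc e + F i q) (hsum e 0) p \<noteq> 0"
proof -
 let ?E = "%i j \<epsilon>. ((if i = j then of_nat (Suc e) else 0) + \<epsilon> * dd j (F i) p) - (1 + \<epsilon> * F i p) * (0 ^ j * of_nat e)"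
 have "\<exists>P. \<forall>x. sdet n (%(i, j). ?E i j x) = poly P x"
 proof (rule det_polynomial)
  fix i j
  show "\<exists>P. \<forall>x. ?E i j x = poly P x"
   by (intro exI[of _ "[: (if i = j then of_nat (Suc e) else 0) - 0 ^ j * of_nat e, dd j (F i) p - F i p * (0 ^ j * of_nat e) :]"])
    (simp add: algebra_simps)
 qed
 then obtain P where P: "\<forall>x. sdet n (%(i, j). ?E i j x) = poly P x" ..
 have "sdet n (%(i, j). ?E i j 0) \<noteq> 0" using nonzero_entry_det[OF of_nat_neq_0[of e, where 'a = complex], of n] by simp
 hence "poly P 0 \<noteq> 0" unfolding P[rule_format, of 0] .
 hence "P \<noteq> 0" by auto
 hence "finite ({x. poly P x = 0} \<union> {0})" using poly_roots_finite by blast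
 from real_avoiding[OF this] obtain \<epsilon> :: real where e: "poly P (of_real \<epsilon>) \<noteq> 0" "\<epsilon> \<noteq> 0" by auto
 have "Matrix.mat n n (%(i, j). (of_real (1 / \<epsilon>) * (if i = j then of_nat (Suc e) else 0) + dd j (F i) p) * (\<Sum>k<n. of_real 0 ^ k)
   - (of_real (1 / \<epsilon>) + F i p) * (of_real 0 ^ j * of_nat e)) = of_real (1 / \<epsilon>) \<cdot>\<^sub>m Matrix.mat n n (%(i, j). ?E i j (of_real \<epsilon>))" (is "?A = ?B")
 proof (rule eq_matI)
  fix i j assume "i < dim_row ?B" "j < dim_col ?B"
  hence ij: "i < n" "j < n" by simp_all
  have s: "(\<Sum>k<n. (0::complex) ^ k) = 1" using npos by (simp add: power_0_left)
  have u: "complex_of_real (1 / \<epsilon>) * of_real \<epsilon> = 1" using e(2) by (simp flip: of_real_mult)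
  have a: "(U * V + C0) * 1 - (U + Z) * W = U * ((V + \<epsilon>' * C0) - (1 + \<epsilon>' * Z) * W)"
   if "U * \<epsilon>' = 1" for U V W C0 Z \<epsilon>' :: complex
  proof -
   have "U * ((V + \<epsilon>' * C0) - (1 + \<epsilon>' * Z) * W) = U * V + (U * \<epsilon>') * C0 - (U + (U * \<epsilon>') * Z) * W"
    by (simp add: algebra_simps)
   thus ?thesis using that by simp
  qed
  show "?A $$ (i, j) = ?B $$ (i, j)"
   using ij a[OF u] by (simp only: index_mat index_smult_mat dim_row_mat dim_col_mat case_prod_conv of_real_0 s)
 qed simp_all
 note AB = this
 have "jac (%i q. of_real (1 / \<epsilon>) * q i ^ Suc e + F i q) (hsum e 0) p = Determinant.det ?A"
  by (rule jac_at_one) (use p F in auto)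
 also have "\<dots> = of_real (1 / \<epsilon>) ^ n * poly P (of_real \<epsilon>)"
  unfolding AB det_smult dim_col_mat P[rule_format, of "of_real \<epsilon>"] ..
 finally have "jac (%i q. of_real (1 / \<epsilon>) * q i ^ Suc e + F i q) (hsum e 0) p = of_real (1 / \<epsilon>) ^ n * poly P (of_real \<epsilon>)" .
 thus ?thesis using e by (intro exI[of _ "1 / \<epsilon>"]) simp
qed

lemma jac_lambda:
 assumes p: "p \<in> Y" "p n \<noteq> 0" "\<And>i. i < n ==> p i = 1" and F: "\<And>i. i < n ==> repr (F i)"
 shows "\<exists>P. \<forall>\<nu>. jac (%i q. of_real \<mu> * q i ^ Suc e + F i q) (hsum e \<nu>) p = poly P (of_real \<nu>)"
proof -
 let ?E = "%i j x. (of_real \<mu> * (if i = j then of_nat (Suc e) else 0) + dd j (F i) p) * (\<Sum>k<n. x ^ k)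
   - (of_real \<mu> + F i p) * (x ^ j * of_nat e)"
 have "\<exists>P. \<forall>x. sdet n (%(i, j). ?E i j x) = poly P x"
 proof (rule det_polynomial)
  fix i j
  show "\<exists>P. \<forall>x. ?E i j x = poly P x"
   by (intro exI[of _ "Polynomial.smult (of_real \<mu> * (if i = j then of_nat (Suc e) else 0) + dd j (F i) p) (\<Sum>k<n. Polynomial.monom 1 k)
    - Polynomial.smult (of_real \<mu> + F i p) (Polynomial.monom (of_nat e) j)"])
    (simp add: poly_sum poly_monom mult.commute)
 qed
 then obtain P where P: "\<forall>x. sdet n (%(i, j). ?E i j x) = poly P x" ..
 show ?thesis
 proof (intro exI[of _ P] allI)
  fix \<nu>
  have "jac (%i q. of_real \<mu> * q i ^ Suc e + F i q) (hsum e \<nu>) p = sdet n (%(i, j). ?E i j (of_real \<nu>))"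
   by (rule jac_at_one) (use p F in auto)
  thus "jac (%i q. of_real \<mu> * q i ^ Suc e + F i q) (hsum e \<nu>) p = poly P (of_real \<nu>)"
   unfolding P[rule_format, of "of_real \<nu>"] .
 qed
qed

text \<open>The parameters are chosen one after the other: \<open>\<mu>\<close> makes the Jacobian a nonzero function,
  \<open>\<nu>\<close> keeps it nonzero and makes \<open>h\<close> nonzero at the finitely many zeros of
  \<open>f\<close> off the origin, and \<open>s\<close> is a regular value of \<open>f / h\<close>.\<close>

lemma generic_deformation:
 assumes par: "\<And>M. maximalideal M R ==> \<exists>l. (\<forall>i<n. l i \<in> M) \<and> (\<forall>x\<in>M. \<exists>v. tup n v \<and> x = lincomb n v l)"
  and F: "\<And>i. i < n ==> rpoly (Suc n) e (F i)"
 shows "\<exists>\<mu> \<nu> s. \<forall>G. tup n G -->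
   (\<forall>i<n. \<forall>p\<in>Y. ev (G i) p = of_real \<mu> * p i ^ Suc e + F i p - of_real (s i) * hsum e \<nu> p) -->
   finite {M. maximalideal M R \<and> (\<forall>i<n. G i \<in> M)} \<and>
   (\<forall>M. maximalideal M R --> M \<noteq> m0 --> (\<forall>i<n. G i \<in> M) --> gens n M G)"
proof -
 define p0 where "p0 = lift (%i. 1)"
 have p0: "p0 \<in> Y" "\<And>i. i < n ==> p0 i = 1" by (simp_all add: p0_def lift_Y lift_coord)
 have p0n: "p0 n \<noteq> 0" by (rule cnj_last(2)[OF p0(1)]) (simp add: p0(2))
 have Fr: "\<And>i. i < n ==> repr (F i)" using poly_repr[OF F] by blast
 note q0 = p0(1) p0n p0(2)
 have "\<exists>\<mu>::real. \<mu> \<noteq> 0 \<and> jac (%i q. of_real \<mu> * q i ^ Suc e + F i q) (hsum e 0) p0 \<noteq> 0"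
  by (rule generic_mu[of p0 F e, OF q0 Fr])
 then obtain \<mu> :: real where mu: "\<mu> \<noteq> 0" "jac (%i q. of_real \<mu> * q i ^ Suc e + F i q) (hsum e 0) p0 \<noteq> 0"
  by (elim exE conjE)
 define f where "f = (%i q. of_real \<mu> * q i ^ Suc e + F i q)"
 have fp: "rpoly (Suc n) (Suc e) (f i)" if i: "i < n" for i unfolding f_def
 proof (rule rpoly.add)
  show "rpoly (Suc n) (Suc e) (%q. of_real \<mu> * q i ^ Suc e)"
   by (intro rpoly_scale rpoly_power[OF rpoly.var[of i "Suc n" 1]]) (use i in auto)
  show "rpoly (Suc n) (Suc e) (F i)" by (rule rpoly_mono[OF F[OF i]]) auto
 qed
 define V where "V = {M. maximalideal M R \<and> (\<forall>i<n. mem M (f i))} - {m0}"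
 have "finite {M. maximalideal M R \<and> (\<forall>i<n. mem M (%p. of_real \<mu> * p i ^ Suc e + F i p))}"
  by (rule finite_zero_set[OF mu(1)]) (use F in simp_all)
 hence finV: "finite V" by (simp add: V_def f_def)
 have "\<exists>P. \<forall>\<nu>. jac f (hsum e \<nu>) p0 = poly P (of_real \<nu>)"
  unfolding f_def by (rule jac_lambda[of p0 F \<mu> e]) (use q0 Fr in auto)
 then obtain P where P: "\<forall>\<nu>. jac f (hsum e \<nu>) p0 = poly P (of_real \<nu>)" ..
 have "poly P (of_real 0) \<noteq> 0" using P mu(2) unfolding f_def by metis
 hence P0: "P \<noteq> 0" by auto
 have "\<exists>z Q. M \<in> V --> z \<in> Y \<and> M = point_ideal z \<and> Q \<noteq> 0 \<and> (\<forall>\<nu>. hsum e \<nu> z = poly Q (of_real \<nu>))" for M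
 proof (cases "M \<in> V")
  case True
  hence M: "maximalideal M R" "M \<noteq> m0" by (auto simp: V_def)
  obtain z where z: "z \<in> Y" "M = point_ideal z" using nullstellensatz[OF M(1)] by blast
  have "\<exists>k<n. z k \<noteq> 0"
  proof (rule ccontr)
   assume "\<not> ?thesis"
   hence yz: "yel i \<in> M" if "i < n" for i using that yel[of i] z by (simp add: point_ideal_def)
   have "m0 \<subseteq> M"
   proof
    fix x assume "x \<in> m0"
    then obtain v where v: "tup n v" "x = lincomb n v yel" using origin_gen by blast
    show "x \<in> M" unfolding v(2) by (rule lincomb_in_ideal[OF maximalideal.axioms(1)[OF M(1)] v(1) yz])
   qed
   thus False using maximal_unique[OF m0_maximal M(1)] M(2) by blast
  qed
  then obtain k where k: "k < n" "z k \<noteq> 0" by blast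
  obtain Q where "Q \<noteq> 0 \<and> (\<forall>\<nu>. hsum e \<nu> z = poly Q (of_real \<nu>))" using hsum_roots[of k z e, OF k] ..
  thus ?thesis using z by (intro exI[of _ z] exI[of _ Q]) simp
 next
  case False
  show ?thesis by (rule exI, rule exI, rule impI, erule notE[OF False])
 qed
 hence "\<forall>M. \<exists>Q. M \<in> V --> (\<exists>z\<in>Y. M = point_ideal z \<and> Q \<noteq> 0 \<and> (\<forall>\<nu>. hsum e \<nu> z = poly Q (of_real \<nu>)))" by meson
 from choice[OF this] obtain Q where Q: "\<forall>M. M \<in> V --> (\<exists>z\<in>Y. M = point_ideal z \<and> Q M \<noteq> 0 \<and> (\<forall>\<nu>. hsum e \<nu> z = poly (Q M) (of_real \<nu>)))" ..
 have "finite ({x. poly P x = 0} \<union> (\<Union>M\<in>V. {x. poly (Q M) x = 0}))"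
 proof (intro finite_UnI finite_UN_I finV poly_roots_finite P0)
  fix M assume "M \<in> V" thus "Q M \<noteq> 0" using Q by blast
 qed
 from real_avoiding[OF this] obtain \<nu> :: real where
  "of_real \<nu> \<notin> {x. poly P x = 0} \<union> (\<Union>M\<in>V. {x. poly (Q M) x = 0})" ..
 hence lam: "poly P (of_real \<nu>) \<noteq> 0" "\<And>M. M \<in> V ==> poly (Q M) (of_real \<nu>) \<noteq> 0" by auto
 let ?h = "hsum e \<nu>"
 have hp: "rpoly (Suc n) (Suc e) ?h" by (rule rpoly_mono[OF hsum_poly]) auto
 have "\<exists>d J. rpoly (Suc n) d J \<and> (\<forall>p\<in>Y. (p n = 0 --> J p = 0) \<and> (p n \<noteq> 0 --> J p = p n * ((2 * p n) ^ n * jac f ?h p)))"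
  by (rule jac_poly[of "Suc e" f ?h]) (use fp hp in auto)
 then obtain d J where J: "rpoly (Suc n) d J"
  "\<forall>p\<in>Y. (p n = 0 --> J p = 0) \<and> (p n \<noteq> 0 --> J p = p n * ((2 * p n) ^ n * jac f ?h p))" by (elim exE conjE)
 have "J p0 = p0 n * ((2 * p0 n) ^ n * jac f ?h p0)" using J(2) q0 by blast
 hence J0: "J p0 \<noteq> 0" using P lam(1) p0n by simp
 have "\<exists>s::nat => real. \<forall>z\<in>Y. ?h z \<noteq> 0 --> (\<forall>i<n. f i z = of_real (s i) * ?h z) --> J z \<noteq> 0"
  by (rule generic_values[of "Suc e" f ?h d J p0, OF _ hp J(1) p0(1) J0]) (rule fp)
 then obtain s :: "nat => real" where s: "\<forall>z\<in>Y. ?h z \<noteq> 0 --> (\<forall>i<n. f i z = of_real (s i) * ?h z) --> J z \<noteq> 0" ..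
 show ?thesis
 proof (rule exI[of _ \<mu>], rule exI[of _ \<nu>], rule exI[of _ s], intro allI impI conjI)
  fix G assume tG: "tup n G"
   and G': "\<forall>i<n. \<forall>p\<in>Y. ev (G i) p = of_real \<mu> * p i ^ Suc e + F i p - of_real (s i) * ?h p"
  have G: "ev (G i) p = f i p - of_real (s i) * ?h p" if "i < n" "p \<in> Y" for i p using G' that by (simp add: f_def)
  show "finite {M. maximalideal M R \<and> (\<forall>i<n. G i \<in> M)}"
  proof (rule finite_subset)
   show "finite {M. maximalideal M R \<and> (\<forall>i<n. mem M (%p. of_real \<mu> * p i ^ Suc e + (F i p - of_real (s i) * ?h p)))}"
   proof (rule finite_zero_set[OF mu(1)])
    show "rpoly (Suc n) (Suc e - 1) (%p. F i p - of_real (s i) * ?h p)" if "i < n" for i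
     using rpoly_diff[OF F[OF that] rpoly_scale[OF hsum_poly]] by simp
   qed simp
   show "{M. maximalideal M R \<and> (\<forall>i<n. G i \<in> M)} \<subseteq> {M. maximalideal M R \<and> (\<forall>i<n. mem M (%p. of_real \<mu> * p i ^ Suc e + (F i p - of_real (s i) * ?h p)))}"
   proof (intro subsetI CollectI conjI allI impI)
    fix M assume M: "M \<in> {M. maximalideal M R \<and> (\<forall>i<n. G i \<in> M)}"
    thus "maximalideal M R" by blast
    fix i assume i: "i < n"
    have "mem M (ev (G i))" using M i unfolding mem_def by blast
    thus "mem M (%p. of_real \<mu> * p i ^ Suc e + (F i p - of_real (s i) * ?h p))" by (rule mem_cong) (simp add: G[OF i] f_def)
   qed
  qed
  fix M assume M: "maximalideal M R" "M \<noteq> m0" "\<forall>i<n. G i \<in> M"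
  obtain z where z: "z \<in> Y" "M = point_ideal z" using nullstellensatz[OF M(1)] by blast
  have fz: "f i z = of_real (s i) * ?h z" if i: "i < n" for i
  proof -
   have "ev (G i) z = 0" using M(3) i z(2) by (simp add: point_ideal_def)
   thus ?thesis using G[OF i z(1)] by simp
  qed
  have hz: "?h z \<noteq> 0"
  proof
   assume h0: "?h z = 0"
   have "mem M (f i)" if i: "i < n" for i unfolding z(2) mem_point[OF z(1)] using poly_repr[OF fp[OF i]] fz[OF i] h0 by simp
   hence MV: "M \<in> V" using M(1,2) by (simp add: V_def)
   then obtain w where w: "w \<in> Y" "M = point_ideal w" "\<forall>\<nu>. hsum e \<nu> w = poly (Q M) (of_real \<nu>)" using Q by blast
   have "mem (point_ideal z) ?h" using mem_point[OF z(1)] poly_repr[OF hsum_poly] h0 by blast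
   hence "?h w = 0" using mem_point[OF w(1)] z(2) w(2) by metis
   thus False using lam(2)[OF MV] w(3) by simp
  qed
  have Jz: "J z \<noteq> 0" using s z(1) hz fz by blast
  have zn: "z n \<noteq> 0" using J(2) z(1) Jz by blast
  hence "jac f ?h z \<noteq> 0" using J(2) z(1) Jz by auto
  moreover have "jac f ?h z = ?h z ^ n * sdet n (%(i, j). dd j (ev (G i)) z)"
   by (rule jac_specialize[where f = f and g = "%i. ev (G i)" and s = s])
    (use z(1) zn poly_repr[OF fp] poly_repr[OF hp] fz G in auto)
  ultimately have det: "sdet n (%(i, j). dd j (ev (G i)) z) \<noteq> 0" by auto
  obtain l where l: "\<forall>i<n. l i \<in> M" "\<forall>x\<in>M. \<exists>v. tup n v \<and> x = lincomb n v l" using par[OF M(1)] by blast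
  show "gens n M G" unfolding z(2) by (rule jacobian_criterion[OF z(1) zn, of l]) (use l M(3) z(2) det in auto)
 qed
qed

end

section \<open>Powers of the maximal ideal at the origin\<close>

context chart
begin

primrec m0_power :: "nat => 'a set" where
 "m0_power 0 = carrier R"
| "m0_power (Suc j) = m0 \<cdot> m0_power j"

lemma m0_ideal: "ideal m0 R" by (rule maximalideal.axioms(1)[OF m0_maximal])

lemma m0_power_ideal: "ideal (m0_power j) R" by (induction j) (simp_all add: oneideal ideal_prod_is_ideal[OF m0_ideal])

lemma prod_least:
 assumes I: "ideal I R" and h: "\<And>a b. a \<in> A ==> b \<in> B ==> a \<otimes> b \<in> I" and x: "x \<in> A \<cdot> B"
 shows "x \<in> I" using x by (induction rule: ideal_prod.induct) (simp_all add: h ideal_add[OF I])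

lemma monom_upd_mult:
 assumes i: "i < n"
 shows "monom_val n (\<alpha>(i := Suc (\<alpha> i))) p = p i * monom_val n \<alpha> p"
  and "(\<Sum>j<n. (\<alpha>(i := Suc (\<alpha> i))) j) = Suc (\<Sum>j<n. \<alpha> j)"
 using monom_reduce[of i 1 "\<alpha>(i := Suc (\<alpha> i))"] i by simp_all

text \<open>Colon ideals by the coordinates strip one factor at a time from a product of elements of
  \<open>m0\<close>.\<close>

lemma m0_power_subset:
 "ideal Z R ==> (\<And>\<alpha>. (\<Sum>i<n. \<alpha> i) = j ==> mem Z (monom_val n \<alpha>)) ==> m0_power j \<subseteq> Z"
proof (induction j arbitrary: Z)
 case 0
 have "mem Z (monom_val n (%i. 0))" by (rule "0.prems"(2)) simp
 hence "mem Z (%p. 1)" by (rule mem_cong) (simp add: monom_val_def)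
 hence "Z = carrier R" by (rule mem_one[OF "0.prems"(1)])
 thus ?case by simp
next
 case (Suc j)
 note Z = Suc.prems(1)
 show ?case
 proof
  fix x assume "x \<in> m0_power (Suc j)"
  hence "x \<in> m0 \<cdot> m0_power j" by simp
  thus "x \<in> Z"
  proof (rule prod_least[OF Z, rotated])
   fix a b assume a: "a \<in> m0" and b: "b \<in> m0_power j"
   have bc: "b \<in> carrier R" by (rule ideal_subsetD[OF m0_power_ideal b])
   obtain v where v: "tup n v" "a = lincomb n v yel" using origin_gen[OF a] by blast
   have yb: "b \<otimes> yel i \<in> Z" if i: "i < n" for i
   proof -
    have yc: "yel i \<in> carrier R" using yel(1) i by simp
    have "m0_power j \<subseteq> {a \<in> carrier R. a \<otimes> yel i \<in> Z}"
    proof (rule Suc.IH[OF colon_ideal[OF Z yc]])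
     fix \<alpha> :: "nat => nat" assume s: "(\<Sum>i<n. \<alpha> i) = j"
     obtain c where c: "c \<in> carrier R" "\<forall>p\<in>Y. ev c p = monom_val n \<alpha> p"
      using poly_repr[OF rpoly_monom[of \<alpha> n j "Suc n"]] s unfolding repr_def by auto
     have "mem Z (monom_val n (\<alpha>(i := Suc (\<alpha> i))))" by (rule Suc.prems(2)) (simp only: monom_upd_mult(2)[OF i] s)
     hence "mem Z (ev (c \<otimes> yel i))"
      by (rule mem_cong) (use i in \<open>simp add: monom_upd_mult(1)[OF i] ev_mult c yc yel(2)\<close>)
     hence "c \<in> {a \<in> carrier R. a \<otimes> yel i \<in> Z}" using mem_ev[OF Z] c(1) yc by simp
     thus "mem {a \<in> carrier R. a \<otimes> yel i \<in> Z} (monom_val n \<alpha>)" using c(2) unfolding mem_def by blast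
    qed
    thus ?thesis using b by blast
   qed
   have "a \<otimes> b = lincomb n v (%i. b \<otimes> yel i)"
   proof (rule ev_inject)
    have t: "tup n (%i. b \<otimes> yel i)" using tup_yel bc by (simp add: tup_def)
    show "a \<otimes> b \<in> carrier R" "lincomb n v (%i. b \<otimes> yel i) \<in> carrier R"
     using v bc lincomb_closed[OF v(1)] tup_yel t by simp_all
    fix p assume p: "p \<in> Y"
    have "ev (a \<otimes> b) p = (\<Sum>i<n. ev (v i) p * ev (yel i) p) * ev b p"
     unfolding v(2) using ev_mult[OF lincomb_closed[OF v(1) tup_yel] bc p] ev_lincomb[OF v(1) tup_yel p] by simp
    also have "\<dots> = (\<Sum>i<n. ev (v i) p * ev (b \<otimes> yel i) p)"
     unfolding sum_distrib_right by (rule sum.cong) (use p bc tupD[OF tup_yel] in \<open>simp_all add: ev_mult\<close>)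
    finally show "ev (a \<otimes> b) p = ev (lincomb n v (%i. b \<otimes> yel i)) p" using ev_lincomb[OF v(1) t p] by simp
   qed
   also have "\<dots> \<in> Z" by (rule lincomb_in_ideal[OF Z v(1) yb])
   finally show "a \<otimes> b \<in> Z" .
  qed
 qed
qed

text \<open>A monomial of degree \<open>n k\<close> in \<open>n\<close> variables has an exponent that is at least
  \<open>k\<close>.\<close>

lemma m0_power_coordinate_powers:
 assumes l: "tup n l" "\<And>i p. i < n ==> p \<in> Y ==> ev (l i) p = p i ^ k"
 shows "m0_power (n * k) \<subseteq> {lincomb n v l | v. tup n v}"
proof (rule m0_power_subset[OF lincomb_set_ideal[OF l(1)]])
 let ?L = "{lincomb n v l | v. tup n v}"
 note L = lincomb_set_ideal[OF l(1)]
 fix \<alpha> :: "nat => nat" assume s: "(\<Sum>i<n. \<alpha> i) = n * k"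
 have "\<exists>i<n. k \<le> \<alpha> i"
 proof (rule ccontr)
  assume "\<not> ?thesis"
  hence "(\<Sum>i<n. \<alpha> i) < (\<Sum>i<n. k)" using npos by (intro sum_strict_mono) (auto simp: not_le lessThan_empty_iff)
  thus False using s by simp
 qed
 then obtain i where i: "i < n" "k \<le> \<alpha> i" by blast
 have "mem ?L (ev (l i))" unfolding mem_ev[OF L tupD[OF l(1) i(1)]] by (rule lincomb_set_gen[OF l(1) i(1)])
 from mem_mult[OF L this poly_repr[OF rpoly_monom[of "\<alpha>(i := \<alpha> i - k)" n "\<Sum>j<n. (\<alpha>(i := \<alpha> i - k)) j" "Suc n"]]]
 have "mem ?L (%p. monom_val n (\<alpha>(i := \<alpha> i - k)) p * ev (l i) p)" by simp
 thus "mem ?L (monom_val n \<alpha>)" by (rule mem_cong) (simp add: monom_reduce(1)[of i k \<alpha>, OF i] l(2)[OF i(1)])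
qed

section \<open>The primary ideal and finitely many simple points\<close>

text \<open>Since \<open>N \<subseteq> m0\<close>, the equation \<open>N = I + N\<^sup>2\<close> can be iterated.\<close>

lemma primary_power_bound:
 assumes N: "ideal N R" and I: "ideal I R" and Nm: "N \<subseteq> m0"
  and sq: "\<And>x. x \<in> N ==> \<exists>y\<in>I. x \<ominus> y \<in> N \<cdot> N"
 shows "x \<in> N ==> \<exists>y\<in>I. x \<ominus> y \<in> m0_power j"
proof (induction j arbitrary: x)
 case 0
 have "\<zero> \<in> I" by (rule ideal_zero[OF I])
 moreover have "x \<ominus> \<zero> \<in> carrier R" using ideal_subsetD[OF N 0] by simp
 ultimately show ?case by (intro bexI[of _ \<zero>]) simp_all
next
 case (Suc j)
 have split: "\<exists>y\<in>I. w \<ominus> y \<in> m0_power (Suc j)" if w: "w \<in> N \<cdot> N" for w using w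
 proof (induction rule: ideal_prod.induct)
  case (prod a b)
  obtain y where y: "y \<in> I" "b \<ominus> y \<in> m0_power j" using Suc.IH[OF prod(2)] by blast
  have c: "a \<in> carrier R" "b \<in> carrier R" "y \<in> carrier R"
   using ideal_subsetD[OF N] ideal_subsetD[OF I] prod y(1) by simp_all
  have "a \<otimes> b \<ominus> a \<otimes> y = a \<otimes> (b \<ominus> y)" using c by (simp add: minus_eq r_distr r_minus)
  moreover have "a \<otimes> (b \<ominus> y) \<in> m0 \<cdot> m0_power j"
   by (rule ideal_prod.prod[OF _ y(2)]) (use Nm prod(1) in blast)
  moreover have "a \<otimes> y \<in> I" by (rule ideal.I_l_closed[OF I y(1) c(1)])
  ultimately show ?case by (intro bexI[of _ "a \<otimes> y"]) simp_all
 next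
  case (sum a b)
  then obtain y z where y: "y \<in> I" "a \<ominus> y \<in> m0_power (Suc j)" "z \<in> I" "b \<ominus> z \<in> m0_power (Suc j)" by blast
  have c: "a \<in> carrier R" "b \<in> carrier R" "y \<in> carrier R" "z \<in> carrier R"
   using ideal_subsetD[OF prod_ideal[OF N]] ideal_subsetD[OF I] sum.hyps y by simp_all
  have "(a \<oplus> b) \<ominus> (y \<oplus> z) = (a \<ominus> y) \<oplus> (b \<ominus> z)"
   by (rule ev_inject) (use c in \<open>simp_all add: ev_add ev_minus\<close>)
  moreover have "(a \<ominus> y) \<oplus> (b \<ominus> z) \<in> m0_power (Suc j)" by (rule ideal_add[OF m0_power_ideal y(2,4)])
  moreover have "y \<oplus> z \<in> I" by (rule ideal_add[OF I y(1,3)])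
  ultimately show ?case by (intro bexI[of _ "y \<oplus> z"]) simp_all
 qed
 obtain y where y: "y \<in> I" "x \<ominus> y \<in> N \<cdot> N" using sq[OF Suc.prems] by blast
 obtain z where z: "z \<in> I" "x \<ominus> y \<ominus> z \<in> m0_power (Suc j)" using split[OF y(2)] by blast
 have c: "x \<in> carrier R" "y \<in> carrier R" "z \<in> carrier R"
  using ideal_subsetD[OF N Suc.prems] ideal_subsetD[OF I] y(1) z(1) by simp_all
 have "x \<ominus> (y \<oplus> z) = x \<ominus> y \<ominus> z" by (rule ev_inject) (use c in \<open>simp_all add: ev_add ev_minus\<close>)
 thus ?case using z(2) ideal_add[OF I y(1) z(1)] by (intro bexI[of _ "y \<oplus> z"]) simp_all
qed

text \<open>Locally at the origin the \<open>G\<close> generate \<open>N\<close>. Nakayama's lemma is applied to the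
  powers \<open>y\<^sub>i\<^sup>k\<close> in \<open>N\<close>: modulo \<open>I = (G)\<close> they lie in
  \<open>m0\<close> times their own span, because \<open>N \<subseteq> I + m0\<^sup>n\<^sup>k\<^sup>+\<^sup>1\<close>,
  and \<open>N\<close> itself lies in that span modulo \<open>I\<close>.\<close>

lemma origin_multiplier:
 assumes N: "ideal N R" and Nm: "N \<subseteq> m0" and G: "tup n G" "\<And>i. i < n ==> G i \<in> N"
  and sq: "\<And>x. x \<in> N ==> \<exists>v. tup n v \<and> x \<ominus> lincomb n v G \<in> N \<cdot> N"
  and l: "tup n l" "\<And>i. i < n ==> l i \<in> N" "\<And>i p. i < n ==> p \<in> Y ==> ev (l i) p = p i ^ k"
 shows "\<exists>a\<in>carrier R. a \<notin> m0 \<and> (\<forall>x\<in>N. a \<otimes> x \<in> {lincomb n v G | v. tup n v})"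
proof -
 let ?I = "{lincomb n v G | v. tup n v}" and ?L = "{lincomb n v l | v. tup n v}"
 note I = lincomb_set_ideal[OF G(1)] and L = lincomb_set_ideal[OF l(1)]
 have sq': "\<exists>y\<in>?I. x \<ominus> y \<in> N \<cdot> N" if "x \<in> N" for x using sq[OF that] by blast
 have bound: "\<exists>y\<in>?I. x \<ominus> y \<in> m0_power j" if "x \<in> N" for x j
  by (rule primary_power_bound[OF N I Nm _ that]) (rule sq')
 note pL = m0_power_coordinate_powers[OF l(1,3)]
 have "\<exists>a\<in>carrier R. a \<notin> m0 \<and> (\<forall>v. tup n v --> a \<otimes> lincomb n v l \<in> ?I)"
 proof (rule local_multiplier[OF I m0_maximal l(1)])
  fix i assume i: "i < n"
  obtain y where y: "y \<in> ?I" "l i \<ominus> y \<in> m0_power (Suc (n * k))" using bound[OF l(2)[OF i]] by blast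
  have "m0 \<cdot> m0_power (n * k) \<subseteq> m0 \<cdot> ?L"
  proof
   fix x assume "x \<in> m0 \<cdot> m0_power (n * k)"
   thus "x \<in> m0 \<cdot> ?L" by (rule prod_least[OF ideal_prod_is_ideal[OF m0_ideal L], rotated])
     (use pL in \<open>blast intro: ideal_prod.prod\<close>)
  qed
  hence "l i \<ominus> y \<in> m0 \<cdot> ?L" using y(2) by auto
  then obtain v where v: "\<forall>j<n. v j \<in> m0" "l i \<ominus> y = lincomb n v l" using prod_lincomb[OF m0_ideal l(1)] by blast
  have tv: "tup n v" using v(1) ideal_subsetD[OF m0_ideal] by (simp add: tup_def)
  have c: "l i \<in> carrier R" "y \<in> carrier R" using tupD[OF l(1) i] ideal_subsetD[OF I y(1)] by simp_all
  have "l i \<ominus> lincomb n v l = y"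
   unfolding v(2)[symmetric] by (rule ev_inject) (use c in \<open>simp_all add: ev_minus\<close>)
  thus "\<exists>v. (\<forall>j<n. v j \<in> m0) \<and> l i \<ominus> lincomb n v l \<in> ?I" using v(1) y(1) by (intro exI[of _ v]) simp
 qed
 then obtain a where a: "a \<in> carrier R" "a \<notin> m0" "\<And>v. tup n v ==> a \<otimes> lincomb n v l \<in> ?I" by blast
 have "a \<otimes> x \<in> ?I" if x: "x \<in> N" for x
 proof -
  obtain y where y: "y \<in> ?I" "x \<ominus> y \<in> m0_power (n * k)" using bound[OF x] by blast
  then obtain v where v: "tup n v" "x \<ominus> y = lincomb n v l" using pL by blast
  have c: "x \<in> carrier R" "y \<in> carrier R" using ideal_subsetD[OF N x] ideal_subsetD[OF I y(1)] by simp_all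
  have "a \<otimes> (x \<ominus> y) \<in> ?I" using a(3)[OF v(1)] v(2) by simp
  moreover have "a \<otimes> y \<in> ?I" by (rule ideal.I_l_closed[OF I y(1) a(1)])
  ultimately have "a \<otimes> (x \<ominus> y) \<oplus> a \<otimes> y \<in> ?I" by (rule ideal_add[OF I])
  moreover have "a \<otimes> (x \<ominus> y) \<oplus> a \<otimes> y = a \<otimes> x"
   by (rule ev_inject) (use c a(1) in \<open>simp_all add: ev_add ev_mult ev_minus algebra_simps\<close>)
  ultimately show ?thesis by simp
 qed
 thus ?thesis using a(1,2) by blast
qed

lemma simple_point_multiplier:
 assumes M: "maximalideal M R" and l: "\<And>i. i < n ==> l i \<in> M"
  and gen: "\<And>x. x \<in> M ==> \<exists>v. tup n v \<and> x = lincomb n v l" and g: "gens n M G"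
 shows "\<exists>a\<in>carrier R. a \<notin> M \<and> (\<forall>x\<in>M. a \<otimes> x \<in> {lincomb n v G | v. tup n v})"
proof -
 have Mi: "ideal M R" by (rule maximalideal.axioms(1)[OF M])
 have tl: "tup n l" using l ideal_subsetD[OF Mi] by (simp add: tup_def)
 note tG = gens_tup[OF Mi g]
 let ?I = "{lincomb n v G | v. tup n v}"
 note I = lincomb_set_ideal[OF tG]
 have ex: "\<exists>a\<in>carrier R. a \<notin> M \<and> (\<forall>v. tup n v --> a \<otimes> lincomb n v l \<in> ?I)"
 proof (rule local_multiplier[OF I M tl])
  fix i assume i: "i < n"
  obtain w where w: "tup n w" "l i \<ominus> lincomb n w G \<in> M \<cdot> M" using g l[OF i] unfolding gens_def by blast
  have "M \<cdot> M \<subseteq> M \<cdot> {lincomb n v l | v. tup n v}"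
  proof
   fix x assume "x \<in> M \<cdot> M"
   thus "x \<in> M \<cdot> {lincomb n v l | v. tup n v}"
   proof (rule prod_least[OF ideal_prod_is_ideal[OF Mi lincomb_set_ideal[OF tl]], rotated])
    fix a b assume a: "a \<in> M" and b: "b \<in> M"
    obtain v where "tup n v" "b = lincomb n v l" using gen[OF b] by blast
    hence "b \<in> {lincomb n v l | v. tup n v}" by blast
    thus "a \<otimes> b \<in> M \<cdot> {lincomb n v l | v. tup n v}" by (rule ideal_prod.prod[OF a])
   qed
  qed
  then obtain v where v: "\<forall>j<n. v j \<in> M" "l i \<ominus> lincomb n w G = lincomb n v l"
   using w(2) prod_lincomb[OF Mi tl] by blast
  have c: "l i \<in> carrier R" "lincomb n w G \<in> carrier R" using tupD[OF tl i] lincomb_closed[OF w(1) tG] by simp_all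
  have "l i \<ominus> lincomb n v l = lincomb n w G"
   unfolding v(2)[symmetric] by (rule ev_inject) (use c in \<open>simp_all add: ev_minus\<close>)
  hence "l i \<ominus> lincomb n v l \<in> ?I" using w(1) by blast
  thus "\<exists>v. (\<forall>j<n. v j \<in> M) \<and> l i \<ominus> lincomb n v l \<in> ?I" using v(1) by blast
 qed
 obtain a where a: "a \<in> carrier R" "a \<notin> M" "\<And>v. tup n v ==> a \<otimes> lincomb n v l \<in> ?I" using ex by blast
 have "a \<otimes> x \<in> ?I" if x: "x \<in> M" for x
 proof -
  obtain v where v: "tup n v" "x = lincomb n v l" using gen[OF x] by blast
  show ?thesis unfolding v(2) by (rule a(3)[OF v(1)])
 qed
 thus ?thesis by (intro bexI[OF _ a(1)] conjI a(2) ballI)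
qed

text \<open>Let \<open>x\<close> lie in \<open>N\<close> and in all \<open>M \<in> \<M>\<close>. A maximal ideal
  containing the colon ideal of \<open>x\<close> into \<open>(g)\<close> contains all \<open>g i\<close>, so it is the
  origin or a simple zero, and there the local multipliers show that it does not contain the colon ideal after all.\<close>

lemma bertini_origin:
 assumes par: "\<And>M. maximalideal M R ==> \<exists>l. (\<forall>i<n. l i \<in> M) \<and> (\<forall>x\<in>M. \<exists>v. tup n v \<and> x = lincomb n v l)"
  and N: "ideal N R" and rad: "ideal_radical R N = m0" and f: "gens n N f"
 shows "\<exists>g \<M>. (\<forall>i<n. g i \<in> N \<and> g i \<ominus> f i \<in> N \<cdot> N) \<and> finite \<M> \<and>
   (\<forall>M\<in>\<M>. maximalideal M R) \<and> m0 \<notin> \<M> \<and>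
   (\<forall>x\<in>N. (\<forall>M\<in>\<M>. x \<in> M) --> (\<exists>v. tup n v \<and> x = lincomb n v g)) \<and>
   (\<forall>M\<in>\<M>. \<forall>i<n. g i \<in> M)"
proof -
 note tf = gens_tup[OF N f]
 note N2 = prod_ideal[OF N]
 have Nm: "N \<subseteq> m0"
 proof
  fix x assume x: "x \<in> N"
  have "x [^] (1::nat) \<in> N" using x ideal_subsetD[OF N x] by (simp add: nat_pow_eone)
  thus "x \<in> m0" unfolding rad[symmetric] ideal_radical_def using ideal_subsetD[OF N x] by blast
 qed
 have ev_pow: "ev (yel i [^] (k::nat)) p = p i ^ k" if i: "i < n" and p: "p \<in> Y" for i k p
 proof (induction k)
  case (Suc k)
  have "yel i \<in> carrier R" using yel(1) i by simp
  thus ?case using Suc ev_mult[of "yel i [^] k" "yel i" p] p yel(2)[of i p] i by (simp add: mult.commute)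
 qed (simp add: ev_one p)
 have "\<forall>i. \<exists>k::nat. i < n --> yel i [^] k \<in> N"
 proof
  fix i show "\<exists>k::nat. i < n --> yel i [^] k \<in> N"
  proof (cases "i < n")
   case True
   have "yel i \<in> ideal_radical R N" unfolding rad by (rule yel_m0[OF True])
   thus ?thesis unfolding ideal_radical_def by blast
  qed simp
 qed
 from choice[OF this] obtain e where e: "\<forall>i. i < n --> yel i [^] (e i :: nat) \<in> N" ..
 define k where "k = (\<Sum>i<n. e i)"
 have yN: "yel i [^] m \<in> N" if i: "i < n" and m: "k \<le> m" for i m
 proof -
  have yc: "yel i \<in> carrier R" using yel(1) i by simp
  have "e i \<le> m" using member_le_sum[of i "{..<n}" e] i m by (simp add: k_def)
  hence "yel i [^] m = yel i [^] (m - e i) \<otimes> yel i [^] e i" using yc by (simp add: nat_pow_mult)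
  thus ?thesis using ideal.I_l_closed[OF N] e i yc by simp
 qed
 have y2: "yel i [^] m \<in> N \<cdot> N" if i: "i < n" and m: "2 * k \<le> m" for i m
 proof -
  have yc: "yel i \<in> carrier R" using yel(1) i by simp
  have "yel i [^] m = yel i [^] k \<otimes> yel i [^] (m - k)" using yc m by (simp add: nat_pow_mult)
  thus ?thesis using prod_mem[OF yN[OF i, of k] yN[OF i, of "m - k"]] m by simp
 qed
 obtain d F where F: "\<forall>i\<in>{..<n}. rpoly (Suc n) d (F i) \<and> (\<forall>p\<in>Y. ev (f i) p = F i p)"
  using ev_poly_bounded[of "{..<n}" f] tf by (auto simp: tup_def)
 define E where "E = d + 2 * k"
 have FE: "rpoly (Suc n) E (F i)" if "i < n" for i by (rule rpoly_mono[of _ d]) (use F that in \<open>auto simp: E_def\<close>)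
 have "\<exists>\<mu> \<nu> s. \<forall>G. tup n G -->
   (\<forall>i<n. \<forall>p\<in>Y. ev (G i) p = of_real \<mu> * p i ^ Suc E + F i p - of_real (s i) * hsum E \<nu> p) -->
   finite {M. maximalideal M R \<and> (\<forall>i<n. G i \<in> M)} \<and>
   (\<forall>M. maximalideal M R --> M \<noteq> m0 --> (\<forall>i<n. G i \<in> M) --> gens n M G)"
 proof (rule generic_deformation)
  fix M assume M: "maximalideal M R"
  show "\<exists>l. (\<forall>i<n. l i \<in> M) \<and> (\<forall>x\<in>M. \<exists>v. tup n v \<and> x = lincomb n v l)" by (rule par[OF M])
 qed (rule FE)
 then obtain \<mu> \<nu> s where gen: "\<forall>G. tup n G -->
   (\<forall>i<n. \<forall>p\<in>Y. ev (G i) p = of_real \<mu> * p i ^ Suc E + F i p - of_real (s i) * hsum E \<nu> p) -->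
   finite {M. maximalideal M R \<and> (\<forall>i<n. G i \<in> M)} \<and>
   (\<forall>M. maximalideal M R --> M \<noteq> m0 --> (\<forall>i<n. G i \<in> M) --> gens n M G)" by (elim exE)
 have mem_pow: "mem (N \<cdot> N) (%p. p i ^ m)" if i: "i < n" and m: "2 * k \<le> m" for i m
  unfolding mem_def using y2[OF i m] ev_pow[OF i] by blast
 have D: "mem (N \<cdot> N) (%p. of_real \<mu> * p i ^ Suc E - of_real (s i) * hsum E \<nu> p)" if i: "i < n" for i
 proof (rule mem_diff[OF N2])
  show "mem (N \<cdot> N) (%p. of_real \<mu> * p i ^ Suc E)" by (rule mem_mult[OF N2 mem_pow[OF i] scalar_repr]) (simp add: E_def)
  have "mem (N \<cdot> N) (hsum E \<nu>)" unfolding hsum_def[abs_def]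
  proof (rule mem_sum[OF N2])
   fix j assume "j \<in> {..<n}"
   hence "mem (N \<cdot> N) (%p. of_real (\<nu> ^ j) * p j ^ E)"
    by (intro mem_mult[OF N2 mem_pow scalar_repr]) (simp_all add: E_def)
   thus "mem (N \<cdot> N) (%p. of_real \<nu> ^ j * p j ^ E)" by simp
  qed
  thus "mem (N \<cdot> N) (%p. of_real (s i) * hsum E \<nu> p)" by (rule mem_mult[OF N2 _ scalar_repr])
 qed
 have "\<forall>i. \<exists>a. i < n --> a \<in> N \<cdot> N \<and> (\<forall>p\<in>Y. ev a p = of_real \<mu> * p i ^ Suc E - of_real (s i) * hsum E \<nu> p)"
  using D unfolding mem_def by blast
 from choice[OF this] obtain b where b: "\<forall>i. i < n --> b i \<in> N \<cdot> N \<and> (\<forall>p\<in>Y. ev (b i) p = of_real \<mu> * p i ^ Suc E - of_real (s i) * hsum E \<nu> p)" ..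
 define g where "g i = f i \<oplus> b i" for i
 have bN: "b i \<in> N \<cdot> N" "b i \<in> N" "b i \<in> carrier R" "f i \<in> N" "f i \<in> carrier R" if i: "i < n" for i
 proof -
  show 1: "b i \<in> N \<cdot> N" using b i by blast
  show 2: "b i \<in> N" using 1 prod_subset[OF N] by blast
  show "b i \<in> carrier R" by (rule ideal_subsetD[OF N 2])
  show 3: "f i \<in> N" using f i by (simp add: gens_def)
  show "f i \<in> carrier R" by (rule ideal_subsetD[OF N 3])
 qed
 have gN: "g i \<in> N" if i: "i < n" for i unfolding g_def by (rule ideal_add[OF N bN(4)[OF i] bN(2)[OF i]])
 have gf: "g i \<ominus> f i = b i" if i: "i < n" for i
  by (rule ev_inject) (use bN[OF i] in \<open>simp_all add: g_def ev_add ev_minus\<close>)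
 have tg: "tup n g" using gN ideal_subsetD[OF N] by (simp add: tup_def)
 let ?I = "{lincomb n v g | v. tup n v}"
 note I = lincomb_set_ideal[OF tg]
 have "ev (g i) p = of_real \<mu> * p i ^ Suc E + F i p - of_real (s i) * hsum E \<nu> p" if i: "i < n" and p: "p \<in> Y" for i p
  using b F i p bN[OF i] by (simp add: g_def ev_add)
 hence G: "finite {M. maximalideal M R \<and> (\<forall>i<n. g i \<in> M)}"
  "\<And>M. maximalideal M R ==> M \<noteq> m0 ==> (\<forall>i<n. g i \<in> M) ==> gens n M g"
  using gen[rule_format, of g] tg by simp_all
 define \<M> where "\<M> = {M. maximalideal M R \<and> (\<forall>i<n. g i \<in> M)} - {m0}"
 have sqg: "\<exists>v. tup n v \<and> x \<ominus> lincomb n v g \<in> N \<cdot> N" if x: "x \<in> N" for x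
 proof -
  obtain v where v: "tup n v" "x \<ominus> lincomb n v f \<in> N \<cdot> N" using f x unfolding gens_def by blast
  have "lincomb n v g \<ominus> lincomb n v f \<in> N \<cdot> N"
   unfolding lincomb_diff_right[OF v(1) tg tf] by (rule lincomb_in_ideal[OF N2 v(1)]) (simp add: gf bN)
  hence "(x \<ominus> lincomb n v f) \<ominus> (lincomb n v g \<ominus> lincomb n v f) \<in> N \<cdot> N" by (rule ideal_minus[OF N2 v(2)])
  moreover have "(x \<ominus> lincomb n v f) \<ominus> (lincomb n v g \<ominus> lincomb n v f) = x \<ominus> lincomb n v g"
   by (rule ev_inject) (use ideal_subsetD[OF N x] lincomb_closed[OF v(1) tg] lincomb_closed[OF v(1) tf] in \<open>simp_all add: ev_minus\<close>)
  ultimately show ?thesis using v(1) by (intro exI[of _ v]) simp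
 qed
 have main: "x \<in> ?I" if x: "x \<in> N" "\<forall>M\<in>\<M>. x \<in> M" for x
 proof (rule ccontr)
  assume no: "x \<notin> ?I"
  have xc: "x \<in> carrier R" by (rule ideal_subsetD[OF N x(1)])
  let ?C = "{a \<in> carrier R. a \<otimes> x \<in> ?I}"
  note C = colon_ideal[OF I xc]
  have "\<one> \<notin> ?C" using no xc by simp
  hence neC: "?C \<noteq> carrier R" by blast
  obtain M where M: "maximalideal M R" "?C \<subseteq> M" by (rule exists_maximal_above[OF C neC])
  have gM: "g i \<in> M" if i: "i < n" for i
  proof -
   have "x \<otimes> g i \<in> ?I" by (rule ideal.I_l_closed[OF I lincomb_set_gen[OF tg i] xc])
   hence "g i \<in> ?C" using tupD[OF tg i] xc m_comm by simp
   thus ?thesis using M(2) by blast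
  qed
  have "\<exists>a\<in>carrier R. a \<notin> M \<and> a \<otimes> x \<in> ?I"
  proof (cases "M = m0")
   case True
   define l where "l i = yel i [^] k" for i
   have l: "tup n l" "\<And>i. i < n ==> l i \<in> N" "\<And>i p. i < n ==> p \<in> Y ==> ev (l i) p = p i ^ k"
    using yN[of _ k] ideal_subsetD[OF N] ev_pow by (simp_all add: l_def tup_def)
   have "\<exists>a\<in>carrier R. a \<notin> m0 \<and> (\<forall>x\<in>N. a \<otimes> x \<in> ?I)"
    by (rule origin_multiplier[OF N Nm tg gN sqg l])
   thus ?thesis using x(1) True by blast
  next
   case False
   have MM: "M \<in> \<M>" using M(1) gM False by (simp add: \<M>_def)
   obtain l where l: "\<forall>i<n. l i \<in> M" "\<forall>x\<in>M. \<exists>v. tup n v \<and> x = lincomb n v l" using par[OF M(1)] by blast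
   have "gens n M g" using G(2)[OF M(1) False] gM by blast
   hence "\<exists>a\<in>carrier R. a \<notin> M \<and> (\<forall>x\<in>M. a \<otimes> x \<in> ?I)"
    by (intro simple_point_multiplier[OF M(1), of l]) (use l in auto)
   thus ?thesis using x(2) MM by blast
  qed
  thus False using M(2) by blast
 qed
 show ?thesis
 proof (rule exI[of _ g], rule exI[of _ \<M>], intro conjI)
  show "\<forall>i<n. g i \<in> N \<and> g i \<ominus> f i \<in> N \<cdot> N" using gN gf bN(1) by simp
  show "finite \<M>" using G(1) by (simp add: \<M>_def)
  show "\<forall>M\<in>\<M>. maximalideal M R" "m0 \<notin> \<M>" "\<forall>M\<in>\<M>. \<forall>i<n. g i \<in> M" by (simp_all add: \<M>_def)
  show "\<forall>x\<in>N. (\<forall>M\<in>\<M>. x \<in> M) --> (\<exists>v. tup n v \<and> x = lincomb n v g)" using main by blast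
 qed
qed

end

section \<open>Changing the chart\<close>

context chart
begin

lemma change_chart:
 assumes c': "rpoly n 2 c'" "\<And>p. (\<And>i. i < n ==> p i \<in> \<real>) ==> 0 < Re (c' p)"
  and TY: "\<And>y. T y \<in> Y \<longleftrightarrow> y n ^ 2 + c' y = 0"
  and T: "\<And>i. i < Suc n ==> rpoly (Suc n) 1 (%y. T y i)"
  and U: "\<And>i. i < Suc n ==> rpoly (Suc n) 1 (%p. U p i)"
  and TU: "\<And>p. T (U p) = p" and UT: "\<And>y. U (T y) = y"
 shows "chart R (%a y. ev a (T y)) {y. T y \<in> Y} n c'"
proof (intro chart.intro chart_axioms.intro function_ring.intro function_ring_axioms.intro)
 show "cring R" by (rule is_cring)
 fix a b y assume ab: "a \<in> carrier R" "b \<in> carrier R"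
 show "ev (a \<oplus> b) (T y) = ev a (T y) + ev b (T y)" "ev (a \<otimes> b) (T y) = ev a (T y) * ev b (T y)"
  if "y \<in> {y. T y \<in> Y}" using that ab by (simp_all add: ev_add ev_mult)
next
 fix y assume "y \<in> {y. T y \<in> Y}"
 thus "ev \<one> (T y) = 1" by (simp add: ev_one)
next
 fix a b assume ab: "a \<in> carrier R" "b \<in> carrier R" and e: "\<And>y. y \<in> {y. T y \<in> Y} ==> ev a (T y) = ev b (T y)"
 show "a = b"
 proof (rule ev_inject[OF ab])
  fix p assume "p \<in> Y"
  thus "ev a p = ev b p" using e[of "U p"] by (simp add: TU)
 qed
next
 fix a assume "a \<in> carrier R"
 then obtain d F where F: "rpoly (Suc n) d F" "\<forall>p\<in>Y. ev a p = F p" using ev_poly by blast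
 have "rpoly (Suc n) d (%y. F (%i. T y i))" by (rule rpoly_comp[OF F(1) T])
 thus "\<exists>d F. rpoly (Suc n) d F \<and> (\<forall>y\<in>{y. T y \<in> Y}. ev a (T y) = F y)"
  using F(2) by (intro exI[of _ d] exI[of _ "%y. F (T y)"]) simp
next
 fix d F assume F: "rpoly (Suc n) d F"
 have "rpoly (Suc n) d (%p. F (%i. U p i))" by (rule rpoly_comp[OF F U])
 then obtain a where a: "a \<in> carrier R" "\<forall>p\<in>Y. ev a p = F (U p)" using poly_repr unfolding repr_def by blast
 interpret T: function_ring R "%a y. ev a (T y)" "{y. T y \<in> Y}"
 proof (intro function_ring.intro function_ring_axioms.intro)
  show "cring R" by (rule is_cring)
  fix a b assume ab: "a \<in> carrier R" "b \<in> carrier R" and e: "\<And>y. y \<in> {y. T y \<in> Y} ==> ev a (T y) = ev b (T y)"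
  show "a = b"
  proof (rule ev_inject[OF ab])
   fix p assume "p \<in> Y"
   thus "ev a p = ev b p" using e[of "U p"] by (simp add: TU)
  qed
 qed (simp_all add: ev_add ev_mult ev_one)
 show "function_ring.repr R (%a y. ev a (T y)) {y. T y \<in> Y} F"
  unfolding T.repr_def using a by (intro bexI[of _ a]) (simp_all add: UT)
qed (use npos c' TY in auto)

end

locale quadric = chart R ev Y n "%p. (\<Sum>i<n. p i ^ 2) + 1" for R (structure) and ev Y n
begin

lemma quadric_Y: "p \<in> Y \<longleftrightarrow> (\<Sum>i\<le>n. p i ^ 2) + 1 = 0"
 by (simp add: Y_eq lessThan_Suc_atMost[symmetric] add.commute add.left_commute)

text \<open>The line through \<open>z\<close> and its conjugate has real equations \<open>x\<^sub>k = \<alpha>\<^sub>k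
  + \<beta>\<^sub>k x\<^sub>n\<close>, after exchanging \<open>x\<^sub>n\<close> with a coordinate that is not real at
  \<open>z\<close>. With \<open>y\<^sub>k = x\<^sub>k - \<alpha>\<^sub>k - \<beta>\<^sub>k x\<^sub>n\<close> the
  quadric is \<open>g (t\<^sup>2 + c'(y)) = 0\<close> for a translate \<open>t\<close> of \<open>x\<^sub>n\<close>,
  where \<open>g = 1 + \<Sum> \<beta>\<^sub>k\<^sup>2\<close>, and \<open>c' > 0\<close> is the Cauchy-Schwarz
  inequality. The origin of this chart is \<open>z\<close> or its conjugate, which have the same ideal.\<close>

lemma recentre:
 assumes z: "z \<in> Y"
 shows "\<exists>ev' Y' c'. chart R ev' Y' n c' \<and> point_ideal z = chart.point_ideal R ev' (chart.origin n c')"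
proof -
 obtain i0 where i0: "i0 \<le> n" "Im (z i0) \<noteq> 0" using nonreal_coord[OF z] .
 define \<tau> where "\<tau> i = (if i = i0 then n else if i = n then i0 else i)" for i
 have tt: "\<tau> (\<tau> i) = i" for i by (simp add: \<tau>_def)
 have tle: "\<tau> i \<le> n" if "i \<le> n" for i using that i0(1) by (simp add: \<tau>_def)
 have tn: "\<tau> n = i0" by (simp add: \<tau>_def)
 define w where "w i = z (\<tau> i)" for i
 have wn: "Im (w n) \<noteq> 0" using i0(2) by (simp add: w_def tn)
 define \<beta> where "\<beta> k = Im (w k) / Im (w n)" for k
 define \<alpha> where "\<alpha> k = Re (w k) - \<beta> k * Re (w n)" for k
 define g where "g = 1 + (\<Sum>k<n. \<beta> k ^ 2)"
 have g1: "g \<ge> 1" by (simp add: g_def sum_nonneg)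
 let ?h = "complex_of_real (1 / g)"
 have gh: "of_real g * ?h = 1" using g1 by (simp flip: of_real_mult)
 define S where "S y = (\<Sum>k<n. complex_of_real (\<beta> k) * (y k + of_real (\<alpha> k)))" for y
 define s where "s y = y n - ?h * S y" for y
 define q where "q y i = (if i < n then y i + of_real (\<alpha> i) + of_real (\<beta> i) * s y else if i = n then s y else y i)" for y i
 define T where "T y i = q y (\<tau> i)" for y i
 define u where "u r i = (if i < n then r i - of_real (\<alpha> i) - of_real (\<beta> i) * r n
   else if i = n then r n + ?h * (\<Sum>k<n. of_real (\<beta> k) * (r k - of_real (\<beta> k) * r n)) else r i)" for r :: "nat => complex" and i
 define U where "U p = u (%i. p (\<tau> i))" for p
 define c' where "c' y = ?h * ((\<Sum>k<n. (y k + of_real (\<alpha> k)) ^ 2) + 1 - ?h * S y ^ 2)" for y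
 have Sp: "rpoly n 1 S" unfolding S_def[abs_def] by (intro rpoly_sum rpoly_scale rpoly.add rpoly.var rpoly.const) auto
 have sp: "rpoly (Suc n) 1 s" unfolding s_def[abs_def] by (intro rpoly_diff rpoly_scale rpoly.var rpoly_Suc[OF Sp]) auto
 have qp: "rpoly (Suc n) 1 (%y. q y i)" if "i \<le> n" for i
 proof (cases "i < n")
  case True
  have "rpoly (Suc n) 1 (%y. y i + of_real (\<alpha> i) + of_real (\<beta> i) * s y)"
   by (intro rpoly.add rpoly_scale rpoly.var rpoly.const sp) (use True in auto)
  thus ?thesis using True by (simp add: q_def)
 next
  case False
  thus ?thesis using sp that by (simp add: q_def)
 qed
 have Tp: "rpoly (Suc n) 1 (%y. T y i)" if "i < Suc n" for i unfolding T_def by (rule qp) (use tle that in simp)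
 have up: "rpoly (Suc n) 1 (%p. p (\<tau> i))" if "i \<le> n" for i by (rule rpoly.var) (use tle[OF that] in auto)
 have Up: "rpoly (Suc n) 1 (%p. U p i)" if i: "i < Suc n" for i
 proof (cases "i < n")
  case True
  have "rpoly (Suc n) 1 (%p. p (\<tau> i) - of_real (\<alpha> i) - of_real (\<beta> i) * p (\<tau> n))"
   by (intro rpoly_diff rpoly_scale up rpoly.const) (use True in auto)
  thus ?thesis using True by (simp add: U_def u_def)
 next
  case False
  hence i: "i = n" using i by simp
  have "rpoly (Suc n) 1 (%p. p (\<tau> n) + ?h * (\<Sum>k<n. of_real (\<beta> k) * (p (\<tau> k) - of_real (\<beta> k) * p (\<tau> n))))"
   by (intro rpoly.add rpoly_scale rpoly_sum rpoly_diff up) auto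
  thus ?thesis using i by (simp add: U_def u_def)
 qed
 have uq: "u (q y) = y" for y
 proof
  fix i
  have "(\<Sum>k<n. of_real (\<beta> k) * (q y k - of_real (\<beta> k) * q y n)) = S y"
   unfolding S_def by (rule sum.cong) (simp_all add: q_def)
  thus "u (q y) i = y i" by (simp add: u_def q_def s_def)
 qed
 have qu: "q (u r) = r" for r
 proof -
  have "S (u r) = (\<Sum>k<n. of_real (\<beta> k) * (r k - of_real (\<beta> k) * r n))"
   unfolding S_def by (rule sum.cong) (simp_all add: u_def)
  hence "s (u r) = r n" by (simp add: s_def u_def)
  thus ?thesis by (auto simp: q_def u_def)
 qed
 have UT: "U (T y) = y" for y using uq[of y] by (simp add: U_def T_def tt)
 have TU: "T (U p) = p" for p using qu[of "%i. p (\<tau> i)"] by (simp add: U_def T_def[abs_def] tt)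
 have c'p: "rpoly n 2 c'" unfolding c'_def[abs_def]
 proof (intro rpoly_scale rpoly_diff rpoly.add rpoly_sum rpoly_1)
  show "rpoly n 2 (%y. (y k + of_real (\<alpha> k)) ^ 2)" if "k \<in> {..<n}" for k
  proof (rule rpoly_power[where d = 1])
   show "rpoly n 1 (%y. y k + of_real (\<alpha> k))" by (intro rpoly.add rpoly.var rpoly.const) (use that in auto)
  qed simp
  show "rpoly n 2 (%y. S y ^ 2)" by (rule rpoly_power[OF Sp]) simp
 qed
 have c'pos: "0 < Re (c' y)" if re: "\<And>i. i < n ==> y i \<in> \<real>" for y
 proof -
  define a where "a k = Re (y k) + \<alpha> k" for k
  have ya: "y k + of_real (\<alpha> k) = of_real (a k)" if "k < n" for k using re[OF that] by (simp add: a_def of_real_Re)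
  have "S y = of_real (\<Sum>k<n. \<beta> k * a k)" by (simp add: S_def ya)
  hence "c' y = of_real ((1 / g) * ((\<Sum>k<n. a k ^ 2) + 1 - (1 / g) * (\<Sum>k<n. \<beta> k * a k) ^ 2))"
   by (simp add: c'_def ya)
  hence e: "Re (c' y) = (1 / g) * ((\<Sum>k<n. a k ^ 2) + 1 - (1 / g) * (\<Sum>k<n. \<beta> k * a k) ^ 2)" by (simp only: Re_complex_of_real)
  have "(\<Sum>k<n. \<beta> k * a k) ^ 2 \<le> (\<Sum>k<n. \<beta> k ^ 2) * (\<Sum>k<n. a k ^ 2)" by (rule Cauchy_Schwarz_ineq_sum)
  also have "\<dots> \<le> g * (\<Sum>k<n. a k ^ 2)" by (rule mult_right_mono) (simp_all add: g_def sum_nonneg)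
  finally have "(1 / g) * (\<Sum>k<n. \<beta> k * a k) ^ 2 \<le> (\<Sum>k<n. a k ^ 2)" using g1 by (simp add: divide_le_eq mult.commute)
  thus ?thesis unfolding e using g1 by (intro mult_pos_pos) auto
 qed
 have TY: "T y \<in> Y \<longleftrightarrow> y n ^ 2 + c' y = 0" for y
 proof -
  define A where "A = (\<Sum>k<n. (y k + of_real (\<alpha> k)) ^ 2)"
  have "(\<Sum>i\<le>n. T y i ^ 2) = (\<Sum>i\<le>n. q y i ^ 2)"
   by (rule sum.reindex_bij_witness[of _ \<tau> \<tau>]) (simp_all add: tt tle T_def)
  also have "\<dots> = (\<Sum>i<n. q y i ^ 2) + s y ^ 2" by (simp add: lessThan_Suc_atMost[symmetric] q_def)
  also have "(\<Sum>i<n. q y i ^ 2) = (\<Sum>i<n. (y i + of_real (\<alpha> i)) ^ 2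
    + 2 * s y * (of_real (\<beta> i) * (y i + of_real (\<alpha> i))) + of_real (\<beta> i ^ 2) * s y ^ 2)"
   by (rule sum.cong) (simp_all add: q_def power2_eq_square algebra_simps)
  also have "\<dots> = A + 2 * s y * S y + of_real (g - 1) * s y ^ 2"
   by (simp add: sum.distrib A_def S_def sum_distrib_left sum_distrib_right g_def)
  finally have "(\<Sum>i\<le>n. T y i ^ 2) + 1 = A + 2 * s y * S y + of_real g * s y ^ 2 + 1" by (simp add: algebra_simps)
  also have "\<dots> = of_real g * (y n ^ 2 + c' y)"
  proof -
   have "A + 2 * (t - h * b) * b + G * (t - h * b) ^ 2 + 1 = G * (t ^ 2 + h * (A + 1 - h * b ^ 2))"
    if "G * h = 1" for A t h b G :: complex
   proof -
    have 1: "A + 2 * (t - h * b) * b + G * (t - h * b) ^ 2 + 1 = A + 2 * t * b - 2 * h * b ^ 2 + G * t ^ 2 - 2 * (G * h) * t * b + (G * h) * h * b ^ 2 + 1"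
     by (simp add: power2_eq_square algebra_simps)
    have 2: "G * (t ^ 2 + h * (A + 1 - h * b ^ 2)) = G * t ^ 2 + (G * h) * (A + 1) - (G * h) * h * b ^ 2"
     by (simp add: power2_eq_square algebra_simps)
    show ?thesis unfolding 1 2 that by (simp add: algebra_simps)
   qed
   from this[OF gh] show ?thesis unfolding s_def c'_def A_def .
  qed
  finally show ?thesis using quadric_Y g1 by simp
 qed
 interpret N: chart R "%a y. ev a (T y)" "{y. T y \<in> Y}" n c' by (rule change_chart[OF c'p c'pos TY Tp Up TU UT])
 define o' where "o' = N.origin"
 have o'Y: "o' \<in> {y. T y \<in> Y}" and o'i: "\<And>i. i < n ==> o' i = 0" by (simp_all only: o'_def N.origin_Y N.origin_coord)
 have UzY: "U z \<in> {y. T y \<in> Y}" using z by (simp add: TU)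
 have real_rel: "w i = of_real (\<alpha> i) + of_real (\<beta> i) * w n" for i
  using wn by (simp add: complex_eq_iff \<alpha>_def \<beta>_def)
 have Uzi: "U z i = 0" if "i < n" for i
 proof -
  have "U z i = w i - of_real (\<alpha> i) - of_real (\<beta> i) * w n" using that by (simp add: U_def u_def w_def)
  thus ?thesis using real_rel[of i] by simp
 qed
 have qUz: "q (U z) = w" using qu[of w] by (simp add: U_def w_def[abs_def])
 have cc: "cnj (U z n) = - U z n" by (rule N.cnj_last(1)[OF UzY]) (simp add: Uzi)
 have "c' o' = c' (U z)" by (rule rpoly_cong[OF c'p]) (simp add: Uzi o'i)
 hence "o' n ^ 2 = U z n ^ 2" using o'Y UzY by (simp add: TY) (metis add_right_cancel)
 hence on: "o' n = U z n \<or> o' n = cnj (U z n)" by (simp add: cc power2_eq_iff)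
 have SS: "S o' = S (U z)" unfolding S_def by (rule sum.cong) (simp_all add: Uzi o'i)
 have Sre: "cnj (S (U z)) = S (U z)" unfolding S_def by (simp add: Uzi)
 have "s o' = s (U z) \<or> s o' = cnj (s (U z))" using on by (auto simp: s_def SS Sre)
 moreover have swn: "s (U z) = w n" using fun_cong[OF qUz, of n] by (simp add: q_def)
 ultimately have sw: "s o' = w n \<or> s o' = cnj (w n)" by simp
 have qo: "q o' i = (if i < n then of_real (\<alpha> i) + of_real (\<beta> i) * s o' else s o')" if "i \<le> n" for i
  using that by (simp add: q_def o'i)
 have pts: "(\<forall>i<Suc n. T o' i = z i) \<or> (\<forall>i<Suc n. T o' i = cnj (z i))"
 proof -
  have zi: "z i = w (\<tau> i)" for i by (simp add: w_def tt)
  from sw show ?thesis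
  proof
   assume a: "s o' = w n"
   have "q o' i = w i" if "i \<le> n" for i
   proof (cases "i < n")
    case True thus ?thesis using qo[OF that] a real_rel[of i] by simp
   next
    case False
    hence "i = n" using that by simp
    thus ?thesis using qo[OF that] a by simp
   qed
   thus ?thesis using tle by (simp add: T_def zi)
  next
   assume a: "s o' = cnj (w n)"
   have "q o' i = cnj (w i)" if "i \<le> n" for i
   proof (cases "i < n")
    case True
    have "cnj (w i) = of_real (\<alpha> i) + of_real (\<beta> i) * cnj (w n)" by (subst real_rel) simp
    thus ?thesis using qo[OF that] a True by simp
   next
    case False
    hence "i = n" using that by simp
    thus ?thesis using qo[OF that] a by simp
   qed
   thus ?thesis using tle by (simp add: T_def zi)
  qed
 qed
 have "N.point_ideal N.origin = point_ideal z"
 proof -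
  have "ev a (T o') = 0 \<longleftrightarrow> ev a z = 0" if a: "a \<in> carrier R" for a
  proof -
   obtain d F where F: "rpoly (Suc n) d F" "\<forall>p\<in>Y. ev a p = F p" using ev_poly[OF a] by blast
   have ToY: "T o' \<in> Y" using o'Y by simp
   from pts have "F (T o') = F z \<or> F (T o') = cnj (F z)"
   proof
    assume "\<forall>i<Suc n. T o' i = z i"
    hence "F (T o') = F z" by (intro rpoly_cong[OF F(1)]) simp
    thus ?thesis ..
   next
    assume "\<forall>i<Suc n. T o' i = cnj (z i)"
    hence "F (T o') = F (%i. cnj (z i))" by (intro rpoly_cong[OF F(1)]) simp
    thus ?thesis using rpoly_cnj[OF F(1)] by simp
   qed
   thus ?thesis using F(2) ToY z by auto
  qed
  thus ?thesis unfolding N.point_ideal_def point_ideal_def o'_def[symmetric] by auto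
 qed
 thus ?thesis using N.chart_axioms
  by (intro exI[of _ "%a y. ev a (T y)"] exI[of _ "{y. T y \<in> Y}"] exI[of _ c'] conjI) (simp_all only:)
qed

lemma maximal_parameters:
 assumes M: "maximalideal M R"
 shows "\<exists>l. (\<forall>i<n. l i \<in> M) \<and> (\<forall>x\<in>M. \<exists>v. tup n v \<and> x = lincomb n v l) \<and>
   (\<forall>v. tup n v --> lincomb n v l \<in> M \<cdot> M --> (\<forall>i<n. v i \<in> M))"
proof -
 obtain z where z: "z \<in> Y" "M = point_ideal z" using nullstellensatz[OF M] by blast
 obtain ev' Y' c' where C: "chart R ev' Y' n c'" "point_ideal z = chart.point_ideal R ev' (chart.origin n c')"
  using recentre[OF z(1)] by (elim exE conjE)
 interpret C: chart R ev' Y' n c' by (rule C(1))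
 show ?thesis unfolding z(2) C(2)
 proof (rule exI[of _ C.yel], intro conjI allI ballI impI)
  show "C.yel i \<in> C.m0" if "i < n" for i by (rule C.yel_m0[OF that])
  show "\<exists>v. tup n v \<and> x = lincomb n v C.yel" if "x \<in> C.m0" for x by (rule C.origin_gen[OF that])
  show "v i \<in> C.m0" if "tup n v" "lincomb n v C.yel \<in> C.m0 \<cdot> C.m0" "i < n" for v i
   by (rule C.origin_independent[OF that])
 qed
qed

lemma maximal_height:
 assumes M: "maximalideal M R" shows "ideal_height R M = enat n"
proof -
 obtain z where z: "z \<in> Y" "M = point_ideal z" using nullstellensatz[OF M] by blast
 obtain ev' Y' c' where C: "chart R ev' Y' n c'" "point_ideal z = chart.point_ideal R ev' (chart.origin n c')"
  using recentre[OF z(1)] by (elim exE conjE)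
 interpret C: chart R ev' Y' n c' by (rule C(1))
 show ?thesis unfolding z(2) C(2) by (rule C.ideal_height_origin)
qed

lemma maximal_rationally_trivial:
 assumes M: "maximalideal M R" shows "frag_of M \<in> rationally_trivial R"
proof -
 obtain z where z: "z \<in> Y" "M = point_ideal z" using nullstellensatz[OF M] by blast
 obtain ev' Y' c' where C: "chart R ev' Y' n c'" "point_ideal z = chart.point_ideal R ev' (chart.origin n c')"
  using recentre[OF z(1)] by (elim exE conjE)
 interpret C: chart R ev' Y' n c' by (rule C(1))
 show ?thesis unfolding z(2) C(2) by (rule C.origin_rationally_trivial)
qed

lemma maximal_square_root:
 assumes M: "maximalideal M R" and a: "a \<in> carrier R"
 shows "\<exists>b\<in>carrier R. a \<ominus> b \<otimes> b \<in> M"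
proof -
 obtain z where z: "z \<in> Y" "M = point_ideal z" using nullstellensatz[OF M] by blast
 obtain b where b: "b \<in> carrier R" "ev b z = csqrt (ev a z)" using value_lift[OF z(1)] by blast
 have "ev (a \<ominus> b \<otimes> b) z = 0" using a b z(1) by (simp add: ev_minus ev_mult flip: power2_eq_square)
 hence "a \<ominus> b \<otimes> b \<in> M" using a b(1) z(2) by (simp add: point_ideal_def)
 thus ?thesis using b(1) by blast
qed

lemma bertini_maximal:
 assumes N: "ideal N R" and M: "maximalideal M R" and rad: "ideal_radical R N = M" and f: "gens n N f"
 shows "\<exists>g \<M>. (\<forall>i<n. g i \<in> N \<and> g i \<ominus> f i \<in> N \<cdot> N) \<and> finite \<M> \<and>
   (\<forall>L\<in>\<M>. maximalideal L R) \<and> M \<notin> \<M> \<and>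
   (\<forall>x\<in>N. (\<forall>L\<in>\<M>. x \<in> L) --> (\<exists>v. tup n v \<and> x = lincomb n v g)) \<and>
   (\<forall>L\<in>\<M>. \<forall>i<n. g i \<in> L)"
proof -
 obtain z where z: "z \<in> Y" "M = point_ideal z" using nullstellensatz[OF M] by blast
 obtain ev' Y' c' where C: "chart R ev' Y' n c'" "point_ideal z = chart.point_ideal R ev' (chart.origin n c')"
  using recentre[OF z(1)] by (elim exE conjE)
 interpret C: chart R ev' Y' n c' by (rule C(1))
 show ?thesis unfolding z(2) C(2)
 proof (rule C.bertini_origin[OF _ N _ f])
  show "\<exists>l. (\<forall>i<n. l i \<in> L) \<and> (\<forall>x\<in>L. \<exists>v. tup n v \<and> x = lincomb n v l)" if "maximalideal L R" for L
   using maximal_parameters[OF that] by (elim exE conjE) (intro exI conjI)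
  show "ideal_radical R N = C.point_ideal C.origin" using rad z(2) C(2) by simp
 qed
qed

lemma euler_setting:
 assumes "n \<ge> 2" shows "euler_setting R ev Y n"
proof (intro euler_setting.intro euler_setting_axioms.intro)
 show "function_ring R ev Y" by (rule function_ring_axioms)
 show "krull_dim R = enat n" by (rule krull_dim_eq)
 show "n \<ge> 2" by (rule assms)
 show "ideal_height R m = enat n" if "maximalideal m R" for m by (rule maximal_height[OF that])
 show "\<exists>l. (\<forall>i<n. l i \<in> m) \<and> (\<forall>x\<in>m. \<exists>v. tup n v \<and> x = lincomb n v l) \<and>
   (\<forall>v. tup n v --> lincomb n v l \<in> m \<cdot> m --> (\<forall>i<n. v i \<in> m))" if "maximalideal m R" for m
  by (rule maximal_parameters[OF that])
 show "\<exists>b\<in>carrier R. a \<ominus> b \<otimes> b \<in> m" if "maximalideal m R" "a \<in> carrier R" for m a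
  by (rule maximal_square_root[OF that])
qed (rule bertini_maximal)

end

section \<open>The coordinate ring as a ring of functions\<close>

definition qpts :: "nat => (nat => complex) set" where
 "qpts n = {p. p n ^ 2 + ((\<Sum>i<n. p i ^ 2) + 1) = 0}"

text \<open>Division by the monic quadratic equation in the last variable.\<close>

lemma divide_quadric:
 "rpoly (Suc n) d F ==> \<exists>A B Q dA dB dQ. rpoly n dA A \<and> rpoly n dB B \<and> rpoly (Suc n) dQ Q \<and>
   (\<forall>p. F p = A p + B p * p n + Q p * (p n ^ 2 + ((\<Sum>i<n. p i ^ 2) + 1)))"
proof (induction rule: rpoly.induct)
 case (const d r)
 show ?case by (rule exI[of _ "%p. of_real r"], rule exI[of _ "%p. 0"], rule exI[of _ "%p. 0"], intro exI[of _ 0])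
   (simp add: rpoly_0 rpoly.const)
next
 case (var i d)
 show ?case
 proof (cases "i = n")
  case True
  show ?thesis by (rule exI[of _ "%p. 0"], rule exI[of _ "%p. 1"], rule exI[of _ "%p. 0"], intro exI[of _ 0])
    (simp add: rpoly_0 rpoly_1 True)
 next
  case False
  show ?thesis by (rule exI[of _ "%p. p i"], rule exI[of _ "%p. 0"], rule exI[of _ "%p. 0"], intro exI[of _ 1])
    (use False var in \<open>simp add: rpoly_0 rpoly.var\<close>)
 qed
next
 case (add d F G)
 then obtain A B Q dA dB dQ A' B' Q' dA' dB' dQ' where
  1: "rpoly n dA A" "rpoly n dB B" "rpoly (Suc n) dQ Q"
   "\<forall>p. F p = A p + B p * p n + Q p * (p n ^ 2 + ((\<Sum>i<n. p i ^ 2) + 1))"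
  and 2: "rpoly n dA' A'" "rpoly n dB' B'" "rpoly (Suc n) dQ' Q'"
   "\<forall>p. G p = A' p + B' p * p n + Q' p * (p n ^ 2 + ((\<Sum>i<n. p i ^ 2) + 1))" by (elim exE conjE)
 have plus: "rpoly k (d1 + d2) (%p. f p + g p)" if "rpoly k d1 f" "rpoly k d2 g" for k d1 d2 f g
  by (intro rpoly.add rpoly_mono[OF that(1)] rpoly_mono[OF that(2)]) auto
 show ?case by (rule exI[of _ "%p. A p + A' p"], rule exI[of _ "%p. B p + B' p"], rule exI[of _ "%p. Q p + Q' p"],
    rule exI[of _ "dA + dA'"], rule exI[of _ "dB + dB'"], rule exI[of _ "dQ + dQ'"], intro conjI plus 1(1,2,3) 2(1,2,3))
   (simp add: 1(4) 2(4) algebra_simps)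
next
 case (mult d F e G f)
 then obtain A B Q dA dB dQ A' B' Q' dA' dB' dQ' where
  1: "rpoly n dA A" "rpoly n dB B" "rpoly (Suc n) dQ Q"
   "\<forall>p. F p = A p + B p * p n + Q p * (p n ^ 2 + ((\<Sum>i<n. p i ^ 2) + 1))"
  and 2: "rpoly n dA' A'" "rpoly n dB' B'" "rpoly (Suc n) dQ' Q'"
   "\<forall>p. G p = A' p + B' p * p n + Q' p * (p n ^ 2 + ((\<Sum>i<n. p i ^ 2) + 1))" by (elim exE conjE)
 define c where "c p = (\<Sum>i<n. p i ^ 2) + (1::complex)" for p :: "nat => complex"
 have c: "rpoly n 2 c" unfolding c_def[abs_def] by (intro rpoly.add rpoly_sum rpoly_1 rpoly_power[OF rpoly.var[where d = 1]]) auto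
 have plus: "rpoly k (d1 + d2) (%p. f p + g p)" if "rpoly k d1 f" "rpoly k d2 g" for k d1 d2 f g
  by (intro rpoly.add rpoly_mono[OF that(1)] rpoly_mono[OF that(2)]) auto
 have minus: "rpoly k (d1 + d2) (%p. f p - g p)" if "rpoly k d1 f" "rpoly k d2 g" for k d1 d2 f g
  by (intro rpoly_diff rpoly_mono[OF that(1)] rpoly_mono[OF that(2)]) auto
 have times: "rpoly k (d1 + d2) (%p. f p * g p)" if "rpoly k d1 f" "rpoly k d2 g" for k d1 d2 f g
  by (rule rpoly.mult[OF that order_refl])
 have up: "rpoly (Suc n) d1 f" if "rpoly n d1 f" for d1 f by (rule rpoly_mono[OF that]) auto
 have "F p * G p = (A p * A' p - B p * B' p * c p) + (A p * B' p + B p * A' p) * p n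
   + ((B p * B' p + (A p + B p * p n) * Q' p) + Q p * G p) * (p n ^ 2 + c p)" for p
 proof -
  have "F p * G p = (A p + B p * p n) * (A' p + B' p * p n)
    + ((A p + B p * p n) * Q' p + Q p * G p) * (p n ^ 2 + c p)" using 1(4) 2(4) by (simp add: c_def algebra_simps)
  moreover have "(A p + B p * p n) * (A' p + B' p * p n) = (A p * A' p - B p * B' p * c p)
    + (A p * B' p + B p * A' p) * p n + B p * B' p * (p n ^ 2 + c p)" by (simp add: power2_eq_square algebra_simps)
  ultimately show ?thesis by (simp add: algebra_simps)
 qed
 hence eq: "\<forall>p. F p * G p = (A p * A' p - B p * B' p * c p) + (A p * B' p + B p * A' p) * p n
   + ((B p * B' p + (A p + B p * p n) * Q' p) + Q p * G p) * (p n ^ 2 + ((\<Sum>i<n. p i ^ 2) + 1))" by (simp add: c_def)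
 note a = minus[OF times[OF 1(1) 2(1)] times[OF times[OF 1(2) 2(2)] c]]
 note b = plus[OF times[OF 1(1) 2(2)] times[OF 1(2) 2(1)]]
 have t: "rpoly (Suc n) 1 (%p. p n)" by (rule rpoly.var) auto
 note q = plus[OF plus[OF up[OF times[OF 1(2) 2(2)]] times[OF plus[OF up[OF 1(1)] times[OF up[OF 1(2)] t]] 2(3)]] times[OF 1(3) mult.hyps(2)]]
 show ?case by (rule exI, rule exI, rule exI, rule exI, rule exI, rule exI) (rule conjI[OF a conjI[OF b conjI[OF q eq]]])
qed

text \<open>Over a real \<open>y\<close> the quadric has two points, with opposite nonzero values of the last
  coordinate; so both coefficients of the remainder vanish there.\<close>

lemma vanish_divisible:
 assumes F: "rpoly (Suc n) d F" and z: "\<And>p. p \<in> qpts n ==> F p = 0"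
 shows "\<exists>Q e. rpoly (Suc n) e Q \<and> (\<forall>p. F p = Q p * (p n ^ 2 + ((\<Sum>i<n. p i ^ 2) + 1)))"
proof -
 obtain A B Q dA dB dQ where 1: "rpoly n dA A" "rpoly n dB B" "rpoly (Suc n) dQ Q"
   "\<forall>p. F p = A p + B p * p n + Q p * (p n ^ 2 + ((\<Sum>i<n. p i ^ 2) + 1))"
  using divide_quadric[OF F] by (elim exE conjE)
 have AB: "A p = 0 \<and> B p = 0" if re: "\<And>i. p i \<in> \<real>" for p
 proof -
  define r where "r = sqrt ((\<Sum>i<n. Re (p i) ^ 2) + 1)"
  have pos: "(\<Sum>i<n. Re (p i) ^ 2) + 1 > 0" by (rule add_nonneg_pos) (auto intro: sum_nonneg)
  hence r: "r > 0" "r ^ 2 = (\<Sum>i<n. Re (p i) ^ 2) + 1" by (simp_all add: r_def)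
  have s: "(\<Sum>i<n. p i ^ 2) + 1 = of_real (r ^ 2)" unfolding r(2) using re by (simp add: of_real_Re)
  have e: "A p + B p * t = 0" if t: "t ^ 2 = - of_real (r ^ 2)" for t
  proof -
   let ?p = "p(n := t)"
   have "?p \<in> qpts n" using t s by (simp add: qpts_def)
   moreover have "A ?p = A p" "B ?p = B p" by (auto intro!: rpoly_cong[OF 1(1)] rpoly_cong[OF 1(2)])
   ultimately show ?thesis using z[of ?p] 1(4) by (auto simp: qpts_def)
  qed
  have e1: "A p + B p * (\<i> * of_real r) = 0" by (rule e) (simp add: power_mult_distrib)
  have e2: "A p + B p * (- (\<i> * of_real r)) = 0" by (rule e) (simp add: power_mult_distrib)
  have "2 * A p = 0" using e1 e2 by (simp add: add_eq_0_iff)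
  thus ?thesis using e1 r(1) by simp
 qed
 have "A p = 0" "B p = 0" for p using rpoly_vanish_real[OF 1(1)] rpoly_vanish_real[OF 1(2)] AB by blast+
 thus ?thesis using 1(3,4) by (intro exI[of _ Q] exI[of _ dQ]) simp
qed

subsection \<open>Evaluating polynomials\<close>

abbreviation "PR n \<equiv> real_mpoly_ring n"

definition monom_eval :: "nat => (nat \<Rightarrow>\<^sub>0 nat) => (nat => complex) => complex" where
 "monom_eval n m p = (\<Prod>i<Suc n. p i ^ Poly_Mapping.lookup m i)"

definition evp :: "nat => ((nat \<Rightarrow>\<^sub>0 nat) \<Rightarrow>\<^sub>0 real) => (nat => complex) => complex" where
 "evp n f p = (\<Sum>m\<in>Poly_Mapping.keys f. of_real (Poly_Mapping.lookup f m) * monom_eval n m p)"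

lemma evp_superset:
 assumes "finite A" "Poly_Mapping.keys f \<subseteq> A"
 shows "evp n f p = (\<Sum>m\<in>A. of_real (Poly_Mapping.lookup f m) * monom_eval n m p)"
 unfolding evp_def by (rule sum.mono_neutral_left) (use assms in \<open>auto simp: in_keys_iff\<close>)

lemma evp_add: "evp n (f + g) p = evp n f p + evp n g p"
proof -
 let ?A = "Poly_Mapping.keys f \<union> Poly_Mapping.keys g"
 have A: "finite ?A" "Poly_Mapping.keys f \<subseteq> ?A" "Poly_Mapping.keys g \<subseteq> ?A" "Poly_Mapping.keys (f + g) \<subseteq> ?A"
  using Poly_Mapping.keys_add[of f g] by auto
 show ?thesis unfolding evp_superset[OF A(1,2)] evp_superset[OF A(1,3)] evp_superset[OF A(1,4)]
  by (simp add: lookup_add distrib_right sum.distrib)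
qed

lemma evp_0: "evp n 0 p = 0" by (simp add: evp_def)

lemma evp_single: "evp n (Poly_Mapping.single m r) p = of_real r * monom_eval n m p" by (simp add: evp_def)

lemma evp_sum: "evp n (\<Sum>i\<in>A. f i) p = (\<Sum>i\<in>A. evp n (f i) p)"
 by (induction A rule: infinite_finite_induct) (simp_all add: evp_0 evp_add)

lemma sum_of_singles: "f = (\<Sum>m\<in>Poly_Mapping.keys f. Poly_Mapping.single m (Poly_Mapping.lookup f m))"
proof (rule poly_mapping_eqI)
 fix k
 have "Poly_Mapping.lookup (\<Sum>m\<in>Poly_Mapping.keys f. Poly_Mapping.single m (Poly_Mapping.lookup f m)) k
   = (\<Sum>m\<in>Poly_Mapping.keys f. if m = k then Poly_Mapping.lookup f k else 0)"
  unfolding lookup_sum by (rule sum.cong) (auto simp: lookup_single when_def)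
 also have "\<dots> = Poly_Mapping.lookup f k" by (simp add: in_keys_iff)
 finally show "Poly_Mapping.lookup f k = Poly_Mapping.lookup (\<Sum>m\<in>Poly_Mapping.keys f. Poly_Mapping.single m (Poly_Mapping.lookup f m)) k" ..
qed

lemma evp_mult: "evp n (f * g) p = evp n f p * evp n g p"
proof -
 have "f * g = (\<Sum>m\<in>Poly_Mapping.keys f. \<Sum>l\<in>Poly_Mapping.keys g.
   Poly_Mapping.single (m + l) (Poly_Mapping.lookup f m * Poly_Mapping.lookup g l))"
  by (subst (1) sum_of_singles[of f], subst (1) sum_of_singles[of g]) (simp add: sum_product mult_single)
 hence "evp n (f * g) p = (\<Sum>m\<in>Poly_Mapping.keys f. \<Sum>l\<in>Poly_Mapping.keys g.
   of_real (Poly_Mapping.lookup f m * Poly_Mapping.lookup g l) * monom_eval n (m + l) p)" by (simp only: evp_sum evp_single)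
 also have "\<dots> = evp n f p * evp n g p" unfolding evp_def sum_product
  by (intro sum.cong refl) (simp add: monom_eval_def lookup_add power_add prod.distrib algebra_simps)
 finally show ?thesis .
qed

lemma monom_eval_0: "monom_eval n 0 p = 1" by (simp add: monom_eval_def)

lemma evp_1: "evp n 1 p = 1" by (simp only: single_one[symmetric] evp_single monom_eval_0 of_real_1 mult_1)

lemma evp_var: "i \<le> n ==> evp n (mpoly_var i) p = p i"
proof -
 assume i: "i \<le> n"
 have "monom_eval n (Poly_Mapping.single i 1) p = (\<Prod>j<Suc n. if j = i then p i else 1)"
  unfolding monom_eval_def by (rule prod.cong) (auto simp: lookup_single when_def)
 thus ?thesis using i by (simp add: mpoly_var_def evp_single)
qed

lemma evp_power: "evp n (f ^ k) p = evp n f p ^ k" by (induction k) (simp_all add: evp_1 evp_mult)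

lemma PR_cring: "cring (PR n)"
proof -
 interpret T: cring "ring_of_type_algebra :: ((nat \<Rightarrow>\<^sub>0 nat) \<Rightarrow>\<^sub>0 real) ring" by (rule cring_from_type_algebra)
 let ?H = "{f::(nat \<Rightarrow>\<^sub>0 nat) \<Rightarrow>\<^sub>0 real. \<forall>m\<in>Poly_Mapping.keys f. Poly_Mapping.keys m \<subseteq> {..n}}"
 have neg: "\<ominus>\<^bsub>ring_of_type_algebra\<^esub> f = - f" for f :: "(nat \<Rightarrow>\<^sub>0 nat) \<Rightarrow>\<^sub>0 real"
  by (rule T.minus_equality) (simp_all add: ring_of_type_algebra_def)
 have "subring ?H ring_of_type_algebra"
 proof (rule T.subringI)
  show "\<one>\<^bsub>ring_of_type_algebra\<^esub> \<in> ?H" by (simp add: ring_of_type_algebra_def flip: single_one)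
  show "\<ominus>\<^bsub>ring_of_type_algebra\<^esub> f \<in> ?H" if "f \<in> ?H" for f using that by (simp add: neg)
  fix f g assume f: "f \<in> ?H" and g: "g \<in> ?H"
  have "f + g \<in> ?H" using f g Poly_Mapping.keys_add[of f g] by blast
  thus "f \<oplus>\<^bsub>ring_of_type_algebra\<^esub> g \<in> ?H" by (simp add: ring_of_type_algebra_def)
  have "Poly_Mapping.keys m \<subseteq> {..n}" if m: "m \<in> Poly_Mapping.keys (f * g)" for m
  proof -
   obtain a b where ab: "m = a + b" "a \<in> Poly_Mapping.keys f" "b \<in> Poly_Mapping.keys g"
    using m Poly_Mapping.keys_mult[of f g] by blast
   have "Poly_Mapping.keys a \<subseteq> {..n}" "Poly_Mapping.keys b \<subseteq> {..n}" using ab f g by blast+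
   thus ?thesis unfolding ab(1) using Poly_Mapping.keys_add[of a b] by blast
  qed
  thus "f \<otimes>\<^bsub>ring_of_type_algebra\<^esub> g \<in> ?H" by (simp add: ring_of_type_algebra_def)
 qed (simp add: ring_of_type_algebra_def)
 from T.subcringI'[OF this] show ?thesis
  unfolding real_mpoly_ring_def using T.subcring_iff[of ?H] by (simp add: ring_of_type_algebra_def)
qed

lemma PR_simps:
 "\<zero>\<^bsub>PR n\<^esub> = 0" "\<one>\<^bsub>PR n\<^esub> = 1" "f \<otimes>\<^bsub>PR n\<^esub> g = f * g" "f \<oplus>\<^bsub>PR n\<^esub> g = f + g"
 by (simp_all add: real_mpoly_ring_def ring_of_type_algebra_def)

lemma PR_carrier: "f \<in> carrier (PR n) \<longleftrightarrow> (\<forall>m\<in>Poly_Mapping.keys f. Poly_Mapping.keys m \<subseteq> {..n})"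
 by (simp add: real_mpoly_ring_def)

lemma PR_closed:
 "f \<in> carrier (PR n) ==> g \<in> carrier (PR n) ==> f + g \<in> carrier (PR n)"
 "f \<in> carrier (PR n) ==> g \<in> carrier (PR n) ==> f * g \<in> carrier (PR n)"
 using cring.axioms(1)[OF PR_cring, of n] ring.ring_simprules(1,5)[of "PR n"] by (auto simp: PR_simps)

lemma PR_minus:
 assumes "f \<in> carrier (PR n)" "g \<in> carrier (PR n)" shows "f \<ominus>\<^bsub>PR n\<^esub> g = f - g"
proof -
 interpret cring "PR n" by (rule PR_cring)
 have c: "- g \<in> carrier (PR n)" using assms(2) by (simp add: PR_carrier)
 have "\<ominus>\<^bsub>PR n\<^esub> g = - g" by (rule minus_equality) (use assms c in \<open>simp_all add: PR_simps\<close>)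
 thus ?thesis by (simp add: minus_eq PR_simps)
qed

lemma PR_var: "i \<le> n ==> mpoly_var i \<in> carrier (PR n)" by (simp add: PR_carrier mpoly_var_def)

lemma PR_const: "Poly_Mapping.single 0 r \<in> carrier (PR n)" by (simp add: PR_carrier)

lemma PR_sum: "(\<And>i. i \<in> A ==> f i \<in> carrier (PR n)) ==> (\<Sum>i\<in>A. f i) \<in> carrier (PR n)"
proof (induction A rule: infinite_finite_induct)
 case (insert x A) thus ?case by (simp add: PR_closed)
qed (simp_all add: PR_carrier)

lemma evp_rpoly: "\<exists>d. rpoly (Suc n) d (evp n f)"
proof -
 define d where "d = (\<Sum>m\<in>Poly_Mapping.keys f. \<Sum>i<Suc n. Poly_Mapping.lookup m i)"
 have "rpoly (Suc n) d (%p. \<Sum>m\<in>Poly_Mapping.keys f. of_real (Poly_Mapping.lookup f m) * monom_eval n m p)"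
 proof (intro rpoly_sum rpoly_scale)
  fix m assume m: "m \<in> Poly_Mapping.keys f"
  have le: "(\<Sum>i<Suc n. Poly_Mapping.lookup m i) \<le> d" unfolding d_def by (rule member_le_sum[OF m]) auto
  show "rpoly (Suc n) d (monom_eval n m)" unfolding monom_eval_def[abs_def]
  proof (rule rpoly_prod[OF _ _ le])
   show "rpoly (Suc n) (Poly_Mapping.lookup m i) (%p. p i ^ Poly_Mapping.lookup m i)" if "i \<in> {..<Suc n}" for i
    by (rule rpoly_power[OF rpoly.var[where d = 1]]) (use that in auto)
  qed simp
 qed
 thus ?thesis unfolding evp_def[abs_def] by blast
qed

lemma rpoly_evp: "rpoly (Suc n) d F ==> \<exists>f\<in>carrier (PR n). \<forall>p. evp n f p = F p"
proof (induction rule: rpoly.induct)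
 case (const d r)
 show ?case by (rule bexI[OF _ PR_const[of r]]) (simp add: evp_single monom_eval_0)
next
 case (var i d)
 show ?case by (rule bexI[OF _ PR_var[of i]]) (use var in \<open>simp_all add: evp_var\<close>)
next
 case (add d F G)
 then obtain f g where "f \<in> carrier (PR n)" "\<forall>p. evp n f p = F p" "g \<in> carrier (PR n)" "\<forall>p. evp n g p = G p" by blast
 thus ?case by (intro bexI[of _ "f + g"]) (simp_all add: evp_add PR_closed)
next
 case (mult d F e G f')
 then obtain f g where "f \<in> carrier (PR n)" "\<forall>p. evp n f p = F p" "g \<in> carrier (PR n)" "\<forall>p. evp n g p = G p" by blast
 thus ?case by (intro bexI[of _ "f * g"]) (simp_all add: evp_mult PR_closed)
qed

text \<open>The coefficients are indexed by finitely supported exponents; restricted to the variables in use they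
  become the exponent functions of \<open>poly_function_nonzero\<close>.\<close>

lemma evp_eq_0:
 assumes f: "f \<in> carrier (PR n)" and z: "\<And>p. evp n f p = 0"
 shows "f = 0"
proof (rule ccontr)
 assume "f \<noteq> 0"
 then obtain m0 where m0: "m0 \<in> Poly_Mapping.keys f" by (metis keys_eq_empty equals0I)
 let ?K = "Poly_Mapping.keys f" and ?k = "Suc n"
 define \<phi> where "\<phi> m = restrict (Poly_Mapping.lookup m) {..<?k}" for m :: "nat \<Rightarrow>\<^sub>0 nat"
 have inj: "inj_on \<phi> ?K"
 proof (rule inj_onI, rule poly_mapping_eqI)
  fix m l k assume ml: "m \<in> ?K" "l \<in> ?K" "\<phi> m = \<phi> l"
  show "Poly_Mapping.lookup m k = Poly_Mapping.lookup l k"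
  proof (cases "k < ?k")
   case True thus ?thesis using fun_cong[OF ml(3), of k] by (simp add: \<phi>_def)
  next
   case False
   have "Poly_Mapping.keys m \<subseteq> {..n}" "Poly_Mapping.keys l \<subseteq> {..n}" using f ml(1,2) by (simp_all add: PR_carrier)
   hence "k \<notin> Poly_Mapping.keys m" "k \<notin> Poly_Mapping.keys l" using False by auto
   thus ?thesis by (simp add: in_keys_iff)
  qed
 qed
 define D where "D = Suc (\<Sum>m\<in>?K. \<Sum>i<?k. Poly_Mapping.lookup m i)"
 have sub: "\<phi> ` ?K \<subseteq> expbox ?k D"
 proof (rule image_subsetI)
  fix m assume m: "m \<in> ?K"
  have "Poly_Mapping.lookup m i < D" if i: "i < ?k" for i
  proof -
   have "Poly_Mapping.lookup m i \<le> (\<Sum>i<?k. Poly_Mapping.lookup m i)" by (rule member_le_sum) (use i in auto)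
   also have "\<dots> \<le> (\<Sum>m\<in>?K. \<Sum>i<?k. Poly_Mapping.lookup m i)" by (rule member_le_sum[OF m]) auto
   finally show ?thesis by (simp add: D_def)
  qed
  thus "\<phi> m \<in> expbox ?k D" by (auto simp: expbox_def \<phi>_def PiE_iff)
 qed
 define c where "c \<alpha> = (if \<alpha> \<in> \<phi> ` ?K then Poly_Mapping.lookup f (the_inv_into ?K \<phi> \<alpha>) else 0)" for \<alpha>
 have cm: "c (\<phi> m) = Poly_Mapping.lookup f m" if "m \<in> ?K" for m
  using that the_inv_into_f_f[OF inj that] by (simp add: c_def)
 have "\<forall>\<alpha>\<in>expbox ?k D. c \<alpha> = 0"
 proof (rule poly_function_nonzero)
  fix s :: "nat => real"
  have "(\<Sum>\<alpha>\<in>expbox ?k D. c \<alpha> * (\<Prod>i<?k. s i ^ \<alpha> i)) = (\<Sum>\<alpha>\<in>\<phi> ` ?K. c \<alpha> * (\<Prod>i<?k. s i ^ \<alpha> i))"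
   by (rule sum.mono_neutral_right[OF finite_box sub]) (simp add: c_def)
  also have "\<dots> = (\<Sum>m\<in>?K. Poly_Mapping.lookup f m * (\<Prod>i<?k. s i ^ Poly_Mapping.lookup m i))"
   unfolding sum.reindex[OF inj] comp_def
  proof (rule sum.cong[OF refl])
   fix m assume m: "m \<in> ?K"
   have "(\<Prod>i<?k. s i ^ \<phi> m i) = (\<Prod>i<?k. s i ^ Poly_Mapping.lookup m i)" by (rule prod.cong) (simp_all add: \<phi>_def)
   thus "c (\<phi> m) * (\<Prod>i<?k. s i ^ \<phi> m i) = Poly_Mapping.lookup f m * (\<Prod>i<?k. s i ^ Poly_Mapping.lookup m i)"
    by (simp only: cm[OF m])
  qed
  finally have "complex_of_real (\<Sum>\<alpha>\<in>expbox ?k D. c \<alpha> * (\<Prod>i<?k. s i ^ \<alpha> i)) = evp n f (%i. of_real (s i))"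
   by (simp only: evp_def monom_eval_def of_real_sum of_real_mult of_real_prod of_real_power)
  thus "(\<Sum>\<alpha>\<in>expbox ?k D. c \<alpha> * (\<Prod>i<?k. s i ^ \<alpha> i)) = 0" unfolding z of_real_eq_0_iff .
 qed
 hence "c (\<phi> m0) = 0" using sub m0 by blast
 thus False using cm[OF m0] m0 by (simp add: in_keys_iff)
qed

lemma quad_closed: "(\<Sum>i\<le>n. mpoly_var i ^ 2) + 1 \<in> carrier (PR n)"
proof (intro PR_closed(1) PR_sum)
 show "mpoly_var i ^ 2 \<in> carrier (PR n)" if "i \<in> {..n}" for i
  using PR_closed(2)[OF PR_var PR_var, of i n i] that by (simp add: power2_eq_square)
 show "1 \<in> carrier (PR n)" using PR_const[of 1 n] by simp
qed

lemma evp_quad: "evp n ((\<Sum>i\<le>n. mpoly_var i ^ 2) + 1) p = p n ^ 2 + ((\<Sum>i<n. p i ^ 2) + 1)"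
proof -
 have "evp n ((\<Sum>i\<le>n. mpoly_var i ^ 2) + 1) p = (\<Sum>i\<le>n. p i ^ 2) + 1" unfolding evp_add evp_1 evp_sum evp_power
  by (intro arg_cong2[of _ _ _ _ "(+)"] sum.cong refl) (simp add: evp_var)
 thus ?thesis by (simp add: lessThan_Suc_atMost[symmetric] add.commute add.left_commute)
qed

definition QI :: "nat => ((nat \<Rightarrow>\<^sub>0 nat) \<Rightarrow>\<^sub>0 real) set" where
 "QI n = Idl\<^bsub>PR n\<^esub> {(\<Sum>i\<le>n. mpoly_var i ^ 2) + 1}"

lemma QI_ideal: "ideal (QI n) (PR n)"
 and QI_eq: "QI n = {f \<otimes>\<^bsub>PR n\<^esub> ((\<Sum>i\<le>n. mpoly_var i ^ 2) + 1) | f. f \<in> carrier (PR n)}"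
 unfolding QI_def cring.cgenideal_eq_genideal[OF PR_cring quad_closed, symmetric]
 by (rule cring.cgenideal_ideal[OF PR_cring quad_closed]) (rule cgenideal_def)

lemma QI_mem:
 assumes f: "f \<in> carrier (PR n)"
 shows "f \<in> QI n \<longleftrightarrow> (\<forall>p\<in>qpts n. evp n f p = 0)"
proof
 let ?q = "(\<Sum>i\<le>n. mpoly_var i ^ 2) + 1 :: (nat \<Rightarrow>\<^sub>0 nat) \<Rightarrow>\<^sub>0 real"
 assume "f \<in> QI n"
 then obtain g where "f = g * ?q" unfolding QI_eq PR_simps by blast
 thus "\<forall>p\<in>qpts n. evp n f p = 0" by (simp only: evp_mult evp_quad) (simp add: qpts_def)
next
 let ?q = "(\<Sum>i\<le>n. mpoly_var i ^ 2) + 1 :: (nat \<Rightarrow>\<^sub>0 nat) \<Rightarrow>\<^sub>0 real"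
 assume z: "\<forall>p\<in>qpts n. evp n f p = 0"
 obtain d where d: "rpoly (Suc n) d (evp n f)" using evp_rpoly by blast
 obtain Q e where Q: "rpoly (Suc n) e Q" "\<forall>p. evp n f p = Q p * (p n ^ 2 + ((\<Sum>i<n. p i ^ 2) + 1))"
  using vanish_divisible[OF d] z by blast
 obtain g where g: "g \<in> carrier (PR n)" "\<forall>p. evp n g p = Q p" using rpoly_evp[OF Q(1)] by blast
 have gc: "g * ?q \<in> carrier (PR n)" by (rule PR_closed(2)[OF g(1) quad_closed])
 interpret P: cring "PR n" by (rule PR_cring)
 have "f - g * ?q = 0"
 proof (rule evp_eq_0)
  show "f - g * ?q \<in> carrier (PR n)" using P.minus_closed[OF f gc] by (simp only: PR_minus[OF f gc])
  fix p
  have "evp n (f - g * ?q) p + evp n (g * ?q) p = evp n f p" by (simp only: evp_add[symmetric] diff_add_cancel)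
  moreover have "evp n (g * ?q) p = evp n f p" by (simp only: evp_mult evp_quad g(2) Q(2))
  ultimately show "evp n (f - g * ?q) p = 0" by simp
 qed
 thus "f \<in> QI n" unfolding QI_eq PR_simps using g(1) by auto
qed

text \<open>The value of any representative; on the quadric it does not depend on the choice.\<close>

definition qev :: "nat => ((nat \<Rightarrow>\<^sub>0 nat) \<Rightarrow>\<^sub>0 real) set => (nat => complex) => complex" where
 "qev n a = evp n (SOME f. f \<in> carrier (PR n) \<and> a = QI n +>\<^bsub>PR n\<^esub> f)"

lemma coset_eq_iff:
 assumes "f \<in> carrier (PR n)" "g \<in> carrier (PR n)"
 shows "QI n +>\<^bsub>PR n\<^esub> f = QI n +>\<^bsub>PR n\<^esub> g \<longleftrightarrow> (\<forall>p\<in>qpts n. evp n f p = evp n g p)"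
proof -
 interpret P: cring "PR n" by (rule PR_cring)
 have c: "f - g \<in> carrier (PR n)" using P.minus_closed[OF assms] by (simp only: PR_minus[OF assms])
 have "evp n (f - g) p = 0 \<longleftrightarrow> evp n f p = evp n g p" for p
 proof -
  have "evp n (f - g) p + evp n g p = evp n f p" by (simp only: evp_add[symmetric] diff_add_cancel)
  thus ?thesis by auto
 qed
 thus ?thesis unfolding P.quot_eq[OF QI_ideal assms] PR_minus[OF assms] QI_mem[OF c] by simp
qed

lemma qev_coset:
 assumes f: "f \<in> carrier (PR n)" and p: "p \<in> qpts n"
 shows "qev n (QI n +>\<^bsub>PR n\<^esub> f) p = evp n f p"
proof -
 let ?P = "%g. g \<in> carrier (PR n) \<and> QI n +>\<^bsub>PR n\<^esub> f = QI n +>\<^bsub>PR n\<^esub> g"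
 have "?P (SOME g. ?P g)" by (rule someI[of ?P f]) (simp add: f)
 thus ?thesis using coset_eq_iff[OF f, of "SOME g. ?P g"] p unfolding qev_def by simp
qed

lemma quadric_ring_elements: "a \<in> carrier (quadric_ring n) \<longleftrightarrow> (\<exists>f\<in>carrier (PR n). a = QI n +>\<^bsub>PR n\<^esub> f)"
 unfolding quadric_ring_def QI_def[symmetric] cring.quot_carrier[OF PR_cring] by blast

lemma quadric_ring_functions: "function_ring (quadric_ring n) (qev n) (qpts n)"
proof (intro function_ring.intro function_ring_axioms.intro)
 interpret P: cring "PR n" by (rule PR_cring)
 show "cring (quadric_ring n)"
  unfolding quadric_ring_def QI_def[symmetric] by (rule ideal.quotient_is_cring[OF QI_ideal PR_cring])
 fix a b p assume ab: "a \<in> carrier (quadric_ring n)" "b \<in> carrier (quadric_ring n)"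
 then obtain f g where f: "f \<in> carrier (PR n)" "a = QI n +>\<^bsub>PR n\<^esub> f" and g: "g \<in> carrier (PR n)" "b = QI n +>\<^bsub>PR n\<^esub> g"
  unfolding quadric_ring_elements by blast
 have s: "a \<oplus>\<^bsub>quadric_ring n\<^esub> b = QI n +>\<^bsub>PR n\<^esub> (f + g)" "a \<otimes>\<^bsub>quadric_ring n\<^esub> b = QI n +>\<^bsub>PR n\<^esub> (f * g)"
  unfolding quadric_ring_def QI_def[symmetric] f(2) g(2)
  by (simp_all only: P.quot_add[OF QI_ideal f(1) g(1)] P.quot_mult[OF QI_ideal f(1) g(1)] PR_simps)
 show "qev n (a \<oplus>\<^bsub>quadric_ring n\<^esub> b) p = qev n a p + qev n b p"
  "qev n (a \<otimes>\<^bsub>quadric_ring n\<^esub> b) p = qev n a p * qev n b p" if p: "p \<in> qpts n"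
 proof -
  have v: "qev n a p = evp n f p" "qev n b p = evp n g p"
   unfolding f(2) g(2) by (rule qev_coset[OF f(1) p], rule qev_coset[OF g(1) p])
  show "qev n (a \<oplus>\<^bsub>quadric_ring n\<^esub> b) p = qev n a p + qev n b p"
   unfolding s(1) v qev_coset[OF PR_closed(1)[OF f(1) g(1)] p] by (rule evp_add)
  show "qev n (a \<otimes>\<^bsub>quadric_ring n\<^esub> b) p = qev n a p * qev n b p"
   unfolding s(2) v qev_coset[OF PR_closed(2)[OF f(1) g(1)] p] by (rule evp_mult)
 qed
 show "a = b" if e: "\<And>p. p \<in> qpts n ==> qev n a p = qev n b p" unfolding f(2) g(2) coset_eq_iff[OF f(1) g(1)]
  using e[unfolded f(2) g(2)] by (simp add: qev_coset[OF f(1)] qev_coset[OF g(1)])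
next
 interpret P: cring "PR n" by (rule PR_cring)
 fix p assume p: "p \<in> qpts n"
 have "\<one>\<^bsub>quadric_ring n\<^esub> = QI n +>\<^bsub>PR n\<^esub> 1"
  unfolding quadric_ring_def QI_def[symmetric] P.quot_one PR_simps ..
 moreover have "1 \<in> carrier (PR n)" using P.one_closed by (simp add: PR_simps)
 ultimately show "qev n \<one>\<^bsub>quadric_ring n\<^esub> p = 1" using qev_coset[OF _ p] evp_1 by simp
qed

lemma quadric_ring_chart:
 assumes n: "n \<ge> 1"
 shows "chart (quadric_ring n) (qev n) (qpts n) n (%p. (\<Sum>i<n. p i ^ 2) + 1)"
proof (intro chart.intro chart_axioms.intro)
 show "function_ring (quadric_ring n) (qev n) (qpts n)" by (rule quadric_ring_functions)
 then interpret F: function_ring "quadric_ring n" "qev n" "qpts n" .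
 show "rpoly n 2 (%p. (\<Sum>i<n. p i ^ 2) + 1)"
  by (intro rpoly.add rpoly_sum rpoly_1 rpoly_power[OF rpoly.var[where d = 1]]) auto
 show "0 < Re ((\<Sum>i<n. p i ^ 2) + 1)" if re: "\<And>i. i < n ==> p i \<in> \<real>" for p :: "nat => complex"
 proof -
  have "Re (p i ^ 2) = Re (p i) ^ 2" if "i < n" for i using re[OF that] by (simp add: complex_is_Real_iff)
  hence "Re ((\<Sum>i<n. p i ^ 2) + 1) = (\<Sum>i<n. Re (p i) ^ 2) + 1" by simp
  also have "\<dots> > 0" by (rule add_nonneg_pos) (auto intro: sum_nonneg)
  finally show ?thesis .
 qed
 show "\<exists>d F. rpoly (Suc n) d F \<and> (\<forall>p\<in>qpts n. qev n a p = F p)" if a: "a \<in> carrier (quadric_ring n)" for a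
 proof -
  obtain f where f: "f \<in> carrier (PR n)" "a = QI n +>\<^bsub>PR n\<^esub> f" using a unfolding quadric_ring_elements by blast
  obtain d where "rpoly (Suc n) d (evp n f)" using evp_rpoly by blast
  thus ?thesis using qev_coset[OF f(1)] f(2) by (intro exI[of _ d] exI[of _ "evp n f"]) simp
 qed
 show "F.repr F" if F: "rpoly (Suc n) d F" for d F
 proof -
  obtain f where f: "f \<in> carrier (PR n)" "\<forall>p. evp n f p = F p" using rpoly_evp[OF F] by blast
  have "QI n +>\<^bsub>PR n\<^esub> f \<in> carrier (quadric_ring n)" unfolding quadric_ring_elements using f(1) by blast
  thus ?thesis unfolding F.repr_def using qev_coset[OF f(1)] f(2) by (intro bexI[of _ "QI n +>\<^bsub>PR n\<^esub> f"]) simp_all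
 qed
qed (use n in \<open>simp_all add: qpts_def\<close>)

section \<open>The theorem\<close>

theorem mainTheorem4:
  fixes n :: nat
  assumes "n \<ge> 2"
  shows "trivial_group (euler_class_group (quadric_ring n)) \<and> trivial_group (CH0 (quadric_ring n))"
proof -
 have n: "n \<ge> 1" using assms by simp
 interpret Q: quadric "quadric_ring n" "qev n" "qpts n" n by (rule quadric.intro[OF quadric_ring_chart[OF n]])
 interpret E: euler_setting "quadric_ring n" "qev n" "qpts n" n by (rule Q.euler_setting[OF assms])
 show ?thesis using E.euler_class_group_trivial Q.CH0_trivial[OF Q.maximal_rationally_trivial] by (rule conjI)
qed

end
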